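(* Let $A=\Bbbk Q/I$, let $R$ be a reduction system satisfying $(\diamond)$ for $I$, let $(P_\bullet,\partial_\bullet)$ be the associated projective $A$-bimodule resolution of $A$ and $(\mathrm{Bar}_\bullet,d_\bullet)$ the normalized bar resolution. With the $A$-bimodule morphisms $F_n:P_n\to\mathrm{Bar}_n$, $G_n:\mathrm{Bar}_n\to P_n$, $h_n:\mathrm{Bar}_n\to\mathrm{Bar}_{n+1}$ defined in the context, one has a homotopy deformation retract, namely (with $F_\bullet,G_\bullet$ morphisms of complexes) $G_nF_n=\mathrm{id}$ and $F_nG_n-\mathrm{id}=h_{n-1}d_n+d_{n+1}h_n$ for each $n\ge0$ (setting $h_{-1}=0$). Moreover, the homotopy deformation retract is special, i.e. it satisfies $$h_nF_n=0,\qquad G_{n+1}h_n=0,\qquad h_{n+1}h_n=0 .$$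
   Context: $\Bbbk$ is a field of characteristic $0$, $Q$ a finite quiver, $Q_n$ the set of paths of length $n$; $pq$ is concatenation if the target of $p$ is the source of $q$, else $0$. $\otimes=\otimes_{\Bbbk Q_0}$; $I\subset\Bbbk Q$ is a two-sided ideal, $\pi:\Bbbk Q\to A$ the projection. Reduction systems: $R=\{(s,\varphi_s)\mid s\in S\}$ with $S\subset Q_{\ge2}$, $s$ not a subpath of $s'$ for $s\ne s'\in S$, $\varphi_s$ a linear combination of irreducible paths parallel to $s$; a path is irreducible if it has no subpath in $S$; $\mathrm{Irr}_S$ is the set of irreducible paths. A basic reduction sends one path $qsr$ ($s\in S$) to $q\varphi_sr$ and fixes all other paths; a reduction is a finite composition. A path $p$ is reduction-finite if for any infinite sequence of reductions $\mathfrak r_n\cdots\mathfrak r_1(p)$ is eventually constant, reduction-unique if moreover all irreducible $\mathfrak r(p)$ coincide. $R$ satisfies $(\diamond)$ for $I$ if $I=\langle s-\varphi_s\rangle_{s\in S}$ and all paths are reduction-unique. Resolution $P_\bullet$: $S_0=Q_0$, $S_1=Q_1$, $S_2=S$, and for $n\ge1$, $S_{n+2}$ is the set of paths $u_0u_1\cdots u_{n+1}$ with $u_0\in Q_1$, $u_1,\dots,u_{n+1}$ irreducible, each $u_iu_{i+1}$ reducible and $u_id$ irreducible for every proper left subpath $d$ of $u_{i+1}$. For a path $p$, $\mathrm{split}_n(p)=\sum\pi(q)\otimes w\otimes\pi(r)$ over all $p=qwr$ with $w\in S_n$; $\mathrm{split}_n^{\mathrm R}(p)$, $\mathrm{split}^{\mathrm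 L}_n(p)$ are the single summands with $w$ rightmost, leftmost (zero if none). $P_n=A\otimes\Bbbk S_n\otimes A$. $\delta_n$: bimodule maps $P_n\to P_{n-1}$ with $\delta_1(1\otimes w\otimes1)=\pi(w)\otimes1-1\otimes\pi(w)$, $\delta_n(1\otimes w\otimes1)=\mathrm{split}^{\mathrm R}_{n-1}(w)-\mathrm{split}^{\mathrm L}_{n-1}(w)$ ($n>2$ odd), $=\mathrm{split}_{n-1}(w)$ ($n$ even). $\gamma_{n-1}:P_{n-1}\to P_n$: left module maps with $\gamma_{n-1}(1\otimes w\otimes\pi(u))=(-1)^n\mathrm{split}_n(wu)$ for $u\in\mathrm{Irr}_S$. $\partial_0(a\otimes b)=ab$, $\rho_{-1}(a)=a\otimes1$, and for $n\ge1$: $\partial_n(a\otimes w\otimes b)=a((\mathrm{id}-\rho_{n-2}\partial_{n-1})\delta_n(1\otimes w\otimes1))b$, $\rho_{n-1}=\gamma_{n-1}+\sum_{i\ge1}\gamma_{n-1}(\delta_n\gamma_{n-1}-\partial_n\gamma_{n-1})^i$. Bar resolution: $\bar A=A/(\Bbbk Q_0\cdot1_A)$, $\mathrm{Bar}_n=A\otimes\bar A^{\otimes n}\otimes A$ with the usual differential $d_n(a_0\otimes\cdots\otimes a_{n+1})=\sum_{i=0}^n(-1)^ia_0\otimes\cdots\otimes a_ia_{i+1}\otimes\cdots\otimes a_{n+1}$, $d_0$ the multiplication. Comparison maps and homotopy: $P_{-1}=\mathrm{Bar}_{-1}=A$, $F_{-1}=G_{-1}=\varpi_{-1}=\mathrm{id}_A$;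 $\varpi:A\to\bar A$ the projection, $\varpi_n=\mathrm{id}_{A\otimes\bar A^{\otimes n}}\otimes\varpi:A\otimes\bar A^{\otimes n}\otimes A\to A\otimes\bar A^{\otimes n}\otimes\bar A$. For $n\ge0$, $F_n(a\otimes w\otimes b)=(-1)^n\varpi_{n-1}F_{n-1}\partial_n(a\otimes w\otimes1)\otimes b$, $G_n(a\otimes y\otimes b)=(\rho_{n-1}G_{n-1}d_n(a\otimes y\otimes1))b$ (so $F_0=G_0=\mathrm{id}_{A\otimes A}$), and $h_n(a_0\otimes\bar a_1\otimes\cdots\otimes\bar a_n\otimes a_{n+1})=\sum_{i=1}^n(-1)^{i+1}\varpi_iF_iG_i(a_0\otimes\bar a_1\otimes\cdots\otimes\bar a_i\otimes1)\otimes\bar a_{i+1}\otimes\cdots\otimes\bar a_n\otimes a_{n+1}$ (so $h_0=0$). *)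

theory Defs
  imports
    Graph_Theory.Arc_Walk
    "HOL-Algebra.QuotRing"
    "HOL-Algebra.Module"
    "HOL-Algebra.Free_Abelian_Groups"
begin

section \<open>Tensor products over a ring of scalars\<close>

text \<open>
  As for \<^typ>\<open>('a, 'b) module\<close> in \<^theory>\<open>HOL-Algebra.Module\<close>, the underlying abelian group is
  stored in the additive part of a ring record; the multiplicative part is never used.
\<close>

record ('r, 'm) bimodule = "'m ring" +
  lact :: "'r \<Rightarrow> 'm \<Rightarrow> 'm"
  ract :: "'m \<Rightarrow> 'r \<Rightarrow> 'm"

definition additive_record :: "'m monoid \<Rightarrow> 'm ring" where
  "additive_record G =
    \<lparr>carrier = carrier G, monoid.mult = (\<lambda>_ _. \<one>\<^bsub>G\<^esub>), one = \<one>\<^bsub>G\<^esub>, ring.zero = \<one>\<^bsub>G\<^esub>, add = (\<otimes>\<^bsub>G\<^esub>)\<rparr>"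

text \<open>
  For a list \<open>Ms = [M\<^sub>0, \<dots>, M\<^sub>k]\<close> of bimodules over a ring with underlying set \<open>K\<close>, the tensor product
  \<open>M\<^sub>0 \<otimes>\<^sub>K \<dots> \<otimes>\<^sub>K M\<^sub>k\<close> is the free abelian group on \<open>M\<^sub>0 \<times> \<dots> \<times> M\<^sub>k\<close> modulo additivity in each factor
  and \<open>(\<dots>, x z, y, \<dots>) = (\<dots>, x, z y, \<dots>)\<close> for \<open>z \<in> K\<close>.
\<close>

definition tuples :: "('r, 'm) bimodule list \<Rightarrow> 'm list set" where
  "tuples Ms = listset (map carrier Ms)"

definition tensor_rels :: "'r set \<Rightarrow> ('r, 'm) bimodule list \<Rightarrow> ('m list \<Rightarrow>\<^sub>0 int) set" where
  "tensor_rels K Ms =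
     {frag_of (xs[i := x \<oplus>\<^bsub>Ms ! i\<^esub> y]) - frag_of (xs[i := x]) - frag_of (xs[i := y]) | xs i x y.
        xs \<in> tuples Ms \<and> i < length Ms \<and> x \<in> carrier (Ms ! i) \<and> y \<in> carrier (Ms ! i)} \<union>
     {frag_of (xs[i := ract (Ms ! i) (xs ! i) z]) -
      frag_of (xs[Suc i := lact (Ms ! Suc i) z (xs ! Suc i)]) | xs i z.
        xs \<in> tuples Ms \<and> Suc i < length Ms \<and> z \<in> K}"

definition tensor_null :: "'r set \<Rightarrow> ('r, 'm) bimodule list \<Rightarrow> ('m list \<Rightarrow>\<^sub>0 int) set" where
  "tensor_null K Ms = generate (free_Abelian_group (tuples Ms)) (tensor_rels K Ms)"

definition tensor :: "'r set \<Rightarrow> ('r, 'm) bimodule list \<Rightarrow> ('m list \<Rightarrow>\<^sub>0 int) set ring" where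
  "tensor K Ms = additive_record (free_Abelian_group (tuples Ms) Mod tensor_null K Ms)"

definition pure_tensor :: "'r set \<Rightarrow> ('r, 'm) bimodule list \<Rightarrow> 'm list \<Rightarrow> ('m list \<Rightarrow>\<^sub>0 int) set" where
  "pure_tensor K Ms xs = tensor_null K Ms #>\<^bsub>free_Abelian_group (tuples Ms)\<^esub> frag_of xs"

text \<open>
  The additive map out of a tensor product which sends the pure tensor of \<open>xs\<close> to \<open>g xs\<close>.  It does not
  depend on the chosen representative when \<open>g\<close> respects \<^const>\<open>tensor_rels\<close>.
\<close>

definition tensor_lift ::
    "('n, 'z) ring_scheme \<Rightarrow> ('m list \<Rightarrow> 'n) \<Rightarrow> ('m list \<Rightarrow>\<^sub>0 int) set \<Rightarrow> 'n" where
  "tensor_lift H g X =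
     (let c = (SOME c. c \<in> X)
      in \<Oplus>\<^bsub>H\<^esub>xs \<in> Poly_Mapping.keys c. [Poly_Mapping.lookup c xs] \<cdot>\<^bsub>H\<^esub> g xs)"

text \<open>\<open>m\<^sub>0 \<otimes> \<dots> \<otimes> m\<^sub>k \<mapsto> m\<^sub>0 \<otimes> \<dots> \<otimes> m\<^sub>k \<otimes> y\<^sub>1 \<otimes> \<dots> \<otimes> y\<^sub>l\<close>, where \<open>Ms\<close> lists the factors of the target\<close>

definition tensor_append ::
    "'r set \<Rightarrow> ('r, 'm) bimodule list \<Rightarrow> ('m list \<Rightarrow>\<^sub>0 int) set \<Rightarrow> 'm list \<Rightarrow> ('m list \<Rightarrow>\<^sub>0 int) set" where
  "tensor_append K Ms X ys = tensor_lift (tensor K Ms) (\<lambda>xs. pure_tensor K Ms (xs @ ys)) X"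

text \<open>The bimodule structure over a ring \<open>R\<close> when the first and the last factor are \<open>R\<close> itself\<close>

definition bimodule_tensor ::
    "'m ring \<Rightarrow> 'r set \<Rightarrow> ('r, 'm) bimodule list \<Rightarrow> ('m, ('m list \<Rightarrow>\<^sub>0 int) set) bimodule" where
  "bimodule_tensor R K Ms =
     ring.extend (tensor K Ms)
       \<lparr>lact = (\<lambda>a. tensor_lift (tensor K Ms) (\<lambda>xs. pure_tensor K Ms (xs[0 := a \<otimes>\<^bsub>R\<^esub> hd xs]))),
        ract = (\<lambda>X b. tensor_lift (tensor K Ms)
                        (\<lambda>xs. pure_tensor K Ms (xs[length xs - 1 := last xs \<otimes>\<^bsub>R\<^esub> b])) X)\<rparr>"

definition bimodule_hom :: "'r ring \<Rightarrow> ('r, 'm) bimodule \<Rightarrow> ('r, 'n) bimodule \<Rightarrow> ('m \<Rightarrow> 'n) set" where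
  "bimodule_hom R M N =
     {f \<in> carrier M \<rightarrow> carrier N.
        (\<forall>x\<in>carrier M. \<forall>y\<in>carrier M. f (x \<oplus>\<^bsub>M\<^esub> y) = f x \<oplus>\<^bsub>N\<^esub> f y) \<and>
        (\<forall>a\<in>carrier R. \<forall>x\<in>carrier M.
           f (lact M a x) = lact N a (f x) \<and> f (ract M x a) = ract N (f x) a)}"

definition bimodule_complex ::
    "'r ring \<Rightarrow> (nat \<Rightarrow> ('r, 'm) bimodule) \<Rightarrow> (nat \<Rightarrow> 'm \<Rightarrow> 'm) \<Rightarrow> bool" where
  "bimodule_complex R C D \<longleftrightarrow>
     (\<forall>n. D (Suc n) \<in> bimodule_hom R (C (Suc n)) (C n)) \<and>
     (\<forall>n. \<forall>x\<in>carrier (C (Suc (Suc n))). D (Suc n) (D (Suc (Suc n)) x) = \<zero>\<^bsub>C n\<^esub>)"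

definition complex_morphism ::
    "'r ring \<Rightarrow> (nat \<Rightarrow> ('r, 'm) bimodule) \<Rightarrow> (nat \<Rightarrow> 'm \<Rightarrow> 'm) \<Rightarrow>
     (nat \<Rightarrow> ('r, 'n) bimodule) \<Rightarrow> (nat \<Rightarrow> 'n \<Rightarrow> 'n) \<Rightarrow> (nat \<Rightarrow> 'm \<Rightarrow> 'n) \<Rightarrow> bool" where
  "complex_morphism R C D C' D' f \<longleftrightarrow>
     bimodule_complex R C D \<and> bimodule_complex R C' D' \<and>
     (\<forall>n. f n \<in> bimodule_hom R (C n) (C' n)) \<and>
     (\<forall>n. \<forall>x\<in>carrier (C (Suc n)). D' (Suc n) (f (Suc n) x) = f n (D (Suc n) x))"

text \<open>The condition for \<open>n = 0\<close> is stated with \<open>h\<^bsub>-1\<^esub> = 0\<close>.\<close>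

definition homotopy_deformation_retract ::
    "'r ring \<Rightarrow> (nat \<Rightarrow> ('r, 'm) bimodule) \<Rightarrow> (nat \<Rightarrow> 'm \<Rightarrow> 'm) \<Rightarrow>
     (nat \<Rightarrow> ('r, 'n) bimodule) \<Rightarrow> (nat \<Rightarrow> 'n \<Rightarrow> 'n) \<Rightarrow>
     (nat \<Rightarrow> 'm \<Rightarrow> 'n) \<Rightarrow> (nat \<Rightarrow> 'n \<Rightarrow> 'm) \<Rightarrow> (nat \<Rightarrow> 'n \<Rightarrow> 'n) \<Rightarrow> bool" where
  "homotopy_deformation_retract R C D C' D' f g h \<longleftrightarrow>
     complex_morphism R C D C' D' f \<and>
     complex_morphism R C' D' C D g \<and>
     (\<forall>n. h n \<in> bimodule_hom R (C' n) (C' (Suc n))) \<and>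
     (\<forall>n. \<forall>x\<in>carrier (C n). g n (f n x) = x) \<and>
     (\<forall>n. \<forall>y\<in>carrier (C' n).
        f n (g n y) \<ominus>\<^bsub>C' n\<^esub> y =
        (if n = 0 then \<zero>\<^bsub>C' n\<^esub> else h (n - 1) (D' n y)) \<oplus>\<^bsub>C' n\<^esub> D' (Suc n) (h n y))"

definition special ::
    "(nat \<Rightarrow> ('r, 'm) bimodule) \<Rightarrow> (nat \<Rightarrow> ('r, 'n) bimodule) \<Rightarrow>
     (nat \<Rightarrow> 'm \<Rightarrow> 'n) \<Rightarrow> (nat \<Rightarrow> 'n \<Rightarrow> 'm) \<Rightarrow> (nat \<Rightarrow> 'n \<Rightarrow> 'n) \<Rightarrow> bool" where
  "special C C' f g h \<longleftrightarrow>
     (\<forall>n. \<forall>x\<in>carrier (C n). h n (f n x) = \<zero>\<^bsub>C' (Suc n)\<^esub>) \<and>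
     (\<forall>n. \<forall>y\<in>carrier (C' n). g (Suc n) (h n y) = \<zero>\<^bsub>C (Suc n)\<^esub>) \<and>
     (\<forall>n. \<forall>y\<in>carrier (C' n). h (Suc n) (h n y) = \<zero>\<^bsub>C' (Suc (Suc n))\<^esub>)"


section \<open>Path algebras\<close>

text \<open>
  A quiver is a \<^typ>\<open>('v, 'e) pre_digraph\<close> (loops and parallel arrows allowed).  A path is its source
  together with its list of arrows, so that the trivial path at \<open>v\<close> is \<open>(v, [])\<close>.
\<close>

type_synonym ('v, 'e) path = "'v \<times> 'e list"
type_synonym ('v, 'e, 'k) pathalg = "('v, 'e) path \<Rightarrow>\<^sub>0 'k"

definition paths :: "('v, 'e) pre_digraph \<Rightarrow> ('v, 'e) path set" where
  "paths Q = {(u, es). \<exists>v. pre_digraph.awalk Q u es v}"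

definition src :: "('v, 'e) path \<Rightarrow> 'v" where
  "src p = fst p"

definition tgt :: "('v, 'e) pre_digraph \<Rightarrow> ('v, 'e) path \<Rightarrow> 'v" where
  "tgt Q p = pre_digraph.awlast Q (fst p) (snd p)"

definition plen :: "('v, 'e) path \<Rightarrow> nat" where
  "plen p = length (snd p)"

definition trivial_paths :: "('v, 'e) pre_digraph \<Rightarrow> ('v, 'e) path set" where
  "trivial_paths Q = {p \<in> paths Q. plen p = 0}"

fun composable :: "('v, 'e) pre_digraph \<Rightarrow> ('v, 'e) path list \<Rightarrow> bool" where
  "composable Q [] \<longleftrightarrow> True"
| "composable Q [p] \<longleftrightarrow> p \<in> paths Q"
| "composable Q (p # q # ps) \<longleftrightarrow> p \<in> paths Q \<and> tgt Q p = src q \<and> composable Q (q # ps)"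

text \<open>Only meaningful for nonempty composable lists.\<close>

definition pconcat :: "('v, 'e) path list \<Rightarrow> ('v, 'e) path" where
  "pconcat ps = (src (hd ps), concat (map snd ps))"

definition subpath :: "('v, 'e) pre_digraph \<Rightarrow> ('v, 'e) path \<Rightarrow> ('v, 'e) path \<Rightarrow> bool" where
  "subpath Q w p \<longleftrightarrow> (\<exists>q r. composable Q [q, w, r] \<and> pconcat [q, w, r] = p)"

definition pmult ::
    "('v, 'e) pre_digraph \<Rightarrow> ('v, 'e, 'k) pathalg \<Rightarrow> ('v, 'e, 'k) pathalg \<Rightarrow> ('v, 'e, 'k::field) pathalg" where
  "pmult Q x y = (\<Sum>p\<in>Poly_Mapping.keys x. \<Sum>q\<in>Poly_Mapping.keys y.
     if tgt Q p = src q
     then Poly_Mapping.single (pconcat [p, q]) (Poly_Mapping.lookup x p * Poly_Mapping.lookup y q)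
     else 0)"

definition scalar :: "('v, 'e) pre_digraph \<Rightarrow> 'k \<Rightarrow> ('v, 'e, 'k::field) pathalg" where
  "scalar Q c = (\<Sum>p\<in>trivial_paths Q. Poly_Mapping.single p c)"

definition path_algebra :: "('v, 'e) pre_digraph \<Rightarrow> ('v, 'e, 'k::field) pathalg ring" where
  "path_algebra Q =
     \<lparr>carrier = {x. Poly_Mapping.keys x \<subseteq> paths Q}, monoid.mult = pmult Q, one = scalar Q 1,
      ring.zero = 0, add = (+)\<rparr>"

definition path_span :: "('v, 'e) path set \<Rightarrow> ('v, 'e, 'k::field) pathalg set" where
  "path_span T = {x. Poly_Mapping.keys x \<subseteq> T}"

abbreviation vertex_algebra :: "('v, 'e) pre_digraph \<Rightarrow> ('v, 'e, 'k::field) pathalg set" where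
  "vertex_algebra Q \<equiv> path_span (trivial_paths Q)"

abbreviation ppath :: "('v, 'e) path \<Rightarrow> ('v, 'e, 'k::field) pathalg" where
  "ppath p \<equiv> Poly_Mapping.single p 1"

text \<open>
  The subquotient \<open>V / U\<close> of the path algebra, for sub-bimodules \<open>U \<subseteq> V\<close> over the vertex algebra.  All
  tensor factors below are of this form, which gives them a common type.
\<close>

definition subquotient ::
    "('v, 'e) pre_digraph \<Rightarrow> ('v, 'e, 'k) pathalg set \<Rightarrow> ('v, 'e, 'k) pathalg set \<Rightarrow>
     (('v, 'e, 'k) pathalg, ('v, 'e, 'k::field) pathalg set) bimodule" where
  "subquotient Q V U =
     ring.extend
       (additive_record
          \<lparr>carrier = (\<lambda>x. U +>\<^bsub>path_algebra Q\<^esub> x) ` V,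
           monoid.mult = set_add (path_algebra Q), one = U\<rparr>)
       \<lparr>lact = (\<lambda>z X. U <+>\<^bsub>path_algebra Q\<^esub> pmult Q z ` X),
        ract = (\<lambda>X z. U <+>\<^bsub>path_algebra Q\<^esub> (\<lambda>x. pmult Q x z) ` X)\<rparr>"


section \<open>Reduction systems\<close>

text \<open>
  A reduction system \<open>{(s, \<phi> s) | s \<in> S}\<close> is given by the set \<open>S\<close> and the function \<open>\<phi>\<close>, whose values
  outside \<open>S\<close> are irrelevant.
\<close>

definition irr :: "('v, 'e) pre_digraph \<Rightarrow> ('v, 'e) path set \<Rightarrow> ('v, 'e) path set" where
  "irr Q S = {p \<in> paths Q. \<not> (\<exists>s\<in>S. subpath Q s p)}"

definition reduction_system ::
    "('v, 'e) pre_digraph \<Rightarrow> ('v, 'e) path set \<Rightarrow> (('v, 'e) path \<Rightarrow> ('v, 'e, 'k::field) pathalg) \<Rightarrow> bool" where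
  "reduction_system Q S \<phi> \<longleftrightarrow>
     S \<subseteq> {p \<in> paths Q. plen p \<ge> 2} \<and>
     (\<forall>s\<in>S. \<forall>s'\<in>S. s \<noteq> s' \<longrightarrow> \<not> subpath Q s s') \<and>
     (\<forall>s\<in>S. \<forall>p\<in>Poly_Mapping.keys (\<phi> s). p \<in> irr Q S \<and> src p = src s \<and> tgt Q p = tgt Q s)"

definition basic_reduction ::
    "('v, 'e) pre_digraph \<Rightarrow> (('v, 'e) path \<Rightarrow> ('v, 'e, 'k::field) pathalg) \<Rightarrow>
     ('v, 'e) path \<Rightarrow> ('v, 'e) path \<Rightarrow> ('v, 'e) path \<Rightarrow> ('v, 'e, 'k) pathalg \<Rightarrow> ('v, 'e, 'k) pathalg" where
  "basic_reduction Q \<phi> q s r x =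
     (let c = Poly_Mapping.lookup x (pconcat [q, s, r])
      in x - Poly_Mapping.single (pconcat [q, s, r]) c
           + pmult Q (pmult Q (Poly_Mapping.single q c) (\<phi> s)) (ppath r))"

inductive_set reductions ::
    "('v, 'e) pre_digraph \<Rightarrow> ('v, 'e) path set \<Rightarrow> (('v, 'e) path \<Rightarrow> ('v, 'e, 'k::field) pathalg) \<Rightarrow>
     (('v, 'e, 'k) pathalg \<Rightarrow> ('v, 'e, 'k) pathalg) set"
  for Q S \<phi> where
  id: "id \<in> reductions Q S \<phi>"
| comp: "\<rho> \<in> reductions Q S \<phi> \<Longrightarrow> s \<in> S \<Longrightarrow> composable Q [q, s, r] \<Longrightarrow>
    basic_reduction Q \<phi> q s r \<circ> \<rho> \<in> reductions Q S \<phi>"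

primrec iterated :: "(nat \<Rightarrow> 'a \<Rightarrow> 'a) \<Rightarrow> nat \<Rightarrow> 'a \<Rightarrow> 'a" where
  "iterated f 0 x = x"
| "iterated f (Suc n) x = f n (iterated f n x)"

definition reduction_finite where
  "reduction_finite Q S \<phi> p \<longleftrightarrow>
     (\<forall>f. (\<forall>i. f i \<in> reductions Q S \<phi>) \<longrightarrow>
          (\<exists>N. \<forall>n\<ge>N. iterated f n (ppath p) = iterated f N (ppath p)))"

definition reduction_unique where
  "reduction_unique Q S \<phi> p \<longleftrightarrow>
     reduction_finite Q S \<phi> p \<and>
     (\<forall>\<rho>\<in>reductions Q S \<phi>. \<forall>\<rho>'\<in>reductions Q S \<phi>.
        \<rho> (ppath p) \<in> path_span (irr Q S) \<longrightarrow> \<rho>' (ppath p) \<in> path_span (irr Q S) \<longrightarrow>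
        \<rho> (ppath p) = \<rho>' (ppath p))"

definition diamond ::
    "('v, 'e) pre_digraph \<Rightarrow> ('v, 'e, 'k::field) pathalg set \<Rightarrow> ('v, 'e) path set \<Rightarrow>
     (('v, 'e) path \<Rightarrow> ('v, 'e, 'k) pathalg) \<Rightarrow> bool" where
  "diamond Q I S \<phi> \<longleftrightarrow>
     I = Idl\<^bsub>path_algebra Q\<^esub> ((\<lambda>s. ppath s - \<phi> s) ` S) \<and>
     (\<forall>p\<in>paths Q. reduction_unique Q S \<phi> p)"


section \<open>The two resolutions and the comparison maps\<close>

locale presentation =
  fixes Q :: "('v, 'e) pre_digraph"
    and I :: "('v, 'e, 'k::field_char_0) pathalg set"
    and S :: "('v, 'e) path set"
begin

definition A :: "('v, 'e, 'k) pathalg set ring" where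
  "A = path_algebra Q Quot I"

definition proj :: "('v, 'e, 'k) pathalg \<Rightarrow> ('v, 'e, 'k) pathalg set" where
  "proj x = I +>\<^bsub>path_algebra Q\<^esub> x"

text \<open>The unique irreducible representative of a class in \<open>A\<close> (unique if the diamond condition holds)\<close>

definition nf :: "('v, 'e, 'k) pathalg set \<Rightarrow> ('v, 'e, 'k) pathalg" where
  "nf a = (THE x. x \<in> a \<and> x \<in> path_span (irr Q S))"

definition fac_A where
  "fac_A = subquotient Q (carrier (path_algebra Q)) I"

text \<open>\<open>Abar = A / (\<k>Q\<^sub>0 \<cdot> 1\<^sub>A)\<close>, that is \<open>\<k>Q / (I + \<k>Q\<^sub>0)\<close>\<close>

definition bar_null :: "('v, 'e, 'k) pathalg set" where
  "bar_null = I <+>\<^bsub>path_algebra Q\<^esub> vertex_algebra Q"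

definition fac_Abar where
  "fac_Abar = subquotient Q (carrier (path_algebra Q)) bar_null"

definition to_bar :: "('v, 'e, 'k) pathalg set \<Rightarrow> ('v, 'e, 'k) pathalg set" where
  "to_bar a = bar_null <+>\<^bsub>path_algebra Q\<^esub> a"

text \<open>Some lift to \<open>A\<close> of a class in \<open>A\<close> (where it is the class itself) or in \<open>Abar\<close>\<close>

definition lift_A :: "('v, 'e, 'k) pathalg set \<Rightarrow> ('v, 'e, 'k) pathalg set" where
  "lift_A X = proj (SOME x. x \<in> X)"

text \<open>The chains \<open>S\<^sub>n\<close>; for \<open>n \<ge> 3\<close> they are products of \<open>n\<close> paths \<open>us = [u\<^sub>0, \<dots>, u\<^bsub>n-1\<^esub>]\<close>.\<close>

definition chains :: "nat \<Rightarrow> ('v, 'e) path set" where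
  "chains n =
     (if n = 0 then trivial_paths Q
      else if n = 1 then {p \<in> paths Q. plen p = 1}
      else if n = 2 then S
      else {pconcat us | us. composable Q us \<and> length us = n \<and> plen (us ! 0) = 1 \<and>
             (\<forall>i. 0 < i \<and> i < n \<longrightarrow> us ! i \<in> irr Q S) \<and>
             (\<forall>i. Suc i < n \<longrightarrow> pconcat [us ! i, us ! Suc i] \<notin> irr Q S) \<and>
             (\<forall>i d e. Suc i < n \<and> composable Q [d, e] \<and> pconcat [d, e] = us ! Suc i \<and> plen e > 0
                \<longrightarrow> pconcat [us ! i, d] \<in> irr Q S)})"

text \<open>\<open>\<k>S\<^sub>n\<close>, with \<open>x\<close> represented by its class \<open>{x}\<close> modulo \<open>0\<close>\<close>

definition fac_S where
  "fac_S n = subquotient Q (path_span (chains n)) {0}"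

definition facs_P where
  "facs_P n = [fac_A, fac_S n, fac_A]"

definition P where
  "P n = bimodule_tensor A (vertex_algebra Q) (facs_P n)"

definition P_pure where
  "P_pure n a w b = pure_tensor (vertex_algebra Q) (facs_P n) [a, {w}, b]"

text \<open>The additive map out of \<open>P\<^sub>n\<close> given on \<open>a \<otimes> w \<otimes> b\<close>, \<open>w \<in> S\<^sub>n\<close>, by \<open>g a w b\<close>\<close>

definition P_lift where
  "P_lift H g = tensor_lift H (\<lambda>xs. let x = the_elem (xs ! 1) in
     \<Oplus>\<^bsub>H\<^esub>w \<in> Poly_Mapping.keys x.
       g (proj (scalar Q (Poly_Mapping.lookup x w)) \<otimes>\<^bsub>A\<^esub> (xs ! 0)) w (xs ! 2))"

text \<open>The bimodule map out of \<open>P\<^sub>n\<close> given on \<open>1 \<otimes> w \<otimes> 1\<close>, \<open>w \<in> S\<^sub>n\<close>, by \<open>g w\<close>\<close>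

definition P_bilift where
  "P_bilift H g = P_lift H (\<lambda>a w b. lact H a (ract H (g w) b))"

definition occs :: "nat \<Rightarrow> ('v, 'e) path \<Rightarrow> (('v, 'e) path \<times> ('v, 'e) path \<times> ('v, 'e) path) set" where
  "occs n p = {(q, w, r). composable Q [q, w, r] \<and> pconcat [q, w, r] = p \<and> w \<in> chains n}"

definition split_sum where
  "split_sum n T = (\<Oplus>\<^bsub>P n\<^esub>t \<in> T.
     case t of (q, w, r) \<Rightarrow> P_pure n (proj (ppath q)) (ppath w) (proj (ppath r)))"

definition split where
  "split n p = split_sum n (occs n p)"

text \<open>The sets of rightmost and of leftmost occurrences have at most one element.\<close>

definition splitR where
  "splitR n p = split_sum n
     {(q, w, r) \<in> occs n p. \<forall>(q', w', r') \<in> occs n p. plen q' \<le> plen q}"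

definition splitL where
  "splitL n p = split_sum n
     {(q, w, r) \<in> occs n p. \<forall>(q', w', r') \<in> occs n p. plen q \<le> plen q'}"

text \<open>
  \<open>\<delta> n : P\<^sub>n \<rightarrow> P\<^bsub>n-1\<^esub>\<close> for \<open>n \<ge> 1\<close>.  Here \<open>P\<^sub>0 = A \<otimes> \<k>Q\<^sub>0 \<otimes> A\<close> is identified with \<open>A \<otimes> A\<close> via
  \<open>a \<otimes> b = a \<otimes> 1 \<otimes> b\<close>, where \<open>1 \<in> \<k>Q\<^sub>0\<close> is the sum of the vertices.
\<close>

definition \<delta> where
  "\<delta> n = P_bilift (P (n - 1)) (\<lambda>w.
     if n = 1 then P_pure 0 (proj (ppath w)) (scalar Q 1) \<one>\<^bsub>A\<^esub>
                   \<ominus>\<^bsub>P 0\<^esub> P_pure 0 \<one>\<^bsub>A\<^esub> (scalar Q 1) (proj (ppath w))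
     else if odd n then splitR (n - 1) w \<ominus>\<^bsub>P (n - 1)\<^esub> splitL (n - 1) w
     else split (n - 1) w)"

text \<open>
  \<open>\<gamma> n : P\<^sub>n \<rightarrow> P\<^bsub>n+1\<^esub>\<close>.  Note that \<open>1 \<otimes> w \<otimes> \<pi>(u) = 0\<close> unless \<open>w\<close> and \<open>u\<close> are composable.
\<close>

definition \<gamma> where
  "\<gamma> n = P_lift (P (Suc n)) (\<lambda>a w b.
     \<Oplus>\<^bsub>P (Suc n)\<^esub>u \<in> {u \<in> Poly_Mapping.keys (nf b). tgt Q w = src u}.
       lact (P (Suc n)) (a \<otimes>\<^bsub>A\<^esub> proj (scalar Q (Poly_Mapping.lookup (nf b) u)))
         ([((-1::int) ^ Suc n)] \<cdot>\<^bsub>P (Suc n)\<^esub> split (Suc n) (pconcat [w, u])))"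

definition aug_P where
  "aug_P = P_lift A (\<lambda>a w b. a \<otimes>\<^bsub>A\<^esub> proj (ppath w) \<otimes>\<^bsub>A\<^esub> b)"

definition \<rho>_aug where
  "\<rho>_aug a = P_pure 0 a (scalar Q 1) \<one>\<^bsub>A\<^esub>"

text \<open>
  \<open>\<rho>\<^sub>n\<close> in terms of \<open>D = \<partial>\<^bsub>n+1\<^esub>\<close>.  For each \<open>X\<close> only finitely many terms of the series are nonzero.
\<close>

definition \<rho>_of where
  "\<rho>_of n D X = (let t = (\<lambda>i. \<gamma> n (((\<lambda>Y. \<delta> (Suc n) (\<gamma> n Y) \<ominus>\<^bsub>P n\<^esub> D (\<gamma> n Y)) ^^ i) X)) in
     \<gamma> n X \<oplus>\<^bsub>P (Suc n)\<^esub> (\<Oplus>\<^bsub>P (Suc n)\<^esub>i \<in> {i. i \<ge> 1 \<and> t i \<noteq> \<zero>\<^bsub>P (Suc n)\<^esub>}. t i))"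

text \<open>\<open>dP n = \<partial>\<^sub>n : P\<^sub>n \<rightarrow> P\<^bsub>n-1\<^esub>\<close> for \<open>n \<ge> 1\<close>; \<^const>\<open>aug_P\<close> takes the place of \<open>\<partial>\<^sub>0\<close>.\<close>

fun dP where
  "dP (Suc 0) = P_bilift (P 0) (\<lambda>w.
     let X = \<delta> 1 (P_pure 1 \<one>\<^bsub>A\<^esub> (ppath w) \<one>\<^bsub>A\<^esub>) in X \<ominus>\<^bsub>P 0\<^esub> \<rho>_aug (aug_P X))"
| "dP (Suc (Suc n)) = P_bilift (P (Suc n)) (\<lambda>w.
     let X = \<delta> (n + 2) (P_pure (n + 2) \<one>\<^bsub>A\<^esub> (ppath w) \<one>\<^bsub>A\<^esub>)
     in X \<ominus>\<^bsub>P (Suc n)\<^esub> \<rho>_of n (dP (Suc n)) (dP (Suc n) X))"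

definition \<rho> where
  "\<rho> n = \<rho>_of n (dP (Suc n))"

definition facs_bar where
  "facs_bar n = [fac_A] @ replicate n fac_Abar @ [fac_A]"

definition Bar where
  "Bar n = bimodule_tensor A (vertex_algebra Q) (facs_bar n)"

abbreviation Bar_pure where
  "Bar_pure n xs \<equiv> pure_tensor (vertex_algebra Q) (facs_bar n) xs"

text \<open>\<open>a\<^sub>0 \<otimes> abar\<^sub>1 \<otimes> \<dots> \<otimes> abar\<^sub>n \<otimes> a\<^bsub>n+1\<^esub>\<close> for \<open>as = [a\<^sub>0, \<dots>, a\<^bsub>n+1\<^esub>]\<close> in \<open>A\<close>\<close>

definition Bar_elt where
  "Bar_elt n as = Bar_pure n ([hd as] @ map to_bar (butlast (tl as)) @ [last as])"

text \<open>
  \<open>dBar n : Bar\<^sub>n \<rightarrow> Bar\<^bsub>n-1\<^esub>\<close> for \<open>n \<ge> 1\<close>.  The individual summands depend on the lifts of the middle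
  entries to \<open>A\<close>, their alternating sum does not.  \<open>aug_Bar\<close> takes the place of \<open>d\<^sub>0\<close>.
\<close>

definition dBar where
  "dBar n = tensor_lift (Bar (n - 1)) (\<lambda>xs. let as = map lift_A xs in
     \<Oplus>\<^bsub>Bar (n - 1)\<^esub>i \<in> {0..n}. [((-1::int) ^ i)] \<cdot>\<^bsub>Bar (n - 1)\<^esub>
       Bar_elt (n - 1) (take i as @ [as ! i \<otimes>\<^bsub>A\<^esub> as ! Suc i] @ drop (i + 2) as))"

definition aug_Bar where
  "aug_Bar = tensor_lift A (\<lambda>xs. xs ! 0 \<otimes>\<^bsub>A\<^esub> xs ! 1)"

text \<open>
  \<open>varpi n : A \<otimes> Abar\<^bsup>\<otimes>n\<^esup> \<otimes> A \<rightarrow> A \<otimes> Abar\<^bsup>\<otimes>n\<^esup> \<otimes> Abar\<close>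
\<close>

definition varpi where
  "varpi n = (let Ms = fac_A # replicate (Suc n) fac_Abar in
     tensor_lift (tensor (vertex_algebra Q) Ms)
       (\<lambda>xs. pure_tensor (vertex_algebra Q) Ms (butlast xs @ [to_bar (last xs)])))"

primrec F where
  "F 0 = P_lift (Bar 0) (\<lambda>a w b. Bar_pure 0 [aug_P (P_pure 0 a (ppath w) \<one>\<^bsub>A\<^esub>), b])"
| "F (Suc n) = P_lift (Bar (Suc n)) (\<lambda>a w b. [((-1::int) ^ Suc n)] \<cdot>\<^bsub>Bar (Suc n)\<^esub>
     tensor_append (vertex_algebra Q) (facs_bar (Suc n))
       (varpi n (F n (dP (Suc n) (P_pure (Suc n) a (ppath w) \<one>\<^bsub>A\<^esub>)))) [b])"

primrec G where
  "G 0 = tensor_lift (P 0) (\<lambda>xs.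
     ract (P 0) (\<rho>_aug (aug_Bar (Bar_pure 0 (butlast xs @ [\<one>\<^bsub>A\<^esub>])))) (last xs))"
| "G (Suc n) = tensor_lift (P (Suc n)) (\<lambda>xs.
     ract (P (Suc n)) (\<rho> n (G n (dBar (Suc n) (Bar_pure (Suc n) (butlast xs @ [\<one>\<^bsub>A\<^esub>]))))) (last xs))"

text \<open>For \<open>xs = [a\<^sub>0, abar\<^sub>1, \<dots>, abar\<^sub>n, a\<^bsub>n+1\<^esub>]\<close>, the list is cut after \<open>abar\<^sub>i\<close>.\<close>

definition h where
  "h n = tensor_lift (Bar (Suc n)) (\<lambda>xs.
     \<Oplus>\<^bsub>Bar (Suc n)\<^esub>i \<in> {1..n}. [((-1::int) ^ (i + 1))] \<cdot>\<^bsub>Bar (Suc n)\<^esub>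
       tensor_append (vertex_algebra Q) (facs_bar (Suc n))
         (varpi i (F i (G i (Bar_pure i (take (i + 1) xs @ [\<one>\<^bsub>A\<^esub>])))))
         (drop (i + 1) xs))"

end

end

theory Submission
 imports Defs "HOL-Library.Multiset"
begin

text \<open>
 Both complexes are contractible by left module maps, and everything else is formal in the two
 contractions.  Write \<open>\<sigma>\<^sub>n(X) = (-1)\<^sup>n\<^sup>+\<^sup>1 \<varpi>\<^sub>n(X) \<otimes> 1\<close> on the bar side and \<open>\<rho>\<close> on the small side.  Then
 \<open>d \<sigma> = 1 - \<sigma> d\<close> and \<open>\<partial> \<rho> = 1 - \<rho> \<partial>\<close>, both contractions kill the elements with last tensor factor \<open>1\<close>,
 \<open>\<sigma> \<sigma> = 0\<close> and \<open>\<rho> \<rho> = 0\<close>, and on elements ending in \<open>1\<close> the three maps are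
 \<open>F = \<sigma> F \<partial>\<close>, \<open>G = \<rho> G d\<close> and \<open>h = \<sigma> (F G - h d)\<close>, extended right linearly.  Induction on the degree gives
 \<open>G F = \<rho> G d \<sigma> F \<partial> = \<rho> G F \<partial> = \<rho> \<partial> = 1\<close> on such elements (\<open>GF\<close>), and in the same way the homotopy
 relation (\<open>homotopy\<close>) and the vanishing of \<open>h F\<close>, \<open>G h\<close> and \<open>h h\<close>.
 
 The contraction of the small complex is where the reduction system enters.  Confluence makes the
 irreducible paths a basis of the algebra, and termination makes the order on paths generated by the
 reductions well-founded (\<open>wf_red_rel\<close>).  If all \<open>\<phi>\<^sub>s\<close> are zero, the algebra is monomial, \<open>\<delta>\<close> is a
 differential and \<open>1 - \<delta> \<gamma>\<close> takes its values in the image of the preceding \<open>\<gamma>\<close>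
 (\<open>contraction_even\<close>, \<open>contraction_odd\<close>).  This is a statement about the positions of chains in a path: these
 positions are found greedily, always passing to the next relation, which gives monotone functions of
 the starting point along which the sums telescope.  In general the same identities hold up to terms
 over strictly smaller paths (\<open>delta_delta\<close>, \<open>diff_low\<close>).  The perturbation \<open>(\<delta> - \<partial>) \<gamma>\<close> is therefore locally
 nilpotent, the series for \<open>\<rho>\<close> is finite on each element, and an induction on the degree shows that
 \<open>\<rho> \<partial>\<close> is the projection onto the image of \<open>\<gamma>\<close> along the kernel of \<open>\<partial>\<close> (\<open>pert_step\<close>, \<open>dP_rho\<close>).
 
 Maps out of a tensor product are built from balanced maps on tuples.  The bar differential and the
 homotopy are first defined recursively, through right linear extension, since this is the form in
 which the identities above are formal; \<open>DB_dd\<close> and \<open>hexp_hh\<close> recover the explicit sums.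
\<close>

text \<open>Groups carried by records are named explicitly in the notation for their operations.\<close>
abbreviation (input) add_in ("(_ +[_]/ _)" [65, 0, 66] 65) where "x +[G] y == add G x y"
abbreviation (input) minus_in ("(_ -[_]/ _)" [65, 0, 66] 65) where "x -[G] y == a_minus G x y"
abbreviation (input) zero_in ("\<zero>[_]") where "\<zero>[G] == ring.zero G"
abbreviation (input) one_in ("\<one>[_]") where "\<one>[G] == one G"
abbreviation "keys == Poly_Mapping.keys"
abbreviation "lookup == Poly_Mapping.lookup"
abbreviation "single == Poly_Mapping.single"

section \<open>Additive maps\<close>

lemma (in abelian_group) minus_zero_eq: "\<ominus> \<zero> = \<zero>" by (rule minus_equality) simp_all

text \<open>Makes the method algebra available for abelian groups, not only for rings.\<close>
lemmas (in abelian_group) group_simprules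
 [algebra abelian_group "ring.zero G" "add G" "a_inv G" "a_minus G"] =
 a_closed zero_closed a_inv_closed minus_closed
 a_assoc l_zero l_neg a_comm minus_eq
 r_zero r_neg r_neg2 r_neg1 minus_add minus_minus minus_zero_eq a_lcomm

lemma (in abelian_group) eq_if_minus_zero:
 "[| x \<ominus> y = \<zero>; x : carrier G; y : carrier G |] ==> x = y"
 by (metis minus_eq a_inv_closed minus_equality minus_minus)

definition ahom :: "('a, 'x) ring_scheme => ('b, 'y) ring_scheme => ('a => 'b) set" where
 "ahom G H = {f\<in>carrier G \<rightarrow> carrier H.
  \<forall>x\<in>carrier G. \<forall>y\<in>carrier G. f (x +[G] y) = f x +[H] f y}"

lemma ahomI:
 assumes "!!x. x : carrier G ==> f x : carrier H"
  and "!!x y. [| x : carrier G; y : carrier G |] ==> f (x +[G] y) = f x +[H] f y"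
 shows "f : ahom G H" using assms by (auto simp: ahom_def)

lemma ahom_in: "[| f : ahom G H; x : carrier G |] ==> f x : carrier H" by (auto simp: ahom_def)

lemma ahom_add:
 "[| f : ahom G H; x : carrier G; y : carrier G |] ==> f (x +[G] y) = f x +[H] f y" by (auto simp: ahom_def)

lemma ahom_cong:
 assumes "abelian_group G" "!!x. x : carrier G ==> f x = g x" "f : ahom G H"
 shows "g : ahom G H" proof -
 interpret abelian_group G by fact
 show ?thesis using assms(2,3) by (auto simp: ahom_def Pi_def)
qed

lemma ahom_id: "(%x. x) : ahom G G" by (auto simp: ahom_def)

lemma ahom_comp: "[| g : ahom H K; f : ahom G H |] ==> (%x. g (f x)) : ahom G K" by (auto simp: ahom_def Pi_def)

context
 fixes G :: "('a, 'x) ring_scheme" and H :: "('b, 'y) ring_scheme"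
 assumes G: "abelian_group G" and H: "abelian_group H"
begin

interpretation G: abelian_group G by (rule G)
interpretation H: abelian_group H by (rule H)

lemma ahom_zero: assumes "f : ahom G H" shows "f \<zero>[G] = \<zero>[H]" proof -
 have c: "f \<zero>[G] : carrier H" using assms by (simp add: ahom_in)
 have "f \<zero>[G] = f \<zero>[G] +[H] f \<zero>[G]" using ahom_add[OF assms, of "\<zero>[G]" "\<zero>[G]"] by simp
 thus ?thesis using c by (metis H.add.l_cancel_one')
qed

lemma ahom_neg:
 assumes "f : ahom G H" "x : carrier G" shows "f (\<ominus>\<^bsub>G\<^esub> x) = \<ominus>\<^bsub>H\<^esub> f x"
proof (rule H.minus_equality[symmetric])
 have "f (\<ominus>\<^bsub>G\<^esub> x +[G] x) = f (\<ominus>\<^bsub>G\<^esub> x) +[H] f x"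
  using assms by (intro ahom_add) auto
 thus "f (\<ominus>\<^bsub>G\<^esub> x) +[H] f x = \<zero>[H]" using assms by (simp add: G.l_neg ahom_zero)
qed (use assms in \<open>auto intro: ahom_in\<close>)

lemma ahom_minus:
 assumes "f : ahom G H" "x : carrier G" "y : carrier G"
 shows "f (x -[G] y) = f x -[H] f y" using assms by (simp add: a_minus_def ahom_add ahom_neg)

lemma ahom_finsum:
 assumes "f : ahom G H" "!!i. i : A ==> g i : carrier G"
 shows "f (\<Oplus>\<^bsub>G\<^esub>i\<in>A. g i) = (\<Oplus>\<^bsub>H\<^esub>i\<in>A. f (g i))"
proof (cases "finite A")
 case True
 thus ?thesis using assms(2) proof (induction A rule: finite_induct)
  case empty
  thus ?case by (simp add: ahom_zero[OF assms(1)])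
 next
  case (insert a A)
  hence "f (\<Oplus>\<^bsub>G\<^esub>i\<in>insert a A. g i) = f (g a) +[H] f (\<Oplus>\<^bsub>G\<^esub>i\<in>A. g i)"
  by (subst G.finsum_insert) (auto simp: ahom_add[OF assms(1)] G.finsum_closed)
  also have "\<dots> = (\<Oplus>\<^bsub>H\<^esub>i\<in>insert a A. f (g i))"
  using insert by (subst H.finsum_insert) (auto simp: ahom_in[OF assms(1)])
  finally show ?case .
 qed
qed (simp add: ahom_zero[OF assms(1)] G.finsum_infinite H.finsum_infinite)

lemma ahom_int:
 assumes "f : ahom G H" "x : carrier G"
 shows "f ([(k::int)] \<cdot>\<^bsub>G\<^esub> x) = [k] \<cdot>\<^bsub>H\<^esub> f x" proof -
 have n: "f ([n] \<cdot>\<^bsub>G\<^esub> x) = [n] \<cdot>\<^bsub>H\<^esub> f x" for n :: nat proof (induction n)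
  case 0
  thus ?case by (simp add: ahom_zero[OF assms(1)])
 next
  case (Suc n)
  have "f ([(Suc n)] \<cdot>\<^bsub>G\<^esub> x) = f ([n] \<cdot>\<^bsub>G\<^esub> x) +[H] f x"
  using assms(2) by (simp add: ahom_add[OF assms(1)] G.add.nat_pow_Suc)
  thus ?case using Suc assms(2) by (simp add: H.add.nat_pow_Suc ahom_in[OF assms(1)])
 qed
 show ?thesis by (cases "k \<ge> 0") (simp_all add: add_pow_int_ge add_pow_int_lt n assms ahom_neg)
qed

lemma ahom_const_zero: "(%x. \<zero>[H]) : ahom G H" by (auto simp: ahom_def)

lemma ahom_plus_fun:
 "[| f : ahom G H; g : ahom G H |] ==> (%x. f x +[H] g x) : ahom G H" by (auto simp: ahom_def Pi_def H.a_ac)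

lemma ahom_minus_fun:
 "[| f : ahom G H; g : ahom G H |] ==> (%x. f x -[H] g x) : ahom G H"
 by (auto simp: ahom_def Pi_def a_minus_def H.a_ac H.minus_add)

end

lemma (in abelian_group) int_mult_zero: "[(0::int)] \<cdot> x = \<zero>" by (simp add: add_pow_def)

lemma (in abelian_group) sign_mult:
 "x : carrier G ==> [((-1::int) ^ n)] \<cdot> x = (if even n then x else \<ominus> x)"
 using add.int_pow_neg[of x 1] add.int_pow_1[of x] by (cases "even n") simp_all

section \<open>Tensor products of bimodules\<close>

text \<open>
 Here \<open>K\<close> only labels the scalars over which tensors are balanced, so that a factor needs just
 additive left and right actions of the elements of \<open>K\<close>.
\<close>

lemma abelian_group_additive_record:
 assumes "comm_group G" shows "abelian_group (additive_record G)" proof -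
 interpret comm_group G by fact
 show ?thesis by (rule abelian_groupI) (auto simp: additive_record_def m_assoc l_inv_ex intro: m_comm)
qed

definition factor :: "'r set => ('r, 'm) bimodule => bool" where
 "factor K M \<longleftrightarrow> abelian_group M & (\<forall>z\<in>K. lact M z : ahom M M & (%x. ract M x z) : ahom M M)"

text \<open>
 The maps on tuples that factor through the tensor product, with the changed entries isolated by
 splitting lists instead of updating them.
\<close>

definition balanced ::
  "'r set => ('r, 'm) bimodule list => ('n, 'y) ring_scheme => ('m list => 'n) => bool" where
 "balanced K Ms H g \<longleftrightarrow> g : tuples Ms \<rightarrow> carrier H & (\<forall>Us M Vs us x y vs. Ms = Us @ M # Vs --> us : tuples Us --> vs : tuples Vs \<longrightarrow>
  x : carrier M --> y : carrier M \<longrightarrow>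
  g (us @ (x +[M] y) # vs) = g (us @ x # vs) +[H] g (us @ y # vs)) & (\<forall>Us M N Vs us x y vs z. Ms = Us @ M # N # Vs --> us : tuples Us --> vs : tuples Vs \<longrightarrow>
  x : carrier M --> y : carrier N --> z : K \<longrightarrow>
  g (us @ ract M x z # y # vs) = g (us @ x # lact N z y # vs))"

lemma tuples_iff: "xs : tuples Ms \<longleftrightarrow> list_all2 (%x M. x : carrier M) xs Ms"
proof (induction Ms arbitrary: xs)
 case (Cons M Ms)
 thus ?case by (cases xs) (auto simp: tuples_def set_Cons_def)
qed (auto simp: tuples_def)

lemma tuples_length: "xs : tuples Ms ==> length xs = length Ms" by (auto simp: tuples_iff list_all2_lengthD)

lemma tuples_Nil [simp]: "xs : tuples [] \<longleftrightarrow> xs = []" by (auto simp: tuples_iff)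

lemma tuples_Cons [simp]: "x # xs : tuples (M # Ms) \<longleftrightarrow> x : carrier M & xs : tuples Ms"
 by (auto simp: tuples_iff)

lemma tuples_append:
 "length us = length Us ==> us @ vs : tuples (Us @ Vs) \<longleftrightarrow> us : tuples Us & vs : tuples Vs"
 by (auto simp: tuples_iff list_all2_append)

lemma tuples_appendI [intro]:
 "[| us : tuples Us; vs : tuples Vs |] ==> us @ vs : tuples (Us @ Vs)" by (simp add: tuples_append tuples_length)

lemma tuples_appendE:
 assumes "xs : tuples (Us @ Vs)"
 obtains us vs where "xs = us @ vs" "us : tuples Us" "vs : tuples Vs"
 using assms by (auto simp: tuples_iff list_all2_append2)

lemma tuples_ConsE:
 assumes "xs : tuples (M # Ms)"
 obtains y ys where "xs = y # ys" "y : carrier M" "ys : tuples Ms"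
 using assms by (auto simp: tuples_iff list_all2_Cons2)

lemma balancedI:
 assumes "!!xs. xs : tuples Ms ==> g xs : carrier H"
  and "!!Us M Vs us x y vs. [| Ms = Us @ M # Vs; us : tuples Us; vs : tuples Vs;
  x : carrier M; y : carrier M |] ==>
  g (us @ (x +[M] y) # vs) = g (us @ x # vs) +[H] g (us @ y # vs)"
  and "!!Us M N Vs us x y vs z. [| Ms = Us @ M # N # Vs; us : tuples Us; vs : tuples Vs;
  x : carrier M; y : carrier N; z : K |] ==>
  g (us @ ract M x z # y # vs) = g (us @ x # lact N z y # vs)"
 shows "balanced K Ms H g" using assms unfolding balanced_def by blast

lemma bal_in: "[| balanced K Ms H g; xs : tuples Ms |] ==> g xs : carrier H" by (auto simp: balanced_def)

lemma bal_add:
 "[| balanced K (Us @ M # Vs) H g; us : tuples Us; vs : tuples Vs; x : carrier M; y : carrier M |]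
  ==> g (us @ (x +[M] y) # vs) = g (us @ x # vs) +[H] g (us @ y # vs)" unfolding balanced_def by blast

lemma bal_act:
 "[| balanced K (Us @ M # N # Vs) H g; us : tuples Us; vs : tuples Vs; x : carrier M; y : carrier N;
  z : K |] ==> g (us @ ract M x z # y # vs) = g (us @ x # lact N z y # vs)" unfolding balanced_def by blast

lemma bal_slot:
 assumes "balanced K (Us @ M # Vs) H g" "us : tuples Us" "vs : tuples Vs"
 shows "(%x. g (us @ x # vs)) : ahom M H" using assms
 by (intro ahomI) (auto intro!: bal_in[OF assms(1)] bal_add[OF assms(1)])

lemma bal_comp:
 assumes "balanced K Ms G g" "f : ahom G H"
 shows "balanced K Ms H (%xs. f (g xs))" proof (rule balancedI)
 fix Us M Vs us x y vs
 assume a: "Ms = Us @ M # Vs" "us : tuples Us" "vs : tuples Vs" "x : carrier M" "y : carrier M"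
 have "us @ x # vs : tuples Ms" "us @ y # vs : tuples Ms" using a by auto
 thus "f (g (us @ (x +[M] y) # vs)) = f (g (us @ x # vs)) +[H] f (g (us @ y # vs))"
  using a assms by (simp add: bal_add[of K Us M Vs G g us vs x y] ahom_add bal_in)
next
 fix Us M N Vs us x y vs z
 assume "Ms = Us @ M # N # Vs" "us : tuples Us" "vs : tuples Vs" "x : carrier M" "y : carrier N"
  "z : K"
 thus "f (g (us @ ract M x z # y # vs)) = f (g (us @ x # lact N z y # vs))"
  using assms(1) by (simp add: bal_act[of K Us M N Vs G g us vs x y z])
qed (use assms in \<open>auto simp: bal_in ahom_in\<close>)

context
 fixes K :: "'r set" and Ms :: "('r, 'm) bimodule list"
 assumes factors: "\<forall>M\<in>set Ms. factor K M"
begin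

lemma fac: "M : set Ms ==> factor K M" using factors by blast

abbreviation (input) "TF \<equiv> free_Abelian_group (tuples Ms)"

interpretation TF: comm_group TF by (rule abelian_free_Abelian_group)

lemma list_slot:
 assumes "xs : tuples Ms" "i < length Ms"
 obtains us vs where "Ms = take i Ms @ Ms ! i # drop (Suc i) Ms"
  "us : tuples (take i Ms)" "vs : tuples (drop (Suc i) Ms)" "xs ! i : carrier (Ms ! i)"
  "xs = us @ xs ! i # vs" "!!x. xs[i := x] = us @ x # vs" "length us = i" proof
 show Ms: "Ms = take i Ms @ Ms ! i # drop (Suc i) Ms" using assms(2) by (simp add: id_take_nth_drop[symmetric])
 have l: "length xs = length Ms" using assms(1) by (rule tuples_length)
 show "take i xs : tuples (take i Ms)" "drop (Suc i) xs : tuples (drop (Suc i) Ms)"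
  "xs ! i : carrier (Ms ! i)" using assms by (auto simp: tuples_iff list_all2_conv_all_nth)
 show "xs = take i xs @ xs ! i # drop (Suc i) xs" using assms(2) l by (simp add: id_take_nth_drop[symmetric])
 show "!!x. xs[i := x] = take i xs @ x # drop (Suc i) xs" using assms(2) l by (simp add: upd_conv_take_nth_drop)
 show "length (take i xs) = i" using assms(2) l by simp
qed

lemma fac_ab: "M : set Ms ==> abelian_group M" using fac by (auto simp: factor_def)

lemma rel_add_in:
 assumes "xs : tuples Ms" "i < length Ms" "x : carrier (Ms ! i)"
 shows "xs[i := x] : tuples Ms" using assms by (auto simp: tuples_iff list_all2_conv_all_nth nth_list_update)

lemma act_in:
 assumes "M : set Ms" "z : K" "x : carrier M"
 shows "lact M z x : carrier M" "ract M x z : carrier M"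
 using fac[OF assms(1)] assms(2,3) by (auto simp: factor_def dest: ahom_in)

lemma tensor_rels_sub: "tensor_rels K Ms <= carrier TF" proof -
 have 1: "frag_of (xs[i := x +[Ms ! i] y]) - frag_of (xs[i := x]) - frag_of (xs[i := y]) : carrier TF"
  if "xs : tuples Ms" "i < length Ms" "x : carrier (Ms ! i)" "y : carrier (Ms ! i)" for xs i x y proof -
  interpret abelian_group "Ms ! i" using that(2) by (intro fac_ab) simp
  have "xs[i := x] : tuples Ms" "xs[i := y] : tuples Ms" "xs[i := x +[Ms ! i] y] : tuples Ms"
  using that by (auto intro!: rel_add_in)
  thus ?thesis by (auto dest!: subsetD[OF keys_diff])
 qed
 have 2: "frag_of (xs[i := ract (Ms ! i) (xs ! i) z]) -
  frag_of (xs[Suc i := lact (Ms ! Suc i) z (xs ! Suc i)]) : carrier TF"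
  if "xs : tuples Ms" "Suc i < length Ms" "z : K" for xs i z proof -
  have "xs ! i : carrier (Ms ! i)" "xs ! Suc i : carrier (Ms ! Suc i)"
  using that by (auto simp: tuples_iff list_all2_conv_all_nth)
  hence "xs[i := ract (Ms ! i) (xs ! i) z] : tuples Ms"
  "xs[Suc i := lact (Ms ! Suc i) z (xs ! Suc i)] : tuples Ms" using that by (auto intro!: rel_add_in act_in)
  thus ?thesis by (auto dest!: subsetD[OF keys_diff])
 qed
 show ?thesis unfolding tensor_rels_def using 1 2 by auto
qed

lemma null_subgroup: "subgroup (tensor_null K Ms) TF"
 unfolding tensor_null_def by (rule TF.generate_is_subgroup) (rule tensor_rels_sub)

lemma tensor_null_normal: "tensor_null K Ms \<lhd> TF" using null_subgroup TF.normal_iff_subgroup by blast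

interpretation N: normal "tensor_null K Ms" TF by (rule tensor_null_normal)

lemma abelian_group_tensor: "abelian_group (tensor K Ms)" unfolding tensor_def
 by (intro abelian_group_additive_record TF.abelian_FactGroup null_subgroup)

interpretation T: abelian_group "tensor K Ms" by (rule abelian_group_tensor)

definition tcls where "tcls c = tensor_null K Ms #>\<^bsub>TF\<^esub> c"

lemma tensor_carrier: "carrier (tensor K Ms) = tcls ` {c. keys c <= tuples Ms}"
 by (auto simp: tensor_def additive_record_def FactGroup_def RCOSETS_def tcls_def)

lemma tcls_in: "keys c <= tuples Ms ==> tcls c : carrier (tensor K Ms)" by (auto simp: tensor_carrier)

lemma tcls_add:
 assumes "keys c <= tuples Ms" "keys d <= tuples Ms"
 shows "tcls c +[tensor K Ms] tcls d = tcls (c + d)"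
 using N.rcos_sum[of c d] assms by (simp add: tensor_def additive_record_def FactGroup_def tcls_def)

lemma tcls_eq_iff:
 assumes "keys c <= tuples Ms" "keys d <= tuples Ms"
 shows "tcls c = tcls d \<longleftrightarrow> c - d : tensor_null K Ms" proof
 assume "tcls c = tcls d"
 hence "c : tensor_null K Ms #>\<^bsub>TF\<^esub> d"
  using TF.rcos_self[OF _ null_subgroup, of c] assms by (simp add: tcls_def)
 thus "c - d : tensor_null K Ms" by (auto simp: r_coset_def)
next
 assume "c - d : tensor_null K Ms"
 hence "c : tensor_null K Ms #>\<^bsub>TF\<^esub> d" unfolding r_coset_def by (auto intro!: bexI[of _ "c - d"])
 thus "tcls c = tcls d" using TF.repr_independence[OF _ _ null_subgroup, of c d] assms by (simp add: tcls_def)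
qed

lemma pure_tcls: "pure_tensor K Ms xs = tcls (frag_of xs)" by (simp add: pure_tensor_def tcls_def)

lemma pure_in: "xs : tuples Ms ==> pure_tensor K Ms xs : carrier (tensor K Ms)" by (simp add: pure_tcls tcls_in)

lemma tcls_zero: "tcls 0 = \<zero>[tensor K Ms]"
 using TF.coset_mult_one[of "tensor_null K Ms"] subgroup.subset[OF null_subgroup]
 by (simp add: tensor_def additive_record_def FactGroup_def tcls_def)

lemma bal_pure: "balanced K Ms (tensor K Ms) (pure_tensor K Ms)" proof (rule balancedI)
 fix Us M Vs us x y vs
 assume a: "Ms = Us @ M # Vs" "us : tuples Us" "vs : tuples Vs" "x : carrier M" "y : carrier M"
 interpret M: abelian_group M by (rule fac_ab) (simp add: a)
 let ?xs = "us @ x # vs" let ?i = "length us"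
 have l: "length us = length Us" using a by (simp add: tuples_length)
 have t: "?xs : tuples Ms" "us @ y # vs : tuples Ms" "us @ (x +[M] y) # vs : tuples Ms" using a by auto
 have Mi: "Ms ! ?i = M" using a(1) l by simp
 have "frag_of (?xs[?i := x +[Ms ! ?i] y]) - frag_of (?xs[?i := x]) - frag_of (?xs[?i := y])
  : tensor_rels K Ms"
  using t(1) a l Mi unfolding tensor_rels_def by (intro UnI1 CollectI exI[of _ ?xs] exI[of _ ?i] exI) auto
 hence "frag_of (us @ (x +[M] y) # vs) - frag_of ?xs - frag_of (us @ y # vs) : tensor_null K Ms"
  unfolding tensor_null_def Mi by (auto intro!: generate.incl)
 hence "tcls (frag_of (us @ (x +[M] y) # vs)) = tcls (frag_of ?xs + frag_of (us @ y # vs))"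
  using t by (subst tcls_eq_iff) (auto dest!: subsetD[OF keys_add] simp: algebra_simps)
 thus "pure_tensor K Ms (us @ (x +[M] y) # vs) =
  pure_tensor K Ms ?xs +[tensor K Ms] pure_tensor K Ms (us @ y # vs)" using t by (simp add: pure_tcls tcls_add)
next
 fix Us M N Vs us x y vs z
 assume a: "Ms = Us @ M # N # Vs" "us : tuples Us" "vs : tuples Vs" "x : carrier M" "y : carrier N"
  "z : K"
 let ?xs = "us @ x # y # vs" let ?i = "length us"
 have l: "length us = length Us" using a by (simp add: tuples_length)
 have xz: "ract M x z : carrier M" "lact N z y : carrier N" using a by (auto intro: act_in)
 have t: "?xs : tuples Ms" "us @ ract M x z # y # vs : tuples Ms" "us @ x # lact N z y # vs : tuples Ms"
  using a xz by auto
 have Mi: "Ms ! ?i = M" "Ms ! Suc ?i = N" using a(1) l by (simp_all add: nth_append)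
 have "frag_of (?xs[?i := ract (Ms ! ?i) (?xs ! ?i) z]) -
  frag_of (?xs[Suc ?i := lact (Ms ! Suc ?i) z (?xs ! Suc ?i)]) : tensor_rels K Ms"
  using t(1) a l unfolding tensor_rels_def by (intro UnI2 CollectI exI[of _ ?xs] exI[of _ ?i] exI) auto
 hence "frag_of (us @ ract M x z # y # vs) - frag_of (us @ x # lact N z y # vs) : tensor_null K Ms"
  unfolding tensor_null_def Mi by (intro generate.incl) (simp add: nth_append list_update_append)
 thus "pure_tensor K Ms (us @ ract M x z # y # vs) = pure_tensor K Ms (us @ x # lact N z y # vs)"
  using t by (simp add: pure_tcls tcls_eq_iff)
qed (rule pure_in)

lemma tensor_induct [consumes 1, case_names zero pure add neg]:
 assumes "X : carrier (tensor K Ms)" and "Pr \<zero>[tensor K Ms]"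
  and "!!xs. xs : tuples Ms ==> Pr (pure_tensor K Ms xs)"
  and "!!X Y. [| X : carrier (tensor K Ms); Y : carrier (tensor K Ms); Pr X; Pr Y |]
  ==> Pr (X +[tensor K Ms] Y)"
  and "!!X. [| X : carrier (tensor K Ms); Pr X |] ==> Pr (\<ominus>\<^bsub>tensor K Ms\<^esub> X)"
 shows "Pr X" proof -
 have neg: "tcls (- c) = \<ominus>\<^bsub>tensor K Ms\<^esub> tcls c" if "keys c <= tuples Ms" for c
  using that tcls_add[of "- c" c] by (intro T.minus_equality[symmetric]) (auto simp: tcls_in tcls_zero)
 have "keys c <= tuples Ms & Pr (tcls c)" if "keys c <= tuples Ms" for c using that
 proof (induction c rule: frag_induction)
  case zero
  thus ?case using assms(2) by (simp add: tcls_zero)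
 next
  case (one xs)
  thus ?case using assms(3)[of xs] by (simp add: pure_tcls)
 next
  case (diff a b)
  hence "keys (a - b) <= tuples Ms" by (auto dest!: subsetD[OF keys_diff])
  thus ?case using assms(4)[of "tcls a" "tcls (- b)"] assms(5)[of "tcls b"] diff tcls_add[of a "- b"]
  by (simp add: tcls_in neg[symmetric])
 qed
 thus ?thesis using assms(1) by (auto simp: tensor_carrier)
qed

lemma ahom_tensor_eq:
 assumes "abelian_group H" "f : ahom (tensor K Ms) H" "g : ahom (tensor K Ms) H"
  and "!!xs. xs : tuples Ms ==> f (pure_tensor K Ms xs) = g (pure_tensor K Ms xs)" and "X : carrier (tensor K Ms)"
 shows "f X = g X" using assms(5) proof (induction rule: tensor_induct)
 case zero
 thus ?case using assms by (simp add: ahom_zero[OF abelian_group_tensor])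
next
 case (neg X)
 thus ?case using assms by (simp add: ahom_neg[OF abelian_group_tensor])
qed (use assms in \<open>auto simp: ahom_add\<close>)

context
 fixes H :: "('n, 'y) ring_scheme" and g :: "'m list => 'n"
 assumes H: "abelian_group H" and g: "balanced K Ms H g"
begin

interpretation H: abelian_group H by (rule H)

definition lin :: "('m list \<Rightarrow>\<^sub>0 int) => 'n" where
 "lin c = (\<Oplus>\<^bsub>H\<^esub>xs\<in>keys c. [(lookup c xs)] \<cdot>\<^bsub>H\<^esub> g xs)"

lemma lin_super:
 assumes "keys c <= T" "finite T" "T <= tuples Ms"
 shows "lin c = (\<Oplus>\<^bsub>H\<^esub>xs\<in>T. [(lookup c xs)] \<cdot>\<^bsub>H\<^esub> g xs)" unfolding lin_def
 by (rule H.add.finprod_mono_neutral_cong_left)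
  (use assms in \<open>auto simp: in_keys_iff H.int_mult_zero intro!: H.add.int_pow_closed bal_in[OF g]\<close>)

lemma lin_in: "keys c <= tuples Ms ==> lin c : carrier H" unfolding lin_def
 by (auto intro!: H.finsum_closed H.add.int_pow_closed bal_in[OF g])

lemma lin_add:
 assumes "keys c <= tuples Ms" "keys d <= tuples Ms"
 shows "lin (c + d) = lin c +[H] lin d" proof -
 let ?T = "keys c \<union> keys d"
 have g': "xs : ?T ==> g xs : carrier H" for xs using assms g by (auto intro: bal_in)
 have "lin (c + d) = (\<Oplus>\<^bsub>H\<^esub>xs\<in>?T. [(lookup (c + d) xs)] \<cdot>\<^bsub>H\<^esub> g xs)"
  using assms by (intro lin_super) (auto dest!: subsetD[OF keys_add])
 also have "\<dots> = (\<Oplus>\<^bsub>H\<^esub>xs\<in>?T. [(lookup c xs)] \<cdot>\<^bsub>H\<^esub> g xs +[H]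
  [(lookup d xs)] \<cdot>\<^bsub>H\<^esub> g xs)"
  using g' by (intro H.finsum_cong') (auto simp: lookup_add H.add.int_pow_mult H.add.int_pow_closed)
 also have "\<dots> = lin c +[H] lin d"
  using assms g' by (subst H.finsum_addf) (auto simp: lin_super[of _ ?T] H.add.int_pow_closed)
 finally show ?thesis .
qed

lemma lin_frag: "xs : tuples Ms ==> lin (frag_of xs) = g xs" using g by (auto simp: lin_def bal_in H.add.int_pow_1)

lemma lin_diff:
 assumes "keys c <= tuples Ms" "keys d <= tuples Ms"
 shows "lin (c - d) = lin c -[H] lin d" proof -
 have k: "keys (c - d) <= tuples Ms" using assms by (auto dest!: subsetD[OF keys_diff])
 have "lin c = lin (c - d) +[H] lin d" using lin_add[OF k assms(2)] by (simp only: diff_add_cancel)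
 thus ?thesis using k assms by (simp add: H.minus_eq H.a_assoc H.r_neg lin_in)
qed

lemma lin_null: assumes "c : tensor_null K Ms" shows "lin c = \<zero>[H]" proof -
 have rel: "lin c = \<zero>[H]" if c: "c : tensor_rels K Ms" for c proof -
  consider xs i x y where "c = frag_of (xs[i := x +[Ms ! i] y]) - frag_of (xs[i := x]) - frag_of (xs[i := y])"
  "xs : tuples Ms" "i < length Ms" "x : carrier (Ms ! i)" "y : carrier (Ms ! i)"
  | xs i z where "c = frag_of (xs[i := ract (Ms ! i) (xs ! i) z]) -
  frag_of (xs[Suc i := lact (Ms ! Suc i) z (xs ! Suc i)])" "xs : tuples Ms"
  "Suc i < length Ms" "z : K" using c unfolding tensor_rels_def by blast
  thus ?thesis proof cases
  case 1
  interpret M: abelian_group "Ms ! i" by (rule fac_ab) (simp add: 1)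
  have t: "xs[i := w] : tuples Ms" if "w : carrier (Ms ! i)" for w using that 1 by (intro rel_add_in)
  obtain us vs where s: "Ms = take i Ms @ Ms ! i # drop (Suc i) Ms"
  "us : tuples (take i Ms)" "vs : tuples (drop (Suc i) Ms)" "!!x. xs[i := x] = us @ x # vs"
  using list_slot[OF 1(2,3)] by metis
  have "g (xs[i := x +[Ms ! i] y]) = g (xs[i := x]) +[H] g (xs[i := y])"
  unfolding s(4) using bal_add[OF _ s(2,3) 1(4,5), of K H g] g s(1) by simp
  moreover have "lin c = lin (frag_of (xs[i := x +[Ms ! i] y])) -[H] lin (frag_of (xs[i := x]))
  \<ominus>\<^bsub>H\<^esub> lin (frag_of (xs[i := y]))" unfolding 1(1) using t 1(4,5)
  by (subst lin_diff, (force dest!: subsetD[OF keys_diff])+, subst lin_diff) auto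
  moreover have "g (xs[i := x]) : carrier H" "g (xs[i := y]) : carrier H" using t 1(4,5) g by (auto intro: bal_in)
  ultimately show ?thesis using t 1(4,5) by (simp add: lin_frag) (algebra)
  next
  case 2
  obtain us ws where s: "Ms = take i Ms @ Ms ! i # drop (Suc i) Ms"
  "us : tuples (take i Ms)" "ws : tuples (drop (Suc i) Ms)" "xs ! i : carrier (Ms ! i)"
  "xs = us @ xs ! i # ws" "!!x. xs[i := x] = us @ x # ws" "length us = i"
  using list_slot[OF 2(2), of i] 2(3) by (metis Suc_lessD)
  have d: "drop (Suc i) Ms = Ms ! Suc i # drop (Suc (Suc i)) Ms" using 2(3) by (simp add: Cons_nth_drop_Suc)
  with s(3) obtain y vs where y: "ws = y # vs" "y : carrier (Ms ! Suc i)"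
  "vs : tuples (drop (Suc (Suc i)) Ms)" by (metis tuples_ConsE)
  have Ms: "Ms = take i Ms @ Ms ! i # Ms ! Suc i # drop (Suc (Suc i)) Ms" using s(1) d by simp
  have x: "xs ! Suc i = y" "xs[Suc i := w] = us @ xs ! i # w # vs" for w proof -
  have "xs = us @ xs ! i # y # vs" using s(5) y(1) by simp
  thus "xs ! Suc i = y" "xs[Suc i := w] = us @ xs ! i # w # vs" for w
  using s(7) by (metis nth_append_length nth_append_right le_add2 diff_add_inverse
  append_Cons append_Nil append_assoc length_append_singleton list.size(3) nth_append_length Suc_eq_plus1,
  metis append_Cons append_Nil append_assoc length_append_singleton list_update_length)
  qed
  have "g (us @ ract (Ms ! i) (xs ! i) z # y # vs) = g (us @ xs ! i # lact (Ms ! Suc i) z y # vs)"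
  using bal_act[of K "take i Ms" "Ms ! i" "Ms ! Suc i" "drop (Suc (Suc i)) Ms" H g us vs "xs ! i" y z]
  g Ms s(2,4) y 2(4) by simp
  moreover have "us @ ract (Ms ! i) (xs ! i) z # y # vs : tuples Ms"
  "us @ xs ! i # lact (Ms ! Suc i) z y # vs : tuples Ms" using s(2,4) y(2,3) 2 tuples_appendI[of us "take i Ms"]
  act_in[OF nth_mem[of i Ms], of z "xs ! i"] act_in[OF nth_mem[of "Suc i" Ms], of z y]
  by (subst Ms, intro tuples_appendI; simp)+
  ultimately show ?thesis unfolding 2(1) s(6) x y(1)
  by (subst lin_diff) (auto simp: lin_frag H.minus_eq intro!: H.r_neg bal_in[OF g])
  qed
 qed
 have cl: "d : tensor_null K Ms ==> keys d <= tuples Ms" for d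
  using subsetD[OF subgroup.subset[OF null_subgroup], of d] by simp
 have zero: "lin 0 = \<zero>[H]" by (simp add: lin_def)
 show ?thesis using assms unfolding tensor_null_def proof (induction rule: generate.induct)
  case one
  thus ?case by (simp add: zero)
 next
  case (incl c)
  thus ?case by (rule rel)
 next
  case (inv c)
  hence "keys c <= tuples Ms" using subsetD[OF tensor_rels_sub inv] by simp
  moreover from this have "lin (0 - c) = \<zero>[H] \<ominus>\<^bsub>H\<^esub> lin c"
  by (subst lin_diff) (auto simp: zero)
  ultimately show ?case using rel[OF inv] by (simp add: H.minus_eq)
 next
  case (eng c d)
  hence "keys c <= tuples Ms" "keys d <= tuples Ms" using cl by (simp_all add: tensor_null_def)
  thus ?case using eng by (simp add: lin_add)
 qed
qed

lemma tensor_lift_tcls: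
 assumes "keys c <= tuples Ms" shows "tensor_lift H g (tcls c) = lin c" proof -
 define d where "d = (SOME d. d : tcls c)"
 have "c : tcls c" using TF.rcos_self[OF _ null_subgroup, of c] assms by (simp add: tcls_def)
 hence d: "d : tcls c" unfolding d_def by (rule someI)
 then obtain e where e: "e : tensor_null K Ms" "d = e + c" by (auto simp: tcls_def r_coset_def)
 moreover have "keys e <= tuples Ms" using subsetD[OF subgroup.subset[OF null_subgroup] e(1)] by simp
 ultimately have "lin d = lin c" using assms by (simp add: lin_add lin_null lin_in)
 thus ?thesis by (simp add: tensor_lift_def d_def lin_def Let_def)
qed

lemma tensor_lift_addhom: "tensor_lift H g : ahom (tensor K Ms) H" proof (rule ahomI)
 fix X Y assume "X : carrier (tensor K Ms)" "Y : carrier (tensor K Ms)"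
 then obtain c d where "X = tcls c" "Y = tcls d" "keys c <= tuples Ms"
  "keys d <= tuples Ms" by (auto simp: tensor_carrier)
 moreover from this have "keys (c + d) <= tuples Ms" by (auto dest!: subsetD[OF keys_add])
 ultimately show "tensor_lift H g (X +[tensor K Ms] Y) = tensor_lift H g X +[H] tensor_lift H g Y"
  by (simp add: tcls_add tensor_lift_tcls lin_add)
qed (auto simp: tensor_carrier tensor_lift_tcls lin_in)

lemma tensor_lift_pure: "xs : tuples Ms ==> tensor_lift H g (pure_tensor K Ms xs) = g xs"
 by (simp add: pure_tcls tensor_lift_tcls lin_frag)

end

end

section \<open>Paths and path algebras\<close>

lemma pm_induct [consumes 1, case_names zero single add]:
 fixes x :: "'a \<Rightarrow>\<^sub>0 'b::comm_monoid_add"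
 assumes "keys x <= T" and "Pr 0" and "!!p c. p : T ==> Pr (single p c)"
  and "!!x y. [| keys x <= T; keys y <= T; Pr x; Pr y |] ==> Pr (x + y)"
 shows "Pr x" proof -
 have s: "keys (\<Sum>p\<in>X. single p (lookup x p)) <= T & Pr (\<Sum>p\<in>X. single p (lookup x p))" if "finite X" "X <= T" for X
  using that proof (induction rule: finite_induct)
  case (insert p X)
  have 1: "keys (single p (lookup x p)) <= T" using insert by simp
  have 2: "Pr (single p (lookup x p))" using assms(3) insert by simp
  show ?case using insert assms(4)[OF 1 _ 2] subsetD[OF keys_add] 1 by (auto dest!: subsetD[OF keys_add])
 qed (simp add: assms)
 have "x = (\<Sum>p\<in>keys x. single p (lookup x p))"
  by (rule poly_mapping_eqI) (auto simp: lookup_sum lookup_single when_def in_keys_iff sum.delta)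
 with s[of "keys x"] assms(1) show ?thesis by simp
qed

abbreviation cat :: "('v, 'e) path => ('v, 'e) path => ('v, 'e) path" where
 "cat p q \<equiv> (fst p, snd p @ snd q)"

lemma pconcat2: "pconcat [p, q] = cat p q" by (simp add: pconcat_def src_def)

lemma pconcat3: "pconcat [q, w, r] = cat q (cat w r)" by (simp add: pconcat_def src_def)

lemma src_cat [simp]: "src (fst p, es) = src p" by (simp add: src_def)

lemma plen_cat [simp]: "plen (cat p q) = plen p + plen q" by (simp add: plen_def)

lemma pmult_super:
 assumes "finite X" "finite Y" "keys x <= X" "keys y <= Y"
 shows "pmult Q x y = (\<Sum>p\<in>X. \<Sum>q\<in>Y. if tgt Q p = src q
  then single (cat p q) (lookup x p * lookup y q) else 0)" proof -
 have "pmult Q x y = (\<Sum>p\<in>keys x. \<Sum>q\<in>Y. if tgt Q p = src q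
  then single (cat p q) (lookup x p * lookup y q) else 0)" unfolding pmult_def pconcat2 using assms
  by (intro sum.cong refl sum.mono_neutral_left) (auto simp: in_keys_iff)
 also have "\<dots> = (\<Sum>p\<in>X. \<Sum>q\<in>Y. if tgt Q p = src q
  then single (cat p q) (lookup x p * lookup y q) else 0)"
  using assms by (intro sum.mono_neutral_left) (auto simp: in_keys_iff intro!: sum.neutral)
 finally show ?thesis .
qed

lemma pmult_add_left: "pmult Q (x + x') y = pmult Q x y + pmult Q x' y" proof -
 let ?X = "keys x \<union> keys x'" and ?Y = "keys y"
 have "keys (x + x') <= ?X" by (rule keys_add)
 thus ?thesis by (subst (1 2 3) pmult_super[of ?X ?Y])
  (auto simp: sum.distrib[symmetric] lookup_add single_add distrib_right intro!: sum.cong)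
qed

lemma pmult_add_right: "pmult Q x (y + y') = pmult Q x y + pmult Q x y'" proof -
 let ?X = "keys x" and ?Y = "keys y \<union> keys y'"
 have "keys (y + y') <= ?Y" by (rule keys_add)
 thus ?thesis by (subst (1 2 3) pmult_super[of ?X ?Y])
  (auto simp: sum.distrib[symmetric] lookup_add single_add distrib_left intro!: sum.cong)
qed

lemma pmult_zero [simp]: "pmult Q 0 y = 0" "pmult Q x 0 = 0" by (simp_all add: pmult_def)

lemma pmult_single:
 "pmult Q (single p c) (single q d) =
  (if tgt Q p = src q then single (cat p q) (c * d) else 0)" by (subst pmult_super[of "{p}" "{q}"]) auto

lemma pmult_sum_left: "pmult Q (\<Sum>i\<in>A. f i) y = (\<Sum>i\<in>A. pmult Q (f i) y)"
 by (induction A rule: infinite_finite_induct) (simp_all add: pmult_add_left)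

lemma pmult_sum_right: "pmult Q x (\<Sum>i\<in>A. f i) = (\<Sum>i\<in>A. pmult Q x (f i))"
 by (induction A rule: infinite_finite_induct) (simp_all add: pmult_add_right)

lemma pmult_minus_left: "pmult Q (- x) y = - pmult Q x y"
 using pmult_add_left[of Q x "- x" y] by (simp add: eq_neg_iff_add_eq_0 add.commute)

lemma pmult_minus_right: "pmult Q x (- y) = - pmult Q x y"
 using pmult_add_right[of Q x y "- y"] by (simp add: eq_neg_iff_add_eq_0 add.commute)

type_synonym ('v, 'e, 'k) tens = "(('v, 'e, 'k) pathalg set list \<Rightarrow>\<^sub>0 int) set"

text \<open>
 The standing hypotheses of the theorem.  The ideal hypothesis already contains that the path
 algebra is a ring.
\<close>

locale confluent_presentation = presentation Q I S
 for Q :: "('v, 'e) pre_digraph" and I :: "('v, 'e, 'k::field_char_0) pathalg set" and S :: "('v, 'e) path set" +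
 fixes \<phi> :: "('v, 'e) path => ('v, 'e, 'k) pathalg"
 assumes fin: "fin_digraph Q" and ideal_I: "ideal I (path_algebra Q)" and rs: "reduction_system Q S \<phi>"
  and dia: "diamond Q I S \<phi>"
begin

abbreviation "cQ == carrier (path_algebra Q :: ('v, 'e, 'k) pathalg ring)"
abbreviation "cA == carrier A"
abbreviation "Ppure == P_pure"
abbreviation "Bpure == Bar_pure"
abbreviation "cP n == carrier (P n)"
abbreviation "cB n == carrier (Bar n)"

abbreviation (input) mult_A (infixl "**" 70) where "a ** b == a \<otimes>\<^bsub>A\<^esub> b"

sublocale fin_digraph Q by (rule fin)

abbreviation kQ :: "('v, 'e, 'k) pathalg ring" where "kQ \<equiv> path_algebra Q"
abbreviation K :: "('v, 'e, 'k) pathalg set" where "K \<equiv> vertex_algebra Q"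
abbreviation pi :: "('v, 'e) path => ('v, 'e, 'k) pathalg set" where "pi p \<equiv> proj (ppath p)"
abbreviation kk :: "'k => ('v, 'e, 'k) pathalg set" where "kk c \<equiv> proj (scalar Q c)"

subsection \<open>Composition of paths\<close>

lemma path_iff: "p : paths Q \<longleftrightarrow> awalk (fst p) (snd p) (tgt Q p)" proof (cases p)
 case (Pair u es)
 have "awlast u es = v" if "awalk u es v" for v using that by auto
 thus ?thesis using Pair by (auto simp: paths_def tgt_def)
qed

lemma tgt_eq: "awalk u es v ==> tgt Q (u, es) = v" by (auto simp: tgt_def)

lemma tgt_Nil [simp]: "tgt Q (v, []) = v" by (simp add: tgt_def)

lemma cat_paths:
 assumes "p : paths Q" "q : paths Q" "tgt Q p = src q"
 shows "cat p q : paths Q" "tgt Q (cat p q) = tgt Q q" proof -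
 have "awalk (fst p) (snd p @ snd q) (tgt Q q)" using assms by (auto simp: path_iff src_def intro!: awalk_appendI)
 thus "cat p q : paths Q" "tgt Q (cat p q) = tgt Q q" by (auto simp: paths_def tgt_eq)
qed

lemma split_path:
 assumes "(u, es @ fs) : paths Q"
 shows "(u, es) : paths Q" "(tgt Q (u, es), fs) : paths Q"
  "tgt Q (tgt Q (u, es), fs) = tgt Q (u, es @ fs)" proof -
 obtain v where "awalk u (es @ fs) v" using assms by (auto simp: paths_def)
 hence "awalk u es (awlast u es)" "awalk (awlast u es) fs v" by auto
 moreover from this `awalk u (es @ fs) v` show "tgt Q (tgt Q (u, es), fs) = tgt Q (u, es @ fs)" by (simp add: tgt_eq)
 ultimately show "(u, es) : paths Q" "(tgt Q (u, es), fs) : paths Q" by (auto simp: paths_def tgt_eq)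
qed

lemma trivial_iff: "p : trivial_paths Q \<longleftrightarrow> (\<exists>v\<in>verts Q. p = (v, []))"
 by (auto simp: trivial_paths_def plen_def paths_def awalk_Nil_iff)

lemma path_ends: "p : paths Q ==> src p : verts Q" "p : paths Q ==> tgt Q p : verts Q"
 by (auto simp: path_iff src_def dest: awalk_hd_in_verts awalk_last_in_verts)

abbreviation vtx :: "'v => ('v, 'e) path" where "vtx v \<equiv> (v, [])"

lemma vtx_path: "v : verts Q ==> vtx v : paths Q" by (auto simp: paths_def awalk_Nil_iff)

lemma finite_trivial: "finite (trivial_paths Q)" proof -
 have "trivial_paths Q = (%v. (v, [])) ` verts Q" by (auto simp: trivial_iff)
 thus ?thesis by simp
qed

lemma composable3:
 "composable Q [q, w, r] \<longleftrightarrow> q : paths Q & w : paths Q & r : paths Q & tgt Q q = src w & tgt Q w = src r"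
 by auto

lemma composable3_path:
 assumes "composable Q [q, w, r]"
 shows "pconcat [q, w, r] : paths Q" "src (pconcat [q, w, r]) = src q"
  "tgt Q (pconcat [q, w, r]) = tgt Q r"
 using assms cat_paths[of w r] cat_paths[of q "cat w r"] by (auto simp: pconcat3)

subsection \<open>The path algebra and its quotient\<close>

sublocale I: ideal I kQ by (rule ideal_I)

lemma kQ_simps [simp]:
 "monoid.mult kQ = pmult Q" "add kQ = (+)" "ring.zero kQ = 0" "one kQ = scalar Q 1"
 by (simp_all add: path_algebra_def)

lemma kQ_iff: "x : cQ \<longleftrightarrow> keys x <= paths Q" by (simp add: path_algebra_def)

lemma kQ_minus: "x : cQ ==> \<ominus>\<^bsub>kQ\<^esub> x = - x" by (rule I.minus_equality) (auto simp: kQ_iff)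

lemma single_carrier: "p : paths Q ==> single p c : cQ" by (simp add: kQ_iff)

lemma K_carrier: "z : K ==> z : cQ" by (auto simp: path_span_def kQ_iff trivial_paths_def)

lemma scalar_K: "scalar Q c : K" unfolding path_span_def scalar_def by (auto dest!: subsetD[OF keys_sum])
  (metis emptyE keys_single singletonD)

lemma scalar_carrier: "scalar Q c : cQ" by (rule K_carrier) (rule scalar_K)

lemma lookup_scalar: "lookup (scalar Q c) p = (if p : trivial_paths Q then c else 0)"
 using finite_trivial by (auto simp: scalar_def lookup_sum lookup_single when_def sum.delta)

lemma scalar_add: "scalar Q (c + d) = scalar Q c + scalar Q d"
 by (rule poly_mapping_eqI) (simp add: lookup_add lookup_scalar)

lemma scalar_zero: "scalar Q 0 = 0" by (rule poly_mapping_eqI) (simp add: lookup_scalar)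

lemma K_mult_single:
 assumes "z : K" "p : paths Q"
 shows "pmult Q z (single p c) =
  single p (lookup z (vtx (src p)) * c)"
  "pmult Q (single p c) z =
  single p (c * lookup z (vtx (tgt Q p)))" proof -
 have k: "keys z <= trivial_paths Q" using assms(1) by (simp add: path_span_def)
 have s: "vtx (src p) : trivial_paths Q" "vtx (tgt Q p) : trivial_paths Q"
  using assms(2) path_ends by (auto simp: trivial_iff)
 have "pmult Q z (single p c) = (\<Sum>q\<in>trivial_paths Q. if q = vtx (src p)
  then single p (lookup z (vtx (src p)) * c) else 0)" by (subst pmult_super[OF finite_trivial _ k, of "{p}"])
  (auto simp: trivial_iff src_def intro!: sum.cong)
 thus "pmult Q z (single p c) =
  single p (lookup z (vtx (src p)) * c)" using s finite_trivial by simp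
 have "pmult Q (single p c) z = (\<Sum>q\<in>trivial_paths Q. if q = vtx (tgt Q p)
  then single p (c * lookup z (vtx (tgt Q p))) else 0)" by (subst pmult_super[OF _ finite_trivial _ k, of "{p}"])
  (auto simp: trivial_iff src_def intro!: sum.cong)
 thus "pmult Q (single p c) z =
  single p (c * lookup z (vtx (tgt Q p)))" using s finite_trivial by simp
qed

lemma scalar_mult_single:
 assumes "p : paths Q"
 shows "pmult Q (scalar Q (d::'k)) (single p c) = single p (d * c)"
  "pmult Q (single p c) (scalar Q d) = single p (c * d)"
 using path_ends[OF assms] K_mult_single[OF scalar_K assms, of d c]
  K_mult_single(2)[OF scalar_K assms, of c d] by (simp_all add: lookup_scalar trivial_iff)

lemma scalar_central: "x : cQ ==> pmult Q (scalar Q c) x = pmult Q x (scalar Q c)" unfolding kQ_iff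
 by (induction rule: pm_induct)
  (auto simp: scalar_mult_single mult.commute pmult_add_left pmult_add_right)

lemma scalar_mult: "pmult Q (scalar Q (c::'k)) (scalar Q d) = scalar Q (c * d)" proof -
 have "pmult Q (scalar Q c) (scalar Q d) =
  (\<Sum>p\<in>trivial_paths Q. pmult Q (scalar Q c) (single p d))" by (subst (2) scalar_def) (rule pmult_sum_right)
 also have "\<dots> = scalar Q (c * d)" unfolding scalar_def[of Q "c * d"]
  by (intro sum.cong refl scalar_mult_single(1)) (simp add: trivial_paths_def)
 finally show ?thesis .
qed

lemma K_mult_span:
 assumes "T <= paths Q" "z : K" "x : path_span T"
 shows "pmult Q z x : path_span T" "pmult Q x z : path_span T" proof -
 have k: "keys x <= T" using assms(3) by (simp add: path_span_def)
 thus "pmult Q z x : path_span T" unfolding path_span_def mem_Collect_eq using assms(1,2)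
  by (induction rule: pm_induct)
  (auto simp: K_mult_single pmult_add_right dest!: subsetD[OF keys_add] split: if_splits)
 from k show "pmult Q x z : path_span T" unfolding path_span_def mem_Collect_eq using assms(1,2)
  by (induction rule: pm_induct)
  (auto simp: K_mult_single pmult_add_left dest!: subsetD[OF keys_add] split: if_splits)
qed

lemma span_add: "[| x : path_span T; y : path_span T |] ==> x + y : path_span T"
 by (auto simp: path_span_def dest!: subsetD[OF keys_add])

lemma span_neg: "x : path_span T ==> - x : path_span T" by (auto simp: path_span_def)

lemma span_zero: "0 : path_span T" by (simp add: path_span_def)

sublocale A: ring A unfolding A_def by (rule I.quotient_is_ring)

lemma proj_hom: "proj : ring_hom kQ A" using I.rcos_ring_hom unfolding A_def proj_def[abs_def] .

lemma proj_in [simp]: "x : cQ ==> proj x : cA" using proj_hom by (rule ring_hom_closed)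

lemma proj_mult: "[| x : cQ; y : cQ |] ==> proj (pmult Q x y) = proj x ** proj y"
 using ring_hom_mult[OF proj_hom, of x y] by simp

lemma proj_add: "[| x : cQ; y : cQ |] ==> proj (x + y) = proj x +[A] proj y"
 using ring_hom_add[OF proj_hom, of x y] by simp

lemma proj_one: "proj (scalar Q 1) = \<one>[A]" using ring_hom_one[OF proj_hom] by simp

lemma proj_eq_iff:
 assumes "x : cQ" "y : cQ" shows "proj x = proj y \<longleftrightarrow> x - y : I" proof -
 have "x - y = x -[kQ] y" using assms by (simp add: a_minus_def kQ_minus)
 thus ?thesis using I.quotient_eq_iff_same_a_r_cos[OF ideal_I assms] by (simp add: proj_def)
qed

lemma proj_zero: "proj 0 = \<zero>[A]"
 using I.a_coset_add_zero[OF I.a_subset] by (simp add: proj_def A_def FactRing_def)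

lemma A_carrierE:
 assumes "a : cA" obtains x where "x : cQ" "a = proj x"
 using assms by (auto simp: A_def FactRing_def A_RCOSETS_def RCOSETS_def proj_def a_r_coset_def)

lemma pi_in: "p : paths Q ==> pi p : cA" by (simp add: single_carrier)

lemma pi_cat:
 assumes "p : paths Q" "q : paths Q" "tgt Q p = src q"
 shows "pi p ** pi q = pi (cat p q)" using assms by (simp add: proj_mult[symmetric] single_carrier pmult_single)

lemma kk_in [simp]: "kk c : cA" by (simp add: scalar_carrier)

lemma proj_K_in: "z : K ==> proj z : cA" by (simp add: K_carrier)

lemma kk_one: "kk 1 = \<one>[A]" by (rule proj_one)

lemma kk_zero: "kk 0 = \<zero>[A]" by (simp add: scalar_zero proj_zero)

lemma kk_add: "kk (c + d) = kk c +[A] kk d" by (simp add: scalar_add proj_add scalar_carrier)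

lemma kk_mult: "kk (c * d) = kk c ** kk d" by (simp add: scalar_mult[symmetric] proj_mult scalar_carrier)

lemma kk_central: "a : cA ==> kk c ** a = a ** kk c"
 by (elim A_carrierE) (simp add: proj_mult[symmetric] scalar_carrier scalar_central)

lemma proj_single:
 assumes "p : paths Q"
 shows "proj (single p c) = kk c ** pi p"
 using assms by (simp add: proj_mult[symmetric] single_carrier scalar_carrier scalar_mult_single)

lemma K_mult_pi:
 assumes "z : K" "p : paths Q"
 shows "proj z ** pi p = kk (lookup z (vtx (src p))) ** pi p"
  "pi p ** proj z = kk (lookup z (vtx (tgt Q p))) ** pi p" using assms
 by (simp_all add: proj_mult[symmetric] single_carrier scalar_carrier scalar_mult_single
  K_mult_single K_carrier)

subsection \<open>Subquotients of the path algebra as tensor factors\<close>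

definition sub_bimodule :: "('v, 'e, 'k) pathalg set => bool" where
 "sub_bimodule V \<longleftrightarrow> V <= cQ & 0 : V & (\<forall>x\<in>V. \<forall>y\<in>V. x + y : V) & (\<forall>x\<in>V. - x : V) & (\<forall>x\<in>V. \<forall>z\<in>K. pmult Q z x : V & pmult Q x z : V)"

lemma sub_bimoduleD:
 assumes "sub_bimodule V"
 shows "x : V ==> x : cQ" "0 : V" "[| x : V; y : V |] ==> x + y : V"
  "x : V ==> - x : V" "[| x : V; z : K |] ==> pmult Q z x : V"
  "[| x : V; z : K |] ==> pmult Q x z : V" using assms unfolding sub_bimodule_def by blast+

lemma sub_bimoduleI:
 assumes "!!x. x : V ==> x : cQ" "0 : V" "!!x y. [| x : V; y : V |] ==> x + y : V"
  "!!x. x : V ==> - x : V" "!!x z. [| x : V; z : K |] ==> pmult Q z x : V"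
  "!!x z. [| x : V; z : K |] ==> pmult Q x z : V"
 shows "sub_bimodule V" unfolding sub_bimodule_def using assms by auto

context
 fixes V U :: "('v, 'e, 'k) pathalg set"
 assumes V_sub: "sub_bimodule V" and U_sub: "sub_bimodule U"
begin

lemmas V = sub_bimoduleD[OF V_sub] and U = sub_bimoduleD[OF U_sub]

abbreviation (input) "ucls x \<equiv> U +>\<^bsub>kQ\<^esub> x"
abbreviation (input) "sq \<equiv> subquotient Q V U"

lemma ucls_eq: "ucls x = {u + x | u. u : U}" by (auto simp: a_r_coset_def' )

lemma ucls_eq_iff: "ucls x = ucls y \<longleftrightarrow> x - y : U" proof
 assume "ucls x = ucls y"
 hence "x : ucls y" using U(2) by (force simp: ucls_eq)
 thus "x - y : U" by (auto simp: ucls_eq)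
next
 assume a: "x - y : U"
 have "u + x : ucls y" if "u : U" for u
  unfolding ucls_eq using that a U(3)[of u "x - y"] by (intro CollectI exI[of _ "u + (x - y)"]) simp
 moreover have "u + y : ucls x" if "u : U" for u
  unfolding ucls_eq using that a U(3)[of u "- (x - y)"] U(4)[of "x - y"]
  by (intro CollectI exI[of _ "u - (x - y)"]) (simp add: algebra_simps)
 ultimately show "ucls x = ucls y" by (auto simp: ucls_eq[of x] ucls_eq[of y])
qed

lemma ucls_add: "ucls x <+>\<^bsub>kQ\<^esub> ucls y = ucls (x + y)" proof -
 have "u + x + (v + y) : ucls (x + y)" if "u : U" "v : U" for u v unfolding ucls_eq using that U(3)[of u v]
  by (intro CollectI exI[of _ "u + v"]) (simp add: algebra_simps)
 moreover have "u + (x + y) : ucls x <+>\<^bsub>kQ\<^esub> ucls y" if "u : U" for u proof -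
  have "u + x : ucls x" "y : ucls y" using that U(2) by (force simp: ucls_eq)+
  hence "(u + x) + y : ucls x <+>\<^bsub>kQ\<^esub> ucls y" by (auto simp: set_add_def')
  thus ?thesis by (simp add: algebra_simps)
 qed
 ultimately show ?thesis by (auto simp: set_add_def' ucls_eq[of x] ucls_eq[of y]) (auto simp: set_add_def' ucls_eq)
qed

lemma sq_carrier: "carrier sq = ucls ` V" by (simp add: subquotient_def additive_record_def ring.defs)

lemma sq_add: "ucls x +[sq] ucls y = ucls (x + y)"
 by (simp add: subquotient_def additive_record_def ring.defs ucls_add)

lemma sq_zero: "\<zero>[sq] = ucls 0" by (auto simp: subquotient_def additive_record_def ring.defs ucls_eq)

lemma sq_lact: "z : K ==> lact sq z (ucls x) = ucls (pmult Q z x)" proof -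
 assume z: "z : K"
 have "\<exists>w. w : U & u + pmult Q z (v + x) = w + pmult Q z x" if "u : U" "v : U" for u v
  using that U(3)[of u "pmult Q z v"] U(5)[of v z] z
  by (intro exI[of _ "u + pmult Q z v"]) (simp add: algebra_simps pmult_add_right)
 moreover have "\<exists>v w. v : U & w : U & u + pmult Q z x = v + pmult Q z (w + x)" if "u : U" for u
  using that U(2) by (intro exI[of _ u] exI[of _ 0]) simp
 ultimately show ?thesis by (auto simp: subquotient_def ring.defs set_add_def' ucls_eq) (metis (no_types, lifting))+
qed

lemma sq_ract: "z : K ==> ract sq (ucls x) z = ucls (pmult Q x z)" proof -
 assume z: "z : K"
 have "\<exists>w. w : U & u + pmult Q (v + x) z = w + pmult Q x z" if "u : U" "v : U" for u v
  using that U(3)[of u "pmult Q v z"] U(6)[of v z] z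
  by (intro exI[of _ "u + pmult Q v z"]) (simp add: algebra_simps pmult_add_left)
 moreover have "\<exists>v w. v : U & w : U & u + pmult Q x z = v + pmult Q (w + x) z" if "u : U" for u
  using that U(2) by (intro exI[of _ u] exI[of _ 0]) simp
 ultimately show ?thesis by (auto simp: subquotient_def ring.defs set_add_def' ucls_eq) (metis (no_types, lifting))+
qed

lemma sq_group: "abelian_group sq" proof (rule abelian_groupI)
 fix x assume "x : carrier sq"
 then obtain v where "v : V" "x = ucls v" by (auto simp: sq_carrier)
 thus "\<exists>y\<in>carrier sq. y +[sq] x = \<zero>[sq]"
  using V(4)[of v] by (intro bexI[of _ "ucls (- v)"]) (auto simp: sq_add sq_zero sq_carrier)
qed (use V(2,3) in \<open>auto simp: sq_carrier sq_add sq_zero algebra_simps\<close>)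

lemma sq_factor: "factor K sq" unfolding factor_def
 by (auto simp: sq_group ahom_def sq_carrier sq_lact sq_ract sq_add V pmult_add_left pmult_add_right)

lemma sq_central: "x : carrier sq ==> lact sq (scalar Q c) x = ract sq x (scalar Q c)"
 using V(1) by (auto simp: sq_carrier sq_lact sq_ract scalar_K scalar_central)

end

lemma carrier_subD:
 "x : cQ ==> x : cQ" "0 : cQ"
 "[| x : cQ; y : cQ |] ==> x + y : cQ" "x : cQ ==> - x : cQ"
 "[| x : cQ; z : K |] ==> pmult Q z x : cQ"
 "[| x : cQ; z : K |] ==> pmult Q x z : cQ"
 using I.a_closed[of x y] I.m_closed[of x z] I.m_closed[of z x] K_carrier[of z] by (simp_all add: kQ_iff)

lemma carrier_sub: "sub_bimodule (cQ)" by (rule sub_bimoduleI) (fact carrier_subD)+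

lemma I_subD:
 "x : I ==> x : cQ" "0 : I"
 "[| x : I; y : I |] ==> x + y : I" "x : I ==> - x : I"
 "[| x : I; z : K |] ==> pmult Q z x : I"
 "[| x : I; z : K |] ==> pmult Q x z : I"
 using I.a_closed[of x y] I.I_l_closed[of x z] I.I_r_closed[of x z] K_carrier[of z]
  I.a_Hcarr[of x] additive_subgroup.a_inv_closed[OF I.is_additive_subgroup, of x]
  additive_subgroup.a_closed[OF I.is_additive_subgroup, of x y]
  additive_subgroup.zero_closed[OF I.is_additive_subgroup] kQ_minus[of x] by simp_all

lemma I_sub: "sub_bimodule I" by (rule sub_bimoduleI) (fact I_subD)+

lemma bar_null_iff: "x : bar_null \<longleftrightarrow> (\<exists>i\<in>I. \<exists>z\<in>K. x = i + z)"
 by (auto simp: bar_null_def set_add_def')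

lemma bar_null_subD:
 "x : bar_null ==> x : cQ" "0 : bar_null"
 "[| x : bar_null; y : bar_null |] ==> x + y : bar_null" "x : bar_null ==> - x : bar_null"
 "[| x : bar_null; z : K |] ==> pmult Q z x : bar_null"
 "[| x : bar_null; z : K |] ==> pmult Q x z : bar_null" proof -
 have tr: "trivial_paths Q <= paths Q" by (auto simp: trivial_paths_def)
 show "x : bar_null ==> x : cQ" using carrier_subD(3) I_subD(1) K_carrier by (auto simp: bar_null_iff)
 show "0 : bar_null" unfolding bar_null_iff using I_subD(2) span_zero by force
 have I: "i + z : bar_null" if "i : I" "z : K" for i z using that by (auto simp: bar_null_iff)
 {
  assume "x : bar_null" "y : bar_null"
  then obtain i z j w where "i : I" "z : K" "j : I" "w : K" "x = i + z" "y = j + w" by (auto simp: bar_null_iff)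
  thus "x + y : bar_null" using I[of "i + j" "z + w"] I_subD(3) span_add[of z _ w] by (simp add: algebra_simps)
 next
  assume "x : bar_null"
  then obtain i z where "i : I" "z : K" "x = i + z" by (auto simp: bar_null_iff)
  thus "- x : bar_null" using I[of "- i" "- z"] I_subD(4) span_neg[of z] by simp
 next
  assume "x : bar_null" "z : K"
  moreover from this obtain i w where "i : I" "w : K" "x = i + w" by (auto simp: bar_null_iff)
  ultimately show "pmult Q z x : bar_null" "pmult Q x z : bar_null"
  using I[of "pmult Q z i" "pmult Q z w"] I[of "pmult Q i z" "pmult Q w z"] I_subD(5,6)
  K_mult_span[OF tr] by (simp_all add: pmult_add_right pmult_add_left)
 }
qed

lemma bar_null_sub: "sub_bimodule bar_null" by (rule sub_bimoduleI) (fact bar_null_subD)+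

lemma span_sub:
 assumes "T <= paths Q" shows "sub_bimodule (path_span T)" proof (rule sub_bimoduleI)
 show "x : cQ" if "x : path_span T" for x using that assms by (auto simp: path_span_def kQ_iff)
qed (use assms in \<open>auto intro: span_zero span_add span_neg K_mult_span\<close>)

lemma zero_sub: "sub_bimodule {0}" by (rule sub_bimoduleI) (auto simp: kQ_iff)

lemma car_A: "carrier fac_A = cA" proof -
 have "carrier fac_A = proj ` cQ" unfolding fac_A_def sq_carrier[OF carrier_sub I_sub] proj_def[abs_def] ..
 thus ?thesis by (auto elim: A_carrierE)
qed

lemmas sqA = sq_add[OF carrier_sub I_sub, folded fac_A_def proj_def]
 sq_zero[OF carrier_sub I_sub, folded fac_A_def proj_def]
 sq_lact[OF carrier_sub I_sub, folded fac_A_def proj_def]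
 sq_ract[OF carrier_sub I_sub, folded fac_A_def proj_def]

lemma A_add: "[| a : cA; b : cA |] ==> a +[fac_A] b = a +[A] b" by (elim A_carrierE) (simp add: sqA proj_add)

lemma A_lact: "[| z : K; a : cA |] ==> lact fac_A z a = proj z ** a"
 by (elim A_carrierE) (simp add: sqA proj_mult K_carrier)

lemma A_ract: "[| z : K; a : cA |] ==> ract fac_A a z = a ** proj z"
 by (elim A_carrierE) (simp add: sqA proj_mult K_carrier)

lemma fac_A_factor: "factor K fac_A" unfolding fac_A_def by (rule sq_factor[OF carrier_sub I_sub])

abbreviation bcls where "bcls x \<equiv> bar_null +>\<^bsub>kQ\<^esub> x"

lemmas sqB = sq_add[OF carrier_sub bar_null_sub, folded fac_Abar_def]
 sq_zero[OF carrier_sub bar_null_sub, folded fac_Abar_def]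
 sq_lact[OF carrier_sub bar_null_sub, folded fac_Abar_def]
 sq_ract[OF carrier_sub bar_null_sub, folded fac_Abar_def]
 sq_carrier[OF carrier_sub bar_null_sub, folded fac_Abar_def]

lemma fac_Abar_factor: "factor K fac_Abar" unfolding fac_Abar_def by (rule sq_factor[OF carrier_sub bar_null_sub])

lemma to_bar_proj: "x : cQ ==> to_bar (proj x) = bcls x" proof -
 have "\<exists>w. w : bar_null & u + (i + x) = w + x" if "u : bar_null" "i : I" for u i proof -
  have "i : bar_null" using that span_zero by (force simp: bar_null_iff)
  thus ?thesis using that bar_null_subD(3)[of u i] by (intro exI[of _ "u + i"]) (simp add: algebra_simps)
 qed
 moreover have "\<exists>v i. v : bar_null & i : I & u + x = v + (i + x)" if "u : bar_null" for u
  using that I_subD(2) by (intro exI[of _ u] exI[of _ 0]) simp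
 ultimately show ?thesis by (auto simp: to_bar_def proj_def set_add_def' a_r_coset_def') (metis (no_types, lifting))+
qed

lemma bcls_eq_iff: "bcls x = bcls y \<longleftrightarrow> x - y : bar_null"
 by (rule ucls_eq_iff[OF carrier_sub bar_null_sub])

lemma to_bar_hom: "to_bar : ahom fac_A fac_Abar"
 by (rule ahomI) (auto simp: car_A A_add sqB to_bar_proj proj_add[symmetric]
  I.a_closed[simplified] elim!: A_carrierE)

lemma to_bar_in: "a : cA ==> to_bar a : carrier fac_Abar" using ahom_in[OF to_bar_hom] by (simp add: car_A)

lemma to_bar_act:
 assumes "z : K" "a : cA"
 shows "to_bar (proj z ** a) = lact fac_Abar z (to_bar a)"
  "to_bar (a ** proj z) = ract fac_Abar (to_bar a) z" using assms carrier_subD(5,6)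
 by (auto simp: proj_mult[symmetric] to_bar_proj sqB K_carrier elim!: A_carrierE)

lemma to_bar_K: "z : K ==> to_bar (proj z) = \<zero>[fac_Abar]" proof -
 assume "z : K"
 hence "z - 0 : bar_null" using I_subD(2) by (force simp: bar_null_iff)
 thus ?thesis using `z : K` by (simp only: to_bar_proj K_carrier sqB bcls_eq_iff)
qed

lemma Abar_carrierE:
 assumes "b : carrier fac_Abar" obtains a where "a : cA" "b = to_bar a" proof -
 obtain x where "x : cQ" "b = bcls x" using assms unfolding sqB by (elim imageE)
 thus thesis using that[of "proj x"] by (simp add: to_bar_proj)
qed

lemma lift_A_A: "a : cA ==> lift_A a = a" proof (elim A_carrierE)
 fix x assume x: "x : cQ" "a = proj x"
 have "x : a" using x I_subD(2) by (auto simp: proj_def a_r_coset_def' intro!: exI[of _ 0])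
 hence "(SOME x. x : a) : a" by (rule someI)
 then obtain i where "i : I" "(SOME x. x : a) = i + x" by (auto simp: x proj_def a_r_coset_def')
 thus "lift_A a = a" using x I_subD(1) carrier_subD(3) by (simp add: lift_A_def proj_eq_iff)
qed

text \<open>Lifting a class from the reduced factor recovers an element of it only up to vertices.\<close>

lemma lift_A_to_bar:
 assumes "a : cA"
 obtains z where "z : K" "lift_A (to_bar a) = a +[A] proj z" proof -
 obtain x where x: "x : cQ" "a = proj x" using assms by (rule A_carrierE)
 have e: "to_bar a = {u + x | u. u : bar_null}" using x by (auto simp: to_bar_proj a_r_coset_def')
 have "x : to_bar a" using bar_null_subD(2) by (auto simp: e intro!: exI[of _ 0])
 hence "(SOME x. x : to_bar a) : to_bar a" by (rule someI)
 then obtain i z where iz: "i : I" "z : K" "(SOME x. x : to_bar a) = i + z + x" by (auto simp: e bar_null_iff)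
 have "lift_A (to_bar a) = proj (x + z)"
  unfolding lift_A_def iz(3) using iz(1,2) x I_subD(1)[of i] K_carrier[of z] carrier_subD(3)
  by (subst proj_eq_iff) (auto simp: algebra_simps)
 with iz x that[of z] show thesis by (simp add: proj_add K_carrier)
qed

lemma lift_A_in: "b : carrier fac_Abar ==> lift_A b : cA" proof (elim Abar_carrierE)
 fix a assume a: "a : cA" "b = to_bar a"
 from a(1) obtain z where "z : K" "lift_A (to_bar a) = a +[A] proj z" by (rule lift_A_to_bar)
 thus "lift_A b : cA" using a by (simp add: proj_K_in)
qed

lemma to_bar_lift: "b : carrier fac_Abar ==> to_bar (lift_A b) = b" proof (elim Abar_carrierE)
 fix a assume a: "a : cA" "b = to_bar a"
 from a(1) obtain z where "z : K" "lift_A (to_bar a) = a +[A] proj z" by (rule lift_A_to_bar)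
 hence z: "z : K" "lift_A b = a +[A] proj z" by (simp_all add: a)
 interpret B: abelian_group fac_Abar using fac_Abar_factor by (simp add: factor_def)
 show "to_bar (lift_A b) = b" using ahom_add[OF to_bar_hom, of a "proj z"] a z
  by (simp add: car_A A_add proj_K_in to_bar_K to_bar_in)
qed

end

section \<open>Reductions and normal forms\<close>

definition smul :: "'k::comm_ring_1 => ('a \<Rightarrow>\<^sub>0 'k) => ('a \<Rightarrow>\<^sub>0 'k)" where
 "smul c x = Poly_Mapping.map ((*) c) x"

lemma lookup_smul [simp]: "lookup (smul c x) p = c * lookup x p" by (auto simp: smul_def map.rep_eq when_def)

lemma keys_smul: "keys (smul c x) <= keys x" by (auto simp: in_keys_iff)

lemma smul_single: "smul c (single p d) = single p (c * d)"
 by (rule poly_mapping_eqI) (simp add: lookup_single when_def)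

lemma smul_add: "smul c (x + y) = smul c x + smul c y" "smul (c + d) x = smul c x + smul d x"
 by (rule poly_mapping_eqI, simp add: lookup_add algebra_simps)+

lemma smul_zero [simp]: "smul 0 x = 0" "smul c 0 = 0" by (rule poly_mapping_eqI, simp)+

context confluent_presentation
begin

lemma S_path: "s : S ==> s : paths Q" "s : S ==> plen s \<ge> 2" using rs by (auto simp: reduction_system_def)

lemma S_antichain: "[| s : S; s' : S; subpath Q s s' |] ==> s = s'" using rs by (auto simp: reduction_system_def)

lemma phi_key:
 assumes "s : S" "t : keys (\<phi> s)"
 shows "t : irr Q S" "src t = src s" "tgt Q t = tgt Q s" "t : paths Q"
 using rs assms by (auto simp: reduction_system_def irr_def)

lemma irr_path: "p : irr Q S ==> p : paths Q" by (simp add: irr_def)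

lemma irr_sub: "irr Q S <= paths Q" by (auto simp: irr_def)

lemma subpath_iff: "subpath Q w p \<longleftrightarrow>
  (\<exists>q r. q : paths Q & w : paths Q & r : paths Q & tgt Q q = src w & tgt Q w = src r & p = cat q (cat w r))"
 by (auto simp: subpath_def pconcat3)

subsection \<open>The order on paths generated by the reductions\<close>

text \<open>The result of the basic reduction on the path \<open>q s r\<close> itself\<close>

definition red where
 "red q s r = (\<Sum>t\<in>keys (\<phi> s). single (pconcat [q, t, r])
  (lookup (\<phi> s) t))"

definition red_rel :: "(('v, 'e) path \<times> ('v, 'e) path) set" where
 "red_rel = {(u, p). \<exists>q s r. s : S & composable Q [q, s, r] & p = pconcat [q, s, r] & u : keys (red q s r)}"

lemma red_relE:
 assumes "(u, p) : red_rel"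
 obtains q s r where "s : S" "composable Q [q, s, r]" "p = pconcat [q, s, r]"
  "u : keys (red q s r)" using assms unfolding red_rel_def by blast

lemma pconcat3_inj: "pconcat [q, t, r] = pconcat [q, t', r] \<longleftrightarrow> snd t = snd t'"
 by (auto simp: pconcat3)

lemma phi_inj:
 assumes "s : S" "t : keys (\<phi> s)" "t' = s \<or> t' : keys (\<phi> s)" "snd t = snd t'"
 shows "t = t'" using assms phi_key[of s t] phi_key[of s t'] by (auto simp: src_def prod_eq_iff)

lemma lookup_red:
 assumes "s : S"
 shows "t : keys (\<phi> s) ==>
  lookup (red q s r) (pconcat [q, t, r]) = lookup (\<phi> s) t"
  "keys (red q s r) = (%t. pconcat [q, t, r]) ` keys (\<phi> s)" proof -
 have l: "lookup (red q s r) u =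
  (\<Sum>t\<in>keys (\<phi> s). if pconcat [q, t, r] = u then lookup (\<phi> s) t else 0)" for u
  by (auto simp: red_def lookup_sum lookup_single when_def intro!: sum.cong)
 show 1: "lookup (red q s r) (pconcat [q, t, r]) = lookup (\<phi> s) t" if "t : keys (\<phi> s)" for t proof -
  have "lookup (red q s r) (pconcat [q, t, r]) =
  (\<Sum>t'\<in>keys (\<phi> s). if t' = t then lookup (\<phi> s) t else 0)"
  unfolding l pconcat3_inj using phi_inj[OF assms _ disjI2, of _ t] that by (intro sum.cong) auto
  thus ?thesis using that by simp
 qed
 show "keys (red q s r) = (%t. pconcat [q, t, r]) ` keys (\<phi> s)" proof (intro equalityI subsetI)
  fix u assume "u : keys (red q s r)"
  thus "u : (%t. pconcat [q, t, r]) ` keys (\<phi> s)"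
  by (auto simp: in_keys_iff l elim!: sum.not_neutral_contains_not_neutral split: if_splits)
 qed (use 1 in \<open>auto simp: in_keys_iff\<close>)
qed

lemma self_not_red: "s : S ==> pconcat [q, s, r] ~: keys (red q s r)" proof
 assume s: "s : S" "pconcat [q, s, r] : keys (red q s r)"
 then obtain t where t: "t : keys (\<phi> s)" "snd s = snd t" by (auto simp: lookup_red(2) pconcat3_inj)
 hence "s : irr Q S" using phi_inj[OF s(1) t(1), of s] phi_key(1)[OF s(1) t(1)] by auto
 moreover have "subpath Q s s" unfolding subpath_iff using S_path(1)[OF s(1)] path_ends[of s]
  by (intro exI[of _ "vtx (src s)"] exI[of _ "vtx (tgt Q s)"]) (auto simp: vtx_path src_def)
 ultimately show False using s(1) by (auto simp: irr_def)
qed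

lemma red_carrier:
 assumes "s : S" "composable Q [q, s, r]" "u : keys (red q s r)"
 shows "u : paths Q" "src u = src q" "tgt Q u = tgt Q r" proof -
 obtain t where t: "t : keys (\<phi> s)" "u = pconcat [q, t, r]" using assms by (auto simp: lookup_red(2))
 have "composable Q [q, t, r]" using assms(2) phi_key[OF assms(1) t(1)] by simp
 thus "u : paths Q" "src u = src q" "tgt Q u = tgt Q r" using composable3_path[of q t r] t(2) by auto
qed

lemma red_pmult:
 assumes "s : S" "composable Q [q, s, r]"
 shows "pmult Q (pmult Q (single q c) (\<phi> s)) (single r d) =
  smul (c * d) (red q s r)" proof -
 have 0: "pmult Q (pmult Q (single q c) (single t a)) (single r d)
  = smul (c * d) (single (pconcat [q, t, r]) a)" if "t : keys (\<phi> s)" for t a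
  using assms(2) phi_key[OF assms(1) that] cat_paths(2)[of q t]
  by (simp add: pmult_single pconcat3 smul_single ac_simps)
 have 1: "pmult Q (pmult Q (single q c) w) (single r d) =
  smul (c * d) (\<Sum>t\<in>T. single (pconcat [q, t, r]) (a t))"
  if "w = (\<Sum>t\<in>T. single t (a t))" "T <= keys (\<phi> s)" for w a T proof -
  have "smul (c * d) (\<Sum>t\<in>B. f t) = (\<Sum>t\<in>B. smul (c * d) (f t))"
  for f :: "('v, 'e) path => ('v, 'e, 'k) pathalg" and B
  by (induction B rule: infinite_finite_induct) (simp_all add: smul_add)
  thus ?thesis using that 0 by (auto simp: pmult_sum_left pmult_sum_right intro!: sum.cong)
 qed
 have "\<phi> s = (\<Sum>t\<in>keys (\<phi> s). single t (lookup (\<phi> s) t))"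
  by (rule poly_mapping_eqI) (auto simp: lookup_sum lookup_single when_def in_keys_iff sum.delta)
 from 1[OF this] show ?thesis by (simp add: red_def)
qed

lemma basic_red:
 assumes "s : S" "composable Q [q, s, r]"
 shows "basic_reduction Q \<phi> q s r x =
  x - single (pconcat [q, s, r]) (lookup x (pconcat [q, s, r]))
  + smul (lookup x (pconcat [q, s, r])) (red q s r)"
 using red_pmult[OF assms, of _ 1] by (simp add: basic_reduction_def Let_def)

lemma lookup_basic:
 assumes "s : S" "composable Q [q, s, r]"
 shows "lookup (basic_reduction Q \<phi> q s r x) u =
  (if u = pconcat [q, s, r] then 0 else lookup x u) +
  lookup x (pconcat [q, s, r]) * lookup (red q s r) u" using self_not_red[OF assms(1), of q r]
 by (auto simp: basic_red[OF assms] lookup_add lookup_minus lookup_single in_keys_iff)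

lemma basic_in_reductions:
 "[| s : S; composable Q [q, s, r] |] ==> basic_reduction Q \<phi> q s r : reductions Q S \<phi>"
 using reductions.comp[OF reductions.id, of s S Q q r] by simp

lemma no_perpetual:
 assumes "p : paths Q" "Inv (ppath p)"
  and step: "!!x. Inv x ==> \<exists>\<theta>\<in>reductions Q S \<phi>. Inv (\<theta> x) & \<theta> x ~= x"
 shows False proof -
 define g where "g x = (SOME \<theta>. \<theta> : reductions Q S \<phi> & Inv (\<theta> x) & \<theta> x ~= x)" for x
 have g: "g x : reductions Q S \<phi> & Inv (g x x) & g x x ~= x" if "Inv x" for x proof -
  from step[OF that] obtain \<theta> where "\<theta> : reductions Q S \<phi> & Inv (\<theta> x) & \<theta> x ~= x" by blast
  thus ?thesis unfolding g_def
  by (rule someI[of "%\<theta>. \<theta> : reductions Q S \<phi> & Inv (\<theta> x) & \<theta> x ~= x"])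
 qed
 define X where "X n = ((%x. g x x) ^^ n) (ppath p)" for n
 have X: "Inv (X n)" for n by (induction n) (use assms(2) g in \<open>auto simp: X_def\<close>)
 have it: "iterated (%n. g (X n)) n (ppath p) = X n" for n by (induction n) (auto simp: X_def)
 have "reduction_finite Q S \<phi> p" using dia assms(1) by (auto simp: diamond_def reduction_unique_def)
 then obtain N where "!!n. n \<ge> N ==> X n = X N"
  unfolding reduction_finite_def using g X it by (metis (no_types, lifting))
 from this[of "Suc N"] show False using g[OF X[of N]] by (simp add: X_def)
qed

text \<open>
 A path that starts an infinite descending chain would allow an endless reduction: some such path
 stays in the support, unless reducing it cancels another one.  A cancellation produces two paths
 each occurring in a reduction of the other, and alternating between these two never terminates
 either.
\<close>

lemma wf_red_rel: "wf red_rel" proof (rule ccontr)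
 assume "\<not> wf red_rel"
 then obtain b0 where b0: "b0 ~: Wellfounded.acc red_rel" by (auto simp: wf_iff_acc)
 have dn: "\<exists>q s r u. s : S & composable Q [q, s, r] & b = pconcat [q, s, r] & u : keys (red q s r) & u ~: Wellfounded.acc red_rel" if nb: "b ~: Wellfounded.acc red_rel" for b
 proof -
  obtain u where "(u, b) : red_rel" "u ~: Wellfounded.acc red_rel" using not_acc_down[OF nb] by blast
  from this(1) show ?thesis by (rule red_relE) (use `u ~: Wellfounded.acc red_rel` in blast)
 qed
 have path: "b : paths Q" if "b ~: Wellfounded.acc red_rel" for b using dn[OF that] composable3_path(1) by blast
 have two: False if up: "(u, p) : red_rel" and pu: "(p, u) : red_rel" for p u proof -
  obtain q s r where 1: "s : S" "composable Q [q, s, r]" "p = pconcat [q, s, r]"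
  "u : keys (red q s r)" using up by (rule red_relE)
  obtain q' s' r' where 2: "s' : S" "composable Q [q', s', r']" "u = pconcat [q', s', r']"
  "p : keys (red q' s' r')" using pu by (rule red_relE)
  have np: "p ~: keys (red q s r)" "u ~: keys (red q' s' r')" using self_not_red 1 2 by auto
  define Inv where "Inv x \<longleftrightarrow> (lookup x p = 0) ~= (lookup x u = 0)" for x :: "('v, 'e, 'k) pathalg"
  show False proof (rule no_perpetual[of p Inv])
  show "p : paths Q" using 1 composable3_path(1) by blast
  have "p ~= u" using np 1 by auto
  thus "Inv (ppath p)" by (simp add: Inv_def lookup_single)
  fix x assume x: "Inv x"
  show "\<exists>\<theta>\<in>reductions Q S \<phi>. Inv (\<theta> x) & \<theta> x ~= x"
  proof (cases "lookup x p = 0")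
  case False
  let ?\<theta> = "basic_reduction Q \<phi> q s r"
  have "lookup (?\<theta> x) p = 0" "lookup (?\<theta> x) u ~= 0"
  using False x 1 np `p ~= u` lookup_basic[OF 1(1,2), of x] by (auto simp: Inv_def in_keys_iff)
  thus ?thesis using False basic_in_reductions[OF 1(1,2)] by (auto simp: Inv_def)
  next
  case True
  let ?\<theta> = "basic_reduction Q \<phi> q' s' r'"
  have "lookup (?\<theta> x) u = 0" "lookup (?\<theta> x) p ~= 0"
  using True x 2 np `p ~= u` lookup_basic[OF 2(1,2), of x] by (auto simp: Inv_def in_keys_iff)
  thus ?thesis using True basic_in_reductions[OF 2(1,2)] by (auto simp: Inv_def)
  qed
  qed
 qed
 define Inv where "Inv x \<longleftrightarrow> (\<exists>b. b ~: Wellfounded.acc red_rel & lookup x b ~= 0)"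
  for x :: "('v, 'e, 'k) pathalg"
 show False proof (rule no_perpetual[of b0 Inv])
  show "b0 : paths Q" using b0 by (rule path)
  show "Inv (ppath b0)" unfolding Inv_def using b0 by (intro exI[of _ b0]) simp
  fix x assume "Inv x"
  then obtain b where b: "b ~: Wellfounded.acc red_rel" "lookup x b ~= 0" by (auto simp: Inv_def)
  obtain q s r u where 1: "s : S" "composable Q [q, s, r]" "b = pconcat [q, s, r]"
  "u : keys (red q s r)" "u ~: Wellfounded.acc red_rel" using dn[OF b(1)] by blast
  let ?\<theta> = "basic_reduction Q \<phi> q s r"
  have nb: "b ~: keys (red q s r)" using self_not_red 1 by auto
  have l: "lookup (?\<theta> x) b = 0" "lookup (?\<theta> x) u =
  lookup x u + lookup x b * lookup (red q s r) u"
  using lookup_basic[OF 1(1,2), of x] 1(3,4) nb by (auto simp: in_keys_iff)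
  show "\<exists>\<theta>\<in>reductions Q S \<phi>. Inv (\<theta> x) & \<theta> x ~= x"
  proof (cases "lookup (?\<theta> x) u = 0")
  case False
  hence "Inv (?\<theta> x)" unfolding Inv_def using 1(5) by blast
  moreover have "?\<theta> x ~= x" using b(2) l(1) by metis
  ultimately show ?thesis using basic_in_reductions[OF 1(1,2)] by blast
  next
  case True
  hence xu: "lookup x u ~= 0" using l 1(4) b(2) by (auto simp: in_keys_iff)
  obtain q' s' r' u' where 2: "s' : S" "composable Q [q', s', r']" "u = pconcat [q', s', r']"
  "u' : keys (red q' s' r')" "u' ~: Wellfounded.acc red_rel" using dn[OF 1(5)] by blast
  let ?\<theta>' = "basic_reduction Q \<phi> q' s' r'"
  have "b ~: keys (red q' s' r')" proof
  assume "b : keys (red q' s' r')"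
  hence "(u, b) : red_rel" "(b, u) : red_rel" using 1 2 unfolding red_rel_def by blast+
  thus False by (rule two)
  qed
  moreover have "u ~: keys (red q' s' r')" using self_not_red 2 by auto
  moreover have "u ~= b" using 1 nb by auto
  ultimately have "lookup (?\<theta>' x) b ~= 0" "lookup (?\<theta>' x) u = 0"
  using lookup_basic[OF 2(1,2), of x] 2(3) b(2) by (auto simp: in_keys_iff)
  hence "Inv (?\<theta>' x)" "?\<theta>' x ~= x" unfolding Inv_def using b(1) xu by metis+
  thus ?thesis using basic_in_reductions[OF 2(1,2)] by blast
  qed
 qed
qed

definition below :: "(('v, 'e) path \<times> ('v, 'e) path) set" where "below = red_rel\<^sup>+"

lemma wf_below: "wf below" unfolding below_def by (rule wf_trancl) (rule wf_red_rel)

lemma trans_below: "trans below" by (simp add: below_def)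

lemma red_rel_parallel:
 "(u, p) : red_rel ==> u : paths Q & p : paths Q & src u = src p & tgt Q u = tgt Q p" proof -
 assume "(u, p) : red_rel"
 then obtain q s r where 1: "s : S" "composable Q [q, s, r]" "p = pconcat [q, s, r]"
  "u : keys (red q s r)" by (rule red_relE)
 thus ?thesis using red_carrier[OF 1(1,2,4)] composable3_path[OF 1(2)] by simp
qed

lemma below_parallel:
 "(u, p) : below ==> u : paths Q & p : paths Q & src u = src p & tgt Q u = tgt Q p"
 unfolding below_def by (induction rule: trancl_induct) (auto dest: red_rel_parallel)

lemma red_rel_cat:
 assumes "(u, p) : red_rel" "composable Q [q, p, r]"
 shows "(cat q (cat u r), cat q (cat p r)) : red_rel" proof -
 obtain q' s r' t where 1: "s : S" "composable Q [q', s, r']" "p = pconcat [q', s, r']"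
  "t : keys (\<phi> s)" "u = pconcat [q', t, r']" using assms(1) by (auto simp: red_rel_def lookup_red(2))
 have e: "src p = src q'" "tgt Q p = tgt Q r'" using composable3_path[OF 1(2)] 1(3) by auto
 have "cat q q' : paths Q" "tgt Q (cat q q') = src s" using cat_paths[of q q'] assms(2) 1(2) e by auto
 moreover have "cat r' r : paths Q" using cat_paths[of r' r] assms(2) 1(2) e by auto
 ultimately have c: "composable Q [cat q q', s, cat r' r]" using 1(2) by simp
 show ?thesis unfolding red_rel_def
  by (intro CollectI case_prodI exI[of _ "cat q q'"] exI[of _ s] exI[of _ "cat r' r"] conjI 1(1) c)
  (use 1 in \<open>auto simp: pconcat3 lookup_red(2)\<close>)
qed

lemma below_cat:
 assumes "(u, p) : below" "composable Q [q, p, r]"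
 shows "(cat q (cat u r), cat q (cat p r)) : below" using assms unfolding below_def
proof (induction rule: trancl_induct)
 case (base p)
 thus ?case using red_rel_cat by blast
next
 case (step u' p)
 hence "composable Q [q, u', r]" using red_rel_parallel by (simp add: composable3)
 thus ?case using step red_rel_cat[of u' p q r] by (meson trancl_into_trancl)
qed

subsection \<open>Reductions are linear and normalise\<close>

lemma reductions_comp:
 assumes "\<theta>' : reductions Q S \<phi>" "\<theta> : reductions Q S \<phi>" shows "\<theta>' \<circ> \<theta> : reductions Q S \<phi>"
 using assms proof (induction rule: reductions.induct)
 case (comp \<theta>' s q r)
 thus ?case using reductions.comp[of "\<theta>' \<circ> \<theta>" Q S \<phi> s q r] by (simp only: comp_assoc)
qed simp

lemma basic_linear:
 assumes "s : S" "composable Q [q, s, r]"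
 shows "basic_reduction Q \<phi> q s r (x + y) = basic_reduction Q \<phi> q s r x + basic_reduction Q \<phi> q s r y"
  "basic_reduction Q \<phi> q s r (smul c x) = smul c (basic_reduction Q \<phi> q s r x)"
 by (rule poly_mapping_eqI, simp add: lookup_basic[OF assms] lookup_add algebra_simps)+

lemma reductions_linear:
 assumes "\<theta> : reductions Q S \<phi>"
 shows "\<theta> (x + y) = \<theta> x + \<theta> y" "\<theta> (smul c x) = smul c (\<theta> x)"
 using assms by (induction rule: reductions.induct) (simp_all add: basic_linear)

lemma reductions_sum:
 assumes "\<theta> : reductions Q S \<phi>" shows "\<theta> (\<Sum>i\<in>B. f i) = (\<Sum>i\<in>B. \<theta> (f i))"
proof -
 have "\<theta> 0 = 0" using reductions_linear(2)[OF assms, of 0 0] by simp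
 thus ?thesis by (induction B rule: infinite_finite_induct) (simp_all add: reductions_linear[OF assms])
qed

lemma reductions_irr:
 assumes "\<theta> : reductions Q S \<phi>" "x : path_span (irr Q S)" shows "\<theta> x = x" using assms
proof (induction rule: reductions.induct)
 case (comp \<theta> s q r)
 have "pconcat [q, s, r] ~: irr Q S" using comp(2,3) unfolding irr_def subpath_def by blast
 hence "lookup x (pconcat [q, s, r]) = 0" using comp.prems by (auto simp: path_span_def in_keys_iff)
 thus ?case using comp by (simp add: basic_red)
qed simp

lemma keys_basic:
 assumes "s : S" "composable Q [q, s, r]" "u : keys (basic_reduction Q \<phi> q s r x)"
 shows "u : keys x & u ~= pconcat [q, s, r] \<or>
  pconcat [q, s, r] : keys x & (u, pconcat [q, s, r]) : red_rel" proof (cases "u : keys (red q s r)")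
 case True
 hence "(u, pconcat [q, s, r]) : red_rel" "u ~= pconcat [q, s, r]"
  using assms self_not_red unfolding red_rel_def by blast+
 thus ?thesis using assms(3) by (auto simp: in_keys_iff lookup_basic[OF assms(1,2)])
qed (use assms(3) in \<open>auto simp: in_keys_iff lookup_basic[OF assms(1,2)] split: if_splits\<close>)

lemma keys_reductions:
 assumes "\<theta> : reductions Q S \<phi>" "u : keys (\<theta> x)"
 shows "\<exists>p\<in>keys x. (u, p) : below\<^sup>=" using assms
proof (induction arbitrary: u rule: reductions.induct)
 case (comp \<theta> s q r)
 let ?p = "pconcat [q, s, r]"
 from keys_basic[OF comp(2,3), of u "\<theta> x"] comp.prems
 consider "u : keys (\<theta> x)" | "?p : keys (\<theta> x)" "(u, ?p) : red_rel" by auto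
 thus ?case proof cases
  case 2
  then obtain p where "p : keys x" "(?p, p) : below\<^sup>=" using comp.IH by blast
  moreover from this 2 have "(u, p) : below" unfolding below_def by (auto intro: trancl_into_trancl2)
  ultimately show ?thesis by blast
 qed (use comp.IH in blast)
qed auto

lemma reductions_carrier:
 "[| \<theta> : reductions Q S \<phi>; x : cQ |] ==> \<theta> x : cQ"
 unfolding kQ_iff using keys_reductions[of \<theta> _ x] below_parallel by blast

text \<open>The supports decrease in the multiset extension of the order on paths.\<close>

lemma normalise:
 assumes "x : cQ" shows "\<exists>\<theta>\<in>reductions Q S \<phi>. \<theta> x : path_span (irr Q S)" proof -
 have "wf (inv_image (mult below) (%x :: ('v, 'e, 'k) pathalg. mset_set (keys x)))"
  by (intro wf_inv_image wf_mult wf_below)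
 thus ?thesis using assms proof (induction x)
  case (less x)
  show ?case proof (cases "x : path_span (irr Q S)")
  case True
  thus ?thesis by (intro bexI[OF _ reductions.id]) simp
  next
  case False
  then obtain p where p: "p : keys x" "p ~: irr Q S" by (auto simp only: path_span_def)
  hence "p : paths Q" using less.prems by (auto simp only: kQ_iff)
  then obtain q s r where 1: "s : S" "composable Q [q, s, r]" "pconcat [q, s, r] : keys x"
  using p unfolding irr_def subpath_def by blast
  let ?p = "pconcat [q, s, r]" and ?b = "basic_reduction Q \<phi> q s r"
  let ?X = "keys x" and ?Y = "keys (?b x)"
  have Y: "(u, ?p) : below" if "u : ?Y - ?X" for u using keys_basic[OF 1(1,2), of u x] that by (auto simp: below_def)
  have "?p ~: ?Y" using self_not_red[OF 1(1), of q r] by (auto simp: in_keys_iff lookup_basic[OF 1(1,2)])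
  hence "mset_set (?X - ?Y) ~= {#}" using 1(3) by (auto simp: mset_set_empty_iff)
  moreover have "?p \<in># mset_set (?X - ?Y)" using 1(3) `?p ~: ?Y` by simp
  ultimately have "(mset_set (?X \<inter> ?Y) + mset_set (?Y - ?X), mset_set (?X \<inter> ?Y) + mset_set (?X - ?Y)) : mult below"
  using Y by (intro one_step_implies_mult) auto
  moreover have "mset_set (B \<inter> C) + mset_set (B - C) = mset_set B" if "finite B" for B C :: "('v, 'e) path set"
  proof -
  have "(B \<inter> C) \<inter> (B - C) = {}" "(B \<inter> C) \<union> (B - C) = B" by blast+
  thus ?thesis using mset_set_Union[of "B \<inter> C" "B - C"] that by simp
  qed
  from this[of ?X ?Y] this[of ?Y ?X]
  have "mset_set (?X \<inter> ?Y) + mset_set (?X - ?Y) = mset_set ?X"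
  "mset_set (?X \<inter> ?Y) + mset_set (?Y - ?X) = mset_set ?Y" by (simp_all add: Int_commute)
  ultimately have "(?b x, x) : inv_image (mult below) (%x. mset_set (keys x))" by (simp add: inv_image_def)
  moreover have "?b x : cQ" using reductions_carrier[OF basic_in_reductions[OF 1(1,2)] less.prems] .
  ultimately obtain \<theta> where "\<theta> : reductions Q S \<phi>" "\<theta> (?b x) : path_span (irr Q S)"
  using less.IH by blast
  thus ?thesis
  using reductions_comp[OF _ basic_in_reductions[OF 1(1,2)], of \<theta>] by (intro bexI[of _ "\<theta> \<circ> ?b"]) auto
  qed
 qed
qed

lemma normalise_set:
 assumes "finite T" "T <= paths Q"
 shows "\<exists>\<theta>\<in>reductions Q S \<phi>. \<forall>p\<in>T. \<theta> (ppath p) : path_span (irr Q S)"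
 using assms proof (induction rule: finite_induct)
 case empty
 show ?case using reductions.id by blast
next
 case (insert p T)
 hence "T <= paths Q" by simp
 from insert.IH[OF this] obtain \<theta>
  where r: "\<theta> : reductions Q S \<phi>" "\<forall>p\<in>T. \<theta> (ppath p) : path_span (irr Q S)" by (rule bexE)
 have "\<theta> (ppath p) : cQ" using insert.prems by (intro reductions_carrier[OF r(1)] single_carrier) simp
 from normalise[OF this]
 obtain \<theta>' where r': "\<theta>' : reductions Q S \<phi>" "\<theta>' (\<theta> (ppath p)) : path_span (irr Q S)" by (rule bexE)
 show ?case proof (rule bexI[of _ "\<theta>' \<circ> \<theta>"])
  have "\<theta>' (\<theta> (ppath u)) : path_span (irr Q S)" if "u : insert p T" for u proof (cases "u = p")
  case False
  hence "\<theta> (ppath u) : path_span (irr Q S)" using that r(2) by blast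
  thus ?thesis by (simp only: reductions_irr[OF r'(1)])
  qed (simp only: r'(2))
  thus "\<forall>u\<in>insert p T. (\<theta>' \<circ> \<theta>) (ppath u) : path_span (irr Q S)" by (simp only: o_def) blast
 qed (rule reductions_comp[OF r'(1) r(1)])
qed

subsection \<open>The normal form of an element\<close>

definition nfp :: "('v, 'e) path => ('v, 'e, 'k) pathalg" where
 "nfp p = (SOME y. y : path_span (irr Q S) & (\<exists>\<theta>\<in>reductions Q S \<phi>. y = \<theta> (ppath p)))"

definition NF :: "('v, 'e, 'k) pathalg => ('v, 'e, 'k) pathalg" where
 "NF x = (\<Sum>p\<in>keys x. smul (lookup x p) (nfp p))"

lemma nfp_eq:
 assumes "p : paths Q" "\<theta> : reductions Q S \<phi>" "\<theta> (ppath p) : path_span (irr Q S)"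
 shows "nfp p = \<theta> (ppath p)" proof -
 have "nfp p : path_span (irr Q S) & (\<exists>\<theta>\<in>reductions Q S \<phi>. nfp p = \<theta> (ppath p))"
  unfolding nfp_def
  by (rule someI[of "%y. y : path_span (irr Q S) & (\<exists>\<theta>\<in>reductions Q S \<phi>. y = \<theta> (ppath p))"
  "\<theta> (ppath p)"]) (use assms(2,3) in blast)
 moreover have "reduction_unique Q S \<phi> p" using dia assms(1) by (auto simp: diamond_def)
 ultimately show ?thesis using assms unfolding reduction_unique_def by metis
qed

lemma NF_eq:
 assumes "\<theta> : reductions Q S \<phi>" "!!p. p : T ==> \<theta> (ppath p) : path_span (irr Q S)"
  "keys x <= T" "T <= paths Q"
 shows "\<theta> x = NF x" proof -
 have "x = (\<Sum>p\<in>keys x. single p (lookup x p))"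
  by (rule poly_mapping_eqI) (auto simp: lookup_sum lookup_single when_def in_keys_iff sum.delta)
 hence "\<theta> x = (\<Sum>p\<in>keys x. \<theta> (single p (lookup x p)))"
  using reductions_sum[OF assms(1)] by metis
 also have "\<dots> = NF x" unfolding NF_def proof (intro sum.cong refl)
  fix p assume "p : keys x"
  hence "nfp p = \<theta> (ppath p)" using nfp_eq assms by blast
  thus "\<theta> (single p (lookup x p)) = smul (lookup x p) (nfp p)"
  by (simp add: reductions_linear(2)[OF assms(1), symmetric] smul_single)
 qed
 finally show ?thesis .
qed

lemma NF_reduction:
 assumes "finite T" "T <= paths Q"
 obtains \<theta> where "\<theta> : reductions Q S \<phi>" "!!x. keys x <= T ==> NF x = \<theta> x"
  "!!p. p : T ==> \<theta> (ppath p) : path_span (irr Q S)"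
 using normalise_set[OF assms] NF_eq[of _ T] assms(2) by metis

lemma NF_add:
 assumes "x : cQ" "y : cQ" shows "NF (x + y) = NF x + NF y" proof -
 have "finite (keys x \<union> keys y)"
  "keys x \<union> keys y <= paths Q" using assms by (auto simp: kQ_iff)
 then obtain \<theta> where r: "\<theta> : reductions Q S \<phi>"
  "!!z. keys z <= keys x \<union> keys y ==> NF z = \<theta> z" by (rule NF_reduction) blast
 thus ?thesis using reductions_linear(1)[OF r(1)] keys_add[of x y] by simp
qed

lemma NF_smul:
 assumes "x : cQ" shows "NF (smul c x) = smul c (NF x)" proof -
 have "finite (keys x)" "keys x <= paths Q" using assms by (auto simp: kQ_iff)
 then obtain \<theta> where r: "\<theta> : reductions Q S \<phi>" "!!z. keys z <= keys x ==> NF z = \<theta> z"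
  by (rule NF_reduction) blast
 thus ?thesis using reductions_linear(2)[OF r(1)] keys_smul[of c x] by simp
qed

lemma NF_irr: "NF x : path_span (irr Q S)" if "x : cQ" proof -
 have f: "finite (keys x)" "keys x <= paths Q" using that by (auto simp: kQ_iff)
 obtain \<theta> where r: "\<theta> : reductions Q S \<phi>" "!!z. keys z <= keys x ==> NF z = \<theta> z"
  "!!p. p : keys x ==> \<theta> (ppath p) : path_span (irr Q S)" by (rule NF_reduction[OF f]) blast
 obtain \<theta>' where r': "\<theta>' : reductions Q S \<phi>" "\<theta>' x : path_span (irr Q S)" using normalise[OF `x : cQ`] by blast
 have "nfp p : path_span (irr Q S)" if "p : keys x" for p
  using nfp_eq[OF _ r(1) r(3)[OF that]] r(3)[OF that] that f by auto
 thus ?thesis unfolding NF_def path_span_def using keys_smul by (fastforce dest!: subsetD[OF keys_sum])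
qed

lemma NF_id: "x : path_span (irr Q S) ==> NF x = x"
 using NF_eq[OF reductions.id, of "irr Q S" x] irr_sub by (auto simp: path_span_def)

text \<open>Confluence: reducing a path in any one way does not change its normal form.\<close>

lemma NF_red:
 assumes "s : S" "composable Q [q, s, r]"
 shows "NF (ppath (pconcat [q, s, r])) = NF (red q s r)" proof -
 let ?p = "pconcat [q, s, r]" and ?b = "basic_reduction Q \<phi> q s r"
 have p: "?p : paths Q" using composable3_path(1) assms by blast
 have f: "finite (keys (red q s r))" "keys (red q s r) <= paths Q" using red_carrier(1)[OF assms] by auto
 obtain \<theta> where r: "\<theta> : reductions Q S \<phi>"
  "!!z. keys z <= keys (red q s r) ==> NF z = \<theta> z" by (rule NF_reduction[OF f]) blast
 have "?b (ppath ?p) = red q s r" by (rule poly_mapping_eqI) (simp add: lookup_basic[OF assms] lookup_single when_def)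
 hence "(\<theta> \<circ> ?b) (ppath ?p) = NF (red q s r)" using r(2)[of "red q s r"] by simp
 moreover have "NF (red q s r) : path_span (irr Q S)" using f(2) by (intro NF_irr) (simp add: kQ_iff)
 ultimately show ?thesis
  using NF_eq[of "\<theta> \<circ> ?b" "{?p}" "ppath ?p"] reductions_comp[OF r(1) basic_in_reductions[OF assms]] p by simp
qed

lemma gen_carrier: "s : S ==> ppath s - \<phi> s : cQ" using phi_key(4)[of s] S_path(1)[of s]
 by (auto simp: kQ_iff dest!: subsetD[OF keys_diff])

lemma I_gen: "I = Idl\<^bsub>kQ\<^esub> ((%s. ppath s - \<phi> s) ` S)" using dia by (simp add: diamond_def)

lemma gen_in_I: "s : S ==> ppath s - \<phi> s : I" proof -
 assume "s : S"
 moreover have "(%s. ppath s - \<phi> s) ` S <= cQ" using gen_carrier by blast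
 ultimately show ?thesis using I.genideal_self[of "(%s. ppath s - \<phi> s) ` S"] I_gen by blast
qed

lemma NF_gen:
 assumes s: "s : S" and x: "x : cQ" and y: "y : cQ"
 shows "NF (pmult Q (pmult Q x (ppath s - \<phi> s)) y) = 0" proof -
 let ?g = "ppath s - \<phi> s"
 have g: "?g : cQ" using gen_carrier[OF s] .
 have single: "NF (pmult Q (pmult Q (single q c) ?g) (single r d)) = 0" if "q : paths Q" "r : paths Q" for q r c d
 proof -
  have e: "pmult Q (pmult Q (single q c) ?g) (single r d) =
  pmult Q (pmult Q (single q c) (ppath s)) (single r d) -
  pmult Q (pmult Q (single q c) (\<phi> s)) (single r d)" using pmult_add_right[of Q "single q c" ?g "\<phi> s"]
  pmult_add_left[of Q "pmult Q (single q c) ?g"] by (simp add: algebra_simps)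
  show ?thesis proof (cases "composable Q [q, s, r]")
  case True
  have cs: "pmult Q (pmult Q (single q c) (ppath s)) (single r d) =
  smul (c * d) (ppath (pconcat [q, s, r]))"
  using True cat_paths(2)[of q s] by (simp add: pmult_single smul_single pconcat3)
  have "NF (smul (c * d) (ppath (pconcat [q, s, r])) - smul (c * d) (red q s r)) =
  smul (c * d) (NF (ppath (pconcat [q, s, r]))) + smul (- (c * d)) (NF (red q s r))" proof -
  have "smul (c * d) (ppath (pconcat [q, s, r])) - smul (c * d) (red q s r) =
  smul (c * d) (ppath (pconcat [q, s, r])) + smul (- (c * d)) (red q s r)"
  by (rule poly_mapping_eqI) (simp add: lookup_add lookup_minus)
  moreover have "ppath (pconcat [q, s, r]) : cQ" "red q s r : cQ"
  using composable3_path(1)[OF True] red_carrier(1)[OF s True] by (auto simp: kQ_iff)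
  moreover have "smul e z : cQ" if "z : cQ" for e z using that keys_smul by (fastforce simp: kQ_iff)
  ultimately show ?thesis by (simp only: NF_add NF_smul)
  qed
  also have "\<dots> = 0" unfolding NF_red[OF s True] by (rule poly_mapping_eqI) (simp add: lookup_add)
  finally show ?thesis unfolding e cs red_pmult[OF s True] .
  next
  case False
  hence f: "tgt Q q ~= src s \<or> tgt Q s ~= src r" using that S_path[OF s] by auto
  have "pmult Q (pmult Q (single q c) (single t a)) (single r d) = 0"
  if "src t = src s" "tgt Q t = tgt Q s" "t : paths Q" for t a
  using f that cat_paths(2)[OF `q : paths Q` that(3)] by (auto simp: pmult_single)
  hence "pmult Q (pmult Q (single q c) (\<phi> s)) (single r d) = 0"
  using pm_induct[of "\<phi> s" "{t\<in>paths Q. src t = src s & tgt Q t = tgt Q s}"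
  "%w. pmult Q (pmult Q (single q c) w) (single r d) = 0"] phi_key[OF s]
  by (force simp: pmult_add_left pmult_add_right)
  moreover have "pmult Q (pmult Q (single q c) (ppath s)) (single r d) = 0"
  using f S_path[OF s] cat_paths(2)[OF that(1), of s] by (auto simp: pmult_single)
  ultimately show ?thesis unfolding e by (simp add: NF_def)
  qed
 qed
 have mc: "pmult Q a b : cQ" if "a : cQ" "b : cQ" for a b using I.m_closed[OF that] by simp
 have zero: "NF 0 = 0" by (simp add: NF_def)
 have 1: "NF (pmult Q (pmult Q (single q c) ?g) y) = 0" if "q : paths Q" for q c using y[unfolded kQ_iff]
 proof (induction rule: pm_induct)
  case (add y z)
  thus ?case using that g by (simp add: pmult_add_right NF_add mc single_carrier kQ_iff[symmetric])
 qed (use single that in \<open>auto simp: zero\<close>)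
 show ?thesis using x[unfolded kQ_iff] proof (induction rule: pm_induct)
  case (add x z)
  thus ?case using g y by (simp add: pmult_add_left NF_add mc kQ_iff[symmetric])
 qed (use 1 in \<open>auto simp: zero\<close>)
qed

lemma NF_I: assumes "x : I" shows "NF x = 0" proof -
 define J where "J = {x\<in>cQ. \<forall>a\<in>cQ. \<forall>b\<in>cQ. NF (pmult Q (pmult Q a x) b) = 0}"
 have mc: "pmult Q a b : cQ" if "a : cQ" "b : cQ" for a b using I.m_closed[OF that] by simp
 have as: "pmult Q (pmult Q a b) c = pmult Q a (pmult Q b c)" if "a : cQ" "b : cQ" "c : cQ" for a b c
  using I.m_assoc[OF that] by simp
 have "ideal J kQ" proof (rule idealI)
  show "subgroup J (add_monoid kQ)" proof (rule I.add.subgroupI)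
  show "J ~= {}" by (auto simp: J_def NF_def kQ_iff intro!: exI[of _ 0])
  show "\<ominus>\<^bsub>kQ\<^esub> x : J" if "x : J" for x proof -
  have "- y = smul (- 1) y" for y :: "('v, 'e, 'k) pathalg" by (rule poly_mapping_eqI) simp
  hence "NF (pmult Q (pmult Q a (- x)) b) = smul (- 1) (NF (pmult Q (pmult Q a x) b))" if "a : cQ" "b : cQ" for a b
  using that `x : J` NF_smul[of "pmult Q (pmult Q a x) b" "- 1"]
  unfolding pmult_minus_left pmult_minus_right by (simp add: J_def mc)
  thus ?thesis using that by (auto simp: J_def kQ_minus carrier_subD(4))
  qed
  show "x +[kQ] y : J" if "x : J" "y : J" for x y
  using that by (auto simp: J_def pmult_add_left pmult_add_right NF_add mc carrier_subD(3))
  qed (auto simp: J_def)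
  have "pmult Q y x : J & pmult Q x y : J" if "x : J" "y : cQ" for x y proof -
  have x: "x : cQ" using that by (simp add: J_def)
  have "NF (pmult Q (pmult Q a (pmult Q y x)) b) = 0 & NF (pmult Q (pmult Q a (pmult Q x y)) b) = 0"
  if ab: "a : cQ" "b : cQ" for a b proof -
  have "pmult Q (pmult Q a (pmult Q y x)) b = pmult Q (pmult Q (pmult Q a y) x) b"
  "pmult Q (pmult Q a (pmult Q x y)) b = pmult Q (pmult Q a x) (pmult Q y b)"
  using ab x `y : cQ` by (simp_all only: as mc)
  moreover have "NF (pmult Q (pmult Q (pmult Q a y) x) b) = 0"
  "NF (pmult Q (pmult Q a x) (pmult Q y b)) = 0" using `x : J` `y : cQ` ab mc unfolding J_def by blast+
  ultimately show ?thesis by metis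
  qed
  moreover have "pmult Q y x : cQ" "pmult Q x y : cQ" using that x mc by blast+
  ultimately show ?thesis unfolding J_def by blast
  qed
  thus "y \<otimes>\<^bsub>kQ\<^esub> x : J" "x \<otimes>\<^bsub>kQ\<^esub> y : J" if "x : J" "y : cQ" for x y
  using that by simp_all
 qed (rule I.ring_axioms)
 moreover have "(%s. ppath s - \<phi> s) ` S <= J" using NF_gen gen_carrier by (auto simp: J_def)
 ultimately have "I <= J" unfolding I_gen by (rule I.genideal_minimal)
 hence "x : J" using assms by blast
 hence "NF (pmult Q (pmult Q (scalar Q 1) x) (scalar Q 1)) = 0" by (auto simp: J_def scalar_carrier)
 moreover have "pmult Q (pmult Q (scalar Q 1) x) (scalar Q 1) = x"
  using I.l_one[of x] I.r_one[of x] I_subD(1)[OF assms] by simp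
 ultimately show ?thesis by simp
qed

lemma basic_diff_I:
 assumes "s : S" "composable Q [q, s, r]" "x : cQ"
 shows "x - basic_reduction Q \<phi> q s r x : I" proof -
 let ?c = "lookup x (pconcat [q, s, r])" and ?g = "ppath s - \<phi> s"
 have e: "pmult Q (pmult Q (single q ?c) ?g) (ppath r) =
  pmult Q (pmult Q (single q ?c) (ppath s)) (ppath r) -
  pmult Q (pmult Q (single q ?c) (\<phi> s)) (ppath r)" using pmult_add_right[of Q "single q ?c" ?g "\<phi> s"]
  pmult_add_left[of Q "pmult Q (single q ?c) ?g"] by (simp add: algebra_simps)
 have "pmult Q (pmult Q (single q ?c) (ppath s)) (ppath r) =
  single (pconcat [q, s, r]) ?c" using assms(2) cat_paths(2)[of q s] by (simp add: pmult_single pconcat3)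
 hence "x - basic_reduction Q \<phi> q s r x = pmult Q (pmult Q (single q ?c) ?g) (ppath r)"
  unfolding e basic_red[OF assms(1,2)] red_pmult[OF assms(1,2)] by simp
 moreover have "single q ?c : cQ" "ppath r : cQ" using assms(2) by (auto intro: single_carrier)
 ultimately show ?thesis using I.I_l_closed[OF gen_in_I[OF assms(1)]] I.I_r_closed by simp
qed

lemma reduction_diff_I:
 assumes "\<theta> : reductions Q S \<phi>" "x : cQ" shows "x - \<theta> x : I" using assms(1)
proof (induction rule: reductions.induct)
 case id
 thus ?case using I_subD(2) by simp
next
 case (comp \<theta> s q r)
 have "\<theta> x - basic_reduction Q \<phi> q s r (\<theta> x) : I"
  using comp reductions_carrier[OF comp(1) assms(2)] by (intro basic_diff_I)
 from I_subD(3)[OF comp.IH this] show ?case by simp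
qed

lemma NF_diff_I: assumes "x : cQ" shows "x - NF x : I" proof -
 have "finite (keys x)" "keys x <= paths Q" using assms by (auto simp: kQ_iff)
 then obtain \<theta> where "\<theta> : reductions Q S \<phi>" "NF x = \<theta> x" by (rule NF_reduction) blast
 thus ?thesis using reduction_diff_I[OF _ assms] by simp
qed

lemma irr_span_carrier: "x : path_span (irr Q S) ==> x : cQ" using irr_sub by (auto simp: path_span_def kQ_iff)

lemma nf_proj: assumes "x : cQ" shows "nf (proj x) = NF x" unfolding nf_def proof (rule the_equality)
 have "NF x = - (x - NF x) + x" by simp
 hence "NF x : proj x" unfolding proj_def a_r_coset_def' using I_subD(4)[OF NF_diff_I[OF assms]] by force
 thus "NF x : proj x & NF x : path_span (irr Q S)" using NF_irr[OF assms] by simp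
next
 fix y assume y: "y : proj x & y : path_span (irr Q S)"
 then obtain i where "i : I" "y = i + x" by (auto simp: proj_def a_r_coset_def')
 hence "NF y = NF x" using NF_add[of i x] assms by (simp add: NF_I I_subD(1))
 thus "y = NF x" using y by (simp add: NF_id)
qed

lemma nf_irr: "a : cA ==> nf a : path_span (irr Q S)" by (elim A_carrierE) (simp add: nf_proj NF_irr)

lemma nf_carrier: "a : cA ==> nf a : cQ" by (rule irr_span_carrier) (rule nf_irr)

lemma proj_nf: "a : cA ==> proj (nf a) = a" proof (elim A_carrierE)
 fix x assume x: "x : cQ" "a = proj x"
 have "nf a = NF x" using x by (simp add: nf_proj)
 moreover have "NF x : cQ" using x by (simp add: irr_span_carrier NF_irr)
 ultimately show "proj (nf a) = a" using x NF_diff_I[of x] proj_eq_iff[of x "NF x"] by metis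
qed

lemma nf_add: "[| a : cA; b : cA |] ==> nf (a +[A] b) = nf a + nf b"
 by (elim A_carrierE) (simp add: proj_add[symmetric] nf_proj NF_add carrier_subD(3))

lemma nf_id: "x : path_span (irr Q S) ==> nf (proj x) = x" by (simp add: nf_proj irr_span_carrier NF_id)

lemma nf_K:
 assumes "z : K" "a : cA" shows "nf (proj z ** a) = pmult Q z (nf a)" proof -
 have "proj z ** a = proj (pmult Q z (nf a))" using assms by (simp add: proj_mult K_carrier nf_carrier proj_nf)
 thus ?thesis using K_mult_span(1)[OF irr_sub assms(1) nf_irr[OF assms(2)]] by (simp add: nf_id)
qed

lemma lookup_K_mult:
 assumes "z : K" "x : cQ"
 shows "lookup (pmult Q z x) u = lookup z (vtx (src u)) * lookup x u" using assms(2)[unfolded kQ_iff]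
 by (induction rule: pm_induct)
  (auto simp: K_mult_single[OF assms(1)] lookup_single when_def pmult_add_right lookup_add algebra_simps)

lemma keys_NF:
 assumes "x : cQ" "u : keys (NF x)"
 shows "\<exists>p\<in>keys x. (u, p) : below\<^sup>=" proof -
 have "finite (keys x)" "keys x <= paths Q" using assms by (auto simp: kQ_iff)
 then obtain \<theta> where "\<theta> : reductions Q S \<phi>" "NF x = \<theta> x" by (rule NF_reduction) blast
 thus ?thesis using keys_reductions assms(2) by metis
qed

lemma nf_pi_below:
 assumes "p : paths Q" "u : keys (nf (pi p))"
 shows "u : irr Q S" "(u, p) : below\<^sup>=" "p ~: irr Q S ==> (u, p) : below" proof -
 have n: "nf (pi p) = NF (ppath p)" using assms(1) by (simp add: nf_proj single_carrier)
 show 1: "u : irr Q S" using nf_irr[OF pi_in[OF assms(1)]] assms(2) by (auto simp: path_span_def)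
 show 2: "(u, p) : below\<^sup>=" using keys_NF[OF single_carrier[OF assms(1), of 1], of u] assms(2) by (simp add: n)
 show "(u, p) : below" if "p ~: irr Q S" using 1 2 that by auto
qed

end

section \<open>Bimodules and the maps between them\<close>

lemma
 assumes "carrier G = carrier H" "add G = add H" "ring.zero G = ring.zero H"
 shows abelian_group_same: "abelian_group H ==> abelian_group G" and finsum_same: "finsum G f B = finsum H f B"
  and a_inv_same: "\<ominus>\<^bsub>G\<^esub> x = \<ominus>\<^bsub>H\<^esub> x"
  and int_mult_same: "[(k::int)] \<cdot>\<^bsub>G\<^esub> x = [k] \<cdot>\<^bsub>H\<^esub> x" proof -
 show "abelian_group G" if "abelian_group H"
  by (rule abelian_groupI) (use abelian_groupE[OF that] in \<open>simp_all add: assms\<close>)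
 show "finsum G f B = finsum H f B" by (simp add: finsum_def finprod_def assms)
 show i: "\<ominus>\<^bsub>G\<^esub> x = \<ominus>\<^bsub>H\<^esub> x" for x by (simp add: a_inv_def m_inv_def assms)
 show "[(k::int)] \<cdot>\<^bsub>G\<^esub> x = [k] \<cdot>\<^bsub>H\<^esub> x" proof -
  have "[(n::nat)] \<cdot>\<^bsub>G\<^esub> x = [n] \<cdot>\<^bsub>H\<^esub> x" for n by (simp add: add_pow_def nat_pow_def assms)
  thus ?thesis by (cases "k \<ge> 0") (simp_all add: add_pow_int_ge add_pow_int_lt i)
 qed
qed

lemma tuples_snoc [simp]: "us @ [x] : tuples (Us @ [M]) \<longleftrightarrow> us : tuples Us & x : carrier M"
 using list_all2_rev[of "%x M. x : carrier M" "us @ [x]" "Us @ [M]"]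
  list_all2_rev[of "%x M. x : carrier M" us Us] by (auto simp: tuples_iff)

lemma bal_cong:
 assumes "!!xs. xs : tuples Ms ==> g xs = g' xs" "\<forall>M\<in>set Ms. factor K M"
  "balanced K Ms H g"
 shows "balanced K Ms H g'" proof (rule balancedI)
 fix xs assume "xs : tuples Ms"
 from assms(1)[OF this] bal_in[OF assms(3) this] show "g' xs : carrier H" by simp
next
 fix Us M Vs us x y vs
 assume a: "Ms = Us @ M # Vs" "us : tuples Us" "vs : tuples Vs" "x : carrier M" "y : carrier M"
 have "abelian_group M" using assms(2) a(1) by (simp add: factor_def)
 hence "x +[M] y : carrier M" using a by (simp add: abelian_groupE)
 hence "us @ x # vs : tuples Ms" "us @ y # vs : tuples Ms" "us @ (x +[M] y) # vs : tuples Ms" using a by auto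
 thus "g' (us @ (x +[M] y) # vs) = g' (us @ x # vs) +[H] g' (us @ y # vs)"
  using bal_add[OF assms(3)[unfolded a(1)] a(2-5)] assms(1) by simp
next
 fix Us M N Vs us x y vs z
 assume a: "Ms = Us @ M # N # Vs" "us : tuples Us" "vs : tuples Vs" "x : carrier M" "y : carrier N"
  "z : K"
 hence "ract M x z : carrier M" "lact N z y : carrier N"
  using assms(2) by (auto simp: factor_def ahom_in[of "lact N z"] ahom_in[of "%x. ract M x z"])
 hence "us @ ract M x z # y # vs : tuples Ms" "us @ x # lact N z y # vs : tuples Ms" using a by auto
 thus "g' (us @ ract M x z # y # vs) = g' (us @ x # lact N z y # vs)"
  using bal_act[OF assms(3)[unfolded a(1)] a(2-6)] assms(1) by simp
qed

lemma bal_head: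
 assumes "balanced K (M # Ms) H g" "f : ahom M M"
  "!!x z. [| x : carrier M; z : K |] ==> f (ract M x z) = ract M (f x) z"
 shows "balanced K (M # Ms) H (%xs. g (f (hd xs) # tl xs))" proof (rule balancedI)
 have fc: "f u : carrier M" if "u : carrier M" for u using ahom_in[OF assms(2) that] .
 {
  fix xs assume "xs : tuples (M # Ms)"
  then obtain y ys where "xs = y # ys" "y : carrier M" "ys : tuples Ms" by (rule tuples_ConsE)
  thus "g (f (hd xs) # tl xs) : carrier H" using bal_in[OF assms(1), of "f y # ys"] fc by simp
 next
  fix Us N Vs us x y vs
  assume a: "M # Ms = Us @ N # Vs" "us : tuples Us" "vs : tuples Vs" "x : carrier N" "y : carrier N"
  show "g (f (hd (us @ (x +[N] y) # vs)) # tl (us @ (x +[N] y) # vs)) =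
  g (f (hd (us @ x # vs)) # tl (us @ x # vs)) +[H] g (f (hd (us @ y # vs)) # tl (us @ y # vs))" proof (cases Us)
  case Nil
  hence "N = M" "Vs = Ms" "us = []" using a by auto
  thus ?thesis using a bal_add[of K "[]" M Ms H g "[]" vs "f x" "f y"] assms(1) fc ahom_add[OF assms(2), of x y]
  by simp
  next
  case (Cons U Us')
  hence U: "U = M" "Ms = Us' @ N # Vs" using a(1) by auto
  obtain u us' where "us = u # us'" "u : carrier M" "us' : tuples Us'"
  using a(2) unfolding Cons U by (rule tuples_ConsE)
  thus ?thesis using a(3-5) bal_add[of K "M # Us'" N Vs H g "f u # us'" vs x y] assms(1) fc U by simp
  qed
 next
  fix Us N N' Vs us x y vs z
  assume a: "M # Ms = Us @ N # N' # Vs" "us : tuples Us" "vs : tuples Vs" "x : carrier N"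
  "y : carrier N'" "z : K"
  show "g (f (hd (us @ ract N x z # y # vs)) # tl (us @ ract N x z # y # vs)) =
  g (f (hd (us @ x # lact N' z y # vs)) # tl (us @ x # lact N' z y # vs))" proof (cases Us)
  case Nil
  hence "N = M" "Ms = N' # Vs" "us = []" using a by auto
  thus ?thesis using a bal_act[of K "[]" M N' Vs H g "[]" vs "f x" y z] assms(1) fc assms(3)[of x z] by simp
  next
  case (Cons U Us')
  hence U: "U = M" "Ms = Us' @ N # N' # Vs" using a(1) by auto
  obtain u us' where "us = u # us'" "u : carrier M" "us' : tuples Us'"
  using a(2) unfolding Cons U by (rule tuples_ConsE)
  thus ?thesis using a(3-6) bal_act[of K "M # Us'" N N' Vs H g "f u # us'" vs x y z] assms(1) fc U by simp
  qed
 }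
qed

lemma bal_append:
 assumes "balanced K (Ms @ Ns) H g" "ys : tuples Ns"
 shows "balanced K Ms H (%xs. g (xs @ ys))" proof (rule balancedI)
 show "g (xs @ ys) : carrier H" if "xs : tuples Ms" for xs using bal_in[OF assms(1)] that assms(2) by blast
 show "g ((us @ (x +[M] y) # vs) @ ys) = g ((us @ x # vs) @ ys) +[H] g ((us @ y # vs) @ ys)"
  if "Ms = Us @ M # Vs" "us : tuples Us" "vs : tuples Vs" "x : carrier M" "y : carrier M" for Us M Vs us x y vs
  using bal_add[of K Us M "Vs @ Ns" H g us "vs @ ys" x y] assms that by auto
 show "g ((us @ ract M x z # y # vs) @ ys) = g ((us @ x # lact N z y # vs) @ ys)"
  if "Ms = Us @ M # N # Vs" "us : tuples Us" "vs : tuples Vs" "x : carrier M" "y : carrier N" "z : K"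
  for Us M N Vs us x y vs z using bal_act[of K Us M N "Vs @ Ns" H g us "vs @ ys" x y z] assms that by auto
qed

text \<open>
 Peeling off the last factor leaves the conditions on the shorter tuple and a single new junction, so
 balancedness can be checked factor by factor.
\<close>
lemma bal_snocI:
 assumes ini: "!!y. y : carrier M ==> balanced K Ms H (%us. g (us @ [y]))"
  and add: "!!us x y. [| us : tuples Ms; x : carrier M; y : carrier M |] ==> g (us @ [x +[M] y]) = g (us @ [x]) +[H] g (us @ [y])"
  and act: "!!Us L us x y z. [| Ms = Us @ [L]; us : tuples Us; x : carrier L; y : carrier M; z : K |] ==>
  g (us @ [ract L x z, y]) = g (us @ [x, lact M z y])"
 shows "balanced K (Ms @ [M]) H g" proof (rule balancedI)
 show "g xs : carrier H" if "xs : tuples (Ms @ [M])" for xs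
  using that bal_in[OF ini] by (elim tuples_appendE tuples_ConsE) simp
next
 fix Us L Vs us x y vs
 assume a: "Ms @ [M] = Us @ L # Vs" "us : tuples Us" "vs : tuples Vs" "x : carrier L" "y : carrier L"
 show "g (us @ (x +[L] y) # vs) = g (us @ x # vs) +[H] g (us @ y # vs)" proof (cases Vs rule: rev_cases)
  case (snoc Vs' V)
  hence V: "V = M" "Ms = Us @ L # Vs'" using a(1) by auto
  obtain vs' v where v: "vs = vs' @ [v]" "v : carrier M" "vs' : tuples Vs'"
  using a(3) unfolding snoc V by (elim tuples_appendE tuples_ConsE) simp
  show ?thesis using bal_add[OF ini[OF v(2), unfolded V] a(2) v(3) a(4,5)] v(1) by simp
 qed (use a add in simp)
next
 fix Us L L' Vs us x y vs z
 assume a: "Ms @ [M] = Us @ L # L' # Vs" "us : tuples Us" "vs : tuples Vs" "x : carrier L" "y : carrier L'" "z : K"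
 show "g (us @ ract L x z # y # vs) = g (us @ x # lact L' z y # vs)" proof (cases Vs rule: rev_cases)
  case (snoc Vs' V)
  hence V: "V = M" "Ms = Us @ L # L' # Vs'" using a(1) by auto
  obtain vs' v where v: "vs = vs' @ [v]" "v : carrier M" "vs' : tuples Vs'"
  using a(3) unfolding snoc V by (elim tuples_appendE tuples_ConsE) simp
  show ?thesis using bal_act[OF ini[OF v(2), unfolded V] a(2) v(3) a(4-6)] v(1) by simp
 qed (use a act in simp)
qed

lemma bal_last:
 assumes hom: "f : ahom M N" and act: "!!x z. [| x : carrier M; z : K |] ==> f (lact M z x) = lact N z (f x)"
  and bal: "balanced K (Ms @ [N]) H g"
 shows "balanced K (Ms @ [M]) H (%xs. g (butlast xs @ [f (last xs)]))" proof (rule bal_snocI)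
 note fc = ahom_in[OF hom]
 show "balanced K Ms H (%us. g (butlast (us @ [y]) @ [f (last (us @ [y]))]))" if "y : carrier M" for y
  using bal_append[OF bal, of "[f y]"] fc that by simp
 show "g (butlast (us @ [x +[M] y]) @ [f (last (us @ [x +[M] y]))]) = g (butlast (us @ [x]) @ [f (last (us @ [x]))]) +[H]
  g (butlast (us @ [y]) @ [f (last (us @ [y]))])" if "us : tuples Ms" "x : carrier M" "y : carrier M" for us x y
  using bal_add[OF bal that(1), of "[]" "f x" "f y"] fc ahom_add[OF hom] that by simp
 show "g (butlast (us @ [ract L x z, y]) @ [f (last (us @ [ract L x z, y]))]) =
  g (butlast (us @ [x, lact M z y]) @ [f (last (us @ [x, lact M z y]))])"
  if "Ms = Us @ [L]" "us : tuples Us" "x : carrier L" "y : carrier M" "z : K" for Us L us x y z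
  using bal_act[of K Us L N "[]" H g us "[]" x "f y" z] bal fc act that by (simp add: butlast_append)
qed

context confluent_presentation
begin

definition bim :: "(('v, 'e, 'k) pathalg set, 'm) bimodule => bool" where
 "bim M \<longleftrightarrow> abelian_group M & (\<forall>a\<in>cA. lact M a : ahom M M & (%x. ract M x a) : ahom M M) & (\<forall>x\<in>carrier M. lact M \<one>[A] x = x & ract M x \<one>[A] = x & (\<forall>c. lact M (kk c) x = ract M x (kk c)) & (\<forall>a\<in>cA. \<forall>b\<in>cA.
  lact M a (lact M b x) = lact M (a ** b) x & ract M (ract M x a) b = ract M x (a ** b) & lact M a (ract M x b) = ract M (lact M a x) b & lact M (a +[A] b) x = lact M a x +[M] lact M b x & ract M x (a +[A] b) = ract M x a +[M] ract M x b))"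

lemma bimD:
 assumes "bim M"
 shows "abelian_group M"
  "a : cA ==> lact M a : ahom M M"
  "a : cA ==> (%x. ract M x a) : ahom M M"
  "x : carrier M ==> lact M \<one>[A] x = x"
  "x : carrier M ==> ract M x \<one>[A] = x"
  "x : carrier M ==> lact M (kk c) x = ract M x (kk c)"
  "[| x : carrier M; a : cA; b : cA |] ==> lact M a (lact M b x) = lact M (a ** b) x"
  "[| x : carrier M; a : cA; b : cA |] ==> ract M (ract M x a) b = ract M x (a ** b)"
  "[| x : carrier M; a : cA; b : cA |] ==> lact M a (ract M x b) = ract M (lact M a x) b"
  "[| x : carrier M; a : cA; b : cA |] ==> lact M (a +[A] b) x = lact M a x +[M] lact M b x"
  "[| x : carrier M; a : cA; b : cA |] ==> ract M x (a +[A] b) = ract M x a +[M] ract M x b"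
  "[| x : carrier M; a : cA |] ==> lact M a x : carrier M"
  "[| x : carrier M; a : cA |] ==> ract M x a : carrier M"
 using assms unfolding bim_def by (blast intro: ahom_in dest: ahom_in)+

text \<open>
 All the contracting homotopies are left module maps which on the right are only linear over the
 vertices; this much is needed to extend them to bimodule maps.
\<close>

definition lhom :: "(('v, 'e, 'k) pathalg set, 'm) bimodule => (('v, 'e, 'k) pathalg set, 'n) bimodule \<Rightarrow>
  ('m => 'n) set" where
 "lhom M N = {f\<in>ahom M N. \<forall>x\<in>carrier M.
  (\<forall>a\<in>cA. f (lact M a x) = lact N a (f x)) & (\<forall>z\<in>K. f (ract M x (proj z)) = ract N (f x) (proj z))}"

abbreviation bhom where "bhom M N \<equiv> bimodule_hom A M N"

lemma lhomI:
 assumes "f : ahom M N" "!!a x. [| a : cA; x : carrier M |] ==> f (lact M a x) = lact N a (f x)"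
  "!!z x. [| z : K; x : carrier M |] ==> f (ract M x (proj z)) = ract N (f x) (proj z)"
 shows "f : lhom M N" using assms unfolding lhom_def by blast

lemma lhomD:
 assumes "f : lhom M N"
 shows "f : ahom M N" "[| a : cA; x : carrier M |] ==> f (lact M a x) = lact N a (f x)"
  "[| z : K; x : carrier M |] ==> f (ract M x (proj z)) = ract N (f x) (proj z)"
  "x : carrier M ==> f x : carrier N" using assms unfolding lhom_def by (auto dest: ahom_in)

lemma bhomI:
 assumes "f : ahom M N" "!!a x. [| a : cA; x : carrier M |] ==> f (lact M a x) = lact N a (f x)"
  "!!a x. [| a : cA; x : carrier M |] ==> f (ract M x a) = ract N (f x) a"
 shows "f : bhom M N" using assms unfolding bimodule_hom_def ahom_def by blast

lemma bhomD:
 assumes "f : bhom M N"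
 shows "f : ahom M N" "[| a : cA; x : carrier M |] ==> f (lact M a x) = lact N a (f x)"
  "[| a : cA; x : carrier M |] ==> f (ract M x a) = ract N (f x) a"
  "x : carrier M ==> f x : carrier N" "f : lhom M N"
 using assms unfolding bimodule_hom_def ahom_def lhom_def by (auto simp: proj_K_in)

lemma lhom_comp: "[| g : lhom M N; f : lhom L M |] ==> (%x. g (f x)) : lhom L N"
 by (rule lhomI) (simp_all add: lhomD ahom_comp[OF lhomD(1) lhomD(1)])

lemma bhom_comp: "[| g : bhom M N; f : bhom L M |] ==> (%x. g (f x)) : bhom L N"
 by (rule bhomI) (simp_all add: bhomD ahom_comp[OF bhomD(1) bhomD(1)])

lemma act_minus:
 assumes "bim M" "a : cA" "x : carrier M" "y : carrier M"
 shows "lact M a (x -[M] y) = lact M a x -[M] lact M a y"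
  "ract M (x -[M] y) a = ract M x a -[M] ract M y a"
 using ahom_minus[OF bimD(1) bimD(1) bimD(2), OF assms(1,1,1,2,3,4)]
  ahom_minus[OF bimD(1) bimD(1) bimD(3), OF assms(1,1,1,2,3,4)] by simp_all

lemma lhom_minus:
 assumes "bim M" "bim N" "f : lhom M N" "g : lhom M N"
 shows "(%x. f x -[N] g x) : lhom M N" proof (rule lhomI)
 show "(%x. f x -[N] g x) : ahom M N" using assms by (intro ahom_minus_fun bimD lhomD)
 fix x assume x: "x : carrier M"
 show "f (lact M a x) -[N] g (lact M a x) = lact N a (f x -[N] g x)" if "a : cA" for a
  using assms x that by (simp add: lhomD act_minus)
 show "f (ract M x (proj z)) -[N] g (ract M x (proj z)) = ract N (f x -[N] g x) (proj z)" if "z : K" for z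
  using assms x that by (simp add: lhomD act_minus proj_K_in)
qed

lemma lhom_id: "(%x. x) : lhom M M" by (rule lhomI) (auto simp: ahom_id)

lemma lact_sum:
 assumes "bim M" "a : cA" "!!i. i : B ==> f i : carrier M"
 shows "lact M a (\<Oplus>\<^bsub>M\<^esub>i\<in>B. f i) = (\<Oplus>\<^bsub>M\<^esub>i\<in>B. lact M a (f i))"
 using assms by (intro ahom_finsum bimD)

lemma ract_sum:
 assumes "bim M" "a : cA" "!!i. i : B ==> f i : carrier M"
 shows "ract M (\<Oplus>\<^bsub>M\<^esub>i\<in>B. f i) a = (\<Oplus>\<^bsub>M\<^esub>i\<in>B. ract M (f i) a)"
 using assms by (intro ahom_finsum[OF _ _ bimD(3)[OF assms(1,2)]] bimD)

lemma act_zero: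
 assumes "bim M" "a : cA"
 shows "lact M a \<zero>[M] = \<zero>[M]" "ract M \<zero>[M] a = \<zero>[M]"
 using assms ahom_zero[OF bimD(1) bimD(1) bimD(2)] ahom_zero[OF bimD(1) bimD(1) bimD(3)] by blast+

lemmas grA = A.is_abelian_group and A_one = A.one_closed

lemma zero_act:
 assumes "bim M" "x : carrier M"
 shows "lact M \<zero>[A] x = \<zero>[M]" "ract M x \<zero>[A] = \<zero>[M]" proof -
 interpret M: abelian_group M using assms(1) by (rule bimD)
 have "(%a. lact M a x) : ahom A M" "(%a. ract M x a) : ahom A M" using assms by (auto intro!: ahomI simp: bimD)
 thus "lact M \<zero>[A] x = \<zero>[M]" "ract M x \<zero>[A] = \<zero>[M]"
  using ahom_zero[OF grA M.abelian_group_axioms] by blast+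
qed

text \<open>Elements supported between two vertices, the images of paths under bimodule maps\<close>

definition between :: "(('v, 'e, 'k) pathalg set, 'm) bimodule => 'v => 'v => 'm set" where
 "between M u v = {x\<in>carrier M. lact M (pi (vtx u)) x = x & ract M x (pi (vtx v)) = x}"

lemma between_K:
 assumes "bim M" "x : between M u v" "u : verts Q" "v : verts Q" "z : K"
 shows "lact M (proj z) x = lact M (kk (lookup z (vtx u))) x"
  "ract M x (proj z) = lact M (kk (lookup z (vtx v))) x" proof -
 have x: "x : carrier M" "lact M (pi (vtx u)) x = x" "ract M x (pi (vtx v)) = x"
  using assms(2) by (auto simp: between_def)
 have c: "pi (vtx u) : cA" "pi (vtx v) : cA" using assms by (auto intro!: pi_in vtx_path)
 have "lact M (proj z) x = lact M (proj z ** pi (vtx u)) x" using x c assms by (metis bimD(7) proj_K_in)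
 also have "\<dots> = lact M (kk (lookup z (vtx u))) x"
  using x c assms K_mult_pi(1)[OF assms(5) vtx_path, of u] by (simp add: bimD(7)[symmetric] src_def)
 finally show "lact M (proj z) x = lact M (kk (lookup z (vtx u))) x" .
 have "ract M x (proj z) = ract M x (pi (vtx v) ** proj z)" using x c assms by (metis bimD(8) proj_K_in)
 also have "\<dots> = ract M x (pi (vtx v) ** kk (lookup z (vtx v)))"
  using c K_mult_pi(2)[OF assms(5) vtx_path[OF assms(4)]] by (simp add: kk_central)
 also have "\<dots> = lact M (kk (lookup z (vtx v))) x" using x c assms by (simp add: bimD(8)[symmetric] bimD(6))
 finally show "ract M x (proj z) = lact M (kk (lookup z (vtx v))) x" .
qed

lemma between_sum:
 assumes "bim M" "u : verts Q" "v : verts Q" "!!i. i : B ==> f i : between M u v"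
 shows "(\<Oplus>\<^bsub>M\<^esub>i\<in>B. f i) : between M u v" proof -
 interpret M: abelian_group M using assms(1) by (rule bimD)
 have f: "f i : carrier M" if "i : B" for i using assms(4)[OF that] by (simp add: between_def)
 thus ?thesis using assms(4) unfolding between_def mem_Collect_eq
  by (subst lact_sum[OF assms(1)], auto simp: pi_in vtx_path assms(2,3) ract_sum[OF assms(1)]
  intro!: M.finsum_closed M.finsum_cong')
qed

lemma between_minus:
 assumes "bim M" "u : verts Q" "v : verts Q" "x : between M u v" "y : between M u v"
 shows "x -[M] y : between M u v" proof -
 interpret M: abelian_group M using assms(1) by (rule bimD)
 show ?thesis using assms by (simp add: between_def pi_in vtx_path act_minus)
qed

lemma between_lhom:
 assumes "f : lhom M N" "x : between M u v" "u : verts Q" "v : verts Q"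
 shows "f x : between N u v" proof -
 have "ppath (vtx v) : K" using assms(4) by (auto simp: path_span_def trivial_iff)
 moreover have x: "x : carrier M" "lact M (pi (vtx u)) x = x" "ract M x (pi (vtx v)) = x"
  using assms(2) by (simp_all add: between_def)
 ultimately have "ract N (f x) (pi (vtx v)) = f x" using lhomD(3)[OF assms(1), of "ppath (vtx v)" x] by simp
 moreover have "lact N (pi (vtx u)) (f x) = f x"
  using lhomD(2)[OF assms(1), of "pi (vtx u)" x] x assms(3) by (simp add: pi_in vtx_path)
 ultimately show ?thesis using lhomD(4)[OF assms(1) x(1)] by (simp add: between_def)
qed

subsection \<open>Tensor products whose outer factors are the algebra\<close>

definition central :: "(('v, 'e, 'k) pathalg, ('v, 'e, 'k) pathalg set) bimodule => bool" where
 "central M \<longleftrightarrow> (\<forall>x\<in>carrier M. \<forall>c. lact M (scalar Q c) x = ract M x (scalar Q c))"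

lemma fac_A_central: "central fac_A" unfolding central_def fac_A_def using sq_central[OF carrier_sub I_sub] by blast

lemma fac_Abar_central: "central fac_Abar"
 unfolding central_def fac_Abar_def using sq_central[OF carrier_sub bar_null_sub] by blast

context
 fixes Mid :: "(('v, 'e, 'k) pathalg, ('v, 'e, 'k) pathalg set) bimodule list"
 assumes Mid: "\<forall>M\<in>set Mid. factor K M & central M"
begin

abbreviation (input) "TMs \<equiv> fac_A # Mid @ [fac_A]"
abbreviation (input) "TT \<equiv> tensor K TMs"
abbreviation (input) "BT \<equiv> bimodule_tensor A K TMs"

lemma TMs_factor: "\<forall>M\<in>set TMs. factor K M" using fac_A_factor Mid by auto

lemmas TT_group = abelian_group_tensor[OF TMs_factor]

lemma BT_simps [simp]: "carrier BT = carrier TT" "add BT = add TT" "ring.zero BT = ring.zero TT"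
 by (simp_all add: bimodule_tensor_def ring.defs)

lemma BT_lact: "lact BT a = tensor_lift TT (%xs. pure_tensor K TMs (xs[0 := a ** hd xs]))"
 by (simp add: bimodule_tensor_def ring.defs)

lemma BT_ract: "ract BT X b = tensor_lift TT (%xs. pure_tensor K TMs (xs[length xs - 1 := last xs ** b])) X"
 by (simp add: bimodule_tensor_def ring.defs)

lemma BT_group: "abelian_group BT" by (rule abelian_group_same[OF _ _ _ TT_group]) simp_all

lemma TT_pure: "balanced K TMs TT (pure_tensor K TMs)" by (rule bal_pure[OF TMs_factor])

lemma fac_A_mult_hom:
 assumes "a : cA"
 shows "(%x. a ** x) : ahom fac_A fac_A" "(%x. x ** a) : ahom fac_A fac_A"
 using assms by (auto intro!: ahomI simp: car_A A_add A.r_distr A.l_distr)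

lemma update_last: "xs ~= [] ==> xs[length xs - 1 := x] = butlast xs @ [x]" by (cases xs rule: rev_cases) auto

lemma tuplesE_TMs:
 assumes "xs : tuples TMs"
 obtains a ms b where "xs = a # ms @ [b]" "a : cA" "ms : tuples Mid" "b : cA"
 using assms by (auto elim!: tuples_ConsE tuples_appendE simp: car_A)

lemma BT_lact_bal:
 assumes "a : cA"
 shows "balanced K TMs TT (%xs. pure_tensor K TMs (xs[0 := a ** hd xs]))" proof (rule bal_cong[OF _ TMs_factor])
 show "balanced K TMs TT (%xs. pure_tensor K TMs ((a ** hd xs) # tl xs))" using assms fac_A_mult_hom(1) TT_pure
  by (intro bal_head) (auto simp: car_A A_ract A.m_assoc proj_K_in)
qed (auto elim!: tuples_ConsE)

lemma BT_ract_bal: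
 assumes "a : cA"
 shows "balanced K TMs TT (%xs. pure_tensor K TMs (xs[length xs - 1 := last xs ** a]))"
proof (rule bal_cong[OF _ TMs_factor])
 show "balanced K TMs TT (%xs. pure_tensor K TMs (butlast xs @ [last xs ** a]))"
  using bal_last[of "%x. x ** a" fac_A fac_A K "fac_A # Mid" TT "pure_tensor K TMs"] TT_pure
  fac_A_mult_hom(2)[OF assms] assms by (auto simp: car_A A_lact A.m_assoc proj_K_in)
 show "pure_tensor K TMs (butlast xs @ [last xs ** a]) =
  pure_tensor K TMs (xs[length xs - 1 := last xs ** a])" if "xs : tuples TMs" for xs
  using that by (subst update_last) (auto elim!: tuples_ConsE)
qed

lemma BT_lact_pure:
 assumes "a : cA" "x # xs : tuples TMs"
 shows "lact BT a (pure_tensor K TMs (x # xs)) = pure_tensor K TMs ((a ** x) # xs)"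
 unfolding BT_lact using tensor_lift_pure[OF TMs_factor TT_group BT_lact_bal[OF assms(1)] assms(2)] by simp

lemma BT_ract_pure:
 assumes "a : cA" "xs @ [x] : tuples TMs"
 shows "ract BT (pure_tensor K TMs (xs @ [x])) a = pure_tensor K TMs (xs @ [x ** a])"
 unfolding BT_ract using tensor_lift_pure[OF TMs_factor TT_group BT_ract_bal[OF assms(1)] assms(2)] by simp

lemma BT_lact_hom: "a : cA ==> lact BT a : ahom TT TT"
 unfolding BT_lact by (rule tensor_lift_addhom[OF TMs_factor TT_group BT_lact_bal])

lemma BT_ract_hom: "a : cA ==> (%X. ract BT X a) : ahom TT TT"
 unfolding BT_ract by (rule tensor_lift_addhom[OF TMs_factor TT_group BT_ract_bal])

lemma pure_move_scalar:
 assumes "Ms = Us @ M # Vs" "us : tuples Us" "x : carrier M" "vs : tuples Vs"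
  "\<forall>M\<in>set Ms. factor K M" "!!N. N : set (M # Vs) ==> central N" "c' = scalar Q c"
 shows "pure_tensor K Ms (us @ lact M c' x # vs) =
  pure_tensor K Ms (butlast (us @ x # vs) @ [ract (last Ms) (last (x # vs)) c'])" using assms(1-4,6)
proof (induction Vs arbitrary: Us M us x vs)
 case Nil
 thus ?case by (simp add: central_def assms(7))
next
 case (Cons N Vs)
 then obtain y vs' where vs: "vs = y # vs'" "y : carrier N" "vs' : tuples Vs" by (auto elim!: tuples_ConsE)
 have "pure_tensor K Ms (us @ lact M c' x # vs) = pure_tensor K Ms (us @ ract M x c' # y # vs')"
  using Cons.prems vs by (simp add: central_def assms(7))
 also have "\<dots> = pure_tensor K Ms (us @ x # lact N c' y # vs')" using Cons.prems vs
  bal_act[OF bal_pure[OF assms(5), unfolded Cons.prems(1)], of us vs' x y c'] by (simp add: assms(7) scalar_K)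
 also have "\<dots> = pure_tensor K Ms (butlast (us @ x # vs) @ [ract (last Ms) (last (x # vs)) c'])"
  using Cons.IH[of "Us @ [M]" N "us @ [x]" y vs'] Cons.prems vs by (auto simp: butlast_append)
 finally show ?case .
qed

lemma bim_BT: "bim BT" proof -
 interpret T: abelian_group TT by (rule TT_group)
 note eq = ahom_tensor_eq[OF TMs_factor TT_group]
 have Lc: "lact BT a x : carrier TT" if "a : cA" "x : carrier TT" for a x using that ahom_in[OF BT_lact_hom] by blast
 have Rc: "ract BT x a : carrier TT" if "a : cA" "x : carrier TT" for a x using that ahom_in[OF BT_ract_hom] by blast
 have pl: "lact BT a (pure_tensor K TMs (x # ms @ [y])) = pure_tensor K TMs ((a ** x) # ms @ [y])"
  "ract BT (pure_tensor K TMs (x # ms @ [y])) a = pure_tensor K TMs (x # ms @ [y ** a])"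
  if "a : cA" "x : cA" "y : cA" "ms : tuples Mid" for a x ms y
  using that BT_lact_pure[of a x "ms @ [y]"] BT_ract_pure[of a "x # ms" y] by (simp_all add: car_A)
 show ?thesis unfolding bim_def proof (intro conjI ballI allI)
  show "abelian_group BT" by (rule BT_group)
  show "lact BT a : ahom BT BT" "(%x. ract BT x a) : ahom BT BT" if "a : cA" for a
  using BT_lact_hom[OF that] BT_ract_hom[OF that] by (simp_all add: ahom_def)
  fix x assume "x : carrier BT"
  hence x: "x : carrier TT" by simp
  show "lact BT \<one>[A] x = x" by (rule eq[OF BT_lact_hom ahom_id _ x]) (auto simp: pl elim!: tuplesE_TMs)
  show "ract BT x \<one>[A] = x" by (rule eq[OF BT_ract_hom ahom_id _ x]) (auto simp: pl elim!: tuplesE_TMs)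
  show "lact BT (kk c) x = ract BT x (kk c)" for c proof (rule eq[OF BT_lact_hom BT_ract_hom _ x])
  fix xs assume "xs : tuples TMs"
  then obtain a ms b where s: "xs = a # ms @ [b]" "a : cA" "ms : tuples Mid" "b : cA" by (rule tuplesE_TMs)
  have "pure_tensor K TMs ([] @ lact fac_A (scalar Q c) a # ms @ [b]) =
  pure_tensor K TMs (butlast ([] @ a # ms @ [b]) @ [ract (last TMs) (last (a # ms @ [b])) (scalar Q c)])"
  by (rule pure_move_scalar[of _ _ fac_A "Mid @ [fac_A]"])
  (use s Mid fac_A_central TMs_factor in \<open>auto simp: car_A\<close>)
  thus "lact BT (kk c) (pure_tensor K TMs xs) = ract BT (pure_tensor K TMs xs) (kk c)"
  using s by (simp add: pl A_lact A_ract scalar_K butlast_append)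
  qed simp_all
  fix a b assume ab: "a : cA" "b : cA"
  show "lact BT a (lact BT b x) = lact BT (a ** b) x"
  by (rule eq[OF ahom_comp[OF BT_lact_hom BT_lact_hom] BT_lact_hom _ x])
  (use ab in \<open>auto simp: pl A.m_assoc elim!: tuplesE_TMs\<close>)
  show "ract BT (ract BT x a) b = ract BT x (a ** b)"
  by (rule eq[OF ahom_comp[OF BT_ract_hom BT_ract_hom] BT_ract_hom _ x])
  (use ab in \<open>auto simp: pl A.m_assoc elim!: tuplesE_TMs\<close>)
  show "lact BT a (ract BT x b) = ract BT (lact BT a x) b"
  by (rule eq[OF ahom_comp[OF BT_lact_hom BT_ract_hom] ahom_comp[OF BT_ract_hom BT_lact_hom] _ x])
  (use ab in \<open>auto simp: pl elim!: tuplesE_TMs\<close>)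
  have "lact BT (a +[A] b) x = lact BT a x +[TT] lact BT b x"
  proof (rule eq[OF BT_lact_hom ahom_plus_fun[OF TT_group TT_group BT_lact_hom BT_lact_hom] _ x])
  fix xs assume "xs : tuples TMs"
  then obtain u ms v where s: "xs = u # ms @ [v]" "u : cA" "ms : tuples Mid" "v : cA" by (rule tuplesE_TMs)
  thus "lact BT (a +[A] b) (pure_tensor K TMs xs) =
  lact BT a (pure_tensor K TMs xs) +[TT] lact BT b (pure_tensor K TMs xs)"
  using ab bal_add[of K "[]" fac_A "Mid @ [fac_A]" TT "pure_tensor K TMs" "[]" "ms @ [v]" "a ** u" "b ** u"]
  TT_pure by (auto simp: pl A.l_distr car_A A_add)
  qed (use ab in auto)
  thus "lact BT (a +[A] b) x = lact BT a x +[BT] lact BT b x" by simp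
  have "ract BT x (a +[A] b) = ract BT x a +[TT] ract BT x b"
  proof (rule eq[OF BT_ract_hom ahom_plus_fun[OF TT_group TT_group BT_ract_hom BT_ract_hom] _ x])
  fix xs assume "xs : tuples TMs"
  then obtain u ms v where s: "xs = u # ms @ [v]" "u : cA" "ms : tuples Mid" "v : cA" by (rule tuplesE_TMs)
  thus "ract BT (pure_tensor K TMs xs) (a +[A] b) =
  ract BT (pure_tensor K TMs xs) a +[TT] ract BT (pure_tensor K TMs xs) b"
  using ab bal_add[of K "fac_A # Mid" fac_A "[]" TT "pure_tensor K TMs" "u # ms" "[]" "v ** a" "v ** b"]
  TT_pure by (auto simp: pl A.r_distr car_A A_add)
  qed (use ab in auto)
  thus "ract BT x (a +[A] b) = ract BT x a +[BT] ract BT x b" by simp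
 qed
qed

end


section \<open>The modules of the resolution\<close>

abbreviation fS :: "nat => (('v, 'e, 'k) pathalg, ('v, 'e, 'k) pathalg set) bimodule" where
 "fS \<equiv> fac_S"

lemma pconcat_Cons: "pconcat (p # q # ps) = cat p (pconcat (q # ps))" by (simp add: pconcat_def src_def)

lemma pconcat_composable:
 "[| composable Q us; us ~= [] |] ==>
  pconcat us : paths Q & src (pconcat us) = src (hd us) & tgt Q (pconcat us) = tgt Q (last us)" proof (induction us)
 case (Cons p us)
 show ?case proof (cases us)
  case Nil
  thus ?thesis using Cons.prems by (simp add: pconcat_def src_def)
 next
  case us: (Cons q ps)
  thus ?thesis using Cons.IH Cons.prems cat_paths[of p "pconcat (q # ps)"] by (auto simp: pconcat_Cons)
 qed
qed simp

lemma ch_path: "w : chains n ==> w : paths Q"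
 using S_path(1) by (auto simp: chains_def trivial_paths_def pconcat_composable split: if_splits)

lemma chains_sub: "chains n <= paths Q" using ch_path by blast

lemma zero_cls: "{0} +>\<^bsub>kQ\<^esub> x = {x}" by (auto simp: a_r_coset_def')

lemmas sqS = sq_add[OF span_sub[OF chains_sub] zero_sub, folded fac_S_def, unfolded zero_cls]
 sq_zero[OF span_sub[OF chains_sub] zero_sub, folded fac_S_def, unfolded zero_cls]
 sq_lact[OF span_sub[OF chains_sub] zero_sub, folded fac_S_def, unfolded zero_cls]
 sq_ract[OF span_sub[OF chains_sub] zero_sub, folded fac_S_def, unfolded zero_cls]

lemma fac_S_carrier_eq: "carrier (fS n) = (%x. {x}) ` path_span (chains n)"
 using sq_carrier[OF span_sub[OF chains_sub] zero_sub] by (auto simp: fac_S_def zero_cls image_def)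

lemma fac_S_factor: "factor K (fS n)" unfolding fac_S_def by (rule sq_factor[OF span_sub[OF chains_sub] zero_sub])

lemma fac_S_central: "central (fS n)"
 unfolding central_def fac_S_def using sq_central[OF span_sub[OF chains_sub] zero_sub] by blast

lemma fac_S_carrier: "{x} : carrier (fS n) \<longleftrightarrow> x : path_span (chains n)"
 by (auto simp: fac_S_carrier_eq)

lemma P_mid: "\<forall>M\<in>set [fS n]. factor K M & central M" by (simp add: fac_S_factor fac_S_central)

lemma facs_P_eq: "facs_P n = fac_A # [fS n] @ [fac_A]" by (simp add: facs_P_def)

lemma bim_P: "bim (P n)" unfolding P_def facs_P_eq by (rule bim_BT[OF P_mid])

lemmas P_simps = BT_simps[OF P_mid, folded facs_P_eq P_def]
lemmas P_factor = TMs_factor[OF P_mid, folded facs_P_eq]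
lemmas grP = bimD(1)[OF bim_P]
lemmas P_lact = BT_lact_pure[OF P_mid, folded facs_P_eq P_def]
lemmas P_ract = BT_ract_pure[OF P_mid, folded facs_P_eq P_def]
lemmas Ppure_bal = TT_pure[OF P_mid, folded facs_P_eq]

lemma ahom_P: "ahom (P n) H = ahom (tensor K (facs_P n)) H" by (simp add: ahom_def P_simps)

lemma P_tuples: "[a, X, b] : tuples (facs_P n) \<longleftrightarrow> a : cA & X : carrier (fS n) & b : cA"
 by (simp add: facs_P_def car_A)

lemma P_tuplesE:
 assumes "xs : tuples (facs_P n)"
 obtains a x b where "xs = [a, {x}, b]" "a : cA" "x : path_span (chains n)" "b : cA"
 using assms unfolding facs_P_def by (elim tuples_ConsE) (auto simp: fac_S_carrier_eq car_A)

lemma pp_span: "w : T ==> single w c : path_span T" by (simp add: path_span_def)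

lemma Ppure_in:
 "[| a : cA; x : path_span (chains n); b : cA |] ==> Ppure n a x b : cP n" unfolding P_pure_def P_simps
 by (rule pure_in[OF P_factor]) (simp add: P_tuples fac_S_carrier)

context
 fixes n and a and x :: "('v, 'e, 'k) pathalg" and b
 assumes a: "a : cA" and x: "x : path_span (chains n)" and b: "b : cA"
begin

lemma Ppure_add:
 "a' : cA ==> Ppure n (a +[A] a') x b = Ppure n a x b +[P n] Ppure n a' x b"
 "x' : path_span (chains n) ==> Ppure n a (x + x') b = Ppure n a x b +[P n] Ppure n a x' b"
 "b' : cA ==> Ppure n a x (b +[A] b') = Ppure n a x b +[P n] Ppure n a x b'"
 using a x b Ppure_bal[of n, unfolded facs_P_def]
  bal_add[of K "[]" fac_A "[fS n, fac_A]" _ _ "[]" "[{x}, b]" a a']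
  bal_add[of K "[fac_A]" "fS n" "[fac_A]" _ _ "[a]" "[b]" "{x}" "{x'}"]
  bal_add[of K "[fac_A, fS n]" fac_A "[]" _ _ "[a, {x}]" "[]" b b']
 by (simp_all add: P_pure_def P_simps facs_P_def car_A A_add fac_S_carrier sqS(1))

lemma Ppure_K:
 "z : K ==> Ppure n (a ** proj z) x b = Ppure n a (pmult Q z x) b"
 "z : K ==> Ppure n a (pmult Q x z) b = Ppure n a x (proj z ** b)" using a x b Ppure_bal[of n, unfolded facs_P_def]
  bal_act[of K "[]" fac_A "fS n" "[fac_A]" _ _ "[]" "[b]" a "{x}" z]
  bal_act[of K "[fac_A]" "fS n" fac_A "[]" _ _ "[a]" "[]" "{x}" b z]
 by (simp_all add: P_pure_def facs_P_def car_A A_ract A_lact fac_S_carrier sqS)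

lemma Ppure_lact: "c : cA ==> lact (P n) c (Ppure n a x b) = Ppure n (c ** a) x b"
 using a x b P_lact[of c a "[{x}, b]" n] by (simp add: P_pure_def P_tuples fac_S_carrier)

lemma Ppure_ract: "c : cA ==> ract (P n) (Ppure n a x b) c = Ppure n a x (b ** c)"
 using a x b P_ract[of c "[a, {x}]" b n] by (simp add: P_pure_def P_tuples fac_S_carrier)

end

lemma span_single_mult:
 assumes "w : chains n"
 shows "single w (c::'k) = pmult Q (scalar Q c) (ppath w)" using ch_path[OF assms] by (simp add: scalar_mult_single)

lemma Ppure_single:
 assumes "a : cA" "b : cA" "w : chains n"
 shows "Ppure n a (single w c) b = Ppure n (kk c ** a) (ppath w) b" unfolding span_single_mult[OF assms(3), of c]
 using assms Ppure_K(1)[OF assms(1) pp_span[OF assms(3), of 1] assms(2) scalar_K[of c]] by (simp add: kk_central)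

lemma Ppure_zero:
 assumes "a : cA" "b : cA" "x : path_span (chains n)"
 shows "Ppure n \<zero>[A] x b = \<zero>[P n]" "Ppure n a x \<zero>[A] = \<zero>[P n]" "Ppure n a 0 b = \<zero>[P n]"
proof -
 show "Ppure n \<zero>[A] x b = \<zero>[P n]" using zero_act(1)[OF bim_P Ppure_in[OF A_one assms(3,2)]] assms
  by (simp add: Ppure_lact)
 show "Ppure n a x \<zero>[A] = \<zero>[P n]" using zero_act(2)[OF bim_P Ppure_in[OF assms(1,3) A_one]] assms
  by (simp add: Ppure_ract)
 interpret P: abelian_group "P n" by (rule grP)
 show "Ppure n a 0 b = \<zero>[P n]"
  using Ppure_add(2)[OF assms(1) span_zero assms(2) span_zero, of n] Ppure_in[OF assms(1) span_zero assms(2), of n]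
  by (simp add: P.add.l_cancel_one')
qed

lemma P_induct [consumes 1, case_names zero pure add neg]:
 assumes "X : cP n" "Pr \<zero>[P n]"
  and pure: "!!a w b. [| a : cA; w : chains n; b : cA |] ==> Pr (Ppure n a (ppath w) b)"
  and add: "!!X Y. [| X : cP n; Y : cP n; Pr X; Pr Y |] ==> Pr (X +[P n] Y)"
  and neg: "!!X. [| X : cP n; Pr X |] ==> Pr (\<ominus>\<^bsub>P n\<^esub> X)"
 shows "Pr X" proof -
 have p: "Pr (Ppure n a x b)" if "a : cA" "x : path_span (chains n)" "b : cA" for a x b
  using that(2)[unfolded path_span_def mem_Collect_eq] proof (induction rule: pm_induct)
  case zero
  thus ?case using that assms(2) by (simp add: Ppure_zero[of _ _ 0] span_zero)
 next
  case (single w c)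
  thus ?case using that by (subst Ppure_single) (simp_all add: pure)
 next
  case (add x y)
  thus ?case using that assms(4)[of "Ppure n a x b" "Ppure n a y b"] by (simp add: Ppure_add path_span_def Ppure_in)
 qed
 have n: "\<ominus>\<^bsub>P n\<^esub> X = \<ominus>\<^bsub>tensor K (facs_P n)\<^esub> X" for X
  by (rule a_inv_same) (simp_all add: P_simps)
 have "X : carrier (tensor K (facs_P n))" using assms(1) by (simp add: P_simps)
 thus ?thesis proof (induction rule: tensor_induct[OF P_factor, consumes 1, case_names zero pure add neg])
  case (pure xs)
  thus ?case using p by (auto elim!: P_tuplesE simp: P_pure_def)
 qed (use assms(2) add neg in \<open>auto simp: P_simps n\<close>)
qed

lemma P_hom_eq:
 assumes "abelian_group H" "f : ahom (P n) H" "g : ahom (P n) H" and "!!a w b. [| a : cA; w : chains n; b : cA |] ==>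
  f (Ppure n a (ppath w) b) = g (Ppure n a (ppath w) b)" and "X : cP n"
 shows "f X = g X" using assms(5) proof (induction rule: P_induct)
 case zero
 thus ?case using assms by (simp add: ahom_zero[OF grP])
next
 case (neg X)
 thus ?case using assms by (simp add: ahom_neg[OF grP])
qed (use assms in \<open>auto simp: ahom_add[of f] ahom_add[of g]\<close>)

subsection \<open>Maps out of the modules of the resolution\<close>

lemma three_split:
 "[p, q, r] = us @ x # vs ==> us = [] & x = p & vs = [q, r] \<or> us = [p] & x = q & vs = [r] \<or>
  us = [p, q] & x = r & vs = []" by (auto simp: Cons_eq_append_conv)

definition P_bal :: "nat => ('m, 'z) ring_scheme \<Rightarrow>
  (('v, 'e, 'k) pathalg set => ('v, 'e) path => ('v, 'e, 'k) pathalg set => 'm) => bool" where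
 "P_bal n H g \<longleftrightarrow> (\<forall>w\<in>chains n. \<forall>a\<in>cA. \<forall>b\<in>cA. g a w b : carrier H & (\<forall>a'\<in>cA. g (a +[A] a') w b = g a w b +[H] g a' w b) & (\<forall>b'\<in>cA. g a w (b +[A] b') = g a w b +[H] g a w b') & (\<forall>z\<in>K. g (a ** proj z) w b = g (kk (lookup z (vtx (src w))) ** a) w b & g a w (proj z ** b) = g (kk (lookup z (vtx (tgt Q w))) ** a) w b))"

lemma P_balI:
 assumes "!!a w b. [| a : cA; w : chains n; b : cA |] ==> g a w b : carrier H"
  and "!!a a' w b. [| a : cA; a' : cA; w : chains n; b : cA |] ==>
  g (a +[A] a') w b = g a w b +[H] g a' w b" and "!!a w b b'. [| a : cA; w : chains n; b : cA; b' : cA |] ==>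
  g a w (b +[A] b') = g a w b +[H] g a w b'" and "!!a w b z. [| a : cA; w : chains n; b : cA; z : K |] ==>
  g (a ** proj z) w b = g (kk (lookup z (vtx (src w))) ** a) w b"
  and "!!a w b z. [| a : cA; w : chains n; b : cA; z : K |] ==>
  g a w (proj z ** b) = g (kk (lookup z (vtx (tgt Q w))) ** a) w b"
 shows "P_bal n H g" unfolding P_bal_def using assms by (intro ballI conjI) assumption+

lemma lookup_mult_K:
 assumes "z : K" "x : cQ"
 shows "lookup (pmult Q x z) u = lookup x u * lookup z (vtx (tgt Q u))" using assms(2)[unfolded kQ_iff]
 by (induction rule: pm_induct)
  (auto simp: K_mult_single[OF assms(1)] lookup_single when_def pmult_add_left lookup_add algebra_simps)

context
 fixes n :: nat and H :: "('m, 'z) ring_scheme" and g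
 assumes H: "abelian_group H" and bal: "P_bal n H g"
begin

interpretation H: abelian_group H by (rule H)

definition "Pg a x b = (\<Oplus>\<^bsub>H\<^esub>w\<in>keys x. g (kk (lookup x w) ** a) w b)"

lemma balD:
 assumes "w : chains n" "a : cA" "b : cA"
 shows "g a w b : carrier H"
  "a' : cA ==> g (a +[A] a') w b = g a w b +[H] g a' w b"
  "b' : cA ==> g a w (b +[A] b') = g a w b +[H] g a w b'"
  "z : K ==> g (a ** proj z) w b = g (kk (lookup z (vtx (src w))) ** a) w b"
  "z : K ==> g a w (proj z ** b) = g (kk (lookup z (vtx (tgt Q w))) ** a) w b"
 using bal assms unfolding P_bal_def by blast+

lemma g_zero: assumes "w : chains n" "b : cA" shows "g \<zero>[A] w b = \<zero>[H]" proof -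
 have "(%a. g a w b) : ahom A H" using assms by (intro ahomI) (simp_all add: balD)
 from ahom_zero[OF grA H this] show ?thesis .
qed

lemma Pg_super:
 assumes "finite T" "keys x <= T" "T <= chains n" "a : cA" "b : cA"
 shows "Pg a x b = (\<Oplus>\<^bsub>H\<^esub>w\<in>T. g (kk (lookup x w) ** a) w b)" unfolding Pg_def
proof (rule H.add.finprod_mono_neutral_cong_left)
 fix w assume w: "w : T - keys x"
 hence "w : chains n" "kk (lookup x w) = \<zero>[A]" using assms(3) by (auto simp: kk_zero in_keys_iff)
 thus "g (kk (lookup x w) ** a) w b = \<zero>[H]" using assms g_zero by simp
qed (use assms in \<open>auto intro!: balD\<close>)

lemma Pg_in: "[| a : cA; x : path_span (chains n); b : cA |] ==> Pg a x b : carrier H"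
 unfolding Pg_def path_span_def by (auto intro!: H.finsum_closed balD)

lemma Pg_add:
 assumes a: "a : cA" and x: "x : path_span (chains n)" and b: "b : cA"
 shows "a' : cA ==> Pg (a +[A] a') x b = Pg a x b +[H] Pg a' x b"
  "x' : path_span (chains n) ==> Pg a (x + x') b = Pg a x b +[H] Pg a x' b"
  "b' : cA ==> Pg a x (b +[A] b') = Pg a x b +[H] Pg a x b'" proof -
 have k: "w : keys x ==> w : chains n" for w using x by (auto simp: path_span_def)
 show "Pg (a +[A] a') x b = Pg a x b +[H] Pg a' x b" if "a' : cA" proof -
  have "Pg (a +[A] a') x b = (\<Oplus>\<^bsub>H\<^esub>w\<in>keys x. g (kk (lookup x w) ** a) w b
  +[H] g (kk (lookup x w) ** a') w b)"
  unfolding Pg_def using a b that k by (intro H.finsum_cong') (auto simp: balD[OF k] A.r_distr)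
  also have "\<dots> = Pg a x b +[H] Pg a' x b"
  unfolding Pg_def using a b that by (intro H.finsum_addf) (auto simp: balD[OF k])
  finally show ?thesis .
 qed
 show "Pg a x (b +[A] b') = Pg a x b +[H] Pg a x b'" if "b' : cA" proof -
  have "Pg a x (b +[A] b') = (\<Oplus>\<^bsub>H\<^esub>w\<in>keys x. g (kk (lookup x w) ** a) w b
  +[H] g (kk (lookup x w) ** a) w b')"
  unfolding Pg_def using a b that k by (intro H.finsum_cong') (auto simp: balD[OF k])
  also have "\<dots> = Pg a x b +[H] Pg a x b'"
  unfolding Pg_def using a b that by (intro H.finsum_addf) (auto simp: balD[OF k])
  finally show ?thesis .
 qed
 assume x': "x' : path_span (chains n)"
 let ?T = "keys x \<union> keys x'"
 have T: "?T <= chains n" "finite ?T" "keys (x + x') <= ?T"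
  using x x' by (auto simp: path_span_def dest!: subsetD[OF keys_add])
 have T': "w : ?T ==> w : chains n" for w using T(1) by blast
 have "Pg a (x + x') b = (\<Oplus>\<^bsub>H\<^esub>w\<in>?T. g (kk (lookup (x + x') w) ** a) w b)"
  by (rule Pg_super[OF T(2,3,1) a b])
 also have "\<dots> = (\<Oplus>\<^bsub>H\<^esub>w\<in>?T. g (kk (lookup x w) ** a) w b
  +[H] g (kk (lookup x' w) ** a) w b)" using a b by (intro H.finsum_cong' refl)
  (simp_all add: balD[OF T'] lookup_add kk_add A.l_distr Pi_def del: Un_iff)
 also have "\<dots> = (\<Oplus>\<^bsub>H\<^esub>w\<in>?T. g (kk (lookup x w) ** a) w b)
  +[H] (\<Oplus>\<^bsub>H\<^esub>w\<in>?T. g (kk (lookup x' w) ** a) w b)"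
  using a b by (intro H.finsum_addf) (simp_all add: balD[OF T'] Pi_def del: Un_iff)
 also have "\<dots> = Pg a x b +[H] Pg a x' b"
  using Pg_super[OF T(2) _ T(1) a b, of x] Pg_super[OF T(2) _ T(1) a b, of x'] by simp
 finally show "Pg a (x + x') b = Pg a x b +[H] Pg a x' b" .
qed

lemma Pg_K:
 assumes a: "a : cA" and x: "x : path_span (chains n)" and b: "b : cA" and z: "z : K"
 shows "Pg (a ** proj z) x b = Pg a (pmult Q z x) b"
  "Pg a (pmult Q x z) b = Pg a x (proj z ** b)" proof -
 have k: "w : keys x ==> w : chains n" for w using x by (auto simp: path_span_def)
 have c: "x : cQ" using x chains_sub by (auto simp: path_span_def kQ_iff)
 have s1: "keys (pmult Q z x) <= keys x"
  "keys (pmult Q x z) <= keys x" by (auto simp: in_keys_iff lookup_K_mult[OF z c] lookup_mult_K[OF z c])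
 have l: "g (kk c ** (a ** proj z)) w b = g (kk (lookup z (vtx (src w)) * c) ** a) w b" if "w : chains n" for c w
  using balD(4)[OF that _ b z, of "kk c ** a"] a z by (simp add: A.m_assoc[symmetric] proj_K_in kk_mult)
 show "Pg (a ** proj z) x b = Pg a (pmult Q z x) b" proof -
  have "Pg (a ** proj z) x b =
  (\<Oplus>\<^bsub>H\<^esub>w\<in>keys x. g (kk (lookup (pmult Q z x) w) ** a) w b)" unfolding Pg_def using a b z
  by (intro H.finsum_cong' refl) (simp_all add: l[OF k] lookup_K_mult[OF z c] balD(1)[OF k] Pi_def)
  also have "\<dots> = Pg a (pmult Q z x) b" by (rule Pg_super[symmetric, OF finite_keys s1(1) subsetI[OF k] a b])
  finally show ?thesis .
 qed
 have r: "g (kk c ** a) w (proj z ** b) = g (kk (c * lookup z (vtx (tgt Q w))) ** a) w b" if "w : chains n" for c w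
  using balD(5)[OF that _ b z, of "kk c ** a"] a z by (simp add: A.m_assoc[symmetric] kk_mult[symmetric] mult.commute)
 show "Pg a (pmult Q x z) b = Pg a x (proj z ** b)" proof -
  have "Pg a (pmult Q x z) b =
  (\<Oplus>\<^bsub>H\<^esub>w\<in>keys x. g (kk (lookup (pmult Q x z) w) ** a) w b)"
  by (rule Pg_super[OF finite_keys s1(2) subsetI[OF k] a b])
  also have "\<dots> = Pg a x (proj z ** b)" unfolding Pg_def using a b z by (intro H.finsum_cong' refl)
  (simp_all add: r[OF k] lookup_mult_K[OF z c] balD(1)[OF k] Pi_def proj_K_in)
  finally show ?thesis .
 qed
qed

definition "Pf xs = (let x = the_elem (xs ! 1) in
  \<Oplus>\<^bsub>H\<^esub>w\<in>keys x. g (kk (lookup x w) ** (xs ! 0)) w (xs ! 2))"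

lemma Pf_Pg: "Pf [a, {x}, b] = Pg a x b" by (simp add: Pf_def Pg_def Let_def)

lemma P_lift_eq: "P_lift H g = tensor_lift H Pf" by (simp add: P_lift_def Pf_def[abs_def])

lemma Pf_bal: "balanced K (facs_P n) H Pf" proof (rule balancedI)
 fix xs assume "xs : tuples (facs_P n)"
 thus "Pf xs : carrier H" by (auto elim!: P_tuplesE simp: Pf_Pg Pg_in)
next
 fix Us M Vs us x y vs
 assume a: "facs_P n = Us @ M # Vs" "us : tuples Us" "vs : tuples Vs" "x : carrier M" "y : carrier M"
 then consider "Us = []" "M = fac_A" "Vs = [fS n, fac_A]" | "Us = [fac_A]" "M = fS n" "Vs = [fac_A]"
  | "Us = [fac_A, fS n]" "M = fac_A" "Vs = []"
  unfolding facs_P_def using three_split[of fac_A "fS n" fac_A Us M Vs] by blast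
 thus "Pf (us @ (x +[M] y) # vs) = Pf (us @ x # vs) +[H] Pf (us @ y # vs)" proof cases
  case 1
  then obtain X b where "us = []" "vs = [{X}, b]" "X : path_span (chains n)" "b : cA"
  using a(2,3) by (auto elim!: tuples_ConsE simp: fac_S_carrier_eq car_A)
  thus ?thesis using a(4,5) 1 by (simp add: Pf_Pg Pg_add(1) A_add car_A)
 next
  case 2
  then obtain c b X Y where "us = [c]" "vs = [b]" "c : cA" "b : cA" "x = {X}" "y = {Y}"
  "X : path_span (chains n)" "Y : path_span (chains n)"
  using a by (auto elim!: tuples_ConsE simp: fac_S_carrier_eq car_A)
  thus ?thesis using 2 by (simp add: Pf_Pg Pg_add(2) sqS(1))
 next
  case 3
  then obtain c X where "us = [c, {X}]" "vs = []" "c : cA" "X : path_span (chains n)"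
  using a(2,3) by (auto elim!: tuples_ConsE simp: fac_S_carrier_eq car_A)
  thus ?thesis using a(4,5) 3 by (simp add: Pf_Pg Pg_add(3) A_add car_A)
 qed
next
 fix Us M N Vs us x y vs z
 assume a: "facs_P n = Us @ M # N # Vs" "us : tuples Us" "vs : tuples Vs" "x : carrier M" "y : carrier N" "z : K"
 then consider "Us = []" "M = fac_A" "N = fS n" "Vs = [fac_A]" | "Us = [fac_A]" "M = fS n" "N = fac_A" "Vs = []"
  unfolding facs_P_def using three_split[of fac_A "fS n" fac_A Us M "N # Vs"] by blast
 thus "Pf (us @ ract M x z # y # vs) = Pf (us @ x # lact N z y # vs)" proof cases
  case 1
  then obtain Y b where "us = []" "vs = [b]" "b : cA" "y = {Y}" "Y : path_span (chains n)"
  using a(2,3,5) by (auto elim!: tuples_ConsE simp: fac_S_carrier_eq car_A)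
  thus ?thesis using a(4,6) 1 by (simp add: Pf_Pg Pg_K(1) A_ract sqS(3) car_A)
 next
  case 2
  then obtain c X where "us = [c]" "vs = []" "c : cA" "x = {X}" "X : path_span (chains n)"
  using a(2,3,4) by (auto elim!: tuples_ConsE simp: fac_S_carrier_eq car_A)
  thus ?thesis using a(5,6) 2 by (simp add: Pf_Pg Pg_K(2) A_lact sqS(4) car_A)
 qed
qed

lemma P_lift_addhom: "P_lift H g : ahom (P n) H"
 unfolding P_lift_eq ahom_P by (rule tensor_lift_addhom[OF P_factor H Pf_bal])

lemma P_lift_pure:
 assumes "a : cA" "w : chains n" "b : cA"
 shows "P_lift H g (Ppure n a (ppath w) b) = g a w b" proof -
 have "P_lift H g (Ppure n a (ppath w) b) = Pg a (ppath w) b" unfolding P_lift_eq P_pure_def using assms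
  by (subst tensor_lift_pure[OF P_factor H Pf_bal]) (auto simp: P_tuples fac_S_carrier pp_span Pf_Pg)
 also have "\<dots> = g a w b" using assms balD(1)[of w a b] by (simp add: Pg_def kk_one H.finsum_insert)
 finally show ?thesis .
qed

end

lemma chain_ends: "w : chains n ==> src w : verts Q" "w : chains n ==> tgt Q w : verts Q"
 using ch_path path_ends by blast+

text \<open>Extending a left linear map along the right action, from its values on \<open>a \<otimes> w \<otimes> 1\<close>\<close>

lemma P_rext:
 assumes "bim H" "f : lhom (P n) H" defines "g \<equiv> %a w b. ract H (f (Ppure n a (ppath w) \<one>[A])) b"
 shows "P_lift H g : bhom (P n) H"
  "[| a : cA; w : chains n; b : cA |] ==>
  P_lift H g (Ppure n a (ppath w) b) = ract H (f (Ppure n a (ppath w) \<one>[A])) b" proof -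
 have gv: "g a w b = ract H (f (Ppure n a (ppath w) \<one>[A])) b" for a w b by (simp add: g_def)
 note fl = lhomD[OF assms(2)]
 have pc: "Ppure n a (ppath w) b : cP n" if "a : cA" "w : chains n" "b : cA" for a w b
  using that by (simp add: Ppure_in pp_span)
 have bal: "P_bal n H g" proof (rule P_balI)
  fix a w b assume a: "a : cA" "w : chains n" "b : cA"
  show "g a w b : carrier H" using a assms(1) by (simp add: gv bimD fl pc)
  show "g (a +[A] a') w b = g a w b +[H] g a' w b" if "a' : cA" for a'
  using a that ahom_add[OF bimD(3)[OF assms(1) a(3)]] by (simp add: gv Ppure_add(1) pp_span ahom_add[OF fl(1)] pc fl)
  show "g a w (b +[A] b') = g a w b +[H] g a w b'" if "b' : cA" for b'
  using a that by (simp add: gv bimD(11)[OF assms(1)] fl pc)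
  fix z assume z: "z : K"
  have w: "pmult Q z (ppath w) = single w (lookup z (vtx (src w)))"
  "pmult Q (ppath w) z = single w (lookup z (vtx (tgt Q w)))"
  using K_mult_single[OF z ch_path[OF a(2)], of 1] by simp_all
  show "g (a ** proj z) w b = g (kk (lookup z (vtx (src w))) ** a) w b"
  using a z Ppure_single[OF a(1) A_one a(2)] by (simp add: gv Ppure_K(1) pp_span w)
  have "f (Ppure n (kk (lookup z (vtx (tgt Q w))) ** a) (ppath w) \<one>[A])
  = f (Ppure n a (pmult Q (ppath w) z) \<one>[A])" unfolding w by (simp only: Ppure_single[OF a(1) A_one a(2)])
  also have "\<dots> = f (ract (P n) (Ppure n a (ppath w) \<one>[A]) (proj z))"
  using a z by (simp add: Ppure_K(2) pp_span Ppure_ract proj_K_in)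
  also have "\<dots> = ract H (f (Ppure n a (ppath w) \<one>[A])) (proj z)" using a z by (simp add: fl(3) pc)
  finally show "g a w (proj z ** b) = g (kk (lookup z (vtx (tgt Q w))) ** a) w b"
  using a z assms(1) by (simp add: gv bimD(8) fl(4) pc proj_K_in)
 qed
 note H = bimD(1)[OF assms(1)]
 note L = P_lift_addhom[OF H bal] and V = P_lift_pure[OF H bal]
 show "[| a : cA; w : chains n; b : cA |] ==>
  P_lift H g (Ppure n a (ppath w) b) = ract H (f (Ppure n a (ppath w) \<one>[A])) b" by (simp add: V gv)
 show "P_lift H g : bhom (P n) H" proof (rule bhomI[OF L])
  fix c x assume c: "c : cA" and x: "x : cP n"
  show "P_lift H g (lact (P n) c x) = lact H c (P_lift H g x)"
  proof (rule P_hom_eq[OF H ahom_comp[OF L bimD(2)[OF bim_P c]] ahom_comp[OF bimD(2)[OF assms(1) c] L] _ x])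
  fix a w b assume a: "a : cA" "w : chains n" "b : cA"
  have "f (Ppure n (c ** a) (ppath w) \<one>[A]) = lact H c (f (Ppure n a (ppath w) \<one>[A]))"
  using a c fl(2)[of c "Ppure n a (ppath w) \<one>[A]"] by (simp add: Ppure_lact pp_span pc)
  thus "P_lift H g (lact (P n) c (Ppure n a (ppath w) b)) = lact H c (P_lift H g (Ppure n a (ppath w) b))"
  using a c assms(1) by (simp add: Ppure_lact pp_span V gv bimD(9) fl(4) pc)
  qed
  show "P_lift H g (ract (P n) x c) = ract H (P_lift H g x) c"
  proof (rule P_hom_eq[OF H ahom_comp[OF L bimD(3)[OF bim_P c]] ahom_comp[OF bimD(3)[OF assms(1) c] L] _ x])
  fix a w b assume a: "a : cA" "w : chains n" "b : cA"
  thus "P_lift H g (ract (P n) (Ppure n a (ppath w) b) c) = ract H (P_lift H g (Ppure n a (ppath w) b)) c"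
  using c assms(1) by (simp add: Ppure_ract pp_span V gv bimD(8) fl(4) pc)
  qed
 qed
qed

lemma P_bilift:
 assumes "bim H" "!!w. w : chains n ==> g w : between H (src w) (tgt Q w)"
 shows "P_bilift H g : bhom (P n) H"
  "[| a : cA; w : chains n; b : cA |] ==>
  P_bilift H g (Ppure n a (ppath w) b) = lact H a (ract H (g w) b)" proof -
 let ?g = "%a w b. lact H a (ract H (g w) b)"
 have gc: "g w : carrier H" if "w : chains n" for w using assms(2)[OF that] by (simp add: between_def)
 note H = bimD(1)[OF assms(1)]
 have bal: "P_bal n H ?g" proof (rule P_balI)
  fix a w b assume a: "a : cA" "w : chains n" "b : cA"
  show "?g a w b : carrier H" using a assms(1) by (simp add: bimD gc)
  show "?g (a +[A] a') w b = ?g a w b +[H] ?g a' w b" if "a' : cA" for a'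
  using a that assms(1) by (simp add: bimD(10) bimD(13) gc)
  show "?g a w (b +[A] b') = ?g a w b +[H] ?g a w b'" if "b' : cA" for b'
  using a that ahom_add[OF bimD(2)[OF assms(1) a(1)]] by (simp add: bimD(11,13)[OF assms(1)] gc)
  fix z assume z: "z : K"
  note e = between_K[OF assms(1) assms(2)[OF a(2)] chain_ends[OF a(2)] z]
  have kc: "kk c : cA" for c by simp
  show "?g (a ** proj z) w b = ?g (kk (lookup z (vtx (src w))) ** a) w b" using a z e(1) assms(1)
  by (simp add: bimD(7)[symmetric] bimD(9) bimD(12) bimD(13) gc proj_K_in kk_central)
  show "?g a w (proj z ** b) = ?g (kk (lookup z (vtx (tgt Q w))) ** a) w b" using a z e(2) assms(1)
  by (simp add: bimD(7)[symmetric] bimD(8)[symmetric] bimD(9) bimD(12) bimD(13) gc proj_K_in kk_central)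
 qed
 note L = P_lift_addhom[OF H bal, folded P_bilift_def] and V = P_lift_pure[OF H bal, folded P_bilift_def]
 show "[| a : cA; w : chains n; b : cA |] ==>
  P_bilift H g (Ppure n a (ppath w) b) = lact H a (ract H (g w) b)" by (rule V)
 show "P_bilift H g : bhom (P n) H" proof (rule bhomI[OF L])
  fix c x assume c: "c : cA" and x: "x : cP n"
  show "P_bilift H g (lact (P n) c x) = lact H c (P_bilift H g x)"
  by (rule P_hom_eq[OF H ahom_comp[OF L bimD(2)[OF bim_P c]] ahom_comp[OF bimD(2)[OF assms(1) c] L] _ x])
  (use c assms(1) in \<open>simp add: Ppure_lact pp_span V bimD(7) bimD(13) gc\<close>)
  show "P_bilift H g (ract (P n) x c) = ract H (P_bilift H g x) c"
  by (rule P_hom_eq[OF H ahom_comp[OF L bimD(3)[OF bim_P c]] ahom_comp[OF bimD(3)[OF assms(1) c] L] _ x])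
  (use c assms(1) in \<open>simp add: Ppure_ract pp_span V bimD(8)[symmetric] bimD(9) bimD(13) gc\<close>)
 qed
qed

end

section \<open>Telescoping along the level sets of a monotone function\<close>

context
 fixes g :: "nat => nat" and L :: nat
 assumes g_mono: "!!x y. x <= y ==> g x <= g y" and g_bound: "!!x. g x <= L ==> x <= L"
begin

definition jumps :: "nat set" where "jumps = {y. g y <= L & g y < g (Suc y)}"

definition next_jump :: "nat => nat" where
 "next_jump i = Max {a\<in>jumps. i <= a & g a <= g (Suc i)}"

lemma finite_jumps: "finite jumps"
 by (rule finite_subset[of _ "{..L}"]) (use g_bound in \<open>auto simp: jumps_def\<close>)

lemma jumps_inj: "[| y : jumps; z : jumps; g y = g z |] ==> y = z"
 using g_mono[of "Suc y" z] g_mono[of "Suc z" y] by (cases y z rule: linorder_cases) (auto simp: jumps_def)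

lemma next_jump:
 assumes "i : jumps" "g (Suc i) <= L"
 shows "next_jump i : jumps" "i < next_jump i" "g (next_jump i) = g (Suc i)" proof -
 define y where "y = (GREATEST y. g y = g (Suc i))"
 have b: "!!z. g z = g (Suc i) ==> z <= L" using g_bound assms(2) by metis
 have y: "g y = g (Suc i)" unfolding y_def by (rule GreatestI_nat[of _ "Suc i"]) (use b in auto)
 have m: "z <= y" if "g z = g (Suc i)" for z unfolding y_def by (rule Greatest_le_nat) (use b that in auto)
 have "g y ~= g (Suc y)" using m[of "Suc y"] y by auto
 hence yj: "y : jumps" using g_mono[of y "Suc y"] y assms(2) by (simp add: jumps_def)
 have iy: "i < y" using m[of "Suc i"] by simp
 have "next_jump i = y" unfolding next_jump_def proof (rule Max_eqI)
  show "finite {a\<in>jumps. i <= a & g a <= g (Suc i)}" using finite_jumps by simp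
  show "y : {a\<in>jumps. i <= a & g a <= g (Suc i)}" using yj iy y by simp
  fix a assume a: "a : {a\<in>jumps. i <= a & g a <= g (Suc i)}"
  show "a <= y" proof (rule ccontr)
  assume "\<not> a <= y"
  hence "g (Suc y) <= g a" by (intro g_mono) simp
  thus False using a y yj by (auto simp: jumps_def)
  qed
 qed
 thus "next_jump i : jumps" "i < next_jump i" "g (next_jump i) = g (Suc i)" using yj iy y by simp_all
qed

lemma not_last_jump:
 assumes "jumps ~= {}"
 shows "{y\<in>jumps. g (Suc y) <= L} = jumps - {Max jumps}" proof -
 have "y ~= Max jumps" if "y : jumps" "g (Suc y) <= L" for y
  using next_jump[OF that] Max_ge[OF finite_jumps, of "next_jump y"] by auto
 moreover have "g (Suc y) <= L" if "y : jumps" "y ~= Max jumps" for y proof -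
  have "Max jumps : jumps" "y <= Max jumps" using assms finite_jumps that by auto
  hence "g (Suc y) <= g (Max jumps)" "g (Max jumps) <= L" using that by (auto simp: jumps_def intro: g_mono)
  thus ?thesis by simp
 qed
 ultimately show ?thesis by blast
qed

lemma next_jump_bij:
 assumes "0 : jumps"
 shows "bij_betw next_jump (jumps - {Max jumps}) (jumps - {0})" proof -
 have ne: "jumps ~= {}" using assms by auto
 note Y = not_last_jump[OF ne, symmetric]
 have inj: "inj_on next_jump (jumps - {Max jumps})" proof (rule inj_onI)
  have *: False if "i < j" "i : jumps - {Max jumps}" "j : jumps - {Max jumps}" "next_jump i = next_jump j" for i j
  proof -
  have "g (Suc i) = g (Suc j)" using that next_jump(3)[of i] next_jump(3)[of j] Y by auto
  moreover have "g (Suc i) <= g j" using that(1) by (intro g_mono) simp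
  ultimately show False using that(3) by (auto simp: jumps_def)
  qed
  fix i j assume "i : jumps - {Max jumps}" "j : jumps - {Max jumps}" "next_jump i = next_jump j"
  thus "i = j" using *[of i j] *[of j i] by (cases i j rule: linorder_cases) auto
 qed
 have "y : next_jump ` (jumps - {Max jumps})" if y: "y : jumps" "y ~= 0" for y proof -
  have 0: "g 0 < g y" using assms g_mono[of "Suc 0" y] y(2) by (auto simp: jumps_def)
  define i where "i = (GREATEST i. g i < g y)"
  have b: "!!i. g i < g y ==> i <= y" using g_mono by (metis leD nat_le_linear)
  have i: "g i < g y" unfolding i_def by (rule GreatestI_nat[of _ 0]) (use 0 b in auto)
  have m: "z <= i" if "g z < g y" for z unfolding i_def by (rule Greatest_le_nat) (use b that in auto)
  have "i < y" using i g_mono[of y i] by (meson leD leI)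
  hence "g (Suc i) <= g y" by (intro g_mono) simp
  moreover have "\<not> g (Suc i) < g y" using m[of "Suc i"] by auto
  ultimately have e: "g (Suc i) = g y" by simp
  hence ij: "i : jumps" "g (Suc i) <= L" using i y by (auto simp: jumps_def)
  hence "next_jump i = y" using jumps_inj[OF next_jump(1)[OF ij] y(1)] next_jump(3)[OF ij] e by simp
  thus ?thesis using ij Y by blast
 qed
 moreover have "next_jump i : jumps - {0}" if "i : jumps - {Max jumps}" for i
  using next_jump(1,2)[of i] that Y by auto
 ultimately have "next_jump ` (jumps - {Max jumps}) = jumps - {0}"
  by (intro equalityI subsetI) (elim imageE, simp, elim DiffE, simp)
 thus ?thesis unfolding bij_betw_def using inj by blast
qed

end

lemma (in abelian_group) telescope:
 assumes "finite X" "a : X" "b : X" "bij_betw r (X - {b}) (X - {a})" "!!x. x : X ==> f x : carrier G"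
 shows "(\<Oplus>x\<in>X - {b}. f (r x) \<ominus> f x) = f b \<ominus> f a" proof -
 have r: "x : X - {b} ==> r x : X - {a}" for x using assms(4) by (auto simp: bij_betw_def)
 have i: "inj_on r (X - {b})" "r ` (X - {b}) = X - {a}" using assms(4) by (auto simp: bij_betw_def)
 have c: "(\<Oplus>x\<in>X - {z}. f x) : carrier G" for z using assms(5) by (auto intro!: finsum_closed)
 have "(\<Oplus>x\<in>X - {b}. f (r x)) = (\<Oplus>x\<in>X - {a}. f x)"
  using finsum_reindex[of f r "X - {b}"] i assms(5) by auto
 moreover have "(\<Oplus>x\<in>X - {b}. f (r x) \<ominus> f x) = (\<Oplus>x\<in>X - {b}. f (r x)) \<oplus> (\<Oplus>x\<in>X - {b}. \<ominus> f x)"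
  unfolding a_minus_def using r assms(5) by (intro finsum_addf) auto
 moreover have "(\<Oplus>x\<in>X - {b}. \<ominus> f x) = \<ominus> (\<Oplus>x\<in>X - {b}. f x)" proof -
  have "a_inv G : ahom G G" by (auto intro!: ahomI simp: minus_add a_comm)
  from ahom_finsum[OF abelian_group_axioms abelian_group_axioms this, of "X - {b}" f] assms(5)
  show ?thesis by simp
 qed
 moreover have s: "(\<Oplus>x\<in>X. f x) = f z \<oplus> (\<Oplus>x\<in>X - {z}. f x)" if "z : X" for z
  using finsum_insert[of "X - {z}" z f] that assms(1,5) by (auto simp: insert_absorb)
 have "f a \<oplus> (\<Oplus>x\<in>X - {a}. f x) = f b \<oplus> (\<Oplus>x\<in>X - {b}. f x)"
  using s[OF assms(2)] s[OF assms(3)] by simp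
 hence "(\<Oplus>x\<in>X - {a}. f x) = f b \<oplus> (\<Oplus>x\<in>X - {b}. f x) \<ominus> f a"
  using c[of a] c[of b] assms(2,3,5) r_neg2[of "\<ominus> f a"] by (metis a_comm a_inv_closed minus_eq minus_minus a_closed)
 moreover have "f b \<oplus> u \<ominus> f a \<oplus> \<ominus> u = (u \<oplus> \<ominus> u) \<oplus> (f b \<ominus> f a)" if "u : carrier G" for u
  using that assms(2,3,5) by (simp add: minus_eq a_ac)
 ultimately show ?thesis using c[of b] assms(2,3,5) by (simp add: r_neg)
qed

context confluent_presentation
begin

section \<open>Positions of chains inside a path\<close>

subsection \<open>Subpaths by position\<close>

definition vt :: "('v, 'e) path => nat => 'v" where "vt p i = tgt Q (fst p, take i (snd p))"

definition sub :: "('v, 'e) path => nat => nat => ('v, 'e) path" where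
 "sub p i j = (vt p i, drop i (take j (snd p)))"

lemma sub_fst [simp]: "src (sub p i j) = vt p i" "fst (sub p i j) = vt p i" by (simp_all add: sub_def src_def)

lemma plen_sub: "[| i <= j; j <= plen p |] ==> plen (sub p i j) = j - i" by (simp add: sub_def plen_def)

lemma sub_refl: "sub p i i = vtx (vt p i)" by (simp add: sub_def)

lemma sub_all: "sub p 0 (plen p) = p" by (simp add: sub_def plen_def vt_def)

lemma sub_path:
 assumes "p : paths Q" "i <= j" "j <= plen p"
 shows "sub p i j : paths Q" "tgt Q (sub p i j) = vt p j" proof -
 have e: "take j (snd p) = take i (snd p) @ drop i (take j (snd p))"
  using assms(2) by (metis append_take_drop_id min.absorb1 take_take)
 have "(fst p, take j (snd p) @ drop j (snd p)) : paths Q" using assms(1) by simp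
 hence "(fst p, take j (snd p)) : paths Q" by (rule split_path(1))
 hence "(fst p, take i (snd p) @ drop i (take j (snd p))) : paths Q" using e by simp
 from split_path(2,3)[OF this] show "sub p i j : paths Q" "tgt Q (sub p i j) = vt p j"
  using e by (simp_all add: sub_def vt_def)
qed

lemma vt_vert: "[| p : paths Q; i <= plen p |] ==> vt p i : verts Q"
 using path_ends(1)[OF sub_path(1), of p i i] by simp

lemma sub_cat:
 assumes "i <= j" "j <= k" shows "cat (sub p i j) (sub p j k) = sub p i k" proof -
 have "drop i (take k (snd p)) = drop i (take j (snd p)) @ drop j (take k (snd p))" proof -
  have "take k (snd p) = take j (snd p) @ drop j (take k (snd p))"
  using assms(2) by (metis append_take_drop_id min.absorb1 take_take)
  hence "drop i (take k (snd p)) = drop i (take j (snd p)) @ drop (i - length (take j (snd p))) (drop j (take k (snd p)))"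
  by (metis drop_append)
  moreover have "drop (i - length (take j (snd p))) (drop j (take k (snd p))) = drop j (take k (snd p))"
  using assms by (cases "j <= length (snd p)") auto
  ultimately show ?thesis by simp
 qed
 thus ?thesis by (simp add: sub_def)
qed

lemma snd_sub: "[| i <= j; j <= k |] ==> snd (sub p i j) @ snd (sub p j k) = snd (sub p i k)"
 using sub_cat[of i j k p] by (metis snd_conv)

lemma pair_sub: "(vt p i, snd (sub p i j)) = sub p i j" by (simp add: sub_def)

lemma sub_split:
 assumes p: "p : paths Q" "i <= j" "j <= plen p" and c: "cat q r = sub p i j" "tgt Q q = src r"
 shows "i + plen q <= j" "q = sub p i (i + plen q)" "r = sub p (i + plen q) j" proof -
 let ?a = "i + plen q"
 have s: "snd q @ snd r = drop i (take j (snd p))" and f: "fst q = vt p i" using c(1) by (auto simp: sub_def)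
 have "length (snd q @ snd r) = j - i" using s p(2,3) by (simp add: plen_def)
 hence "plen q <= j - i" by (simp add: plen_def)
 thus a: "?a <= j" using p(2) by simp
 have "snd q = take (plen q) (drop i (take j (snd p)))" using arg_cong[OF s, of "take (plen q)"] by (simp add: plen_def)
 also have "\<dots> = drop i (take ?a (snd p))" using a by (simp add: take_drop min_def add.commute)
 finally show q: "q = sub p i ?a" using f by (simp add: sub_def prod_eq_iff)
 have "snd r = drop (plen q) (drop i (take j (snd p)))" using arg_cong[OF s, of "drop (plen q)"] by (simp add: plen_def)
 hence "snd r = drop ?a (take j (snd p))" by (simp add: add.commute)
 moreover have "fst r = vt p ?a" using c(2) sub_path(2)[OF p(1), of i ?a] q a p(3) by (simp add: src_def)
 ultimately show "r = sub p ?a j" by (simp add: sub_def prod_eq_iff)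
qed

lemma sub_split3:
 assumes "p : paths Q" "i <= j" "j <= plen p"
 shows "composable Q [q, w, r] & pconcat [q, w, r] = sub p i j \<longleftrightarrow>
  (\<exists>a b. i <= a & a <= b & b <= j & q = sub p i a & w = sub p a b & r = sub p b j)" proof
 assume a: "composable Q [q, w, r] & pconcat [q, w, r] = sub p i j"
 have 1: "cat q (cat w r) = sub p i j" "tgt Q q = src (cat w r)" using a by (simp_all add: pconcat3)
 note s1 = sub_split[OF assms 1]
 let ?a = "i + plen q"
 have "?a <= j" "cat w r = sub p ?a j" "tgt Q w = src r" using s1 a by auto
 from sub_split[OF assms(1) this(1) assms(3) this(2,3)] s1
 show "\<exists>a b. i <= a & a <= b & b <= j & q = sub p i a & w = sub p a b & r = sub p b j"
  by (intro exI[of _ ?a] exI[of _ "?a + plen w"]) auto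
next
 assume "\<exists>a b. i <= a & a <= b & b <= j & q = sub p i a & w = sub p a b & r = sub p b j"
 then obtain a b where "i <= a" "a <= b" "b <= j" "q = sub p i a" "w = sub p a b" "r = sub p b j" by blast
 thus "composable Q [q, w, r] & pconcat [q, w, r] = sub p i j"
  using assms sub_path[OF assms(1)] by (simp add: pconcat3 snd_sub pair_sub)
qed

lemma sub_subpath:
 assumes "p : paths Q" "i <= j" "j <= plen p"
 shows "subpath Q w (sub p i j) \<longleftrightarrow> (\<exists>a b. i <= a & a <= b & b <= j & w = sub p a b)"
 unfolding subpath_def sub_split3[OF assms] by blast

subsection \<open>The greedy description of chains\<close>

text \<open>
 \<open>nxt p x\<close> is the position at which the first occurrence of a relation starting at or after \<open>x\<close>
 ends, and a position behind the path if there is none.  Reading a chain from left to right, every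
 cut point is determined by the one two steps before it.
\<close>

definition nxt :: "('v, 'e) path => nat => nat" where
 "nxt p x = Min (insert (Suc (plen p)) {b. \<exists>a. x <= a & a <= b & b <= plen p & sub p a b : S})"

fun cut :: "('v, 'e) path => nat => nat => nat" where
 "cut p i 0 = i"
| "cut p i (Suc 0) = Suc i"
| "cut p i (Suc (Suc k)) = nxt p (cut p i k)"

declare cut.simps(3) [simp del]

definition chain_at :: "('v, 'e) path => nat => nat => bool" where
 "chain_at p n i \<longleftrightarrow> cut p i n <= plen p & (\<forall>k\<le>n. cut p i k < cut p i (Suc k))"

lemma finite_ends: "finite (insert (Suc (plen p)) {b. \<exists>a. x <= a & a <= b & b <= plen p & sub p a b : S})"
 by (rule finite_subset[of _ "{..Suc (plen p)}"]) auto

lemma nxt_le: "nxt p x <= Suc (plen p)" unfolding nxt_def by (rule Min_le[OF finite_ends]) simp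

lemma nxt_occ: "[| x <= a; a <= b; b <= plen p; sub p a b : S |] ==> nxt p x <= b"
 unfolding nxt_def by (rule Min_le[OF finite_ends]) auto

lemma nxt_ex: "nxt p x <= plen p ==> \<exists>a. x <= a & a <= nxt p x & sub p a (nxt p x) : S"
 using Min_in[OF finite_ends, of p x] unfolding nxt_def[symmetric] by auto

lemma nxt_mono: "x <= y ==> nxt p x <= nxt p y" proof (cases "nxt p y <= plen p")
 case True
 assume xy: "x <= y"
 obtain a where "y <= a" "a <= nxt p y" "sub p a (nxt p y) : S" using nxt_ex[OF True] by blast
 thus ?thesis using nxt_occ[of x a "nxt p y" p] xy True by simp
qed (use nxt_le[of p x] in simp)

lemma nxt_gt:
 "x < plen p ==> Suc x < nxt p x" "x <= plen p ==> x < nxt p x" proof -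
 have *: "x + 2 <= nxt p x" if "nxt p x <= plen p" proof -
  from nxt_ex[OF that] obtain a where "x <= a" "a <= nxt p x" "sub p a (nxt p x) : S" by blast
  thus ?thesis using S_path(2)[of "sub p a (nxt p x)"] plen_sub[of a "nxt p x" p] that by simp
 qed
 show "x < plen p ==> Suc x < nxt p x" "x <= plen p ==> x < nxt p x" using * by fastforce+
qed

lemma irr_sub_iff:
 assumes "p : paths Q" "i <= j" "j <= plen p"
 shows "sub p i j : irr Q S \<longleftrightarrow> j < nxt p i" proof -
 have "(\<exists>s\<in>S. subpath Q s (sub p i j)) \<longleftrightarrow> (\<exists>a b. i <= a & a <= b & b <= j & sub p a b : S)"
  unfolding sub_subpath[OF assms] by blast
 hence "sub p i j : irr Q S \<longleftrightarrow> \<not> (\<exists>a b. i <= a & a <= b & b <= j & sub p a b : S)"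
  using sub_path(1)[OF assms] unfolding irr_def by blast
 also have "(\<exists>a b. i <= a & a <= b & b <= j & sub p a b : S) \<longleftrightarrow> nxt p i <= j" proof
  assume "\<exists>a b. i <= a & a <= b & b <= j & sub p a b : S"
  then obtain a b where "i <= a" "a <= b" "b <= j" "sub p a b : S" by blast
  thus "nxt p i <= j" using nxt_occ[of i a b p] assms(3) by simp
 next
  assume n: "nxt p i <= j"
  then obtain a where "i <= a" "a <= nxt p i" "sub p a (nxt p i) : S" using nxt_ex[of p i] assms(3) by auto
  thus "\<exists>a b. i <= a & a <= b & b <= j & sub p a b : S" using n by blast
 qed
 finally show ?thesis by (simp add: not_le)
qed

lemma cut_mono: "i <= j ==> cut p i k <= cut p j k"
 by (induction p i k rule: cut.induct) (auto simp: cut.simps intro: nxt_mono)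

lemma cut_shift: "even k ==> cut p (Suc i) k = cut p i (Suc k)"
 by (induction p i k rule: cut.induct) (auto simp: cut.simps)

lemma cut_nxt: "even k ==> cut p (nxt p i) k = cut p i (Suc (Suc k))"
 by (induction p i k rule: cut.induct) (auto simp: cut.simps)

lemma cut_bound: "cut p i k <= plen p ==> i <= plen p" proof (induction p i k rule: cut.induct)
 case (3 p i k)
 then obtain a where "cut p i k <= a" "a <= nxt p (cut p i k)" using nxt_ex by (metis cut.simps(3))
 thus ?case using 3 by (simp add: cut.simps)
qed simp_all

lemma cut_ge: "chain_at p n i ==> k <= n ==> i <= cut p i k" proof (induction k)
 case (Suc k)
 hence "cut p i k < cut p i (Suc k)" by (simp add: chain_at_def)
 thus ?case using Suc by simp
qed simp

lemma chain_at_le: "chain_at p n i ==> k <= n ==> cut p i k <= cut p i n" proof (induction "n - k" arbitrary: k)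
 case (Suc d)
 hence "cut p i (Suc k) <= cut p i n" by simp
 thus ?case using Suc.prems by (auto simp: chain_at_def dest!: spec[of _ k])
qed simp

lemma chain_at_Suc: "chain_at p (Suc n) i ==> chain_at p n i" unfolding chain_at_def by (auto dest: spec[of _ n])

lemma chain_at_start: "chain_at p n i ==> i <= plen p" using cut_ge[of p n i n] by (auto simp: chain_at_def)

definition cuts :: "('v, 'e) path => (nat => nat) => nat => nat => ('v, 'e) path list" where
 "cuts p k i m = map (%i. sub p (k i) (k (Suc i))) [i..<m]"

lemma cuts_composable:
 assumes "p : paths Q" "!!i. i < m ==> k i <= k (Suc i)" "k m <= plen p" "i < m"
 shows "composable Q (cuts p k i m) & pconcat (cuts p k i m) = sub p (k i) (k m)" using assms(4)
proof (induction "m - Suc i" arbitrary: i)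
 case 0
 hence "m = Suc i" by simp
 thus ?case using assms sub_path(1)[OF assms(1), of "k i" "k m"] by (simp add: cuts_def pconcat_def sub_def src_def)
next
 case (Suc d)
 have mono: "k j <= k m" if "j <= m" for j using that by (induction "m - j" arbitrary: j)
  (simp, metis Suc_diff_Suc Suc_leI assms(2) diff_diff_cancel diff_is_0_eq' diff_le_self le_neq_implies_less nat.distinct(1) order_trans Suc_inject zero_less_diff zero_less_Suc diff_Suc_Suc)
 have i: "Suc i < m" using Suc by simp
 have e: "cuts p k i m = sub p (k i) (k (Suc i)) # sub p (k (Suc i)) (k (Suc (Suc i))) # cuts p k (Suc (Suc i)) m"
  "cuts p k (Suc i) m = sub p (k (Suc i)) (k (Suc (Suc i))) # cuts p k (Suc (Suc i)) m"
  using i by (simp_all add: cuts_def upt_conv_Cons)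
 have IH: "composable Q (cuts p k (Suc i) m)" "pconcat (cuts p k (Suc i) m) = sub p (k (Suc i)) (k m)"
  using Suc.hyps(1)[of "Suc i"] Suc.hyps(2) i by auto
 have b: "k i <= k (Suc i)" "k (Suc i) <= k m" "k (Suc i) <= plen p"
  using assms(2)[of i] mono[of "Suc i"] assms(3) i by auto
 thus ?case using IH sub_path[OF assms(1) b(1,3)] sub_cat[OF b(1,2), of p] unfolding e by (simp add: pconcat_Cons)
qed

lemma composable_cuts:
 assumes "p : paths Q" "composable Q us" "us ~= []" "pconcat us = sub p a b" "a <= b" "b <= plen p"
 shows "\<exists>k. k 0 = a & k (length us) = b & (\<forall>i<length us. k i <= k (Suc i) & us ! i = sub p (k i) (k (Suc i)))"
 using assms(2-5) proof (induction us arbitrary: a)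
 case (Cons u us)
 show ?case proof (cases us)
  case Nil
  hence "u = sub p a b" using Cons.prems by (simp add: pconcat_def src_def)
  thus ?thesis using Nil Cons.prems by (intro exI[of _ "case_nat a (%_. b)"]) simp
 next
  case us: (Cons v vs)
  have c: "cat u (pconcat us) = sub p a b" "tgt Q u = src (pconcat us)"
  using Cons.prems us pconcat_composable[of us] by (simp_all add: pconcat_Cons)
  note s = sub_split[OF assms(1) Cons.prems(4) assms(6) c]
  obtain k where k: "k 0 = a + plen u" "k (length us) = b"
  "\<forall>i<length us. k i <= k (Suc i) & us ! i = sub p (k i) (k (Suc i))"
  using Cons.IH[of "a + plen u"] Cons.prems us s by auto
  show ?thesis using k s(2) by (intro exI[of _ "case_nat a k"]) (auto simp: nth_Cons split: nat.splits)
 qed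
qed simp

lemma chains_long:
 assumes "n \<ge> 3"
 shows "chains n = {pconcat us | us. composable Q us & length us = n & plen (us ! 0) = 1 & (\<forall>i. 0 < i & i < n --> us ! i : irr Q S) & (\<forall>i. Suc i < n --> pconcat [us ! i, us ! Suc i] ~: irr Q S) & (\<forall>i d e. Suc i < n & composable Q [d, e] & pconcat [d, e] = us ! Suc i & plen e > 0
  --> pconcat [us ! i, d] : irr Q S)}" using assms by (simp only: chains_def) simp

lemma chain_iff_long:
 assumes p: "p : paths Q" and ab: "a <= b" "b <= plen p" and n: "n \<ge> 3"
 shows "sub p a b : chains n \<longleftrightarrow> b = cut p a n & chain_at p n a" proof
 assume "sub p a b : chains n"
 then obtain us where "sub p a b = pconcat us & composable Q us & length us = n & plen (us ! 0) = 1 & (\<forall>i. 0 < i & i < n --> us ! i : irr Q S) & (\<forall>i. Suc i < n --> pconcat [us ! i, us ! Suc i] ~: irr Q S) & (\<forall>i d e. Suc i < n & composable Q [d, e] & pconcat [d, e] = us ! Suc i & plen e > 0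
  --> pconcat [us ! i, d] : irr Q S)" unfolding chains_long[OF n] mem_Collect_eq by (rule exE)
 hence us: "sub p a b = pconcat us" "composable Q us" "length us = n" "plen (us ! 0) = 1"
  "!!i. 0 < i & i < n ==> us ! i : irr Q S"
  "!!i. Suc i < n ==> pconcat [us ! i, us ! Suc i] ~: irr Q S"
  "!!i d e. Suc i < n & composable Q [d, e] & pconcat [d, e] = us ! Suc i & plen e > 0
  ==> pconcat [us ! i, d] : irr Q S" by blast+
 obtain k where k: "k 0 = a" "k n = b" "!!i. i < n ==> k i <= k (Suc i)" "!!i. i < n ==> us ! i = sub p (k i) (k (Suc i))"
  using composable_cuts[OF p us(2) _ us(1)[symmetric] ab] us(3) n by fastforce
 have kn: "k i <= b" if "i <= n" for i
  using that k(2,3) by (induction "n - i" arbitrary: i) (simp, metis Suc_diff_Suc Suc_leI diff_diff_cancel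
  diff_is_0_eq' diff_le_self le_neq_implies_less nat.distinct(1) order_trans Suc_inject zero_less_diff zero_less_Suc diff_Suc_Suc)
 have kL: "k i <= plen p" if "i <= n" for i using kn[OF that] ab by simp
 have k1: "k (Suc 0) = Suc (k 0)"
  using us(4) k(4)[of 0] k(3)[of 0] kL[of 1] n plen_sub[of "k 0" "k (Suc 0)" p] by simp
 have lt: "k (Suc i) < nxt p (k i)" if "i < n" for i proof (cases "i = 0")
  case True
  thus ?thesis using nxt_gt(1)[of "k 0" p] k1 kL[of "Suc 0"] n by simp
 next
  case False
  thus ?thesis using us(5)[of i] that k(4)[OF that] irr_sub_iff[OF p k(3)[OF that] kL[of "Suc i"]] by simp
 qed
 have nx: "k (Suc (Suc i)) = nxt p (k i)" if i: "Suc i < n" for i proof -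
  have m: "k i <= k (Suc i)" "k (Suc i) <= k (Suc (Suc i))" "k (Suc (Suc i)) <= plen p"
  using i k(3)[of i] k(3)[of "Suc i"] kL[of "Suc (Suc i)"] by auto
  have "sub p (k i) (k (Suc (Suc i))) ~: irr Q S"
  using us(6)[OF i] k(4)[of i] k(4)[of "Suc i"] i sub_cat[OF m(1,2), of p] by (simp add: pconcat2)
  hence "nxt p (k i) <= k (Suc (Suc i))" using irr_sub_iff[OF p, of "k i" "k (Suc (Suc i))"] m by simp
  moreover have False if l: "nxt p (k i) < k (Suc (Suc i))" proof -
  let ?m = "nxt p (k i)"
  have m': "k (Suc i) <= ?m" "?m <= k (Suc (Suc i))" "?m <= plen p" using lt[of i] i l m by auto
  have "composable Q [sub p (k (Suc i)) ?m, sub p ?m (k (Suc (Suc i)))]"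
  "pconcat [sub p (k (Suc i)) ?m, sub p ?m (k (Suc (Suc i)))] = us ! Suc i"
  "plen (sub p ?m (k (Suc (Suc i)))) > 0" using m' m l sub_path[OF p] sub_cat[OF m'(1,2), of p] k(4)[of "Suc i"] i
  by (auto simp: pconcat2 plen_sub)
  hence "pconcat [us ! i, sub p (k (Suc i)) ?m] : irr Q S" using us(7) i by blast
  hence "sub p (k i) ?m : irr Q S" using k(4)[of i] i sub_cat[OF m(1) m'(1), of p] by (simp add: pconcat2)
  thus False using irr_sub_iff[OF p, of "k i" ?m] m m' by simp
  qed
  ultimately show ?thesis by (cases "nxt p (k i) < k (Suc (Suc i))") auto
 qed
 have kc: "i <= n ==> k i = cut p a i" for i proof (induction i rule: less_induct)
  case (less i)
  show ?case proof (cases "(p, a, i)" rule: cut.cases)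
  case (3 q c j)
  thus ?thesis using less.IH[of j] less.prems nx[of j] by (simp add: cut.simps)
  qed (use k(1) k1 less.prems in auto)
 qed
 have "cut p a j < cut p a (Suc j)" if "j <= n" for j proof (cases j)
  case (Suc i)
  thus ?thesis using lt[of i] kc[of i] kc[of "Suc i"] that by (simp add: cut.simps)
 qed simp
 thus "b = cut p a n & chain_at p n a" using kc[of n] k(2) ab by (simp add: chain_at_def)
next
 assume "b = cut p a n & chain_at p n a"
 hence b: "b = cut p a n" and c: "chain_at p n a" by auto
 let ?k = "cut p a"
 have lt: "?k i < ?k (Suc i)" if "i <= n" for i using c that by (simp add: chain_at_def)
 have kL: "?k i <= plen p" if "i <= n" for i using chain_at_le[OF c that] b ab by simp
 define us where "us = cuts p ?k 0 n"
 have us: "composable Q us" "pconcat us = sub p a b" "length us = n"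
  using cuts_composable[OF p, of n ?k 0] lt kL b n by (auto simp: us_def cuts_def less_imp_le)
 have nth: "us ! i = sub p (?k i) (?k (Suc i))" if "i < n" for i using that by (simp add: us_def cuts_def)
 have two: "pconcat [us ! i, us ! Suc i] = sub p (?k i) (?k (Suc (Suc i)))" if "Suc i < n" for i
  using that nth[of i] nth[of "Suc i"] sub_cat[of "?k i" "?k (Suc i)" "?k (Suc (Suc i))" p] lt[of i] lt[of "Suc i"]
  by (simp add: pconcat2 less_imp_le)
 have f1: "plen (us ! 0) = 1" using nth[of 0] n kL[of 1] plen_sub[of a "Suc a" p] by simp
 have f2: "us ! i : irr Q S" if "0 < i & i < n" for i
  using nth[of i] that lt[of i] lt[of "Suc i"] kL[of "Suc i"] irr_sub_iff[OF p, of "?k i" "?k (Suc i)"] by (simp add: cut.simps)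
 have f3: "pconcat [us ! i, us ! Suc i] ~: irr Q S" if "Suc i < n" for i
  using two[OF that] that lt[of i] lt[of "Suc i"] kL[of "Suc (Suc i)"]
  irr_sub_iff[OF p, of "?k i" "?k (Suc (Suc i))"] by (simp add: cut.simps)
 have f4: "pconcat [us ! i, d] : irr Q S"
  if "Suc i < n & composable Q [d, e] & pconcat [d, e] = us ! Suc i & plen e > 0" for i d e proof -
  let ?x = "?k i" and ?y = "?k (Suc i)" and ?z = "?k (Suc (Suc i))"
  have xyz: "?x <= ?y" "?y <= ?z" "?z <= plen p" using that lt[of i] lt[of "Suc i"] kL[of "Suc (Suc i)"] by auto
  have "cat d e = sub p ?y ?z" "tgt Q d = src e" using that nth[of "Suc i"] by (auto simp: pconcat2)
  note s = sub_split[OF p xyz(2,3) this]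
  have "plen e = ?z - (?y + plen d)" using s(1) plen_sub[OF s(1) xyz(3)] s(3) by simp
  hence l: "?y + plen d < ?z" using that by simp
  have "pconcat [us ! i, d] = sub p ?x (?y + plen d)"
  using s(2) nth[of i] that sub_cat[of ?x ?y "?y + plen d" p] xyz by (simp add: pconcat2)
  thus ?thesis using irr_sub_iff[OF p, of ?x "?y + plen d"] l xyz by (simp add: cut.simps)
 qed
 show "sub p a b : chains n" unfolding chains_long[OF n] mem_Collect_eq
  by (intro exI[of _ us] conjI allI impI) (rule us(2)[symmetric] us(1,3) f1 f2 f3 f4, assumption?)+
qed

lemma chain_iff:
 assumes p: "p : paths Q" and ab: "a <= b" "b <= plen p"
 shows "sub p a b : chains n \<longleftrightarrow> b = cut p a n & chain_at p n a" proof -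
 consider "n = 0" | "n = 1" | "n = 2" | "n \<ge> 3" by linarith
 thus ?thesis proof cases
  case 1
  thus ?thesis using sub_path(1)[OF p ab] plen_sub[OF ab] ab by (auto simp: chains_def trivial_paths_def chain_at_def)
 next
  case 2
  have "plen (sub p a b) = 1 \<longleftrightarrow> b = Suc a" using plen_sub[OF ab] ab by auto
  thus ?thesis using 2 sub_path(1)[OF p ab] ab nxt_gt(1)[of a p]
  by (auto simp: chains_def chain_at_def le_Suc_eq cut.simps)
 next
  case 3
  have c2: "chain_at p 2 a \<longleftrightarrow> nxt p a <= plen p & Suc a < nxt p a & nxt p a < nxt p (Suc a)"
  by (auto simp: chain_at_def numeral_2_eq_2 le_Suc_eq cut.simps)
  have same: "i = a & j = b" if s: "sub p a b : S" "sub p i j : S" "a <= i" "i <= j" "j <= b" for i j proof -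
  have "subpath Q (sub p i j) (sub p a b)" using sub_subpath[OF p ab] that by blast
  hence "sub p i j = sub p a b" using S_antichain s by blast
  hence "j - i = b - a" using plen_sub[of i j p] plen_sub[OF ab] s ab by simp
  thus ?thesis using that by auto
  qed
  have "sub p a b : S \<longleftrightarrow> b = nxt p a & nxt p a <= plen p & Suc a < nxt p a & nxt p a < nxt p (Suc a)"
  proof (intro iffI)
  assume s: "sub p a b : S"
  have "nxt p a <= b" using nxt_occ[OF order_refl ab s] .
  moreover obtain i where "a <= i" "i <= nxt p a" "sub p i (nxt p a) : S" using nxt_ex[of p a] calculation ab by auto
  ultimately have n: "b = nxt p a" using same[OF s, of i "nxt p a"] by simp
  have "nxt p (Suc a) > b" proof (rule ccontr)
  assume c: "\<not> b < nxt p (Suc a)"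
  then obtain i where "Suc a <= i" "i <= nxt p (Suc a)" "sub p i (nxt p (Suc a)) : S"
  using nxt_ex[of p "Suc a"] ab by auto
  thus False using same[OF s, of i "nxt p (Suc a)"] c by simp
  qed
  moreover have "a < plen p" using plen_sub[OF ab] S_path(2)[OF s] ab by simp
  ultimately show "b = nxt p a & nxt p a <= plen p & Suc a < nxt p a & nxt p a < nxt p (Suc a)"
  using n ab nxt_gt(1)[of a p] by simp
  next
  assume r: "b = nxt p a & nxt p a <= plen p & Suc a < nxt p a & nxt p a < nxt p (Suc a)"
  then obtain i where i: "a <= i" "i <= nxt p a" "sub p i (nxt p a) : S" using nxt_ex[of p a] by auto
  have "i = a" using nxt_occ[of "Suc a" i "nxt p a" p] i r by (cases "i = a") auto
  thus "sub p a b : S" using i r by simp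
  qed
  thus ?thesis using 3 c2 by (auto simp: chains_def numeral_2_eq_2 cut.simps)
 next
  case 4
  thus ?thesis using chain_iff_long[OF p ab] by blast
 qed
qed

subsection \<open>Chains in a path that starts with a chain\<close>

text \<open>
 For even \<open>n\<close> the cut points of index \<open>n\<close> are a monotone function of the starting point, and the
 chains of length \<open>n\<close> sit at its jumps.  The hypotheses cover a chain followed by an irreducible path as
 well as a chain of length \<open>n + 2\<close> .
\<close>

context
 fixes p :: "('v, 'e) path" and n :: nat
 assumes even: "even n" and c0: "chain_at p n 0" and last: "plen p < cut p 0 (Suc (Suc n)) \<or>
  chain_at p (Suc (Suc n)) 0 & plen p < cut p 0 (Suc (Suc (Suc n)))"
begin

lemma cut_step: "[| 0 < y; cut p y n <= plen p; odd k; k < n |] ==> cut p y k < cut p y (Suc k)" proof -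
 assume y: "0 < y" "cut p y n <= plen p" and k: "odd k" "k < n"
 then obtain j where j: "k = Suc j" "even j" by (auto elim: oddE)
 have e: "cut p y k = cut p (Suc y) j" using j cut_shift by simp
 have 1: "cut p 1 (Suc k) <= cut p y (Suc k)" using y by (intro cut_mono) simp
 have s1: "cut p 1 (Suc k) = cut p 0 (Suc (Suc k))" using k(1) cut_shift[of "Suc k" p 0] by simp
 have lt: "cut p 0 (Suc k) < cut p 0 (Suc (Suc k))" using c0 k by (auto simp: chain_at_def)
 show ?thesis proof (cases "y < nxt p 0")
  case True
  hence "cut p (Suc y) j <= cut p (nxt p 0) j" by (intro cut_mono) simp
  also have "\<dots> = cut p 0 (Suc k)" using j cut_nxt by simp
  finally show ?thesis using e lt s1 1 by simp
 next
  case False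
  hence "cut p (nxt p 0) n <= cut p y n" by (intro cut_mono) simp
  hence "cut p 0 (Suc (Suc n)) <= plen p" using y even cut_nxt by simp
  hence l: "chain_at p (Suc (Suc n)) 0" "plen p < cut p 0 (Suc (Suc (Suc n)))" using last by auto
  have "y < nxt p 1" proof (rule ccontr)
  assume "\<not> y < nxt p 1"
  hence "cut p (nxt p 1) n <= cut p y n" by (intro cut_mono) simp
  hence "cut p 1 (Suc (Suc n)) <= plen p" using y(2) cut_nxt[OF even, of p 1] by simp
  thus False using l(2) cut_shift[of "Suc (Suc n)" p 0] even by simp
  qed
  hence "cut p (Suc y) j <= cut p (nxt p 1) j" by (intro cut_mono) simp
  also have "\<dots> = cut p 0 (Suc (Suc k))" using j cut_nxt[of j p 1] s1 by simp
  also have "\<dots> < cut p 0 (Suc (Suc (Suc k)))" using l(1) k by (auto simp: chain_at_def)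
  also have "\<dots> = cut p (nxt p 0) (Suc k)" using j cut_nxt[of "Suc k" p 0] k by simp
  also have "\<dots> <= cut p y (Suc k)" using False by (intro cut_mono) simp
  finally show ?thesis using e by simp
 qed
qed

lemma jumps_hyps: "x <= y ==> cut p x n <= cut p y n" "cut p x n <= plen p ==> x <= plen p"
 by (rule cut_mono cut_bound, assumption)+

lemmas jd = jumps_def[OF jumps_hyps]

lemma chain_at_even: "chain_at p n y \<longleftrightarrow> y : jumps (%y. cut p y n) (plen p)" proof
 assume "chain_at p n y"
 thus "y : jumps (%y. cut p y n) (plen p)" using cut_shift[OF even, of p y] by (simp add: chain_at_def jd)
next
 assume j: "y : jumps (%y. cut p y n) (plen p)"
 show "chain_at p n y" proof (cases "y = 0")
  case False
  have "cut p y k < cut p y (Suc k)" if k: "k <= n" for k proof (cases "even k")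
  case True
  have "cut p y k ~= cut p (Suc y) k" proof
  assume eq: "cut p y k = cut p (Suc y) k"
  have "cut p y (k + 2 * d) = cut p (Suc y) (k + 2 * d)" for d
  by (induction d) (use eq in \<open>auto simp: cut.simps\<close>)
  from this[of "(n - k) div 2"] have "cut p y n = cut p (Suc y) n" using k True even by simp
  thus False using j by (simp add: jd)
  qed
  thus ?thesis using cut_mono[of y "Suc y" p k] cut_shift[OF True] by simp
  next
  case odd: False
  hence "k < n" using k even by (cases "k = n") auto
  thus ?thesis using cut_step[of y k] False j odd by (simp add: jd)
  qed
  thus ?thesis using j by (simp add: chain_at_def jd)
 qed (simp add: c0)
qed

lemma chain_at_even_Suc: "chain_at p (Suc n) y \<longleftrightarrow> chain_at p n y & cut p (Suc y) n <= plen p" proof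
 assume "chain_at p (Suc n) y"
 thus "chain_at p n y & cut p (Suc y) n <= plen p"
  using chain_at_Suc cut_shift[OF even, of p y] by (auto simp: chain_at_def)
next
 assume a: "chain_at p n y & cut p (Suc y) n <= plen p"
 have "cut p y (Suc n) < cut p y (Suc (Suc n))" proof (cases "y = 0 & chain_at p (Suc (Suc n)) 0")
  case True
  thus ?thesis by (simp add: chain_at_def)
 next
  case False
  have "plen p < cut p y (Suc (Suc n))" proof (cases "plen p < cut p 0 (Suc (Suc n))")
  case True
  thus ?thesis using cut_mono[of 0 y p "Suc (Suc n)"] by simp
  next
  case F: False
  hence "y \<ge> 1" "plen p < cut p 0 (Suc (Suc (Suc n)))" using last False by auto
  thus ?thesis using cut_mono[of 1 y p "Suc (Suc n)"] cut_shift[of "Suc (Suc n)" p 0] even by simp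
  qed
  thus ?thesis using a cut_shift[OF even, of p y] by simp
 qed
 thus "chain_at p (Suc n) y"
  using a cut_shift[OF even, of p y] unfolding chain_at_def by (auto simp: le_Suc_eq simp del: cut.simps)
qed

lemma finite_chains_even: "finite {a. chain_at p n a}"
 unfolding chain_at_even using finite_jumps[OF jumps_hyps] by simp

abbreviation (input) "lastc \<equiv> Max {a. chain_at p n a}"

lemma last_chain: "chain_at p n lastc" "plen p < cut p (Suc lastc) n" proof -
 have ne: "{a. chain_at p n a} ~= {}" using c0 by auto
 show "chain_at p n lastc" using Max_in[OF finite_chains_even ne] by simp
 thus "plen p < cut p (Suc lastc) n" using not_last_jump[OF jumps_hyps] ne unfolding chain_at_even by fastforce
qed

text \<open>
 The chains of the next length sit at the jumps of the end point as a function of the starting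
 point.  Each joins two consecutive chains of length \<open>n\<close>, and only the first and the last one survive.
\<close>
lemma chain_telescope:
 assumes "abelian_group H" "!!a. chain_at p n a ==> f a : carrier H"
 shows "(\<Oplus>\<^bsub>H\<^esub>a\<in>{a. chain_at p (Suc n) a}.
  f (Max {b. a <= b & chain_at p n b & cut p b n <= cut p a (Suc n)}) -[H] f a) =
  f lastc -[H] f 0" proof -
 interpret H: abelian_group H by fact
 let ?g = "%y. cut p y n"
 have J: "{a. chain_at p n a} = jumps ?g (plen p)" using chain_at_even by auto
 have 0: "0 : jumps ?g (plen p)" using c0 chain_at_even by simp
 have ne: "jumps ?g (plen p) ~= {}" using 0 by auto
 have J1: "{a. chain_at p (Suc n) a} = jumps ?g (plen p) - {lastc}"
  using not_last_jump[OF jumps_hyps ne] by (auto simp: chain_at_even_Suc J[symmetric])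
 have R: "Max {b. a <= b & chain_at p n b & cut p b n <= cut p a (Suc n)} = next_jump ?g (plen p) a" for a proof -
  have "next_jump ?g (plen p) a = Max {b\<in>jumps ?g (plen p). a <= b & cut p b n <= cut p (Suc a) n}"
  by (rule next_jump_def[OF jumps_hyps])
  also have "{b\<in>jumps ?g (plen p). a <= b & cut p b n <= cut p (Suc a) n} =
  {b. a <= b & chain_at p n b & cut p b n <= cut p a (Suc n)}" using J cut_shift[OF even, of p a] by auto
  finally show ?thesis ..
 qed
 have M: "Max (jumps ?g (plen p)) = lastc" by (simp only: J)
 have l: "lastc : jumps ?g (plen p)" using last_chain(1) J by blast
 show ?thesis unfolding J1 R
  by (rule H.telescope[OF finite_jumps[OF jumps_hyps] 0 l next_jump_bij[OF jumps_hyps 0, unfolded M]])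
  (assumption | rule assms(2), simp only: chain_at_even)+
qed

end

section \<open>The differential and the homotopy of the associated monomial algebra\<close>

definition chains_in :: "nat => ('v, 'e) path => nat => nat => nat set" where
 "chains_in n p i j = {a. i <= a & chain_at p n a & cut p a n <= j}"

definition Fgen where
 "Fgen n p i j a = Ppure n (pi (sub p i a)) (ppath (sub p a (cut p a n))) (pi (sub p (cut p a n) j))"

abbreviation Fel where "Fel n p a \<equiv> Fgen n p 0 (plen p) a"

lemma finite_chains_in: "finite (chains_in n p i j)"
 by (rule finite_subset[of _ "{..plen p}"]) (auto simp: chains_in_def dest: chain_at_start)

lemma chain_at_cut: "chain_at p n a ==> a <= cut p a n" "chain_at p n a ==> cut p a n <= plen p"
 using cut_ge[of p n a n] by (auto simp: chain_at_def)

lemma chain_path_cut: "[| p : paths Q; chain_at p n a |] ==> sub p a (cut p a n) : chains n"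
 using chain_iff[of p a "cut p a n" n] chain_at_cut[of p n a] by simp

context
 fixes p :: "('v, 'e) path" and i j n :: nat
 assumes p: "p : paths Q" and ij: "i <= j" "j <= plen p"
begin

lemma occs_sub:
 "occs n (sub p i j) = (%a. (sub p i a, sub p a (cut p a n), sub p (cut p a n) j)) ` chains_in n p i j"
proof (intro equalityI subsetI)
 fix t assume "t : occs n (sub p i j)"
 then obtain q w r where t: "t = (q, w, r)" "composable Q [q, w, r] & pconcat [q, w, r] = sub p i j" "w : chains n"
  unfolding occs_def by blast
 then obtain a b where ab: "i <= a" "a <= b" "b <= j" "q = sub p i a" "w = sub p a b" "r = sub p b j"
  unfolding sub_split3[OF p ij] by blast
 hence "b = cut p a n & chain_at p n a" using t(3) chain_iff[OF p, of a b n] ij by simp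
 thus "t : (%a. (sub p i a, sub p a (cut p a n), sub p (cut p a n) j)) ` chains_in n p i j"
  using ab t(1) by (auto simp: chains_in_def)
next
 fix t assume "t : (%a. (sub p i a, sub p a (cut p a n), sub p (cut p a n) j)) ` chains_in n p i j"
 then obtain a where a: "i <= a" "chain_at p n a" "cut p a n <= j"
  "t = (sub p i a, sub p a (cut p a n), sub p (cut p a n) j)" by (auto simp: chains_in_def)
 have "\<exists>a' b. i <= a' & a' <= b & b <= j & sub p i a = sub p i a' & sub p a (cut p a n) = sub p a' b & sub p (cut p a n) j = sub p b j" using a chain_at_cut by blast
 thus "t : occs n (sub p i j)"
  using a chain_path_cut[OF p a(2)] unfolding occs_def sub_split3[OF p ij, symmetric] by blast
qed

lemma Fgen_between:
 assumes "i <= a" "chain_at p n a" "cut p a n <= j"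
 shows "Fgen n p i j a : between (P n) (vt p i) (vt p j)" proof -
 let ?b = "cut p a n"
 have l: "a <= ?b" "?b <= plen p" using chain_at_cut assms by auto
 have s: "sub p i a : paths Q" "sub p ?b j : paths Q" "sub p a ?b : chains n"
  "tgt Q (sub p ?b j) = vt p j" using sub_path[OF p] l ij assms chain_path_cut[OF p] by auto
 have v: "vtx (vt p i) : paths Q" "vtx (vt p j) : paths Q" using vt_vert[OF p] ij by (auto intro!: vtx_path)
 have "pi (vtx (vt p i)) ** pi (sub p i a) = pi (sub p i a)" using pi_cat[OF v(1) s(1)] by (simp add: pair_sub)
 moreover have "pi (sub p ?b j) ** pi (vtx (vt p j)) = pi (sub p ?b j)"
  using pi_cat[OF s(2) v(2)] s(4) by (simp add: pair_sub src_def)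
 ultimately show ?thesis using s v by (simp add: between_def Fgen_def Ppure_in Ppure_lact Ppure_ract pi_in pp_span)
qed

lemma Fgen_in: "[| i <= a; chain_at p n a; cut p a n <= j |] ==> Fgen n p i j a : cP n"
 using Fgen_between by (simp add: between_def)

lemma split_sum_image:
 assumes "B <= chains_in n p i j"
 shows "split_sum n ((%a. (sub p i a, sub p a (cut p a n), sub p (cut p a n) j)) ` B) =
  (\<Oplus>\<^bsub>P n\<^esub>a\<in>B. Fgen n p i j a)" proof -
 interpret P: abelian_group "P n" by (rule grP)
 let ?f = "%a. (sub p i a, sub p a (cut p a n), sub p (cut p a n) j)"
 have "inj_on ?f B" proof (rule inj_onI)
  fix a b assume ab: "a : B" "b : B" "?f a = ?f b"
  hence "a : chains_in n p i j" "b : chains_in n p i j" using assms by blast+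
  hence "i <= a" "a <= plen p" "i <= b" "b <= plen p"
  using chain_at_start[of p n a] chain_at_start[of p n b] by (simp_all add: chains_in_def)
  hence "plen (sub p i a) = a - i" "plen (sub p i b) = b - i" by (simp_all add: plen_sub)
  thus "a = b" using ab `i <= a` `i <= b` by simp
 qed
 moreover have "Fgen n p i j a : cP n" if "a : B" for a using that assms by (auto simp: chains_in_def intro: Fgen_in)
 ultimately show ?thesis unfolding split_sum_def by (subst P.finsum_reindex) (auto simp: Fgen_def[abs_def])
qed

lemma split_sub: "split n (sub p i j) = (\<Oplus>\<^bsub>P n\<^esub>a\<in>chains_in n p i j. Fgen n p i j a)"
 unfolding split_def occs_sub by (rule split_sum_image) simp

lemma splitR_sub:
 assumes "chains_in n p i j ~= {}"
 shows "splitR n (sub p i j) = Fgen n p i j (Max (chains_in n p i j))"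
  "splitL n (sub p i j) = Fgen n p i j (Min (chains_in n p i j))" proof -
 interpret P: abelian_group "P n" by (rule grP)
 let ?f = "%a. (sub p i a, sub p a (cut p a n), sub p (cut p a n) j)"
 let ?O = "chains_in n p i j"
 have l: "plen (sub p i a) = a - i & i <= a" if "a : ?O" for a
  using that chain_at_start[of p n a] by (simp add: chains_in_def plen_sub)
 have m: "Max ?O : ?O" "Min ?O : ?O" using finite_chains_in assms by auto
 have c: "Fgen n p i j a : cP n" if "a : ?O" for a using that by (auto simp: chains_in_def intro: Fgen_in)
 have sel: "{(q, w, r)\<in>?f ` ?O. \<forall>(q', w', r')\<in>?f ` ?O. le (plen q') (plen q)} = ?f ` {M}"
  if M: "M : ?O" "!!a. a : ?O ==> (\<forall>b\<in>?O. le (b - i) (a - i)) \<longleftrightarrow> a = M" for le :: "nat => nat => bool" and M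
 proof -
  have "(q, w, r) : ?f ` ?O & (\<forall>b\<in>?O. le (plen (sub p i b)) (plen q)) \<longleftrightarrow> (q, w, r) : ?f ` {M}" for q w r
  proof
  assume a: "(q, w, r) : ?f ` ?O & (\<forall>b\<in>?O. le (plen (sub p i b)) (plen q))"
  then obtain a where a': "a : ?O" "(q, w, r) = ?f a" by blast
  hence "\<forall>b\<in>?O. le (b - i) (a - i)" using a l by simp
  thus "(q, w, r) : ?f ` {M}" using a' M(2) by simp
  next
  assume "(q, w, r) : ?f ` {M}"
  thus "(q, w, r) : ?f ` ?O & (\<forall>b\<in>?O. le (plen (sub p i b)) (plen q))" using M(1) M(2)[OF M(1)] l by simp
  qed
  thus ?thesis by (simp add: set_eq_iff)
 qed
 have "{(q, w, r)\<in>occs n (sub p i j). \<forall>(q', w', r')\<in>occs n (sub p i j). plen q' <= plen q} = ?f ` {Max ?O}"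
  unfolding occs_sub proof (rule sel[of "Max ?O" "(\<le>)", OF m(1)])
  show "(\<forall>b\<in>?O. b - i <= a - i) \<longleftrightarrow> a = Max ?O" if "a : ?O" for a
  using that l m finite_chains_in[of n p i j] Max_ge[of ?O] Max_eqI[of ?O a] by (metis diff_le_mono le_diff_iff)
 qed
 thus "splitR n (sub p i j) = Fgen n p i j (Max ?O)"
  unfolding splitR_def using split_sum_image[of "{Max ?O}"] m c[OF m(1)] by simp
 have "{(q, w, r)\<in>occs n (sub p i j). \<forall>(q', w', r')\<in>occs n (sub p i j). plen q <= plen q'} = ?f ` {Min ?O}"
  unfolding occs_sub proof (rule sel[of "Min ?O" "%x y. y <= x", OF m(2)])
  show "(\<forall>b\<in>?O. a - i <= b - i) \<longleftrightarrow> a = Min ?O" if "a : ?O" for a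
  using that l m finite_chains_in[of n p i j] Min_le[of ?O] Min_eqI[of ?O a] by (metis diff_le_mono le_diff_iff)
 qed
 thus "splitL n (sub p i j) = Fgen n p i j (Min ?O)"
  unfolding splitL_def using split_sum_image[of "{Min ?O}"] m c[OF m(2)] by simp
qed

lemma Fgen_wrap:
 assumes "i <= a" "chain_at p n a" "cut p a n <= j"
 shows "lact (P n) (pi (sub p 0 i)) (ract (P n) (Fgen n p i j a) (pi (sub p j (plen p)))) = Fel n p a" proof -
 let ?b = "cut p a n"
 have l: "a <= ?b" "?b <= plen p" using chain_at_cut assms by auto
 have s: "sub p i a : paths Q" "sub p ?b j : paths Q" "sub p a ?b : chains n" "sub p 0 i : paths Q"
  "sub p j (plen p) : paths Q" "sub p ?b (plen p) : paths Q" "tgt Q (sub p ?b j) = vt p j" "tgt Q (sub p 0 i) = vt p i"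
  using sub_path[OF p] l ij assms chain_path_cut[OF p] by auto
 have "pi (sub p 0 i) ** pi (sub p i a) = pi (sub p 0 a)"
  using pi_cat[OF s(4,1)] s(8) sub_cat[of 0 i a p] assms by simp
 moreover have "pi (sub p ?b j) ** pi (sub p j (plen p)) = pi (sub p ?b (plen p))"
  using pi_cat[OF s(2,5)] s(7) sub_cat[of ?b j "plen p" p] assms ij by simp
 ultimately show ?thesis using s by (simp add: Fgen_def Ppure_ract Ppure_lact pi_in pp_span)
qed

end

lemma P0_vertex:
 assumes "u : paths Q"
 shows "Ppure 0 (pi u) (scalar Q 1) \<one>[A] = Ppure 0 (pi u) (ppath (vtx (tgt Q u))) (pi (vtx (tgt Q u)))"
  "Ppure 0 \<one>[A] (scalar Q 1) (pi u) = Ppure 0 (pi (vtx (src u))) (ppath (vtx (src u))) (pi u)" proof -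
 have c0: "path_span (chains 0) = K" by (simp add: chains_def)
 note [simp] = pi_in[OF assms]
 have mm: "pmult Q (ppath v) (scalar Q 1) = (ppath v :: ('v, 'e, 'k) pathalg)"
  "pmult Q (scalar Q 1) (ppath v) = (ppath v :: ('v, 'e, 'k) pathalg)"
  if "v : paths Q" for v using that by (simp_all add: scalar_mult_single)
 have e: "ppath (vtx v) : K" "vtx v : paths Q" "pmult Q (ppath (vtx v)) (ppath (vtx v)) = (ppath (vtx v) :: ('v, 'e, 'k) pathalg)"
  if "v : verts Q" for v using that by (auto simp: path_span_def trivial_iff pmult_single src_def vtx_path)
 let ?t = "tgt Q u" and ?s = "src u"
 note et = e[OF path_ends(2)[OF assms]] and es = e[OF path_ends(1)[OF assms]]
 have u: "pi u ** pi (vtx ?t) = pi u" "pi (vtx ?s) ** pi u = pi u"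
  using pi_cat[OF assms et(2)] pi_cat[OF es(2) assms] by (simp_all add: src_def)
 have "Ppure 0 (pi u) (scalar Q 1) \<one>[A] = Ppure 0 (pi u ** pi (vtx ?t)) (scalar Q 1) \<one>[A]" using u by simp
 also have "\<dots> = Ppure 0 (pi u) (pmult Q (ppath (vtx ?t)) (ppath (vtx ?t))) \<one>[A]"
  using et by (simp add: Ppure_K(1) c0 scalar_K mm)
 also have "\<dots> = Ppure 0 (pi u) (ppath (vtx ?t)) (pi (vtx ?t))"
  using Ppure_K(2)[of "pi u" "ppath (vtx ?t)" 0 "\<one>[A]" "ppath (vtx ?t)"] et by (simp add: c0 pi_in)
 finally show "Ppure 0 (pi u) (scalar Q 1) \<one>[A] = Ppure 0 (pi u) (ppath (vtx ?t)) (pi (vtx ?t))" .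
 have "Ppure 0 \<one>[A] (scalar Q 1) (pi u) = Ppure 0 \<one>[A] (scalar Q 1) (pi (vtx ?s) ** pi u)" using u by simp
 also have "\<dots> = Ppure 0 \<one>[A] (pmult Q (ppath (vtx ?s)) (ppath (vtx ?s))) (pi u)"
  using es by (simp add: Ppure_K(2)[symmetric] c0 scalar_K mm)
 also have "\<dots> = Ppure 0 (pi (vtx ?s)) (ppath (vtx ?s)) (pi u)"
  using Ppure_K(1)[of "\<one>[A]" "ppath (vtx ?s)" 0 "pi u" "ppath (vtx ?s)"] es by (simp add: c0 pi_in)
 finally show "Ppure 0 \<one>[A] (scalar Q 1) (pi u) = Ppure 0 (pi (vtx ?s)) (ppath (vtx ?s)) (pi u)" .
qed

subsection \<open>The differential\<close>

definition dgen :: "nat => ('v, 'e) path => ('v, 'e, 'k) tens" where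
 "dgen n w = (if n = 1 then Ppure 0 (proj (ppath w)) (scalar Q 1) \<one>[A]
  \<ominus>\<^bsub>P 0\<^esub> Ppure 0 \<one>[A] (scalar Q 1) (proj (ppath w))
  else if odd n then splitR (n - 1) w -[P (n - 1)] splitL (n - 1) w
  else split (n - 1) w)"

lemma delta_dgen: "\<delta> n = P_bilift (P (n - 1)) (dgen n)" unfolding \<delta>_def dgen_def[abs_def] ..

lemma chains_in_start:
 assumes "chain_at p (Suc n) i"
 shows "i : chains_in n p i (cut p i (Suc n))" "Min (chains_in n p i (cut p i (Suc n))) = i" proof -
 have "cut p i n <= cut p i (Suc n)" using assms by (simp add: chain_at_def less_imp_le)
 thus "i : chains_in n p i (cut p i (Suc n))" using chain_at_Suc[OF assms] by (simp add: chains_in_def)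
 thus "Min (chains_in n p i (cut p i (Suc n))) = i"
  using finite_chains_in by (intro Min_eqI) (auto simp: chains_in_def)
qed

lemma dgen_sub:
 assumes p: "p : paths Q" and c: "chain_at p (Suc n) i" defines "j \<equiv> cut p i (Suc n)"
 shows "dgen (Suc n) (sub p i j) = (if even n
  then Fgen n p i j (Max (chains_in n p i j)) -[P n] Fgen n p i j i
  else (\<Oplus>\<^bsub>P n\<^esub>a\<in>chains_in n p i j. Fgen n p i j a))" proof -
 have ij: "i <= j" "j <= plen p" using chain_at_cut[OF c] by (simp_all add: j_def)
 have s: "i : chains_in n p i j" "Min (chains_in n p i j) = i" using chains_in_start[OF c] by (simp_all add: j_def)
 show ?thesis proof (cases "n = 0")
  case True
  hence j: "j = Suc i" by (simp add: j_def)
  hence "chains_in n p i j = {i, j}" using ij True by (auto simp: chains_in_def chain_at_def le_Suc_eq)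
  hence "Max (chains_in n p i j) = j" using j by simp
  moreover have "tgt Q (sub p i j) = vt p j" using sub_path(2)[OF p ij] .
  ultimately show ?thesis using True P0_vertex[OF sub_path(1)[OF p ij]] by (simp add: dgen_def Fgen_def sub_refl)
 next
  case False
  have "chains_in n p i j ~= {}" using s by auto
  thus ?thesis using False s splitR_sub[OF p ij, of n] split_sub[OF p ij, of n] by (simp add: dgen_def)
 qed
qed

lemma chain_self:
 assumes "w : chains n"
 shows "chain_at w n 0" "cut w 0 n = plen w" "w : paths Q"
 using chain_iff[of w 0 "plen w" n] ch_path[OF assms] assms by (simp_all add: sub_all)

lemma dgen_between:
 assumes "w : chains (Suc n)" shows "dgen (Suc n) w : between (P n) (src w) (tgt Q w)" proof -
 note w = chain_self[OF assms]
 have v: "src w = vt w 0" "tgt Q w = vt w (plen w)"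
  using sub_fst(1)[of w 0 "plen w"] sub_path(2)[OF w(3), of 0 "plen w"] by (simp_all add: sub_all)
 have vv: "vt w 0 : verts Q" "vt w (plen w) : verts Q" using vt_vert[OF w(3)] by auto
 let ?O = "chains_in n w 0 (plen w)"
 have b: "Fgen n w 0 (plen w) a : between (P n) (vt w 0) (vt w (plen w))" if "a : ?O" for a
  using that by (intro Fgen_between[OF w(3)]) (auto simp: chains_in_def)
 have "0 : ?O" using chains_in_start(1)[OF w(1)] w(2) by simp
 moreover have "Max ?O : ?O" using calculation finite_chains_in by (intro Max_in) auto
 ultimately show ?thesis using dgen_sub[OF w(3,1)] b unfolding v
  by (auto simp: w(2) sub_all intro!: between_minus[OF bim_P vv] between_sum[OF bim_P vv])
qed

lemma delta_bhom: "\<delta> (Suc n) : bhom (P (Suc n)) (P n)"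
 unfolding delta_dgen using P_bilift(1)[OF bim_P, of "Suc n" "dgen (Suc n)" n] dgen_between by simp

lemma delta_pure:
 assumes "a : cA" "w : chains (Suc n)" "b : cA"
 shows "\<delta> (Suc n) (Ppure (Suc n) a (ppath w) b) = lact (P n) a (ract (P n) (dgen (Suc n) w) b)"
 unfolding delta_dgen using P_bilift(2)[OF bim_P _ assms, of "dgen (Suc n)" n] dgen_between by simp

lemma delta_Fel:
 assumes p: "p : paths Q" and c: "chain_at p (Suc n) i" defines "B \<equiv> chains_in n p i (cut p i (Suc n))"
 shows "\<delta> (Suc n) (Fel (Suc n) p i) =
  (if even n then Fel n p (Max B) -[P n] Fel n p i else (\<Oplus>\<^bsub>P n\<^esub>a\<in>B. Fel n p a))" proof -
 let ?j = "cut p i (Suc n)"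
 have ij: "i <= ?j" "?j <= plen p" using chain_at_cut[OF c] by simp_all
 have s: "sub p 0 i : paths Q" "sub p ?j (plen p) : paths Q" "sub p i ?j : chains (Suc n)"
  using sub_path(1)[OF p] ij chain_path_cut[OF p c] by auto
 have B: "i <= a" "chain_at p n a" "cut p a n <= ?j" if "a : B" for a using that by (auto simp: B_def chains_in_def)
 have iB: "i : B" using chains_in_start[OF c] by (simp add: B_def)
 hence MB: "Max B : B" using finite_chains_in by (intro Max_in) (auto simp: B_def)
 have cl: "Fgen n p i ?j a : cP n" if "a : B" for a using Fgen_in[OF p ij B[OF that]] .
 have cl': "ract (P n) (Fgen n p i ?j a) (pi (sub p ?j (plen p))) : cP n" if "a : B" for a
  using cl[OF that] s by (simp add: bimD(13)[OF bim_P] pi_in)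
 have "\<delta> (Suc n) (Fel (Suc n) p i) =
  lact (P n) (pi (sub p 0 i)) (ract (P n) (dgen (Suc n) (sub p i ?j)) (pi (sub p ?j (plen p))))"
  using delta_pure[of "pi (sub p 0 i)" "sub p i ?j" n "pi (sub p ?j (plen p))"] s by (simp add: Fgen_def pi_in)
 also have "\<dots> = (if even n then Fel n p (Max B) -[P n] Fel n p i else (\<Oplus>\<^bsub>P n\<^esub>a\<in>B. Fel n p a))"
 proof (cases "even n")
  case True
  thus ?thesis unfolding dgen_sub[OF p c] B_def[symmetric]
  using cl[OF MB] cl[OF iB] cl'[OF MB] cl'[OF iB] s Fgen_wrap[OF p ij B[OF MB]] Fgen_wrap[OF p ij B[OF iB]]
  by (simp add: act_minus[OF bim_P] pi_in)
 next
  case False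
  have "lact (P n) (pi (sub p 0 i)) (ract (P n) (\<Oplus>\<^bsub>P n\<^esub>a\<in>B. Fgen n p i ?j a) (pi (sub p ?j (plen p)))) =
  (\<Oplus>\<^bsub>P n\<^esub>a\<in>B. lact (P n) (pi (sub p 0 i)) (ract (P n) (Fgen n p i ?j a) (pi (sub p ?j (plen p)))))"
  using cl cl' s by (simp add: ract_sum[OF bim_P] lact_sum[OF bim_P] pi_in)
  also have "\<dots> = (\<Oplus>\<^bsub>P n\<^esub>a\<in>B. Fel n p a)" proof -
  interpret P: abelian_group "P n" by (rule grP)
  show ?thesis using Fgen_wrap[OF p ij B] cl' s
  by (intro P.finsum_cong' refl) (auto simp: Fgen_in[OF p] B pi_in chain_at_cut)
  qed
  finally show ?thesis unfolding dgen_sub[OF p c] B_def[symmetric] using False by simp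
 qed
 finally show ?thesis .
qed

subsection \<open>The homotopy\<close>

definition sgn_P where "sgn_P n x = (if even n then x else \<ominus>\<^bsub>P n\<^esub> x)"

lemma between_neg:
 assumes "x : between (P n) u v" "u : verts Q" "v : verts Q" shows "sgn_P n x : between (P n) u v" proof -
 interpret P: abelian_group "P n" by (rule grP)
 have x: "x : cP n" using assms by (simp add: between_def)
 show ?thesis using assms x ahom_neg[OF grP grP bimD(2)[OF bim_P pi_in[OF vtx_path[OF assms(2)]]] x]
  ahom_neg[OF grP grP bimD(3)[OF bim_P pi_in[OF vtx_path[OF assms(3)]]] x]
  by (auto simp: sgn_P_def between_def pi_in vtx_path)
qed

lemma split_between:
 assumes "p : paths Q" shows "split n p : between (P n) (src p) (tgt Q p)" proof -
 have v: "src p = vt p 0" "tgt Q p = vt p (plen p)"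
  using sub_fst(1)[of p 0 "plen p"] sub_path(2)[OF assms, of 0 "plen p"] by (simp_all add: sub_all)
 have vv: "vt p 0 : verts Q" "vt p (plen p) : verts Q" using vt_vert[OF assms] by auto
 show ?thesis using split_sub[OF assms, of 0 "plen p" n] unfolding v
  by (auto simp: sub_all chains_in_def intro!: between_sum[OF bim_P vv] Fgen_between[OF assms])
qed

definition gsplit :: "nat => ('v, 'e) path => ('v, 'e) path => ('v, 'e, 'k) tens" where
 "gsplit n w u = [((-1::int) ^ Suc n)] \<cdot>\<^bsub>P (Suc n)\<^esub> split (Suc n) (pconcat [w, u])"

lemma gsplit_eq:
 assumes "w : paths Q" "u : paths Q" "tgt Q w = src u"
 shows "gsplit n w u = sgn_P (Suc n) (split (Suc n) (cat w u))"
  "gsplit n w u : between (P (Suc n)) (src w) (tgt Q u)" proof -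
 interpret P: abelian_group "P (Suc n)" by (rule grP)
 note c = cat_paths[OF assms]
 have s: "split (Suc n) (cat w u) : between (P (Suc n)) (src w) (tgt Q u)" using split_between[OF c(1)] c(2) by simp
 thus 1: "gsplit n w u = sgn_P (Suc n) (split (Suc n) (cat w u))"
  by (simp only: gsplit_def pconcat2 sgn_P_def) (rule P.sign_mult, simp add: between_def)
 show "gsplit n w u : between (P (Suc n)) (src w) (tgt Q u)"
  unfolding 1 using s path_ends assms by (intro between_neg) auto
qed

definition ggen where
 "ggen n a w b = (\<Oplus>\<^bsub>P (Suc n)\<^esub>u\<in>{u\<in>keys (nf b). tgt Q w = src u}.
  lact (P (Suc n)) (a ** kk (lookup (nf b) u)) (gsplit n w u))"

lemma gamma_ggen: "\<gamma> n = P_lift (P (Suc n)) (ggen n)" unfolding \<gamma>_def ggen_def[abs_def] gsplit_def ..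

lemma nf_keys: "b : cA ==> keys (nf b) <= irr Q S" using nf_irr by (simp add: path_span_def)

lemma ggen_super:
 assumes "w : chains n" "a : cA" "b : cA" "finite T" "keys (nf b) <= T" "T <= irr Q S"
 shows "ggen n a w b = (\<Oplus>\<^bsub>P (Suc n)\<^esub>u\<in>{u\<in>T. tgt Q w = src u}.
  lact (P (Suc n)) (a ** kk (lookup (nf b) u)) (gsplit n w u))" proof -
 interpret P: abelian_group "P (Suc n)" by (rule grP)
 have g: "gsplit n w u : cP (Suc n)" if "u : T" "tgt Q w = src u" for u
  using gsplit_eq(2)[OF ch_path[OF assms(1)] irr_path that(2)] that(1) assms(6) by (auto simp: between_def)
 show ?thesis unfolding ggen_def proof (rule P.add.finprod_mono_neutral_cong_left)
  fix u assume u: "u : {u\<in>T. tgt Q w = src u} - {u\<in>keys (nf b). tgt Q w = src u}"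
  hence "kk (lookup (nf b) u) = \<zero>[A]" by (auto simp: in_keys_iff kk_zero)
  thus "lact (P (Suc n)) (a ** kk (lookup (nf b) u)) (gsplit n w u) = \<zero>[P (Suc n)]"
  using g u assms(2) by (simp add: zero_act[OF bim_P])
 qed (use assms g in \<open>auto intro!: bimD(12)[OF bim_P]\<close>)
qed

lemma nf_K2:
 assumes "z : K" "a : cA" shows "nf (a ** proj z) = pmult Q (nf a) z" proof -
 have "a ** proj z = proj (pmult Q (nf a) z)" using assms by (simp add: proj_mult K_carrier nf_carrier proj_nf)
 thus ?thesis using K_mult_span(2)[OF irr_sub assms(1) nf_irr[OF assms(2)]] by (simp add: nf_id)
qed

context
 fixes n w a b
 assumes w: "w : chains n" and a: "a : cA" and b: "b : cA"
begin

lemma gs: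
 assumes "u : irr Q S" "tgt Q w = src u"
 shows "gsplit n w u : between (P (Suc n)) (src w) (tgt Q u)" "gsplit n w u : cP (Suc n)"
  "x : cA ==> lact (P (Suc n)) (x ** kk c) (gsplit n w u) : cP (Suc n)"
 using gsplit_eq(2)[OF ch_path[OF w] irr_path[OF assms(1)] assms(2), of n]
 by (auto simp: between_def bimD(12)[OF bim_P])

end

lemma ggen_act:
 assumes w: "w : chains n" and a: "a : cA" and b: "b : cA"
 shows "ggen n a w b : cP (Suc n)"
  "c : cA ==> lact (P (Suc n)) c (ggen n a w b) = ggen n (c ** a) w b"
  "z : K ==> ract (P (Suc n)) (ggen n a w b) (proj z) = ggen n a w (b ** proj z)" proof -
 interpret P: abelian_group "P (Suc n)" by (rule grP)
 let ?T = "{u\<in>keys (nf b). tgt Q w = src u}"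
 have T: "u : irr Q S" "tgt Q w = src u" if "u : ?T" for u using that nf_keys[OF b] by auto
 note g = gs[OF w a b T]
 have cl: "lact (P (Suc n)) (a ** kk c) (gsplit n w u) : cP (Suc n)" if "u : ?T" for u c
  using gs(3)[OF w a b T[OF that] a] .
 show "ggen n a w b : cP (Suc n)" unfolding ggen_def using cl by (intro P.finsum_closed) auto
 show "lact (P (Suc n)) c (ggen n a w b) = ggen n (c ** a) w b" if c: "c : cA" unfolding ggen_def
  apply (subst lact_sum[OF bim_P c])
  subgoal using cl by blast proof (rule P.finsum_cong'[OF refl])
  show "(%u. lact (P (Suc n)) (c ** a ** kk (lookup (nf b) u)) (gsplit n w u)) : ?T \<rightarrow> cP (Suc n)"
  using gs(3)[OF w a b T] c a by (blast intro: A.m_closed)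
  show "lact (P (Suc n)) c (lact (P (Suc n)) (a ** kk (lookup (nf b) u)) (gsplit n w u)) =
  lact (P (Suc n)) (c ** a ** kk (lookup (nf b) u)) (gsplit n w u)" if "u : ?T" for u
  using g(2)[OF that that] a c by (simp add: bimD(7)[OF bim_P] A.m_assoc)
 qed
 assume z: "z : K"
 let ?b = "b ** proj z"
 have bz: "?b : cA" using b z by (simp add: proj_K_in)
 have l: "lookup (nf ?b) u = lookup (nf b) u * lookup z (vtx (tgt Q u))" for u
  using nf_K2[OF z b] lookup_mult_K[OF z nf_carrier[OF b]] by simp
 have "keys (nf ?b) <= keys (nf b)" by (auto simp: in_keys_iff l)
 hence e: "ggen n a w ?b = (\<Oplus>\<^bsub>P (Suc n)\<^esub>u\<in>?T.
  lact (P (Suc n)) (a ** kk (lookup (nf ?b) u)) (gsplit n w u))"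
  by (rule ggen_super[OF w a bz finite_keys _ nf_keys[OF b]])
 have "ract (P (Suc n)) (lact (P (Suc n)) (a ** kk c) (gsplit n w u)) (proj z) =
  lact (P (Suc n)) (a ** kk (c * lookup z (vtx (tgt Q u)))) (gsplit n w u)" if u: "u : ?T" for u c proof -
  have "ract (P (Suc n)) (gsplit n w u) (proj z) = lact (P (Suc n)) (kk (lookup z (vtx (tgt Q u)))) (gsplit n w u)"
  using g(1)[OF u u] path_ends(2)[OF irr_path[OF T(1)[OF u]]]
  by (intro between_K(2)[OF bim_P _ chain_ends(1)[OF w] _ z]) auto
  thus ?thesis using g(2)[OF u u] a z
  by (simp add: bimD(9)[OF bim_P, symmetric] bimD(7)[OF bim_P] proj_K_in kk_mult A.m_assoc)
 qed
 thus "ract (P (Suc n)) (ggen n a w b) (proj z) = ggen n a w ?b" unfolding e unfolding l ggen_def using cl z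
  by (subst ract_sum[OF bim_P], simp add: proj_K_in, blast, intro P.finsum_cong' refl) auto
qed

lemma ggen_bal: "P_bal n (P (Suc n)) (ggen n)" proof (rule P_balI)
 interpret P: abelian_group "P (Suc n)" by (rule grP)
 fix a w b assume a: "a : cA" and w: "w : chains n" and b: "b : cA"
 let ?T = "{u\<in>keys (nf b). tgt Q w = src u}"
 have T: "u : irr Q S" "tgt Q w = src u" if "u : ?T" for u using that nf_keys[OF b] by auto
 show "ggen n a w b : cP (Suc n)" by (rule ggen_act(1)[OF w a b])
 show "ggen n (a +[A] a') w b = ggen n a w b +[P (Suc n)] ggen n a' w b" if a': "a' : cA" for a' proof -
  have "ggen n (a +[A] a') w b = (\<Oplus>\<^bsub>P (Suc n)\<^esub>u\<in>?T.
  lact (P (Suc n)) (a ** kk (lookup (nf b) u)) (gsplit n w u) +[P (Suc n)]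
  lact (P (Suc n)) (a' ** kk (lookup (nf b) u)) (gsplit n w u))" unfolding ggen_def using a a'
  by (intro P.finsum_cong' refl) (auto simp: A.l_distr bimD(10)[OF bim_P] gs[OF w a b T])
  also have "\<dots> = ggen n a w b +[P (Suc n)] ggen n a' w b"
  unfolding ggen_def using a a' by (intro P.finsum_addf) (auto simp: gs[OF w a b T])
  finally show ?thesis .
 qed
 show "ggen n a w (b +[A] b') = ggen n a w b +[P (Suc n)] ggen n a w b'" if b': "b' : cA" for b' proof -
  let ?K = "keys (nf b) \<union> keys (nf b')"
  have K: "finite ?K" "?K <= irr Q S" using nf_keys b b' by auto
  have k: "keys (nf b) <= ?K" "keys (nf b') <= ?K" "keys (nf (b +[A] b')) <= ?K"
  using keys_add[of "nf b" "nf b'"] nf_add[OF b b'] by auto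
  let ?T' = "{u\<in>?K. tgt Q w = src u}"
  have T': "u : irr Q S" "tgt Q w = src u" if "u : ?T'" for u using that K(2) by auto
  have "ggen n a w (b +[A] b') = (\<Oplus>\<^bsub>P (Suc n)\<^esub>u\<in>?T'.
  lact (P (Suc n)) (a ** kk (lookup (nf (b +[A] b')) u)) (gsplit n w u))"
  using b b' by (intro ggen_super[OF w a _ K(1) k(3) K(2)]) simp
  also have "\<dots> = (\<Oplus>\<^bsub>P (Suc n)\<^esub>u\<in>?T'.
  lact (P (Suc n)) (a ** kk (lookup (nf b) u)) (gsplit n w u) +[P (Suc n)]
  lact (P (Suc n)) (a ** kk (lookup (nf b') u)) (gsplit n w u))" proof (rule P.finsum_cong'[OF refl])
  fix u assume u: "u : ?T'"
  show "lact (P (Suc n)) (a ** kk (lookup (nf (b +[A] b')) u)) (gsplit n w u) =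
  lact (P (Suc n)) (a ** kk (lookup (nf b) u)) (gsplit n w u) +[P (Suc n)]
  lact (P (Suc n)) (a ** kk (lookup (nf b') u)) (gsplit n w u)" using gs(2)[OF w a b T'[OF u]] a
  by (simp add: nf_add[OF b b'] lookup_add kk_add A.r_distr bimD(10)[OF bim_P])
  qed (use gs(3)[OF w a b T' a] in auto)
  also have "\<dots> = (\<Oplus>\<^bsub>P (Suc n)\<^esub>u\<in>?T'. lact (P (Suc n)) (a ** kk (lookup (nf b) u)) (gsplit n w u)) +[P (Suc n)]
  (\<Oplus>\<^bsub>P (Suc n)\<^esub>u\<in>?T'. lact (P (Suc n)) (a ** kk (lookup (nf b') u)) (gsplit n w u))"
  using gs(3)[OF w a b T' a] by (intro P.finsum_addf) auto
  also have "\<dots> = ggen n a w b +[P (Suc n)] ggen n a w b'"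
  using ggen_super[OF w a b K(1) k(1) K(2)] ggen_super[OF w a b' K(1) k(2) K(2)] by simp
  finally show ?thesis .
 qed
 fix z assume z: "z : K"
 have kc: "kk d ** a : cA" for d using a by simp
 show "ggen n (a ** proj z) w b = ggen n (kk (lookup z (vtx (src w))) ** a) w b" unfolding ggen_def
 proof (intro P.finsum_cong' refl)
  let ?d = "kk (lookup z (vtx (src w)))"
  fix u assume u: "u : ?T"
  let ?c = "kk (lookup (nf b) u)" and ?g = "gsplit n w u"
  have g: "?g : cP (Suc n)" using gs(2)[OF w a b T[OF u]] .
  have "lact (P (Suc n)) (proj z) ?g = lact (P (Suc n)) ?d ?g"
  using gs(1)[OF w a b T[OF u]] path_ends(2)[OF irr_path[OF T(1)[OF u]]]
  by (intro between_K(1)[OF bim_P _ chain_ends(1)[OF w] _ z]) auto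
  hence "lact (P (Suc n)) (a ** ?c) (lact (P (Suc n)) (proj z) ?g) =
  lact (P (Suc n)) (a ** ?c) (lact (P (Suc n)) ?d ?g)" by simp
  moreover have "a ** proj z ** ?c = a ** ?c ** proj z"
  using a z kk_central[of "proj z"] by (simp add: A.m_assoc proj_K_in)
  moreover have "?d ** a ** ?c = a ** ?c ** ?d" using a kk_central[of "a ** ?c"] by (simp add: A.m_assoc)
  ultimately show "lact (P (Suc n)) (a ** proj z ** ?c) ?g = lact (P (Suc n)) (?d ** a ** ?c) ?g"
  using g a z by (simp add: bimD(7)[OF bim_P] proj_K_in)
 qed (use gs(3)[OF w a b T kc] in auto)
 let ?b = "proj z ** b"
 have bz: "?b : cA" using b z by (simp add: proj_K_in)
 have l: "lookup (nf ?b) u = lookup z (vtx (src u)) * lookup (nf b) u" for u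
  using nf_K[OF z b] lookup_K_mult[OF z nf_carrier[OF b]] by simp
 have "keys (nf ?b) <= keys (nf b)" by (auto simp: in_keys_iff l)
 hence e: "ggen n a w ?b = (\<Oplus>\<^bsub>P (Suc n)\<^esub>u\<in>?T.
  lact (P (Suc n)) (a ** kk (lookup (nf ?b) u)) (gsplit n w u))"
  by (rule ggen_super[OF w a bz finite_keys _ nf_keys[OF b]])
 show "ggen n a w ?b = ggen n (kk (lookup z (vtx (tgt Q w))) ** a) w b" unfolding e unfolding l ggen_def
 proof (intro P.finsum_cong' refl)
  fix u assume u: "u : ?T"
  have "a ** (kk c ** kk d) = kk c ** a ** kk d" for c d
  using a kk_central[OF a, of c] by (simp add: A.m_assoc[symmetric])
  thus "lact (P (Suc n)) (a ** kk (lookup z (vtx (src u)) * lookup (nf b) u)) (gsplit n w u) =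
  lact (P (Suc n)) (kk (lookup z (vtx (tgt Q w))) ** a ** kk (lookup (nf b) u)) (gsplit n w u)"
  using T(2)[OF u] by (simp add: kk_mult)
 qed (use gs(3)[OF w a b T kc] in auto)
qed

lemma gamma_lhom: "\<gamma> n : lhom (P n) (P (Suc n))" and gamma_pure: "[| a : cA; w : chains n; b : cA |] ==>
  \<gamma> n (Ppure n a (ppath w) b) = ggen n a w b" proof -
 note L = P_lift_addhom[OF grP ggen_bal, folded gamma_ggen] and V = P_lift_pure[OF grP ggen_bal, folded gamma_ggen]
 show "[| a : cA; w : chains n; b : cA |] ==> \<gamma> n (Ppure n a (ppath w) b) = ggen n a w b" by (rule V)
 show "\<gamma> n : lhom (P n) (P (Suc n))" proof (rule lhomI[OF L])
  show "\<gamma> n (lact (P n) c x) = lact (P (Suc n)) c (\<gamma> n x)" if c: "c : cA" and x: "x : cP n" for c x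
  by (rule P_hom_eq[OF grP ahom_comp[OF L bimD(2)[OF bim_P c]] ahom_comp[OF bimD(2)[OF bim_P c] L] _ x])
  (use c in \<open>simp add: Ppure_lact pp_span V ggen_act\<close>)
  show "\<gamma> n (ract (P n) x (proj z)) = ract (P (Suc n)) (\<gamma> n x) (proj z)" if z: "z : K" and x: "x : cP n" for z x
  by (rule P_hom_eq[OF grP ahom_comp[OF L bimD(3)[OF bim_P proj_K_in[OF z]]]
  ahom_comp[OF bimD(3)[OF bim_P proj_K_in[OF z]] L] _ x])
  (use z in \<open>simp add: Ppure_ract pp_span V ggen_act proj_K_in\<close>)
 qed
qed

lemma gamma_Fel:
 assumes p: "p : paths Q" and c: "chain_at p n i" and irr: "plen p < nxt p (cut p i n)"
 shows "\<gamma> n (Fel n p i) = sgn_P (Suc n) (\<Oplus>\<^bsub>P (Suc n)\<^esub>a\<in>chains_in (Suc n) p i (plen p). Fel (Suc n) p a)"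
proof -
 interpret P: abelian_group "P (Suc n)" by (rule grP)
 let ?e = "cut p i n"
 have l: "i <= ?e" "?e <= plen p" using chain_at_cut[OF c] by auto
 have s: "sub p 0 i : paths Q" "sub p ?e (plen p) : irr Q S" "sub p i ?e : chains n"
  using sub_path(1)[OF p] l chain_path_cut[OF p c] irr_sub_iff[OF p l(2)] irr by auto
 note r = irr_path[OF s(2)]
 have t: "tgt Q (sub p i ?e) = src (sub p ?e (plen p))" using sub_path(2)[OF p l] by simp
 have nf: "nf (pi (sub p ?e (plen p))) = ppath (sub p ?e (plen p))" using s(2) by (intro nf_id) (simp add: path_span_def)
 have set: "{u\<in>keys (nf (pi (sub p ?e (plen p)))). tgt Q (sub p i ?e) = src u} = {sub p ?e (plen p)}"
  unfolding nf using t by auto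
 have g: "gsplit n (sub p i ?e) (sub p ?e (plen p)) = sgn_P (Suc n) (split (Suc n) (sub p i (plen p)))"
  "gsplit n (sub p i ?e) (sub p ?e (plen p)) : cP (Suc n)"
  using gsplit_eq[OF ch_path[OF s(3)] r t, of n] sub_cat[OF l, of p] by (simp_all add: between_def)
 have B: "i <= a" "chain_at p (Suc n) a" "cut p a (Suc n) <= plen p" if "a : chains_in (Suc n) p i (plen p)" for a
  using that by (auto simp: chains_in_def)
 have ip: "i <= plen p" using l by simp
 have cl: "Fgen (Suc n) p i (plen p) a : cP (Suc n)" if "a : chains_in (Suc n) p i (plen p)" for a
  using Fgen_in[OF p ip order_refl B[OF that]] .
 have w: "lact (P (Suc n)) (pi (sub p 0 i)) (Fgen (Suc n) p i (plen p) a) = Fel (Suc n) p a"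
  if "a : chains_in (Suc n) p i (plen p)" for a proof -
  have "Fgen (Suc n) p i (plen p) a : between (P (Suc n)) (vt p i) (vt p (plen p))"
  using Fgen_between[OF p ip order_refl B[OF that]] .
  hence "ract (P (Suc n)) (Fgen (Suc n) p i (plen p) a) (pi (sub p (plen p) (plen p))) = Fgen (Suc n) p i (plen p) a"
  by (simp add: between_def sub_refl)
  thus ?thesis using Fgen_wrap[OF p ip order_refl B[OF that]] by simp
 qed
 have "\<gamma> n (Fel n p i) = ggen n (pi (sub p 0 i)) (sub p i ?e) (pi (sub p ?e (plen p)))"
  using s r by (simp add: Fgen_def gamma_pure pi_in)
 also have "\<dots> = lact (P (Suc n)) (pi (sub p 0 i)) (gsplit n (sub p i ?e) (sub p ?e (plen p)))"
  unfolding ggen_def set unfolding nf using s g(2) by (simp add: kk_one pi_in bimD(12)[OF bim_P])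
 also have "\<dots> = sgn_P (Suc n) (lact (P (Suc n)) (pi (sub p 0 i)) (split (Suc n) (sub p i (plen p))))"
  unfolding g(1) using ahom_neg[OF grP grP bimD(2)[OF bim_P pi_in[OF s(1)]], of "split (Suc n) (sub p i (plen p))" "Suc n"]
  split_between[OF sub_path(1)[OF p ip order_refl], of "Suc n"] s(1) by (simp add: sgn_P_def pi_in between_def)
 also have "lact (P (Suc n)) (pi (sub p 0 i)) (split (Suc n) (sub p i (plen p))) =
  (\<Oplus>\<^bsub>P (Suc n)\<^esub>a\<in>chains_in (Suc n) p i (plen p). Fel (Suc n) p a)"
  unfolding split_sub[OF p ip order_refl]
  apply (subst lact_sum[OF bim_P pi_in[OF s(1)]])
  subgoal using cl .
  by (rule P.finsum_cong'[OF refl]) (use cl w s(1) in \<open>simp_all add: pi_in Pi_def bimD(12)[OF bim_P] flip: w\<close>)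
 finally show ?thesis .
qed


section \<open>The filtration by paths\<close>

lemma Fel_in: "[| p : paths Q; chain_at p n a |] ==> Fel n p a : cP n" by (rule Fgen_in) (simp_all add: chain_at_cut)

lemma pi_mult:
 assumes "p : paths Q" "q : paths Q"
 shows "pi p ** pi q = (if tgt Q p = src q then pi (cat p q) else \<zero>[A])"
 using assms by (simp add: pi_cat proj_mult[symmetric] single_carrier pmult_single proj_zero)

lemma Ppure_kk:
 assumes "a : cA" "w : chains n" "b : cA"
 shows "Ppure n a (ppath w) (kk c ** b) = Ppure n (kk c ** a) (ppath w) b" proof -
 have "Ppure n a (ppath w) (kk c ** b) = Ppure n a (pmult Q (ppath w) (scalar Q c)) b"
  using assms by (simp add: Ppure_K(2) pp_span scalar_K)
 also have "\<dots> = Ppure n a (single w c) b" using assms ch_path by (simp add: scalar_mult_single)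
 also have "\<dots> = Ppure n (kk c ** a) (ppath w) b" using assms by (simp add: Ppure_single)
 finally show ?thesis .
qed

lemma Ppure_vertex:
 assumes a: "a : cA" and w: "w : chains n" and b: "b : cA" and v: "v : verts Q"
 shows "Ppure n (a ** pi (vtx v)) (ppath w) b = (if v = src w then Ppure n a (ppath w) b else \<zero>[P n])"
  "Ppure n a (ppath w) (pi (vtx v) ** b) = (if v = tgt Q w then Ppure n a (ppath w) b else \<zero>[P n])" proof -
 have e: "ppath (vtx v) : K" using v by (simp add: path_span_def trivial_iff)
 have m: "pmult Q (ppath (vtx v)) (ppath w) = (if v = src w then ppath w else (0 :: ('v, 'e, 'k) pathalg))"
  "pmult Q (ppath w) (ppath (vtx v)) = (if v = tgt Q w then ppath w else (0 :: ('v, 'e, 'k) pathalg))"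
  by (auto simp: pmult_single src_def)
 show "Ppure n (a ** pi (vtx v)) (ppath w) b = (if v = src w then Ppure n a (ppath w) b else \<zero>[P n])"
  using Ppure_K(1)[OF a pp_span[OF w] b e, of 1] Ppure_zero(3)[OF a b span_zero] by (auto simp: m)
 show "Ppure n a (ppath w) (pi (vtx v) ** b) = (if v = tgt Q w then Ppure n a (ppath w) b else \<zero>[P n])"
  using Ppure_K(2)[OF a pp_span[OF w] b e, of 1] Ppure_zero(3)[OF a b span_zero]
  unfolding m by (cases "v = tgt Q w") simp_all
qed

lemma Ppure_noncomp:
 assumes t: "t : paths Q" and w: "w : chains n" and b: "b : cA"
 shows "tgt Q t ~= src w ==> Ppure n (pi t) (ppath w) b = \<zero>[P n]"
  "tgt Q w ~= src t ==> Ppure n b (ppath w) (pi t) = \<zero>[P n]" proof -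
 note v = path_ends[OF t]
 have "pi t ** pi (vtx (tgt Q t)) = pi t" "pi (vtx (src t)) ** pi t = pi t"
  using t v by (simp_all add: pi_mult vtx_path src_def)
 thus "tgt Q t ~= src w ==> Ppure n (pi t) (ppath w) b = \<zero>[P n]"
  "tgt Q w ~= src t ==> Ppure n b (ppath w) (pi t) = \<zero>[P n]"
  using Ppure_vertex(1)[OF pi_in[OF t] w b v(2)] Ppure_vertex(2)[OF b w pi_in[OF t] v(1)] by auto
qed

lemma chain_tail:
 assumes w: "w : chains n" and u: "u : paths Q" and t: "tgt Q w = src u"
 shows "cat w u : paths Q" "chain_at (cat w u) n 0" "cut (cat w u) 0 n = plen w"
  "sub (cat w u) 0 (plen w) = w" "sub (cat w u) (plen w) (plen w + plen u) = u"
  "u : irr Q S \<longleftrightarrow> plen (cat w u) < cut (cat w u) 0 (Suc (Suc n))" proof -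
 let ?p = "cat w u"
 note wp = ch_path[OF w]
 show p: "?p : paths Q" using cat_paths[OF wp u t] by simp
 have pl: "plen ?p = plen w + plen u" by simp
 have s: "w = sub ?p 0 (plen w)" "u = sub ?p (plen w) (plen ?p)"
  using sub_split(2,3)[of ?p 0 "plen ?p" w u] p wp u t by (simp_all add: sub_all[of ?p, simplified] pconcat2)
 show "sub ?p 0 (plen w) = w" "sub ?p (plen w) (plen w + plen u) = u" using s pl by metis+
 have "sub ?p 0 (plen w) : chains n" using s(1) w by metis
 hence "plen w = cut ?p 0 n & chain_at ?p n 0" using chain_iff[OF p, of 0 "plen w" n] by simp
 thus "chain_at ?p n 0" "cut ?p 0 n = plen w" by simp_all
 thus "u : irr Q S \<longleftrightarrow> plen ?p < cut ?p 0 (Suc (Suc n))"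
  using irr_sub_iff[OF p, of "plen w" "plen ?p"] s(2) by (simp add: cut.simps(3))
qed

lemma Fel_chain:
 assumes a: "a : cA" and w: "w : chains n" and u: "u : paths Q" and t: "tgt Q w = src u"
 shows "lact (P n) a (Fel n (cat w u) 0) = Ppure n a (ppath w) (pi u)" proof -
 note c = chain_tail[OF w u t]
 have v: "vt (cat w u) 0 = src w" using sub_fst(1)[of "cat w u" 0 "plen w"] c(4) by simp
 have "Fel n (cat w u) 0 = Ppure n (pi (vtx (src w))) (ppath w) (pi u)" using c by (simp add: Fgen_def sub_refl v)
 thus ?thesis using a w u chain_ends(1)[OF w] Ppure_vertex(1)[OF a w pi_in[OF u] chain_ends(1)[OF w]]
  by (simp add: Ppure_lact pp_span pi_in vtx_path)
qed

lemma Fel_self: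
 assumes "w : chains n" shows "Fel n w 0 = Ppure n \<one>[A] (ppath w) \<one>[A]" proof -
 have v: "tgt Q w : verts Q" "cat w (vtx (tgt Q w)) = w" using chain_ends[OF assms] by simp_all
 have "Fel n w 0 = lact (P n) \<one>[A] (Fel n w 0)"
  using Fel_in[OF chain_self(3)[OF assms] chain_self(1)[OF assms]] by (simp add: bimD(4)[OF bim_P])
 also have "\<dots> = Ppure n \<one>[A] (ppath w) (pi (vtx (tgt Q w)))"
  using Fel_chain[OF A_one assms vtx_path[OF v(1)]] v(2) by (simp add: src_def)
 also have "\<dots> = Ppure n \<one>[A] (ppath w) \<one>[A]"
  using Ppure_vertex(2)[OF A_one assms A_one v(1)] v(1) by (simp add: pi_in vtx_path)
 finally show ?thesis .
qed

lemma Ppure_zeros: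
 assumes "c : cA" "x : path_span (chains n)"
 shows "Ppure n \<zero>[A] x c = \<zero>[P n]" "Ppure n c x \<zero>[A] = \<zero>[P n]"
 using Ppure_zero[OF assms(1) assms(1) assms(2)] by simp_all

text \<open>
 \<open>low n Z\<close> is spanned by the elements \<open>\<pi>(q) \<otimes> w \<otimes> \<pi>(r)\<close> with \<open>r\<close> irreducible whose path \<open>qwr\<close>
 lies in \<open>Z\<close>; the generators are written in terms of the path \<open>p = wr\<close>.
\<close>

inductive_set low :: "nat => ('v, 'e) path set => ('v, 'e, 'k) tens set" for n Z where
 zero: "\<zero>[P n] : low n Z"
| add: "[| X : low n Z; Y : low n Z |] ==> X +[P n] Y : low n Z"
| gen: "[| p : paths Q; chain_at p n 0; plen p < cut p 0 (Suc (Suc n)); q : paths Q; tgt Q q = src p;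
  cat q p : Z |] ==> lact (P n) (kk c ** pi q) (Fel n p 0) : low n Z"

lemma low_in: "X : low n Z ==> X : cP n" proof (induction rule: low.induct)
 interpret P: abelian_group "P n" by (rule grP)
 { case zero show ?case by simp }
 { case add thus ?case by simp }
 { case gen thus ?case by (simp add: bimD(12)[OF bim_P] Fel_in pi_in) }
qed

lemma low_mono: "[| X : low n Z; Z <= Z' |] ==> X : low n Z'"
 by (induction rule: low.induct) (blast intro: low.intros)+

lemma low_scal: "X : low n Z ==> lact (P n) (kk d) X : low n Z" proof (induction rule: low.induct)
 case zero
 show ?case by (simp add: act_zero[OF bim_P] low.zero)
next
 case (add X Y)
 thus ?case by (simp add: ahom_add[OF bimD(2)[OF bim_P]] low_in low.add)
next
 case (gen p q c)
 have "lact (P n) (kk d) (lact (P n) (kk c ** pi q) (Fel n p 0)) = lact (P n) (kk (d * c) ** pi q) (Fel n p 0)"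
  using gen by (simp add: bimD(7)[OF bim_P] Fel_in pi_in kk_mult A.m_assoc)
 thus ?case using low.gen[OF gen] by simp
qed

lemma low_neg: assumes "X : low n Z" shows "\<ominus>\<^bsub>P n\<^esub> X : low n Z" proof -
 interpret P: abelian_group "P n" by (rule grP)
 note X = low_in[OF assms]
 have "lact (P n) (kk (-1)) X +[P n] X = lact (P n) (kk (-1 + 1)) X"
  using bimD(10)[OF bim_P X kk_in kk_in, of "-1" 1] bimD(4)[OF bim_P X] by (simp only: kk_add kk_one)
 also have "\<dots> = \<zero>[P n]" using X by (simp add: kk_zero zero_act[OF bim_P])
 finally have "\<ominus>\<^bsub>P n\<^esub> X = lact (P n) (kk (-1)) X"
  using X by (intro P.minus_equality) (simp_all add: bimD(12)[OF bim_P])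
 thus ?thesis using low_scal[OF assms] by simp
qed

lemma low_minus: "[| X : low n Z; Y : low n Z |] ==> X -[P n] Y : low n Z" by (simp add: a_minus_def low.add low_neg)

lemma low_sum:
 assumes "!!i. i : B ==> f i : low n Z" shows "(\<Oplus>\<^bsub>P n\<^esub>i\<in>B. f i) : low n Z" proof -
 interpret P: abelian_group "P n" by (rule grP)
 show ?thesis using assms proof (induction B rule: infinite_finite_induct)
  case (insert i B)
  have "f : B \<rightarrow> cP n" "f i : cP n" using insert.prems by (auto intro: low_in)
  thus ?case using insert by (simp add: low.add)
 qed (simp_all add: low.zero P.add.finprod_infinite)
qed

lemma low_lact:
 assumes "X : low n Z" "q : paths Q" "!!z. [| z : Z; tgt Q q = src z |] ==> cat q z : Z'"
 shows "lact (P n) (pi q) X : low n Z'" using assms(1) proof (induction rule: low.induct)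
 case zero
 show ?case using assms(2) by (simp add: act_zero[OF bim_P] low.zero pi_in)
next
 case (add X Y)
 thus ?case using assms(2) by (simp add: ahom_add[OF bimD(2)[OF bim_P]] low_in low.add pi_in)
next
 case (gen p q' c)
 have "pi q ** (kk c ** pi q') = kk c ** (pi q ** pi q')"
  using kk_central[of "pi q" c] assms(2) gen by (simp add: pi_in flip: A.m_assoc)
 hence e: "lact (P n) (pi q) (lact (P n) (kk c ** pi q') (Fel n p 0)) =
  lact (P n) (kk c ** (pi q ** pi q')) (Fel n p 0)" using gen assms(2) by (simp add: bimD(7)[OF bim_P] Fel_in pi_in)
 show ?case proof (cases "tgt Q q = src q'")
  case True
  note c = cat_paths[OF assms(2) gen(4) True]
  have "cat (cat q q') p : Z'" using assms(3)[OF gen(6)] True by simp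
  thus ?thesis unfolding e using low.gen[OF gen(1-3) c(1), of Z' c] gen assms(2) True c by (simp add: pi_mult)
 next
  case False
  thus ?thesis unfolding e using gen assms(2) by (simp add: pi_mult zero_act[OF bim_P] Fel_in low.zero)
 qed
qed

lemma low_expand:
 assumes w: "w : chains n" and x: "keys x <= paths Q" and y: "keys y <= irr Q S"
  and Z: "!!t u. [| t : keys x; u : keys y; tgt Q t = src w; tgt Q w = src u |] ==> cat t (cat w u) : Z"
 shows "Ppure n (proj x) (ppath w) (proj y) : low n Z" proof -
 have r: "Ppure n (pi t) (ppath w) (proj y) : low n Z" if t: "t : keys x" for t proof -
  have tp: "t : paths Q" using x t by blast
  show ?thesis proof (cases "tgt Q t = src w")
  case False
  have "y : cQ" using y irr_sub by (auto simp: kQ_iff)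
  thus ?thesis using Ppure_noncomp(1)[OF tp w _ False] by (simp add: low.zero)
  next
  case True
  let ?T = "{u\<in>irr Q S. tgt Q w = src u --> cat t (cat w u) : Z}"
  have T: "u : paths Q" if "u : ?T" for u using that irr_path by blast
  have sp: "y : cQ" if "keys y <= ?T" for y :: "('v, 'e, 'k) pathalg" using that T by (auto simp: kQ_iff)
  have "keys y <= ?T" using y Z[OF t _ True] by blast
  thus ?thesis proof (induction y rule: pm_induct)
  case zero
  show ?case using tp w by (simp add: proj_zero Ppure_zeros pp_span pi_in low.zero)
  next
  case (single u d)
  note u = T[OF single]
  have "Ppure n (pi t) (ppath w) (proj (single u d)) = lact (P n) (kk d) (Ppure n (pi t) (ppath w) (pi u))"
  using tp w u by (simp add: proj_single[OF u, of d] Ppure_kk Ppure_lact pi_in pp_span)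
  moreover have "Ppure n (pi t) (ppath w) (pi u) : low n Z" proof (cases "tgt Q w = src u")
  case False
  thus ?thesis using Ppure_noncomp(2)[OF u w pi_in[OF tp]] by (simp add: low.zero)
  next
  case wu: True
  note c = chain_tail[OF w u wu]
  have "lact (P n) (kk 1 ** pi t) (Fel n (cat w u) 0) : low n Z" using c single wu True tp by (intro low.gen) simp_all
  thus ?thesis using Fel_chain[OF pi_in[OF tp] w u wu] tp by (simp add: kk_one pi_in)
  qed
  ultimately show ?case by (simp add: low_scal)
  next
  case (add y y')
  thus ?case using sp tp w by (simp add: proj_add Ppure_add(3) pp_span pi_in low.add)
  qed
  qed
 qed
 have yc: "proj y : cA" using y irr_sub by (auto simp: kQ_iff)
 have sp: "x' : cQ" if "keys x' <= keys x" for x' using that x by (auto simp: kQ_iff)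
 show ?thesis proof (induction x rule: pm_induct[OF order_refl])
  case 1
  show ?case using w yc by (simp add: proj_zero Ppure_zeros pp_span low.zero)
 next
  case (2 t d)
  hence t: "t : paths Q" using x by blast
  have "Ppure n (proj (single t d)) (ppath w) (proj y) = lact (P n) (kk d) (Ppure n (pi t) (ppath w) (proj y))"
  using t w yc by (simp add: proj_single[OF t, of d] Ppure_lact pi_in pp_span)
  thus ?case using r[OF 2] by (simp add: low_scal)
 next
  case (3 x y)
  thus ?case using sp w yc by (simp add: proj_add Ppure_add(1) pp_span low.add)
 qed
qed

lemma low_pure:
 assumes w: "w : chains n" and q: "q : paths Q" and r: "r : paths Q" and t: "tgt Q q = src w" "tgt Q w = src r"
  and Z: "!!u. (u, cat q (cat w r)) : below ==> u : Z"
  and str: "cat q (cat w r) : Z \<or> q ~: irr Q S \<or> r ~: irr Q S"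
 shows "Ppure n (pi q) (ppath w) (pi r) : low n Z" proof -
 note wp = ch_path[OF w]
 have "Ppure n (proj (nf (pi q))) (ppath w) (proj (nf (pi r))) : low n Z" proof (rule low_expand[OF w])
  show "keys (nf (pi q)) <= paths Q" "keys (nf (pi r)) <= irr Q S"
  using nf_keys[OF pi_in[OF q]] nf_keys[OF pi_in[OF r]] irr_sub by blast+
  fix s u assume k: "s : keys (nf (pi q))" "u : keys (nf (pi r))"
  note s = nf_pi_below[OF q k(1)] and u = nf_pi_below[OF r k(2)]
  have up: "u : paths Q" "src u = src r" using u(1,2) irr_path[OF u(1)] below_parallel[of u r] by auto
  have wu: "cat w u : paths Q" "cat w u : paths Q" using cat_paths[OF wp up(1)] t up by simp_all
  have c1: "composable Q [vtx (src q), q, cat w u]"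
  using q wu t path_ends[OF q] by (simp add: composable3 vtx_path src_def)
  have c2: "composable Q [cat q w, r, vtx (tgt Q r)]"
  using cat_paths[OF q wp t(1)] r t path_ends[OF r] by (simp add: composable3 vtx_path src_def)
  have 1: "(cat s (cat w u), cat q (cat w u)) : below" if "(s, q) : below"
  using below_cat[OF that c1] below_parallel[OF that] by (simp add: src_def)
  have 2: "(cat q (cat w u), cat q (cat w r)) : below" if "(u, r) : below" using below_cat[OF that c2] by simp
  show "cat s (cat w u) : Z" proof (cases "s = q & u = r")
  case True
  thus ?thesis using str s(1) u(1) by auto
  next
  case False
  hence "(cat s (cat w u), cat q (cat w r)) : below" using 1 2 s(2) u(2) transD[OF trans_below] by blast
  thus ?thesis by (rule Z)
  qed
 qed
 thus ?thesis using q r by (simp add: proj_nf pi_in)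
qed

lemma low_Fel:
 assumes p: "p : paths Q" and c: "chain_at p n a" and Z: "!!u. (u, p) : below ==> u : Z"
  and str: "p : Z \<or> nxt p 0 <= a \<or> cut p a (Suc (Suc n)) <= plen p"
 shows "Fel n p a : low n Z" proof -
 let ?e = "cut p a n"
 note l = chain_at_cut[OF c]
 have s: "sub p 0 a : paths Q" "sub p ?e (plen p) : paths Q" "tgt Q (sub p 0 a) = src (sub p a ?e)"
  "tgt Q (sub p a ?e) = src (sub p ?e (plen p))" using sub_path[OF p] l by simp_all
 have e: "cat (sub p 0 a) (cat (sub p a ?e) (sub p ?e (plen p))) = p"
  using sub_cat[of a ?e "plen p" p] sub_cat[of 0 a "plen p" p] l by (simp add: sub_all)
 have "sub p 0 a ~: irr Q S \<longleftrightarrow> nxt p 0 <= a" "sub p ?e (plen p) ~: irr Q S \<longleftrightarrow> cut p a (Suc (Suc n)) <= plen p"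
  using irr_sub_iff[OF p, of 0 a] irr_sub_iff[OF p, of ?e "plen p"] l by (auto simp: cut.simps(3))
 thus ?thesis unfolding Fgen_def using str e Z by (intro low_pure[OF chain_path_cut[OF p c] s]) simp_all
qed

lemma low_all: assumes "X : cP n" shows "X : low n UNIV" using assms proof (induction rule: P_induct)
 case (pure a w b)
 hence "Ppure n (proj (nf a)) (ppath w) (proj (nf b)) : low n UNIV" using nf_keys irr_sub by (intro low_expand) blast+
 thus ?case using pure by (simp add: proj_nf)
qed (simp_all add: low.intros low_neg)

lemma low_ract:
 assumes "X : low n Z" "r : paths Q" "!!z u. [| z : Z; tgt Q z = src r; (u, cat z r) : below\<^sup>= |] ==> u : Z'"
 shows "ract (P n) X (pi r) : low n Z'" using assms(1) proof (induction rule: low.induct)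
 case zero
 show ?case using assms(2) by (simp add: act_zero[OF bim_P] low.zero pi_in)
next
 case (add X Y)
 thus ?case using assms(2) ahom_add[OF bimD(3)[OF bim_P pi_in[OF assms(2)]], of X n Y]
  by (simp add: low_in low.add pi_in)
next
 case (gen p q c)
 let ?e = "cut p 0 n"
 let ?w = "sub p 0 ?e" and ?t = "sub p ?e (plen p)"
 note l = chain_at_cut[OF gen(2)]
 have s: "?t : paths Q" "?w : chains n" "tgt Q ?w = src ?t" "tgt Q ?t = tgt Q p" "src ?w = src p"
  using sub_path[OF gen(1)] l chain_path_cut[OF gen(1,2)] sub_path(2)[OF gen(1), of 0 "plen p"] sub_fst(1)[of p 0 "plen p"]
  by (simp_all add: sub_all)
 have e: "cat ?w ?t = p" using sub_cat[of 0 ?e "plen p" p] l by (simp add: sub_all)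
 have "lact (P n) (kk c ** pi q) (Fel n p 0) = Ppure n (kk c ** pi q) (ppath ?w) (pi ?t)"
  using Fel_chain[OF _ s(2,1,3), of "kk c ** pi q"] gen(4) e by (simp add: pi_in)
 hence v: "ract (P n) (lact (P n) (kk c ** pi q) (Fel n p 0)) (pi r) =
  lact (P n) (kk c) (Ppure n (pi q) (ppath ?w) (pi ?t ** pi r))"
  using s gen(4) assms(2) by (simp add: Ppure_ract Ppure_lact pi_in pp_span)
 have "Ppure n (pi q) (ppath ?w) (pi ?t ** pi r) : low n Z'" proof (cases "tgt Q p = src r")
  case True
  note c = cat_paths[OF s(1) assms(2)]
  have e': "cat q (cat ?w (cat ?t r)) = cat (cat q p) r" using arg_cong[OF e, of snd] by simp
  have z: "tgt Q (cat q p) = src r" using cat_paths[OF gen(4,1,5)] True by simp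
  have "Ppure n (pi q) (ppath ?w) (pi (cat ?t r)) : low n Z'" using assms(3)[OF gen(6) z] gen(4,5) s c True
  by (intro low_pure) (simp_all only: e' s(3,4) src_cat, simp_all)
  thus ?thesis using True s assms(2) by (simp add: pi_mult)
 next
  case False
  thus ?thesis using s assms(2) gen(4) by (simp add: pi_mult Ppure_zeros pp_span pi_in low.zero)
 qed
 thus ?case unfolding v by (rule low_scal)
qed

lemma low_coef:
 assumes X: "X : low n {u. (u, p) : below}" and q: "q : paths Q" "p : paths Q" "tgt Q q = src p"
 shows "lact (P n) (kk c ** pi q) X : low n {u. (u, cat q p) : below}" proof -
 have co: "composable Q [q, p, vtx (tgt Q p)]" using q path_ends[OF q(2)] by (simp add: composable3 vtx_path src_def)
 have "lact (P n) (pi q) X : low n {u. (u, cat q p) : below}"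
  using below_cat[OF _ co] by (intro low_lact[OF X q(1)]) simp
 hence "lact (P n) (kk c) (lact (P n) (pi q) X) : low n {u. (u, cat q p) : below}" by (rule low_scal)
 thus ?thesis using q low_in[OF X] by (simp add: bimD(7)[OF bim_P] pi_in)
qed

definition downset :: "('v, 'e) path set => bool" where
 "downset Z \<longleftrightarrow> (\<forall>z\<in>Z. \<forall>u. (u, z) : below --> u : Z)"

lemma downset_below: "downset {u. (u, z) : below}" "downset {u. (u, z) : below\<^sup>=}"
 using transD[OF trans_below] by (auto simp: downset_def)

lemma low_coef_down:
 assumes X: "X : low n {u. (u, p) : below\<^sup>=}" and q: "q : paths Q" "p : paths Q" "tgt Q q = src p"
  and Z: "downset Z" "cat q p : Z"
 shows "lact (P n) (kk c ** pi q) X : low n Z" proof -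
 have co: "composable Q [q, p, vtx (tgt Q p)]" using q path_ends[OF q(2)] by (simp add: composable3 vtx_path src_def)
 have "cat q z : Z" if "(z, p) : below\<^sup>=" for z
  using that below_cat[OF _ co, of z] Z by (auto simp: downset_def)
 hence "lact (P n) (pi q) X : low n Z" by (intro low_lact[OF X q(1)]) simp
 hence "lact (P n) (kk c) (lact (P n) (pi q) X) : low n Z" by (rule low_scal)
 thus ?thesis using q low_in[OF X] by (simp add: bimD(7)[OF bim_P] pi_in)
qed

lemma chains_in_all: "chains_in n p i (plen p) = {a. i <= a & chain_at p n a}"
 using chain_at_cut(2)[of p n] by (auto simp: chains_in_def)

lemma sgn_low: "X : low n Z ==> sgn_P n X : low n Z" by (simp add: sgn_P_def low_neg)

lemma gamma_low:
 assumes "X : low n Z" "downset Z" shows "\<gamma> n X : low (Suc n) Z" using assms(1)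
proof (induction rule: low.induct)
 case zero
 show ?case using ahom_zero[OF grP grP lhomD(1)[OF gamma_lhom]] by (simp add: low.zero)
next
 case (add X Y)
 thus ?case by (simp add: ahom_add[OF lhomD(1)[OF gamma_lhom]] low_in low.add)
next
 case (gen p q c)
 have "\<gamma> n (Fel n p 0) : low (Suc n) {u. (u, p) : below\<^sup>=}"
  using gen(3) by (subst gamma_Fel[OF gen(1,2)])
  (auto simp: cut.simps(3) chains_in_def intro!: sgn_low low_sum low_Fel[OF gen(1)])
 hence "lact (P (Suc n)) (kk c ** pi q) (\<gamma> n (Fel n p 0)) : low (Suc n) Z"
  using gen assms(2) by (intro low_coef_down)
 thus ?case using gen by (simp add: lhomD(2)[OF gamma_lhom] Fel_in pi_in)
qed

lemma delta_Fel_low: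
 assumes "p : paths Q" "chain_at p (Suc n) a"
 shows "\<delta> (Suc n) (Fel (Suc n) p a) : low n {u. (u, p) : below\<^sup>=}" proof -
 have "Fel n p b : low n {u. (u, p) : below\<^sup>=}" if "b : chains_in n p a (cut p a (Suc n))" for b
  using that assms by (intro low_Fel) (auto simp: chains_in_def)
 moreover have "Max (chains_in n p a (cut p a (Suc n))) : chains_in n p a (cut p a (Suc n))"
  using chains_in_start(1)[OF assms(2)] finite_chains_in by (intro Max_in) auto
 ultimately show ?thesis using chains_in_start(1)[OF assms(2)] by (simp add: delta_Fel[OF assms] low_minus low_sum)
qed

subsection \<open>The contraction of the monomial complex\<close>

definition Gam :: "nat => ('v, 'e, 'k) tens set" where
 "Gam n = (if n = 0 then \<rho>_aug ` cA else \<gamma> (n - 1) ` cP (n - 1))"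

lemma span_K: "scalar Q (1::'k) : path_span (chains 0)" using scalar_K by (simp add: chains_def)

lemma rho_aug_hom: "\<rho>_aug : ahom A (P 0)"
 by (rule ahomI) (simp_all add: \<rho>_aug_def Ppure_in Ppure_add(1) span_K)

lemma rho_aug_lact: "[| a : cA; b : cA |] ==> lact (P 0) a (\<rho>_aug b) = \<rho>_aug (a ** b)"
 by (simp add: \<rho>_aug_def Ppure_lact span_K)

lemma rho_aug_in: "a : cA ==> \<rho>_aug a : cP 0" using ahom_in[OF rho_aug_hom] .

lemma Gam_cases:
 assumes "X : Gam n"
 obtains a where "n = 0" "a : cA" "X = \<rho>_aug a"
  | m Y where "n = Suc m" "Y : cP m" "X = \<gamma> m Y" using assms by (cases n) (auto simp: Gam_def)

lemma GamI: "a : cA ==> \<rho>_aug a : Gam 0" "Y : cP m ==> \<gamma> m Y : Gam (Suc m)" by (auto simp: Gam_def)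

lemma gamma_in: "X : cP n ==> \<gamma> n X : cP (Suc n)" by (rule lhomD(4)[OF gamma_lhom])

lemma Gam_in: "X : Gam n ==> X : cP n" by (erule Gam_cases) (simp_all add: rho_aug_in gamma_in)

lemma Gam_lact: assumes "a : cA" "X : Gam n" shows "lact (P n) a X : Gam n" using assms(2)
proof (cases rule: Gam_cases)
 case (1 b)
 thus ?thesis using assms(1) by (simp add: rho_aug_lact GamI)
next
 case (2 m Y)
 thus ?thesis using assms(1) GamI(2)[of "lact (P m) a Y" m] by (simp add: lhomD(2)[OF gamma_lhom] bimD(12)[OF bim_P])
qed

lemma Gam_add: assumes "X : Gam n" "Y : Gam n" shows "X +[P n] Y : Gam n" using assms(1) proof (cases rule: Gam_cases)
 case (1 a)
 then obtain b where "b : cA" "Y = \<rho>_aug b" using assms(2) by (auto simp: Gam_def)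
 thus ?thesis using 1 GamI(1)[of "a +[A] b"] by (simp add: ahom_add[OF rho_aug_hom])
next
 case (2 m X')
 interpret P: abelian_group "P m" by (rule grP)
 obtain Y' where "Y' : cP m" "Y = \<gamma> m Y'" using assms(2) 2 by (auto simp: Gam_def)
 thus ?thesis using 2 GamI(2)[of "X' +[P m] Y'" m] by (simp add: ahom_add[OF lhomD(1)[OF gamma_lhom]])
qed

lemma Gam_neg: assumes "X : Gam n" shows "\<ominus>\<^bsub>P n\<^esub> X : Gam n" using assms
proof (cases rule: Gam_cases)
 case (1 a)
 thus ?thesis using GamI(1)[of "\<ominus>\<^bsub>A\<^esub> a"] by (simp add: ahom_neg[OF grA grP rho_aug_hom])
next
 case (2 m Y)
 interpret P: abelian_group "P m" by (rule grP)
 show ?thesis using 2 GamI(2)[of "\<ominus>\<^bsub>P m\<^esub> Y" m] by (simp add: ahom_neg[OF grP grP lhomD(1)[OF gamma_lhom]])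
qed

lemma Gam_minus: "[| X : Gam n; Y : Gam n |] ==> X -[P n] Y : Gam n" by (simp add: a_minus_def Gam_add Gam_neg)

lemma Gam_zero: "\<zero>[P n] : Gam n" proof (cases n)
 case 0
 thus ?thesis using GamI(1)[OF A.zero_closed] ahom_zero[OF grA grP rho_aug_hom] by simp
next
 case (Suc m)
 interpret P: abelian_group "P m" by (rule grP)
 show ?thesis using Suc GamI(2)[OF P.zero_closed] ahom_zero[OF grP grP lhomD(1)[OF gamma_lhom]] by simp
qed

lemma Gam_from_neg: assumes "\<ominus>\<^bsub>P n\<^esub> X : Gam n" "X : cP n" shows "X : Gam n" proof -
 interpret P: abelian_group "P n" by (rule grP)
 show ?thesis using Gam_neg[OF assms(1)] assms(2) by simp
qed

lemma no_later_chain: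
 assumes "chain_at p n 0" "plen p < cut p 0 (Suc (Suc n))" "chain_at p (Suc n) i"
 shows "plen p < nxt p (cut p i (Suc n))" "\<not> chain_at p (Suc (Suc n)) j" proof -
 have "cut p 0 n <= cut p 0 (Suc n)" using assms(1) by (simp add: chain_at_def less_imp_le)
 also have "\<dots> <= cut p i (Suc n)" by (rule cut_mono) simp
 finally show "plen p < nxt p (cut p i (Suc n))"
  using assms(2) nxt_mono[of "cut p 0 n" "cut p i (Suc n)" p] by (simp add: cut.simps(3))
 show "\<not> chain_at p (Suc (Suc n)) j"
  using assms(2) cut_mono[of 0 j p "Suc (Suc n)"] chain_at_cut(2)[of p "Suc (Suc n)" j] by auto
qed

lemma gamma_unit: assumes a: "a : cA" and w: "w : chains n" shows "\<gamma> n (Ppure n a (ppath w) \<one>[A]) = \<zero>[P (Suc n)]"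
proof -
 note c = chain_self[OF w]
 have "chains_in (Suc n) w 0 (plen w) = {}" proof -
  have "plen w < cut w b (Suc n)" for b
  using c(1,2) cut_mono[of 0 b w "Suc n"] by (simp add: chain_at_def) (metis le_refl less_le_trans)
  thus ?thesis by (auto simp: chains_in_def simp flip: not_less)
 qed
 moreover have "plen w < nxt w (cut w 0 n)" using c(2) nxt_gt(2)[of "plen w" w] by simp
 moreover interpret P: abelian_group "P (Suc n)" by (rule grP)
 have "sgn_P (Suc n) \<zero>[P (Suc n)] = \<zero>[P (Suc n)]" by (simp add: sgn_P_def P.minus_zero_eq)
 ultimately have "\<gamma> n (Fel n w 0) = \<zero>[P (Suc n)]" using gamma_Fel[OF c(3,1)] by simp
 hence "\<gamma> n (lact (P n) a (Fel n w 0)) = \<zero>[P (Suc n)]"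
  using a by (simp add: lhomD(2)[OF gamma_lhom] Fel_in c act_zero[OF bim_P])
 thus ?thesis using a w by (simp add: Fel_self Ppure_lact pp_span)
qed

lemma gamma_Gam: assumes "X : Gam n" shows "\<gamma> n X = \<zero>[P (Suc n)]" using assms
proof (cases rule: Gam_cases)
 case (1 a)
 note g0 = ahom_zero[OF grP grP lhomD(1)[OF gamma_lhom]]
 have kQc: "x : cQ" if "keys x <= paths Q" for x :: "('v, 'e, 'k) pathalg" using that by (simp add: kQ_iff)
 obtain x where x: "a = proj x" "keys x <= paths Q" using A_carrierE[OF 1(2)] by (auto simp: kQ_iff)
 have "\<gamma> 0 (\<rho>_aug (proj x)) = \<zero>[P 1]" using x(2) proof (induction x rule: pm_induct)
  case zero
  show ?case using g0[of 0] ahom_zero[OF grA grP rho_aug_hom] by (simp add: proj_zero)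
 next
  case (single p c)
  have v: "vtx (tgt Q p) : chains 0" using path_ends(2)[OF single] by (simp add: chains_def trivial_iff)
  have "\<rho>_aug (pi p) = Ppure 0 (pi p) (ppath (vtx (tgt Q p))) \<one>[A]"
  using P0_vertex(1)[OF single] Ppure_vertex(2)[OF pi_in[OF single] v A_one path_ends(2)[OF single]]
  path_ends(2)[OF single] by (simp add: \<rho>_aug_def pi_in vtx_path)
  hence "\<gamma> 0 (\<rho>_aug (pi p)) = \<zero>[P 1]" using gamma_unit[OF pi_in[OF single] v] by simp
  hence "\<gamma> 0 (lact (P 0) (kk c) (\<rho>_aug (pi p))) = \<zero>[P 1]"
  using single by (simp add: lhomD(2)[OF gamma_lhom] rho_aug_in pi_in act_zero[OF bim_P])
  thus ?case using single by (simp add: proj_single[OF single, of c] rho_aug_lact pi_in)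
 next
  case (add x y)
  interpret P: abelian_group "P (Suc 0)" by (rule grP)
  show ?case using add kQc by (simp add: proj_add ahom_add[OF rho_aug_hom] ahom_add[OF lhomD(1)[OF gamma_lhom]] rho_aug_in)
 qed
 thus ?thesis using 1 x by simp
next
 case (2 m Y)
 have "Y : low m UNIV" using 2 by (simp add: low_all)
 hence "\<gamma> (Suc m) (\<gamma> m Y) = \<zero>[P (Suc (Suc m))]" proof (induction rule: low.induct)
  case zero
  show ?case by (simp add: ahom_zero[OF grP grP lhomD(1)[OF gamma_lhom]])
 next
  case (add X Y)
  interpret P: abelian_group "P (Suc (Suc m))" by (rule grP)
  show ?case using add by (simp add: ahom_add[OF lhomD(1)[OF gamma_lhom]] low_in gamma_in)
 next
  case (gen p q c)
  interpret P: abelian_group "P (Suc (Suc m))" by (rule grP)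
  interpret P1: abelian_group "P (Suc m)" by (rule grP)
  have ch: "chain_at p (Suc m) b" if "b : chains_in (Suc m) p 0 (plen p)" for b using that by (simp add: chains_in_def)
  have z: "\<gamma> (Suc m) (Fel (Suc m) p b) = \<zero>[P (Suc (Suc m))]" if "b : chains_in (Suc m) p 0 (plen p)" for b
  proof -
  have "chains_in (Suc (Suc m)) p b (plen p) = {}"
  using no_later_chain(2)[OF gen(2,3) ch[OF that]] by (simp add: chains_in_def)
  thus ?thesis using gamma_Fel[OF gen(1) ch[OF that] no_later_chain(1)[OF gen(2,3) ch[OF that]]]
  by (simp add: sgn_P_def P.minus_zero_eq)
  qed
  have "\<gamma> (Suc m) (\<Oplus>\<^bsub>P (Suc m)\<^esub>b\<in>chains_in (Suc m) p 0 (plen p). Fel (Suc m) p b) =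
  (\<Oplus>\<^bsub>P (Suc (Suc m))\<^esub>b\<in>chains_in (Suc m) p 0 (plen p). \<gamma> (Suc m) (Fel (Suc m) p b))"
  using Fel_in[OF gen(1) ch] by (intro ahom_finsum[OF grP grP lhomD(1)[OF gamma_lhom]])
  also have "\<dots> = \<zero>[P (Suc (Suc m))]" using z by (simp cong: P.finsum_cong)
  finally have s: "\<gamma> (Suc m) (\<Oplus>\<^bsub>P (Suc m)\<^esub>b\<in>chains_in (Suc m) p 0 (plen p). Fel (Suc m) p b) = \<zero>[P (Suc (Suc m))]" .
  have "(\<Oplus>\<^bsub>P (Suc m)\<^esub>b\<in>chains_in (Suc m) p 0 (plen p). Fel (Suc m) p b) : cP (Suc m)"
  using Fel_in[OF gen(1) ch] by (intro P1.finsum_closed) blast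
  hence "\<gamma> (Suc m) (\<gamma> m (Fel m p 0)) = \<zero>[P (Suc (Suc m))]"
  using gamma_Fel[OF gen(1,2)] gen(3) s ahom_neg[OF grP grP lhomD(1)[OF gamma_lhom]]
  by (simp add: cut.simps(3) sgn_P_def P.minus_zero_eq)
  thus ?case using gen by (simp add: lhomD(2)[OF gamma_lhom] Fel_in pi_in gamma_in act_zero[OF bim_P])
 qed
 thus ?thesis using 2 by simp
qed

lemma delta_sum:
 assumes "p : paths Q" "!!a. a : B ==> chain_at p (Suc n) a"
 shows "\<delta> (Suc n) (\<Oplus>\<^bsub>P (Suc n)\<^esub>a\<in>B. Fel (Suc n) p a) = (\<Oplus>\<^bsub>P n\<^esub>a\<in>B. \<delta> (Suc n) (Fel (Suc n) p a))"
 using Fel_in[OF assms(1,2)] by (intro ahom_finsum[OF grP grP bhomD(1)[OF delta_bhom]])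

lemma telescope_Fel:
 assumes n: "even n" and p: "p : paths Q" and c: "chain_at p n 0"
  and last: "plen p < cut p 0 (Suc (Suc n)) \<or> chain_at p (Suc (Suc n)) 0 & plen p < cut p 0 (Suc (Suc (Suc n)))"
 shows "\<delta> (Suc n) (\<Oplus>\<^bsub>P (Suc n)\<^esub>a\<in>{a. chain_at p (Suc n) a}. Fel (Suc n) p a) =
  Fel n p (Max {a. chain_at p n a}) -[P n] Fel n p 0" proof -
 interpret P: abelian_group "P n" by (rule grP)
 let ?B = "%a. {b. a <= b & chain_at p n b & cut p b n <= cut p a (Suc n)}"
 have M: "chain_at p n (Max (?B a))" if "chain_at p (Suc n) a" for a proof -
  have "Max (?B a) : ?B a" using chains_in_start(1)[OF that] finite_chains_in[of n p a "cut p a (Suc n)"]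
  unfolding chains_in_def by (intro Max_in) auto
  thus ?thesis by simp
 qed
 have "\<delta> (Suc n) (\<Oplus>\<^bsub>P (Suc n)\<^esub>a\<in>{a. chain_at p (Suc n) a}. Fel (Suc n) p a) =
  (\<Oplus>\<^bsub>P n\<^esub>a\<in>{a. chain_at p (Suc n) a}. Fel n p (Max (?B a)) -[P n] Fel n p a)"
  using n M chain_at_Suc Fel_in[OF p] by (subst delta_sum[OF p], simp, intro P.finsum_cong' refl)
  (simp_all add: delta_Fel[OF p] chains_in_def Pi_def)
 also have "\<dots> = Fel n p (Max {a. chain_at p n a}) -[P n] Fel n p 0"
  by (rule chain_telescope[OF n c last grP Fel_in[OF p]])
 finally show ?thesis .
qed

lemma Gam_tail:
 assumes p: "p : paths Q" and c: "chain_at p (Suc n) a" and t: "plen p < cut p a (Suc (Suc n))"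
 shows "(\<Oplus>\<^bsub>P (Suc n)\<^esub>b\<in>{b. a <= b & chain_at p (Suc n) b}. Fel (Suc n) p b) : Gam (Suc n)"
proof -
 interpret P: abelian_group "P (Suc n)" by (rule grP)
 note c' = chain_at_Suc[OF c]
 let ?s = "\<Oplus>\<^bsub>P (Suc n)\<^esub>b\<in>{b. a <= b & chain_at p (Suc n) b}. Fel (Suc n) p b"
 have s: "?s : cP (Suc n)" using Fel_in[OF p] by (intro P.finsum_closed) blast
 have "\<gamma> n (Fel n p a) = sgn_P (Suc n) ?s" using gamma_Fel[OF p c'] t by (simp add: cut.simps(3) chains_in_all)
 hence "sgn_P (Suc n) ?s : Gam (Suc n)" using GamI(2)[OF Fel_in[OF p c']] by simp
 thus ?thesis using Gam_from_neg s by (auto simp: sgn_P_def split: if_splits)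
qed

lemma Gam_tails:
 assumes p: "p : paths Q" and up: "!!a b. [| a : U; a <= b; chain_at p (Suc n) b |] ==> b : U"
  and U: "!!a. a : U ==> chain_at p (Suc n) a & plen p < cut p a (Suc (Suc n))"
 shows "(\<Oplus>\<^bsub>P (Suc n)\<^esub>b\<in>U. Fel (Suc n) p b) : Gam (Suc n)" proof (cases "U = {}")
 case True
 interpret P: abelian_group "P (Suc n)" by (rule grP)
 show ?thesis using True by (simp add: Gam_zero)
next
 case False
 have fin: "finite U" using U chain_at_start[of p "Suc n"] by (intro finite_subset[of U "{..plen p}"]) auto
 note m = Min_in[OF fin False]
 have "U = {b. Min U <= b & chain_at p (Suc n) b}" using up[OF m] U fin by auto
 thus ?thesis using Gam_tail[OF p conjunct1[OF U[OF m]] conjunct2[OF U[OF m]]] by simp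
qed

text \<open>
 The homotopy collects all chains of the next length, and the differential of each is a difference of
 two chains.  The sum telescopes; the term of the last chain is left, which is a value of the
 preceding homotopy.
\<close>
lemma contraction_even:
 assumes n: "even n" and p: "p : paths Q" and c: "chain_at p n 0" and t: "plen p < cut p 0 (Suc (Suc n))"
 shows "Fel n p 0 -[P n] \<delta> (Suc n) (\<gamma> n (Fel n p 0)) : Gam n" proof -
 interpret P: abelian_group "P n" by (rule grP)
 interpret P1: abelian_group "P (Suc n)" by (rule grP)
 let ?C = "{a. chain_at p (Suc n) a}" and ?l = "Max {a. chain_at p n a}"
 note l = last_chain[OF n c disjI1[OF t]]
 let ?s = "\<Oplus>\<^bsub>P (Suc n)\<^esub>a\<in>?C. Fel (Suc n) p a"
 have s: "?s : cP (Suc n)" using Fel_in[OF p] by (intro P1.finsum_closed) blast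
 have "\<gamma> n (Fel n p 0) = \<ominus>\<^bsub>P (Suc n)\<^esub> ?s"
  using gamma_Fel[OF p c] t n by (simp add: cut.simps(3) sgn_P_def chains_in_all)
 hence "\<delta> (Suc n) (\<gamma> n (Fel n p 0)) = \<ominus>\<^bsub>P n\<^esub> (Fel n p ?l -[P n] Fel n p 0)"
  using telescope_Fel[OF n p c disjI1[OF t]] ahom_neg[OF grP grP bhomD(1)[OF delta_bhom] s] by simp
 hence e: "Fel n p 0 -[P n] \<delta> (Suc n) (\<gamma> n (Fel n p 0)) = Fel n p ?l"
  using Fel_in[OF p c] Fel_in[OF p l(1)] by simp algebra
 have "Fel n p ?l : Gam n" proof (cases n)
  case 0
  have "{a. chain_at p n a} = {..plen p}" using 0 by (auto simp: chain_at_def)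
  hence "?l = plen p" by (simp, intro Max_eqI) auto
  moreover have "vt p (plen p) = tgt Q p" using sub_path(2)[OF p, of 0 "plen p"] by (simp add: sub_all)
  ultimately have "Fel n p ?l = \<rho>_aug (pi p)"
  using 0 P0_vertex(1)[OF p] by (simp add: Fgen_def \<rho>_aug_def sub_all sub_refl)
  thus ?thesis using GamI(1)[OF pi_in[OF p]] 0 by simp
 next
  case (Suc m)
  interpret PS: abelian_group "P (Suc m)" by (rule grP)
  have "cut p (Suc ?l) n = cut p ?l (Suc n)" using n by (rule cut_shift)
  hence "plen p < cut p ?l (Suc (Suc m))" using l(2) Suc by simp
  moreover have "{b. ?l <= b & chain_at p (Suc m) b} = {?l}"
  using finite_chains_even[OF n c disjI1[OF t]] l(1) Suc Max_ge[of "{a. chain_at p n a}"] by (auto intro: antisym)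
  ultimately show ?thesis using Gam_tail[OF p, of m ?l] l(1) Suc Fel_in[OF p l(1)] by simp
 qed
 thus ?thesis using e by simp
qed

text \<open>
 In odd degree the differential splits a chain completely instead of taking the difference of the two
 outer terms, and the sum over all longer chains again misses the initial chain only by a value of the
 preceding homotopy.
\<close>
lemma contraction_odd:
 assumes n: "even n" and p: "p : paths Q" and c: "chain_at p (Suc n) 0" and t: "plen p < cut p 0 (Suc (Suc (Suc n)))"
 shows "Fel (Suc n) p 0 -[P (Suc n)] \<delta> (Suc (Suc n)) (\<gamma> (Suc n) (Fel (Suc n) p 0)) : Gam (Suc n)"
proof -
 let ?P = "P (Suc n)"
 interpret P: abelian_group ?P by (rule grP)
 interpret P1: abelian_group "P (Suc (Suc n))" by (rule grP)
 let ?f = "Fel (Suc n) p"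
 let ?C = "{a. chain_at p (Suc n) a}" and ?D = "{a. chain_at p (Suc (Suc n)) a}"
 have fin: "finite ?C" using chain_at_start[of p "Suc n"] by (intro finite_subset[of ?C "{..plen p}"]) auto
 have f: "?f a : carrier ?P" if "a : ?C" for a using Fel_in[OF p] that by simp
 have pos: "plen p < cut p a (Suc (Suc n))" if "0 < a" for a
  using t n cut_shift[of "Suc (Suc n)" p 0] cut_mono[of "Suc 0" a p "Suc (Suc n)"] that by simp
 hence D: "?D <= {0}" using chain_at_cut(2)[of p "Suc (Suc n)"] by (fastforce simp flip: not_less)
 have sum: "(\<Oplus>\<^bsub>?P\<^esub>b\<in>X. ?f b) -[?P] (\<Oplus>\<^bsub>?P\<^esub>b\<in>Y. ?f b) = (\<Oplus>\<^bsub>?P\<^esub>b\<in>X - Y. ?f b)" if "Y <= X" "X <= ?C" for X Y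
 proof -
  have fX: "finite X" using that(2) fin finite_subset by blast
  have "X = Y \<union> (X - Y)" using that(1) by blast
  hence "(\<Oplus>\<^bsub>?P\<^esub>b\<in>X. ?f b) = (\<Oplus>\<^bsub>?P\<^esub>b\<in>Y. ?f b) +[?P] (\<Oplus>\<^bsub>?P\<^esub>b\<in>X - Y. ?f b)"
  using P.finsum_Un_disjoint[of Y "X - Y" ?f] that f fX finite_subset[OF that(1) fX] by (auto simp: Pi_def subset_iff)
  moreover have "(\<Oplus>\<^bsub>?P\<^esub>b\<in>Y. ?f b) : carrier ?P" "(\<Oplus>\<^bsub>?P\<^esub>b\<in>X - Y. ?f b) : carrier ?P"
  using that f by (intro P.finsum_closed; blast)+
  ultimately show ?thesis by simp algebra
 qed
 have G: "(\<Oplus>\<^bsub>?P\<^esub>b\<in>U. ?f b) : Gam (Suc n)"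
  if "U <= ?C" "!!a b. [| a : U; a <= b; b : ?C |] ==> b : U" "0 : U ==> plen p < cut p 0 (Suc (Suc n))" for U
 proof (rule Gam_tails[OF p])
  show "b : U" if "a : U" "a <= b" "chain_at p (Suc n) b" for a b using that that by (metis `!!a b. [| a : U; a <= b; b : ?C |] ==> b : U` mem_Collect_eq)
  show "chain_at p (Suc n) a & plen p < cut p a (Suc (Suc n))" if "a : U" for a
  using that `U <= ?C` `0 : U ==> plen p < cut p 0 (Suc (Suc n))` pos by (cases "a = 0") auto
 qed
 have gam: "\<gamma> (Suc n) (?f 0) = (\<Oplus>\<^bsub>P (Suc (Suc n))\<^esub>a\<in>?D. Fel (Suc (Suc n)) p a)"
  using gamma_Fel[OF p c] t n by (simp add: cut.simps(3) sgn_P_def chains_in_all)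
 show ?thesis proof (cases "chain_at p (Suc (Suc n)) 0")
  case True
  hence D0: "?D = {0}" using D by blast
  let ?B = "chains_in (Suc n) p 0 (cut p 0 (Suc (Suc n)))"
  have "\<gamma> (Suc n) (?f 0) = Fel (Suc (Suc n)) p 0" unfolding gam D0 using Fel_in[OF p True] by simp
  hence "\<delta> (Suc (Suc n)) (\<gamma> (Suc n) (?f 0)) = (\<Oplus>\<^bsub>?P\<^esub>b\<in>?B. ?f b)" using delta_Fel[OF p True] n by simp
  moreover have "?B <= ?C" "0 : ?B" using chains_in_start(1)[OF True] by (auto simp: chains_in_def)
  hence "(\<Oplus>\<^bsub>?P\<^esub>b\<in>?B. ?f b) -[?P] (\<Oplus>\<^bsub>?P\<^esub>b\<in>{0}. ?f b) = (\<Oplus>\<^bsub>?P\<^esub>b\<in>?C - {0}. ?f b) -[?P] (\<Oplus>\<^bsub>?P\<^esub>b\<in>?C - ?B. ?f b)"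
  proof -
  have "(?C - {0}) - (?C - ?B) = ?B - {0}" using `?B <= ?C` by blast
  thus ?thesis using sum[of "{0}" ?B] sum[of "?C - ?B" "?C - {0}"] `?B <= ?C` `0 : ?B` by auto
  qed
  moreover have "(\<Oplus>\<^bsub>?P\<^esub>b\<in>{0}. ?f b) = ?f 0" using f c by simp
  moreover have "(\<Oplus>\<^bsub>?P\<^esub>b\<in>?B. ?f b) : carrier ?P" using f `?B <= ?C` by (intro P.finsum_closed) blast
  ultimately have e': "\<delta> (Suc (Suc n)) (\<gamma> (Suc n) (?f 0)) -[?P] ?f 0 = (\<Oplus>\<^bsub>?P\<^esub>b\<in>?C - {0}. ?f b) -[?P] (\<Oplus>\<^bsub>?P\<^esub>b\<in>?C - ?B. ?f b)"
  and cl: "\<delta> (Suc (Suc n)) (\<gamma> (Suc n) (?f 0)) : carrier ?P" by simp_all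
  have "?f 0 -[?P] \<delta> (Suc (Suc n)) (\<gamma> (Suc n) (?f 0)) = \<ominus>\<^bsub>?P\<^esub> (\<delta> (Suc (Suc n)) (\<gamma> (Suc n) (?f 0)) -[?P] ?f 0)"
  using cl f[of 0] c by simp algebra
  hence e: "?f 0 -[?P] \<delta> (Suc (Suc n)) (\<gamma> (Suc n) (?f 0)) =
  \<ominus>\<^bsub>?P\<^esub> ((\<Oplus>\<^bsub>?P\<^esub>b\<in>?C - {0}. ?f b) -[?P] (\<Oplus>\<^bsub>?P\<^esub>b\<in>?C - ?B. ?f b))" unfolding e' .
  have "(\<Oplus>\<^bsub>?P\<^esub>b\<in>?C - {0}. ?f b) : Gam (Suc n)" by (rule G) auto
  moreover have "(\<Oplus>\<^bsub>?P\<^esub>b\<in>?C - ?B. ?f b) : Gam (Suc n)" proof (rule G)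
  show "b : ?C - ?B" if "a : ?C - ?B" "a <= b" "b : ?C" for a b
  using that cut_mono[of a b p "Suc n"] by (auto simp: chains_in_def)
  qed (use `0 : ?B` in auto)
  ultimately show ?thesis unfolding e by (intro Gam_neg Gam_minus)
 next
  case False
  hence D0: "?D = {}" using D by blast
  have "\<delta> (Suc (Suc n)) (\<gamma> (Suc n) (?f 0)) = \<zero>[?P]"
  unfolding gam D0 using ahom_zero[OF grP grP bhomD(1)[OF delta_bhom]] by simp
  hence "?f 0 -[?P] \<delta> (Suc (Suc n)) (\<gamma> (Suc n) (?f 0)) = ?f 0" using f c by (simp add: P.minus_eq P.minus_zero_eq)
  also have "?f 0 = (\<Oplus>\<^bsub>?P\<^esub>b\<in>?C. ?f b) -[?P] (\<Oplus>\<^bsub>?P\<^esub>b\<in>?C - {0}. ?f b)"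
  using sum[of "?C - {0}" ?C] c f by (simp add: double_diff)
  moreover have "plen p < cut p 0 (Suc (Suc n))" using False c t by (auto simp: chain_at_def le_Suc_eq not_le)
  ultimately show ?thesis by (auto intro!: Gam_minus G)
 qed
qed

lemma contraction:
 assumes "X : cP n" shows "X -[P n] \<delta> (Suc n) (\<gamma> n X) : Gam n" proof -
 interpret P: abelian_group "P n" by (rule grP)
 let ?dg = "%X. \<delta> (Suc n) (\<gamma> n X)"
 have l: "?dg : lhom (P n) (P n)" by (rule lhom_comp[OF bhomD(5)[OF delta_bhom] gamma_lhom])
 note L = lhom_minus[OF bim_P bim_P lhom_id l]
 show ?thesis using low_all[OF assms] proof (induction rule: low.induct)
  case zero
  show ?case using ahom_zero[OF grP grP lhomD(1)[OF L]] by (simp add: Gam_zero)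
 next
  case (add X Y)
  thus ?case using ahom_add[OF lhomD(1)[OF L], of X Y] by (simp add: low_in Gam_add)
 next
  case (gen p q c)
  have "Fel n p 0 -[P n] ?dg (Fel n p 0) : Gam n" proof (cases "even n")
  case True
  thus ?thesis using gen by (intro contraction_even)
  next
  case False
  then obtain m where "n = Suc m" "even m" by (auto elim: oddE)
  thus ?thesis using gen contraction_odd[of m p] by simp
  qed
  thus ?case using gen lhomD(2)[OF L, of "kk c ** pi q" "Fel n p 0"] by (simp add: Fel_in pi_in Gam_lact)
 qed
qed

text \<open>
 The terms that cancel in the monomial algebra cancel here as well.  In every other term an outer
 factor is reducible, and its normal form moves the term strictly below \<open>w\<close>.
\<close>
lemma delta_delta:
 assumes w: "w : chains (Suc (Suc n))"
 shows "\<delta> (Suc n) (\<delta> (Suc (Suc n)) (Ppure (Suc (Suc n)) \<one>[A] (ppath w) \<one>[A])) : low n {u. (u, w) : below}"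
proof -
 note c = chain_self[OF w] and c1 = chain_at_Suc[OF chain_self(1)[OF w]]
 note c0 = chain_at_Suc[OF c1]
 note p = c(3)
 let ?Z = "{u. (u, w) : below}"
 have "cut w 0 (Suc (Suc n)) < cut w 0 (Suc (Suc (Suc n)))" using c(1) unfolding chain_at_def by blast
 hence t: "plen w < cut w 0 (Suc (Suc (Suc n)))" using c(2) by simp
 have lowl: "Fel n w a : low n ?Z" if "chain_at w n a" "nxt w 0 <= a \<or> cut w a (Suc (Suc n)) <= plen w" for a
  using that by (intro low_Fel[OF p]) auto
 show ?thesis unfolding Fel_self[OF w, symmetric] proof (cases "even n")
  case True
  interpret P1: abelian_group "P (Suc n)" by (rule grP)
  note last = disjI2[OF conjI[OF c(1) t]]
  let ?l = "Max {a. chain_at w n a}"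
  note l = last_chain[OF True c0 last]
  have "\<delta> (Suc (Suc n)) (Fel (Suc (Suc n)) w 0) = (\<Oplus>\<^bsub>P (Suc n)\<^esub>a\<in>{a. chain_at w (Suc n) a}. Fel (Suc n) w a)"
  using delta_Fel[OF p c(1)] c(2) True by (simp add: chains_in_all)
  hence "\<delta> (Suc n) (\<delta> (Suc (Suc n)) (Fel (Suc (Suc n)) w 0)) = Fel n w ?l -[P n] Fel n w 0"
  using telescope_Fel[OF True p c0 last] by simp
  moreover have "nxt w 0 <= ?l" proof (rule ccontr)
  assume "\<not> nxt w 0 <= ?l"
  hence "cut w (Suc ?l) n <= cut w (nxt w 0) n" by (intro cut_mono) simp
  thus False using l(2) c(2) cut_nxt[OF True, of w 0] by simp
  qed
  ultimately show "\<delta> (Suc n) (\<delta> (Suc (Suc n)) (Fel (Suc (Suc n)) w 0)) : low n ?Z"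
  using lowl[OF l(1)] lowl[OF c0] c(2) by (simp add: low_minus)
 next
  case False
  interpret P: abelian_group "P n" by (rule grP)
  interpret P1: abelian_group "P (Suc n)" by (rule grP)
  have ev: "even (Suc n)" "n ~= 0" using False by (auto intro: Nat.gr0I)
  then obtain m where m: "n = Suc m" "even m" by (cases n) auto
  let ?M = "Max {a. chain_at w (Suc n) a}"
  note M = last_chain[OF ev(1) c1 disjI1[OF t]]
  have D: "\<delta> (Suc (Suc n)) (Fel (Suc (Suc n)) w 0) = Fel (Suc n) w ?M -[P (Suc n)] Fel (Suc n) w 0"
  using delta_Fel[OF p c(1)] c(2) ev by (simp add: chains_in_all)
  let ?X = "chains_in n w ?M (cut w ?M (Suc n))" and ?Y = "chains_in n w 0 (cut w 0 (Suc n))"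
  let ?f = "Fel n w"
  have XY: "chain_at w n a" if "a : ?X \<union> ?Y" for a using that by (auto simp: chains_in_def)
  have fX: "finite ?X" "finite ?Y" by (rule finite_chains_in)+
  have f: "?f a : cP n" if "a : ?X \<union> ?Y" for a using XY[OF that] by (rule Fel_in[OF p])
  have ds: "\<delta> (Suc n) (\<delta> (Suc (Suc n)) (Fel (Suc (Suc n)) w 0)) = (\<Oplus>\<^bsub>P n\<^esub>a\<in>?X. ?f a) -[P n] (\<Oplus>\<^bsub>P n\<^esub>a\<in>?Y. ?f a)"
  unfolding D using Fel_in[OF p M(1)] Fel_in[OF p c1] False
  by (simp add: ahom_minus[OF grP grP bhomD(1)[OF delta_bhom]] delta_Fel[OF p M(1)] delta_Fel[OF p c1])
  have sp: "(\<Oplus>\<^bsub>P n\<^esub>a\<in>B. ?f a) = (\<Oplus>\<^bsub>P n\<^esub>a\<in>?X \<inter> ?Y. ?f a) +[P n] (\<Oplus>\<^bsub>P n\<^esub>a\<in>B - ?X \<inter> ?Y. ?f a)"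
  if "?X \<inter> ?Y <= B" "B <= ?X \<union> ?Y" for B proof -
  have "B = (?X \<inter> ?Y) \<union> (B - ?X \<inter> ?Y)" using that by blast
  moreover have "finite B" using that fX finite_subset by blast
  ultimately show ?thesis using P.finsum_Un_disjoint[of "?X \<inter> ?Y" "B - ?X \<inter> ?Y" ?f] f that fX
  by (auto simp: Pi_def subset_iff)
  qed
  have M1: "cut w 1 (Suc n) = plen w" using cut_shift[OF ev(1), of w 0] c(2) by simp
  have Mc: "cut w ?M (Suc n) = plen w" proof (rule antisym)
  show "cut w ?M (Suc n) <= plen w" using chain_at_cut(2)[OF M(1)] .
  have "1 <= ?M" proof (rule ccontr)
  assume "\<not> 1 <= ?M"
  hence "Suc ?M = 1" by simp
  thus False using M(2) M1 by simp
  qed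
  thus "plen w <= cut w ?M (Suc n)" using cut_mono[of 1 ?M w "Suc n"] M1 by simp
  qed
  have left: "nxt w 0 <= a" if "a : ?X - ?Y" for a proof (rule ccontr)
  assume "\<not> nxt w 0 <= a"
  hence "cut w (Suc a) m <= cut w (nxt w 0) m" by (intro cut_mono) simp
  hence "cut w a n <= cut w 0 (Suc n)" using cut_shift[OF m(2), of w a] cut_nxt[OF m(2), of w 0] m(1) by simp
  thus False using that by (auto simp: chains_in_def)
  qed
  have right: "cut w a (Suc (Suc n)) <= plen w" if "a : ?Y - ?X" for a proof -
  have "a < ?M" using that chain_at_cut(2)[of w n a] Mc by (auto simp: chains_in_def)
  hence "cut w (Suc a) (Suc n) <= cut w ?M (Suc n)" by (intro cut_mono) simp
  thus ?thesis using Mc cut_shift[OF ev(1), of w a] by simp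
  qed
  have lX: "(\<Oplus>\<^bsub>P n\<^esub>a\<in>?X - ?X \<inter> ?Y. ?f a) : low n ?Z" using left by (intro low_sum lowl XY) auto
  have lY: "(\<Oplus>\<^bsub>P n\<^esub>a\<in>?Y - ?X \<inter> ?Y. ?f a) : low n ?Z" using right by (intro low_sum lowl XY) auto
  have cl: "(\<Oplus>\<^bsub>P n\<^esub>a\<in>?X \<inter> ?Y. ?f a) : cP n" using f by (intro P.finsum_closed) blast
  have "(\<Oplus>\<^bsub>P n\<^esub>a\<in>?X. ?f a) -[P n] (\<Oplus>\<^bsub>P n\<^esub>a\<in>?Y. ?f a) =
  (\<Oplus>\<^bsub>P n\<^esub>a\<in>?X - ?X \<inter> ?Y. ?f a) -[P n] (\<Oplus>\<^bsub>P n\<^esub>a\<in>?Y - ?X \<inter> ?Y. ?f a)"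
  using sp[of ?X] sp[of ?Y] cl low_in[OF lX] low_in[OF lY] by (simp only: Un_upper1 Un_upper2 Int_lower1 Int_lower2) algebra
  thus "\<delta> (Suc n) (\<delta> (Suc (Suc n)) (Fel (Suc (Suc n)) w 0)) : low n ?Z"
  unfolding ds using low_minus[OF lX lY] by simp
 qed
qed


section \<open>The perturbed resolution\<close>

lemma A_induct [consumes 1, case_names zero path add]:
 assumes "a : cA" "Pr \<zero>[A]" "!!p c. p : paths Q ==> Pr (kk c ** pi p)"
  "!!a b. [| a : cA; b : cA; Pr a; Pr b |] ==> Pr (a +[A] b)"
 shows "Pr a" proof -
 obtain x where x: "a = proj x" "keys x <= paths Q" using A_carrierE[OF assms(1)] by (auto simp: kQ_iff)
 have kQc: "x : cQ" if "keys x <= paths Q" for x :: "('v, 'e, 'k) pathalg" using that by (simp add: kQ_iff)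
 from x(2) have "Pr (proj x)" proof (induction x rule: pm_induct)
  case (single p c)
  thus ?case by (simp add: assms(3) proj_single[OF single, of c])
 qed (simp_all add: proj_zero assms(2,4) proj_add kQc)
 thus ?thesis using x by simp
qed

lemma rho_aug_pi:
 assumes "p : paths Q"
 shows "\<rho>_aug (pi p) = Ppure 0 (pi p) (ppath (vtx (tgt Q p))) \<one>[A]" "vtx (tgt Q p) : chains 0" proof -
 note v = path_ends(2)[OF assms]
 show c: "vtx (tgt Q p) : chains 0" using v by (simp add: chains_def trivial_iff)
 show "\<rho>_aug (pi p) = Ppure 0 (pi p) (ppath (vtx (tgt Q p))) \<one>[A]"
  using P0_vertex(1)[OF assms] Ppure_vertex(2)[OF pi_in[OF assms] c A_one v] v
  by (simp add: \<rho>_aug_def pi_in vtx_path)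
qed

lemma rho_aug_ract: "[| a : cA; z : K |] ==> ract (P 0) (\<rho>_aug a) (proj z) = \<rho>_aug (a ** proj z)" proof -
 assume a: "a : cA" and z: "z : K"
 have "Ppure 0 (a ** proj z) (scalar Q 1) \<one>[A] = Ppure 0 a (pmult Q z (scalar Q 1)) \<one>[A]"
  using a z by (simp add: Ppure_K(1) span_K)
 also have "pmult Q z (scalar Q (1::'k)) = pmult Q (scalar Q 1) z" using scalar_central[OF K_carrier[OF z]] by simp
 also have "Ppure 0 a (pmult Q (scalar Q 1) z) \<one>[A] = Ppure 0 a (scalar Q 1) (proj z ** \<one>[A])"
  using a z by (simp add: Ppure_K(2) span_K)
 finally show "ract (P 0) (\<rho>_aug a) (proj z) = \<rho>_aug (a ** proj z)"
  using a z by (simp add: \<rho>_aug_def Ppure_ract span_K proj_K_in)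
qed

lemma aug_bal: "P_bal 0 A (%a w b. a ** pi w ** b)" proof (rule P_balI)
 fix a w b assume a: "a : cA" and w: "w : chains 0" and b: "b : cA"
 note w' = pi_in[OF ch_path[OF w]]
 show "a ** pi w ** b : cA" using a w' b by simp
 show "(a +[A] a') ** pi w ** b = a ** pi w ** b +[A] a' ** pi w ** b" if "a' : cA" for a'
  using a w' b that by (simp add: A.l_distr)
 show "a ** pi w ** (b +[A] b') = a ** pi w ** b +[A] a ** pi w ** b'" if "b' : cA" for b'
  using a w' b that by (simp add: A.r_distr)
 fix z assume z: "z : K"
 note zc = proj_K_in[OF z]
 note k = K_mult_pi[OF z ch_path[OF w]]
 have "a ** proj z ** pi w ** b = a ** kk (lookup z (vtx (src w))) ** pi w ** b"
  using a w' b zc k(1) by (simp add: A.m_assoc flip: A.m_assoc[of "proj z"])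
 thus "a ** proj z ** pi w ** b = kk (lookup z (vtx (src w))) ** a ** pi w ** b" using kk_central[OF a] by simp
 have "a ** pi w ** (proj z ** b) = a ** (pi w ** proj z) ** b" using a w' b zc by (simp add: A.m_assoc)
 also have "\<dots> = a ** kk (lookup z (vtx (tgt Q w))) ** pi w ** b"
  using a w' b unfolding k(2) by (simp add: A.m_assoc)
 finally show "a ** pi w ** (proj z ** b) = kk (lookup z (vtx (tgt Q w))) ** a ** pi w ** b"
  using kk_central[OF a] by simp
qed

lemma aug_P_hom: "aug_P : ahom (P 0) A" unfolding aug_P_def by (rule P_lift_addhom[OF grA aug_bal])

lemma aug_P_pure: "[| a : cA; w : chains 0; b : cA |] ==> aug_P (Ppure 0 a (ppath w) b) = a ** pi w ** b"
 unfolding aug_P_def by (rule P_lift_pure[OF grA aug_bal])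

lemma aug_P_act:
 assumes "X : cP 0" "c : cA"
 shows "aug_P (lact (P 0) c X) = c ** aug_P X" "aug_P (ract (P 0) X c) = aug_P X ** c" proof -
 have m: "(%x. c ** x) : ahom A A" "(%x. x ** c) : ahom A A"
  using assms by (auto intro!: ahomI simp: A.l_distr A.r_distr)
 have w: "pi w : cA" if "w : chains 0" for w using pi_in[OF ch_path[OF that]] .
 show "aug_P (lact (P 0) c X) = c ** aug_P X"
  by (rule P_hom_eq[OF grA ahom_comp[OF aug_P_hom bimD(2)[OF bim_P assms(2)]] ahom_comp[OF m(1) aug_P_hom] _ assms(1)])
  (use assms w in \<open>simp add: Ppure_lact pp_span aug_P_pure A.m_assoc\<close>)
 show "aug_P (ract (P 0) X c) = aug_P X ** c"
  by (rule P_hom_eq[OF grA ahom_comp[OF aug_P_hom bimD(3)[OF bim_P assms(2)]] ahom_comp[OF m(2) aug_P_hom] _ assms(1)])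
  (use assms w in \<open>simp add: Ppure_ract pp_span aug_P_pure A.m_assoc\<close>)
qed

lemma aug_P_rho: assumes "a : cA" shows "aug_P (\<rho>_aug a) = a" using assms proof (induction rule: A_induct)
 case zero
 show ?case using ahom_zero[OF grA grP rho_aug_hom] ahom_zero[OF grP grA aug_P_hom] by simp
next
 case (path p c)
 note v = path_ends(2)[OF path]
 have "aug_P (\<rho>_aug (pi p)) = pi p" using path v rho_aug_pi[OF path]
  by (simp add: aug_P_pure pi_in vtx_path pi_mult src_def)
 thus ?case using path by (simp add: aug_P_act rho_aug_in pi_in flip: rho_aug_lact)
next
 case (add a b)
 thus ?case by (simp add: ahom_add[OF rho_aug_hom] ahom_add[OF aug_P_hom] rho_aug_in)
qed

lemma below_trans:
 "[| (u, v) : below; (v, z) : below\<^sup>= |] ==> (u, z) : below" "[| (u, v) : below\<^sup>=; (v, z) : below |] ==> (u, z) : below"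
 using transD[OF trans_below, of u v z] by auto

text \<open>The idempotent that the perturbed differential has to kill, and the conditions on it under
 which the perturbation works in degree \<open>n\<close>.\<close>

definition T :: "nat => ('v, 'e, 'k) tens => ('v, 'e, 'k) tens" where
 "T n X = (if n = 0 then \<rho>_aug (aug_P X) else \<rho> (n - 1) (dP n X))"

definition pert :: "nat => bool" where
 "pert n \<longleftrightarrow> T n : lhom (P n) (P n) & (\<forall>X\<in>cP n. T n X : Gam n) & (\<forall>X\<in>Gam n. T n X = X) & (\<forall>X\<in>cP n. T n X = \<zero>[P n] --> (\<forall>b\<in>cA. T n (ract (P n) X b) = \<zero>[P n])) & (\<forall>w\<in>chains (Suc n). T n (\<delta> (Suc n) (Fel (Suc n) w 0)) : low n {u. (u, w) : below})"

lemma dP_eq: "dP (Suc n) = P_bilift (P n) (%w. \<delta> (Suc n) (Ppure (Suc n) \<one>[A] (ppath w) \<one>[A]) -[P n]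
  T n (\<delta> (Suc n) (Ppure (Suc n) \<one>[A] (ppath w) \<one>[A])))"
 by (cases n) (simp_all add: T_def \<rho>_def Let_def)

lemma delta_Fel_between: "w : chains (Suc n) ==> \<delta> (Suc n) (Fel (Suc n) w 0) : between (P n) (src w) (tgt Q w)"
 using dgen_between[of w n] by (simp add: Fel_self delta_pure bimD(4)[OF bim_P] bimD(5)[OF bim_P] between_def)

lemma delta_dgen_eq: "w : chains (Suc n) ==> \<delta> (Suc n) (Fel (Suc n) w 0) = dgen (Suc n) w"
 using dgen_between[of w n] by (simp add: Fel_self delta_pure bimD(4)[OF bim_P] bimD(5)[OF bim_P] between_def)

lemma pert_0: "pert 0" unfolding pert_def proof (intro conjI ballI impI)
 have Th: "(%X. \<rho>_aug (aug_P X)) : ahom (P 0) (P 0)" by (rule ahom_comp[OF rho_aug_hom aug_P_hom])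
 note ac = ahom_in[OF aug_P_hom]
 show "T 0 : lhom (P 0) (P 0)" proof (rule lhomI)
  show "T 0 : ahom (P 0) (P 0)" using Th by (simp add: T_def[abs_def])
  show "T 0 (lact (P 0) a x) = lact (P 0) a (T 0 x)" if "a : cA" "x : cP 0" for a x
  using that ac by (simp add: T_def aug_P_act rho_aug_lact)
  show "T 0 (ract (P 0) x (proj z)) = ract (P 0) (T 0 x) (proj z)" if "z : K" "x : cP 0" for z x
  using that ac by (simp add: T_def aug_P_act rho_aug_ract proj_K_in)
 qed
 show "T 0 X : Gam 0" if "X : cP 0" for X using that ac by (simp add: T_def GamI)
 show "T 0 X = X" if "X : Gam 0" for X using that by (auto simp: T_def Gam_def aug_P_rho)
 show "T 0 (ract (P 0) X b) = \<zero>[P 0]" if X: "X : cP 0" and z: "T 0 X = \<zero>[P 0]" and b: "b : cA" for X b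
 proof -
  have "aug_P X = aug_P (T 0 X)" using X ac by (simp add: T_def aug_P_rho)
  hence "aug_P X = \<zero>[A]" using z ahom_zero[OF grP grA aug_P_hom] by simp
  thus ?thesis using X b ahom_zero[OF grA grP rho_aug_hom] by (simp add: T_def aug_P_act)
 qed
 fix w assume w: "w : chains (Suc 0)"
 note wp = pi_in[OF ch_path[OF w]]
 have "dgen (Suc 0) w = \<rho>_aug (pi w) -[P 0] ract (P 0) (\<rho>_aug \<one>[A]) (pi w)"
  using wp by (simp add: dgen_def \<rho>_aug_def Ppure_ract span_K)
 hence "aug_P (dgen (Suc 0) w) = pi w -[A] \<one>[A] ** pi w"
  using wp by (simp add: ahom_minus[OF grP grA aug_P_hom] aug_P_act aug_P_rho rho_aug_in bimD(13)[OF bim_P])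
 also have "\<dots> = \<zero>[A]" using wp by (simp add: A.minus_eq A.r_neg)
 finally have "T 0 (\<delta> (Suc 0) (Fel (Suc 0) w 0)) = \<zero>[P 0]"
  using ahom_zero[OF grA grP rho_aug_hom] by (simp add: delta_dgen_eq[OF w] T_def)
 thus "T 0 (\<delta> (Suc 0) (Fel (Suc 0) w 0)) : low 0 {u. (u, w) : below}" by (simp add: low.zero)
qed

definition pE :: "nat => ('v, 'e, 'k) tens => ('v, 'e, 'k) tens" where
 "pE n Y = \<delta> (Suc n) (\<gamma> n Y) -[P n] dP (Suc n) (\<gamma> n Y)"

context
 fixes n :: nat
 assumes pert: "pert n"
begin

interpretation P: abelian_group "P n" by (rule grP)
interpretation P1: abelian_group "P (Suc n)" by (rule grP)

lemma T_lhom: "T n : lhom (P n) (P n)" and T_Gam: "X : cP n ==> T n X : Gam n" and T_id: "X : Gam n ==> T n X = X"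
 and T_ker: "[| X : cP n; T n X = \<zero>[P n]; b : cA |] ==> T n (ract (P n) X b) = \<zero>[P n]"
 and T_low: "w : chains (Suc n) ==> T n (\<delta> (Suc n) (Fel (Suc n) w 0)) : low n {u. (u, w) : below}"
 using pert by (auto simp: pert_def)

lemma dP_gen_between:
 assumes "w : chains (Suc n)"
 shows "\<delta> (Suc n) (Fel (Suc n) w 0) -[P n] T n (\<delta> (Suc n) (Fel (Suc n) w 0)) : between (P n) (src w) (tgt Q w)"
 using delta_Fel_between[OF assms] chain_ends[OF assms] by (intro between_minus[OF bim_P] between_lhom[OF T_lhom])

lemma dP_eq': "w : chains (Suc n) ==> \<delta> (Suc n) (Ppure (Suc n) \<one>[A] (ppath w) \<one>[A]) = \<delta> (Suc n) (Fel (Suc n) w 0)"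
 by (simp add: Fel_self)

lemma dP_bhom: "dP (Suc n) : bhom (P (Suc n)) (P n)"
 unfolding dP_eq by (rule P_bilift(1)[OF bim_P]) (simp add: dP_eq' dP_gen_between)

lemma dP_pure:
 assumes "a : cA" "w : chains (Suc n)" "b : cA"
 shows "dP (Suc n) (Ppure (Suc n) a (ppath w) b) = lact (P n) a (ract (P n)
  (\<delta> (Suc n) (Fel (Suc n) w 0) -[P n] T n (\<delta> (Suc n) (Fel (Suc n) w 0))) b)" unfolding dP_eq
 by (subst P_bilift(2)[OF bim_P _ assms]) (simp_all add: dP_eq' dP_gen_between assms)

lemma dP_hom: "dP (Suc n) : ahom (P (Suc n)) (P n)" by (rule bhomD(1)[OF dP_bhom])

lemma dP_in: "X : cP (Suc n) ==> dP (Suc n) X : cP n" by (rule bhomD(4)[OF dP_bhom])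

lemma T_dP: assumes "X : cP (Suc n)" shows "T n (dP (Suc n) X) = \<zero>[P n]"
proof (rule P_hom_eq[OF grP ahom_comp[OF lhomD(1)[OF T_lhom] dP_hom] ahom_const_zero[OF grP grP] _ assms])
 fix a w b assume a: "a : cA" and w: "w : chains (Suc n)" and b: "b : cA"
 let ?d = "\<delta> (Suc n) (Fel (Suc n) w 0)"
 have d: "?d : cP n" using delta_Fel_between[OF w] by (simp add: between_def)
 note td = lhomD(4)[OF T_lhom d]
 have "T n (?d -[P n] T n ?d) = T n ?d -[P n] T n (T n ?d)"
  using d td by (intro ahom_minus[OF grP grP lhomD(1)[OF T_lhom]])
 hence "T n (?d -[P n] T n ?d) = \<zero>[P n]" using td by (simp add: T_id[OF T_Gam[OF d]] P.minus_eq P.r_neg)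
 hence "T n (ract (P n) (?d -[P n] T n ?d) b) = \<zero>[P n]" using d td b by (intro T_ker) simp_all
 thus "T n (dP (Suc n) (Ppure (Suc n) a (ppath w) b)) = \<zero>[P n]"
  using a w b d td by (simp add: dP_pure lhomD(2)[OF T_lhom] bimD(13)[OF bim_P] act_zero[OF bim_P])
qed

lemma diff_lhom: "(%X. \<delta> (Suc n) X -[P n] dP (Suc n) X) : lhom (P (Suc n)) (P n)"
 by (rule lhom_minus[OF bim_P bim_P bhomD(5)[OF delta_bhom] bhomD(5)[OF dP_bhom]])

text \<open>
 The correction \<open>\<delta> - \<partial>\<close> only produces terms over strictly smaller paths; this makes the perturbation
 locally nilpotent.
\<close>
lemma diff_low:
 assumes "X : low (Suc n) Z" "!!z u. [| z : Z; (u, z) : below |] ==> u : Z'"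
 shows "\<delta> (Suc n) X -[P n] dP (Suc n) X : low n Z'" using assms(1) proof (induction rule: low.induct)
 case zero
 show ?case using ahom_zero[OF grP grP lhomD(1)[OF diff_lhom]] by (simp add: low.zero)
next
 case (add X Y)
 thus ?case using ahom_add[OF lhomD(1)[OF diff_lhom], of X Y] by (simp add: low_in low.add)
next
 case (gen p q c)
 let ?e = "cut p 0 (Suc n)"
 let ?w = "sub p 0 ?e" and ?r = "sub p ?e (plen p)"
 note l = chain_at_cut[OF gen(2)]
 have s: "?r : paths Q" "?w : chains (Suc n)" "tgt Q ?w = src ?r"
  using sub_path[OF gen(1)] l chain_path_cut[OF gen(1,2)] by (simp_all add: sub_all)
 have e: "cat ?w ?r = p" using sub_cat[of 0 ?e "plen p" p] l by (simp add: sub_all)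
 let ?d = "\<delta> (Suc n) (Fel (Suc n) ?w 0)"
 have d: "?d : cP n" using delta_Fel_between[OF s(2)] by (simp add: between_def)
 note td = lhomD(4)[OF T_lhom d]
 have "Fel (Suc n) p 0 = Ppure (Suc n) \<one>[A] (ppath ?w) (pi ?r)"
  using Fel_chain[OF A_one s(2,1,3)] e Fel_in[OF gen(1,2)] by (simp add: bimD(4)[OF bim_P])
 hence "\<delta> (Suc n) (Fel (Suc n) p 0) = ract (P n) ?d (pi ?r)"
  "dP (Suc n) (Fel (Suc n) p 0) = ract (P n) (?d -[P n] T n ?d) (pi ?r)"
  using s d td by (simp_all add: dP_pure delta_pure delta_dgen_eq pi_in bimD(4)[OF bim_P] bimD(13)[OF bim_P])
 moreover have "ract (P n) (?d -[P n] T n ?d) (pi ?r) = ract (P n) ?d (pi ?r) -[P n] ract (P n) (T n ?d) (pi ?r)"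
  using d td s(1) by (intro act_minus[OF bim_P]) (simp_all add: pi_in)
 moreover have "ract (P n) ?d (pi ?r) : cP n" "ract (P n) (T n ?d) (pi ?r) : cP n"
  using d td s(1) by (simp_all add: pi_in bimD(13)[OF bim_P])
 ultimately have v: "\<delta> (Suc n) (Fel (Suc n) p 0) -[P n] dP (Suc n) (Fel (Suc n) p 0) = ract (P n) (T n ?d) (pi ?r)"
  by simp algebra
 have "ract (P n) (T n ?d) (pi ?r) : low n {u. (u, p) : below}" proof (rule low_ract[OF T_low[OF s(2)] s(1)])
  fix z u assume z: "z : {u. (u, ?w) : below}" "tgt Q z = src ?r" "(u, cat z ?r) : below\<^sup>="
  have ws: "src ?w : verts Q" using chain_ends[OF s(2)] by simp
  have "composable Q [vtx (src ?w), ?w, ?r]" using s ch_path[OF s(2)] ws by (simp add: composable3 vtx_path src_def)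
  from below_cat[OF _ this, of z] z(1) have "(cat z ?r, cat ?w ?r) : below"
  using below_parallel[of z ?w] by (simp add: src_def)
  thus "u : {u. (u, p) : below}" using below_trans(2)[OF z(3)] e by simp
 qed
 hence "lact (P n) (kk c ** pi q) (ract (P n) (T n ?d) (pi ?r)) : low n {u. (u, cat q p) : below}"
  using gen by (intro low_coef)
 hence "lact (P n) (kk c ** pi q) (ract (P n) (T n ?d) (pi ?r)) : low n Z'"
  using assms(2)[OF gen(6)] by (blast intro: low_mono)
 thus ?case using gen lhomD(2)[OF diff_lhom, of "kk c ** pi q" "Fel (Suc n) p 0"] v by (simp add: Fel_in pi_in)
qed

lemma pE_lhom: "pE n : lhom (P n) (P n)" using lhom_comp[OF diff_lhom gamma_lhom[of n]] by (simp add: pE_def[abs_def])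

lemma pE_low:
 assumes "X : low n Z" "downset Z" "!!z u. [| z : Z; (u, z) : below |] ==> u : Z'"
 shows "pE n X : low n Z'" unfolding pE_def by (rule diff_low[OF gamma_low[OF assms(1,2)] assms(3)])

lemma pE_in: "X : cP n ==> (pE n ^^ i) X : cP n" by (induction i) (simp_all add: lhomD(4)[OF pE_lhom])

lemma pE_zero: "pE n \<zero>[P n] = \<zero>[P n]" "(pE n ^^ i) \<zero>[P n] = \<zero>[P n]" proof -
 show *: "pE n \<zero>[P n] = \<zero>[P n]" by (rule ahom_zero[OF grP grP lhomD(1)[OF pE_lhom]])
 show "(pE n ^^ i) \<zero>[P n] = \<zero>[P n]" by (induction i) (simp_all add: *)
qed

lemma pE_mono: "(pE n ^^ N) X = \<zero>[P n] ==> N <= M ==> (pE n ^^ M) X = \<zero>[P n]"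
 using funpow_add[of "M - N" N "pE n"] by (simp add: pE_zero)

lemma pE_add: "[| X : cP n; Y : cP n |] ==> (pE n ^^ i) (X +[P n] Y) = (pE n ^^ i) X +[P n] (pE n ^^ i) Y"
 by (induction i) (simp_all add: ahom_add[OF lhomD(1)[OF pE_lhom]] pE_in)

lemma nil_add:
 assumes "X : cP n" "Y : cP n" "(pE n ^^ N) X = \<zero>[P n]" "(pE n ^^ M) Y = \<zero>[P n]"
 shows "(pE n ^^ max N M) (X +[P n] Y) = \<zero>[P n]"
 using assms by (simp add: pE_add pE_mono[OF assms(3), of "max N M"] pE_mono[OF assms(4), of "max N M"])

lemma locally_nilpotent:
 assumes "X : cP n" shows "\<exists>N. (pE n ^^ N) X = \<zero>[P n]" proof -
 have *: "\<exists>N. (pE n ^^ N) X = \<zero>[P n]" if "X : low n Z" "downset Z"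
  "!!p q c. [| p : paths Q; chain_at p n 0; plen p < cut p 0 (Suc (Suc n)); q : paths Q; tgt Q q = src p; cat q p : Z |] ==>
  \<exists>N. (pE n ^^ N) (lact (P n) (kk c ** pi q) (Fel n p 0)) = \<zero>[P n]" for X Z using that(1)
 proof (induction rule: low.induct)
  case zero
  show ?case by (rule exI[of _ 0]) simp
 next
  case (add X Y)
  thus ?case using nil_add low_in by blast
 qed (rule that(3))
 have g: "\<exists>N. (pE n ^^ N) X = \<zero>[P n]"
  if "X = lact (P n) (kk c ** pi q) (Fel n p 0)" "p : paths Q" "chain_at p n 0"
  "plen p < cut p 0 (Suc (Suc n))" "q : paths Q" "tgt Q q = src p" "cat q p = z" for z X c q p using that
 proof (induction z arbitrary: X c q p rule: wf_induct_rule[OF wf_below])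
  case (1 z)
  have "X : low n {u. (u, z) : below\<^sup>=}" unfolding 1(2) using 1(3-8) by (intro low.gen) auto
  hence "pE n X : low n {u. (u, z) : below}" proof (rule pE_low[OF _ downset_below(2)])
  show "u : {u. (u, z) : below}" if "y : {u. (u, z) : below\<^sup>=}" "(u, y) : below" for y u
  using below_trans(1)[OF that(2), of z] that(1) by simp
  qed
  hence "\<exists>N. (pE n ^^ N) (pE n X) = \<zero>[P n]" by (rule *[OF _ downset_below(1)]) (use 1(1) in blast)
  thus ?case by (metis funpow_Suc_right comp_apply)
 qed
 show ?thesis by (rule *[OF low_all[OF assms]]) (use g in \<open>auto simp: downset_def\<close>)
qed

lemma nil_induct:
 assumes "X : cP n" "Pr \<zero>[P n]" "!!X. [| X : cP n; Pr (pE n X) |] ==> Pr X"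
 shows "Pr X" proof -
 obtain N where "(pE n ^^ N) X = \<zero>[P n]" using locally_nilpotent[OF assms(1)] by blast
 thus ?thesis using assms(1) proof (induction N arbitrary: X)
  case (Suc N)
  hence "Pr (pE n X)" by (simp add: funpow_Suc_right lhomD(4)[OF pE_lhom] del: funpow.simps)
  thus ?case using Suc assms(3) by simp
 qed (use assms(2) in simp)
qed

lemma rho_sum:
 assumes X: "X : cP n" and N: "(pE n ^^ N) X = \<zero>[P n]" and M: "N <= M"
 shows "\<rho> n X = (\<Oplus>\<^bsub>P (Suc n)\<^esub>i\<in>{..M}. \<gamma> n ((pE n ^^ i) X))" proof -
 let ?t = "%i. \<gamma> n ((pE n ^^ i) X)"
 have z: "?t i = \<zero>[P (Suc n)]" if "N <= i" for i
  using pE_mono[OF N that] ahom_zero[OF grP grP lhomD(1)[OF gamma_lhom]] by simp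
 have c: "?t i : cP (Suc n)" for i using X by (simp add: gamma_in pE_in)
 have "(\<Oplus>\<^bsub>P (Suc n)\<^esub>i\<in>{i. i \<ge> 1 & ?t i ~= \<zero>[P (Suc n)]}. ?t i) = (\<Oplus>\<^bsub>P (Suc n)\<^esub>i\<in>{1..M}. ?t i)"
  using z M c by (intro P1.add.finprod_mono_neutral_cong_left) (auto intro: order_trans simp: not_le[symmetric])
 moreover have "{..M} = insert 0 {1..M}" by auto
 moreover have "(%Y. \<delta> (Suc n) (\<gamma> n Y) -[P n] dP (Suc n) (\<gamma> n Y)) = pE n" by (rule ext) (simp add: pE_def)
 ultimately show ?thesis using c c[of 0] by (simp add: \<rho>_def \<rho>_of_def Let_def)
qed

lemma rho_rec: assumes X: "X : cP n" shows "\<rho> n X = \<gamma> n X +[P (Suc n)] \<rho> n (pE n X)" proof -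
 obtain N where N: "(pE n ^^ N) X = \<zero>[P n]" using locally_nilpotent[OF X] by blast
 have c: "\<gamma> n ((pE n ^^ i) X) : cP (Suc n)" for i using X by (simp add: gamma_in pE_in)
 have "(pE n ^^ N) (pE n X) = \<zero>[P n]" using N by (metis funpow_swap1 pE_zero(1))
 hence "\<rho> n (pE n X) = (\<Oplus>\<^bsub>P (Suc n)\<^esub>i\<in>{..N}. \<gamma> n ((pE n ^^ Suc i) X))"
  using rho_sum[of "pE n X" N N] X by (simp add: lhomD(4)[OF pE_lhom] funpow_swap1)
 moreover have "\<rho> n X = (\<Oplus>\<^bsub>P (Suc n)\<^esub>i\<in>{..Suc N}. \<gamma> n ((pE n ^^ i) X))" by (rule rho_sum[OF X N]) simp
 hence "\<rho> n X = (\<Oplus>\<^bsub>P (Suc n)\<^esub>i\<in>{..N}. \<gamma> n ((pE n ^^ Suc i) X)) +[P (Suc n)] \<gamma> n ((pE n ^^ 0) X)"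
  using P1.add.finprod_Suc2[of "%i. \<gamma> n ((pE n ^^ i) X)" N] c by (simp only:) blast
 moreover have "(\<Oplus>\<^bsub>P (Suc n)\<^esub>i\<in>{..N}. \<gamma> n ((pE n ^^ Suc i) X)) : cP (Suc n)" using c by (intro P1.finsum_closed) blast
 ultimately show ?thesis using P1.a_comm[OF _ c[of 0]] by simp
qed

lemma rho_zero: "\<rho> n \<zero>[P n] = \<zero>[P (Suc n)]"
 using rho_sum[of "\<zero>[P n]" 0 0] ahom_zero[OF grP grP lhomD(1)[OF gamma_lhom]] by simp

lemma rho_Gam: assumes "X : cP n" shows "\<rho> n X : Gam (Suc n)" using assms proof (rule nil_induct)
 show "\<rho> n X : Gam (Suc n)" if "X : cP n" "\<rho> n (pE n X) : Gam (Suc n)" for X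
  using that by (simp add: rho_rec[of X] Gam_add GamI)
qed (simp add: rho_zero Gam_zero)

lemma rho_in: "X : cP n ==> \<rho> n X : cP (Suc n)" by (rule Gam_in[OF rho_Gam])

lemma rho_kill_gamma: assumes "X : cP n" "\<gamma> n X = \<zero>[P (Suc n)]" shows "\<rho> n X = \<zero>[P (Suc n)]"
proof -
 have "pE n X = \<zero>[P n]" using assms ahom_zero[OF grP grP lhomD(1)[OF diff_lhom]] by (simp add: pE_def)
 thus ?thesis using assms by (simp add: rho_rec[of X] rho_zero)
qed

lemma rho_kill: "X : Gam n ==> \<rho> n X = \<zero>[P (Suc n)]" by (simp add: rho_kill_gamma gamma_Gam Gam_in)

lemma rho_add: assumes "X : cP n" "Y : cP n" shows "\<rho> n (X +[P n] Y) = \<rho> n X +[P (Suc n)] \<rho> n Y"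
proof -
 obtain N M where N: "(pE n ^^ N) X = \<zero>[P n]" "(pE n ^^ M) Y = \<zero>[P n]" using locally_nilpotent[OF assms(1)] locally_nilpotent[OF assms(2)] by blast
 note z = pE_mono[OF N(1), of "max N M"] pE_mono[OF N(2), of "max N M"]
 have "\<rho> n (X +[P n] Y) = (\<Oplus>\<^bsub>P (Suc n)\<^esub>i\<in>{..max N M}. \<gamma> n ((pE n ^^ i) X) +[P (Suc n)] \<gamma> n ((pE n ^^ i) Y))"
  using rho_sum[OF _ nil_add[OF assms N] order_refl] assms
  by (simp add: pE_add ahom_add[OF lhomD(1)[OF gamma_lhom]] pE_in)
 also have "\<dots> = \<rho> n X +[P (Suc n)] \<rho> n Y"
  using assms z rho_sum[OF assms(1), of N "max N M"] rho_sum[OF assms(2), of M "max N M"] N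
  by (simp add: P1.finsum_addf gamma_in pE_in)
 finally show ?thesis .
qed

lemma rho_lhom: "\<rho> n : lhom (P n) (P (Suc n))" proof (rule lhomI)
 show "\<rho> n : ahom (P n) (P (Suc n))" by (rule ahomI) (simp_all add: rho_in rho_add)
 show "\<rho> n (lact (P n) a X) = lact (P (Suc n)) a (\<rho> n X)" if a: "a : cA" and X: "X : cP n" for a X using X
 proof (rule nil_induct)
  show "\<rho> n (lact (P n) a \<zero>[P n]) = lact (P (Suc n)) a (\<rho> n \<zero>[P n])" using a by (simp add: act_zero[OF bim_P] rho_zero)
  fix X assume "X : cP n" "\<rho> n (lact (P n) a (pE n X)) = lact (P (Suc n)) a (\<rho> n (pE n X))"
  thus "\<rho> n (lact (P n) a X) = lact (P (Suc n)) a (\<rho> n X)"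
  using a by (simp add: rho_rec[of X] rho_rec[of "lact (P n) a X"] bimD(12)[OF bim_P] lhomD(2)[OF pE_lhom]
  lhomD(2)[OF gamma_lhom] ahom_add[OF bimD(2)[OF bim_P]] gamma_in rho_in lhomD(4)[OF pE_lhom])
 qed
 show "\<rho> n (ract (P n) X (proj z)) = ract (P (Suc n)) (\<rho> n X) (proj z)" if z: "z : K" and X: "X : cP n" for z X
  using X proof (rule nil_induct)
  note zc = proj_K_in[OF z]
  show "\<rho> n (ract (P n) \<zero>[P n] (proj z)) = ract (P (Suc n)) (\<rho> n \<zero>[P n]) (proj z)" using zc by (simp add: act_zero[OF bim_P] rho_zero)
  fix X assume "X : cP n" "\<rho> n (ract (P n) (pE n X) (proj z)) = ract (P (Suc n)) (\<rho> n (pE n X)) (proj z)"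
  thus "\<rho> n (ract (P n) X (proj z)) = ract (P (Suc n)) (\<rho> n X) (proj z)"
  using zc z by (simp add: rho_rec[of X] rho_rec[of "ract (P n) X (proj z)"] bimD(13)[OF bim_P] lhomD(3)[OF pE_lhom]
  lhomD(3)[OF gamma_lhom] ahom_add[OF bimD(3)[OF bim_P]] gamma_in rho_in lhomD(4)[OF pE_lhom])
 qed
qed

lemma rho_low: assumes "X : low n Z" "downset Z" shows "\<rho> n X : low (Suc n) Z" proof -
 have "X : low n Z --> \<rho> n X : low (Suc n) Z" proof (rule nil_induct[OF low_in[OF assms(1)]])
  show "\<zero>[P n] : low n Z --> \<rho> n \<zero>[P n] : low (Suc n) Z" by (simp add: rho_zero low.zero)
  fix X assume X: "X : cP n" "pE n X : low n Z --> \<rho> n (pE n X) : low (Suc n) Z"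
  show "X : low n Z --> \<rho> n X : low (Suc n) Z" proof
  assume Z: "X : low n Z"
  have "pE n X : low n Z" using assms(2) by (intro pE_low[OF Z assms(2)]) (auto simp: downset_def)
  thus "\<rho> n X : low (Suc n) Z" using X gamma_low[OF Z assms(2)] by (simp add: rho_rec[of X] low.add)
  qed
 qed
 thus ?thesis using assms(1) by simp
qed

text \<open>
 Induction along the nilpotent perturbation puts the defect \<open>X - \<partial> \<rho> X\<close> into \<open>Gam n\<close>, where \<open>T n\<close> is the
 identity.  As \<open>T n\<close> kills boundaries, the defect is \<open>T n X\<close>.
\<close>
lemma dP_rho: assumes X: "X : cP n" shows "dP (Suc n) (\<rho> n X) = X -[P n] T n X" proof -
 have "X -[P n] dP (Suc n) (\<rho> n X) : Gam n" using X proof (rule nil_induct)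
  show "\<zero>[P n] \<ominus>\<^bsub>P n\<^esub> dP (Suc n) (\<rho> n \<zero>[P n]) : Gam n"
  by (simp add: rho_zero ahom_zero[OF grP grP dP_hom] Gam_zero P.minus_eq P.minus_zero_eq)
  fix X assume X: "X : cP n" and h: "pE n X -[P n] dP (Suc n) (\<rho> n (pE n X)) : Gam n"
  note g = gamma_in[OF X]
  have c: "pE n X : cP n" "\<delta> (Suc n) (\<gamma> n X) : cP n" "dP (Suc n) (\<gamma> n X) : cP n"
  "dP (Suc n) (\<rho> n (pE n X)) : cP n"
  using X g by (simp_all add: lhomD(4)[OF pE_lhom] bhomD(4)[OF delta_bhom] dP_in rho_in)
  have "dP (Suc n) (\<rho> n X) = dP (Suc n) (\<gamma> n X) +[P n] dP (Suc n) (\<rho> n (pE n X))"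
  using X g c by (simp add: rho_rec[of X] ahom_add[OF dP_hom] rho_in)
  hence "X -[P n] dP (Suc n) (\<rho> n X) = (X -[P n] \<delta> (Suc n) (\<gamma> n X)) +[P n] (pE n X -[P n] dP (Suc n) (\<rho> n (pE n X)))"
  using X c unfolding pE_def[of n X] by simp algebra
  thus "X -[P n] dP (Suc n) (\<rho> n X) : Gam n" using Gam_add[OF contraction[OF X] h] by simp
 qed
 hence "T n (X -[P n] dP (Suc n) (\<rho> n X)) = X -[P n] dP (Suc n) (\<rho> n X)" by (rule T_id)
 moreover have r: "\<rho> n X : cP (Suc n)" "dP (Suc n) (\<rho> n X) : cP n" using X by (simp_all add: rho_in dP_in)
 ultimately have "T n X -[P n] \<zero>[P n] = X -[P n] dP (Suc n) (\<rho> n X)"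
  using X by (simp add: ahom_minus[OF grP grP lhomD(1)[OF T_lhom]] T_dP)
 moreover have "T n X : cP n" using X lhomD(4)[OF T_lhom] by simp
 ultimately have "T n X = X -[P n] dP (Suc n) (\<rho> n X)" by (simp add: P.minus_eq P.minus_zero_eq)
 thus ?thesis using X r by simp algebra
qed

text \<open>
 Contractibility in degree \<open>n\<close> turns \<open>\<rho> \<partial>\<close> in the next degree into a projection onto \<open>Gam\<close>.
\<close>
lemma pert_step: "pert (Suc n)" unfolding pert_def proof (intro conjI ballI impI)
 have T: "T (Suc n) = (%X. \<rho> n (dP (Suc n) X))" by (simp add: T_def[abs_def])
 show "T (Suc n) : lhom (P (Suc n)) (P (Suc n))" unfolding T by (rule lhom_comp[OF rho_lhom bhomD(5)[OF dP_bhom]])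
 show "T (Suc n) X : Gam (Suc n)" if "X : cP (Suc n)" for X unfolding T using that by (simp add: rho_Gam dP_in)
 show "T (Suc n) X = X" if X: "X : Gam (Suc n)" for X proof -
  obtain Y where Y: "Y : cP n" "X = \<gamma> n Y" using X by (auto simp: Gam_def)
  note g = gamma_in[OF Y(1)]
  have c: "\<delta> (Suc n) (\<gamma> n Y) : cP n" "dP (Suc n) (\<gamma> n Y) : cP n" "pE n Y : cP n"
  using Y g by (simp_all add: lhomD(4)[OF pE_lhom] bhomD(4)[OF delta_bhom] dP_in)
  let ?e = "Y -[P n] \<delta> (Suc n) (\<gamma> n Y)"
  have "dP (Suc n) (\<gamma> n Y) = Y -[P n] (pE n Y +[P n] ?e)" using Y c unfolding pE_def by simp algebra
  hence "\<rho> n (dP (Suc n) (\<gamma> n Y)) = \<rho> n Y -[P (Suc n)] (\<rho> n (pE n Y) +[P (Suc n)] \<rho> n ?e)"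
  using Y c by (simp add: ahom_minus[OF grP grP lhomD(1)[OF rho_lhom]] rho_add)
  also have "\<dots> = \<gamma> n Y"
  using Y c g rho_in[OF c(3)] by (simp add: rho_kill[OF contraction[OF Y(1)]] rho_rec[OF Y(1)]) algebra
  finally show ?thesis unfolding T Y(2) .
 qed
 show "T (Suc n) (ract (P (Suc n)) X b) = \<zero>[P (Suc n)]"
  if X: "X : cP (Suc n)" and z: "T (Suc n) X = \<zero>[P (Suc n)]" and b: "b : cA" for X b proof -
  note d = dP_in[OF X]
  have "dP (Suc n) X -[P n] T n (dP (Suc n) X) = \<zero>[P n]"
  using dP_rho[OF d] z ahom_zero[OF grP grP dP_hom] unfolding T by simp
  hence "dP (Suc n) X = \<zero>[P n]" using T_dP[OF X] d by (simp add: P.minus_eq P.minus_zero_eq)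
  thus ?thesis unfolding T using X b by (simp add: bhomD(3)[OF dP_bhom] act_zero[OF bim_P] rho_zero)
 qed
 fix w assume w: "w : chains (Suc (Suc n))"
 let ?X = "\<delta> (Suc (Suc n)) (Fel (Suc (Suc n)) w 0)"
 have X: "?X : low (Suc n) {u. (u, w) : below\<^sup>=}"
  by (rule delta_Fel_low[OF chain_self(3)[OF w] chain_self(1)[OF w]])
 note xc = low_in[OF X]
 have dd: "\<delta> (Suc n) ?X : low n {u. (u, w) : below}" using delta_delta[OF w] by (simp add: Fel_self[OF w])
 have df: "\<delta> (Suc n) ?X -[P n] dP (Suc n) ?X : low n {u. (u, w) : below}" proof (rule diff_low[OF X])
  show "u : {u. (u, w) : below}" if "y : {u. (u, w) : below\<^sup>=}" "(u, y) : below" for y u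
  using below_trans(1)[OF that(2), of w] that(1) by simp
 qed
 have "dP (Suc n) ?X = \<delta> (Suc n) ?X -[P n] (\<delta> (Suc n) ?X -[P n] dP (Suc n) ?X)"
  using low_in[OF dd] dP_in[OF xc] by algebra
 hence "dP (Suc n) ?X : low n {u. (u, w) : below}" using low_minus[OF dd df] by simp
 thus "T (Suc n) ?X : low (Suc n) {u. (u, w) : below}" unfolding T by (rule rho_low[OF _ downset_below(1)])
qed

end

lemma pert: "pert n" by (induction n) (simp_all add: pert_0 pert_step)

lemmas dP_bimodule_hom = dP_bhom[OF pert] and rho_left_hom = rho_lhom[OF pert] and dP_after_rho = dP_rho[OF pert]

lemma dP_dP: assumes "X : cP (Suc (Suc n))" shows "dP (Suc n) (dP (Suc (Suc n)) X) = \<zero>[P n]" proof -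
 interpret P: abelian_group "P n" by (rule grP)
 let ?Y = "dP (Suc (Suc n)) X"
 have Y: "?Y : cP (Suc n)" by (rule dP_in[OF pert assms])
 note Z = dP_in[OF pert Y]
 have "\<rho> n (dP (Suc n) ?Y) = \<zero>[P (Suc n)]" using T_dP[OF pert assms] by (simp add: T_def)
 hence "dP (Suc n) ?Y -[P n] T n (dP (Suc n) ?Y) = \<zero>[P n]"
  using dP_rho[OF pert Z] ahom_zero[OF grP grP dP_hom[OF pert]] by simp
 thus ?thesis using T_dP[OF pert Y] Z by (simp add: P.minus_eq P.minus_zero_eq)
qed

lemma aug_dP: assumes "X : cP 1" shows "aug_P (dP 1 X) = \<zero>[A]" proof -
 have c: "aug_P (dP 1 X) : cA" using dP_in[OF pert, of X 0] assms ahom_in[OF aug_P_hom] by simp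
 have "aug_P (dP 1 X) = aug_P (T 0 (dP 1 X))" using c by (simp add: T_def aug_P_rho)
 also have "T 0 (dP 1 X) = \<zero>[P 0]" using T_dP[OF pert, of X 0] assms by simp
 finally show ?thesis using ahom_zero[OF grP grA aug_P_hom] by simp
qed

lemma dP_rho_Suc:
 assumes "X : cP (Suc n)"
 shows "dP (Suc (Suc n)) (\<rho> (Suc n) X) = X -[P (Suc n)] \<rho> n (dP (Suc n) X)"
 using dP_rho[OF pert assms] by (simp add: T_def)

lemma dP_rho_0: "X : cP 0 ==> dP 1 (\<rho> 0 X) = X -[P 0] \<rho>_aug (aug_P X)"
 using dP_rho[OF pert, of X 0] by (simp add: T_def)

lemma rho_unit: "[| a : cA; w : chains n |] ==> \<rho> n (Ppure n a (ppath w) \<one>[A]) = \<zero>[P (Suc n)]"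
 by (rule rho_kill_gamma[OF pert]) (simp_all add: gamma_unit Ppure_in pp_span)

end

section \<open>The bar resolution\<close>

lemma tensor_lift_unique:
 assumes "\<forall>M\<in>set Ms. factor K M" "abelian_group H" "f : ahom (tensor K Ms) H"
  "!!xs. xs : tuples Ms ==> g xs = f (pure_tensor K Ms xs)" "X : carrier (tensor K Ms)"
 shows "tensor_lift H g X = f X" proof -
 have b: "balanced K Ms H g"
  by (rule bal_cong[OF _ assms(1) bal_comp[OF bal_pure[OF assms(1)] assms(3)]]) (simp add: assms(4))
 show ?thesis by (rule ahom_tensor_eq[OF assms(1,2) tensor_lift_addhom[OF assms(1,2) b] assms(3) _ assms(5)])
  (simp add: tensor_lift_pure[OF assms(1,2) b] assms(4))
qed

lemma tensor_append:
 assumes "\<forall>M\<in>set (Us @ Vs). factor K M" "ys : tuples Vs"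
 shows "(%X. tensor_append K (Us @ Vs) X ys) : ahom (tensor K Us) (tensor K (Us @ Vs))"
  "us : tuples Us ==> tensor_append K (Us @ Vs) (pure_tensor K Us us) ys = pure_tensor K (Us @ Vs) (us @ ys)" proof -
 note b = bal_append[OF bal_pure[OF assms(1)] assms(2)]
 have f: "\<forall>M\<in>set Us. factor K M" using assms(1) by simp
 show "(%X. tensor_append K (Us @ Vs) X ys) : ahom (tensor K Us) (tensor K (Us @ Vs))"
  unfolding tensor_append_def by (rule tensor_lift_addhom[OF f abelian_group_tensor[OF assms(1)] b])
 show "us : tuples Us ==> tensor_append K (Us @ Vs) (pure_tensor K Us us) ys = pure_tensor K (Us @ Vs) (us @ ys)"
  unfolding tensor_append_def by (rule tensor_lift_pure[OF f abelian_group_tensor[OF assms(1)] b])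
qed

context confluent_presentation
begin

lemma P_lift_unique:
 assumes H: "abelian_group H" and f: "f : ahom (P n) H"
  and g: "!!a w b. [| a : cA; w : chains n; b : cA |] ==> g a w b = f (Ppure n a (ppath w) b)" and X: "X : cP n"
 shows "P_lift H g X = f X" proof -
 note pc = Ppure_in[OF _ pp_span]
 have b: "P_bal n H g" proof (rule P_balI)
  fix a w b assume a: "a : cA" "w : chains n" "b : cA"
  note c = g[OF a]
  show "g a w b : carrier H" using a by (simp add: c ahom_in[OF f] pc)
  show "g (a +[A] a') w b = g a w b +[H] g a' w b" if "a' : cA" for a'
  using a that by (simp add: g Ppure_add(1) pp_span ahom_add[OF f] pc)
  show "g a w (b +[A] b') = g a w b +[H] g a w b'" if "b' : cA" for b'
  using a that by (simp add: g Ppure_add(3) pp_span ahom_add[OF f] pc)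
  fix z assume z: "z : K"
  have "Ppure n (a ** proj z) (ppath w) b = Ppure n a (single w (lookup z (vtx (src w)))) b"
  using a z K_mult_single(1)[OF z ch_path[OF a(2)], of 1] by (simp add: Ppure_K(1) pp_span)
  thus "g (a ** proj z) w b = g (kk (lookup z (vtx (src w))) ** a) w b"
  using a z Ppure_single[OF a(1,3,2)] by (simp add: g proj_K_in)
  have "Ppure n a (ppath w) (proj z ** b) = Ppure n a (single w (lookup z (vtx (tgt Q w)))) b"
  using a z K_mult_single(2)[OF z ch_path[OF a(2)], of 1] by (simp flip: Ppure_K(2) add: pp_span)
  thus "g a w (proj z ** b) = g (kk (lookup z (vtx (tgt Q w))) ** a) w b"
  using a z Ppure_single[OF a(1,3,2)] by (simp add: g proj_K_in)
 qed
 show ?thesis by (rule P_hom_eq[OF H P_lift_addhom[OF H b] f _ X]) (simp add: P_lift_pure[OF H b] g)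
qed

definition HB where "HB n = fac_A # replicate n fac_Abar"

abbreviation "TB n == tuples (HB n)"

lemma HB_Suc: "HB (Suc n) = HB n @ [fac_Abar]" by (simp add: HB_def replicate_append_same)

lemma HB_0: "HB 0 = [fac_A]" by (simp add: HB_def)

lemma B_mid: "\<forall>M\<in>set (replicate n fac_Abar). factor K M & central M"
 by (simp add: fac_Abar_factor fac_Abar_central)

lemma facs_bar_eq: "facs_bar n = fac_A # replicate n fac_Abar @ [fac_A]" by (simp add: facs_bar_def)

lemma facs_bar_HB: "facs_bar n = HB n @ [fac_A]" by (simp add: facs_bar_def HB_def)

lemma HB_factor: "\<forall>M\<in>set (HB n). factor K M" by (auto simp: HB_def fac_A_factor fac_Abar_factor)

lemma bim_Bar: "bim (Bar n)" unfolding Bar_def facs_bar_eq by (rule bim_BT[OF B_mid])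

lemmas B_simps = BT_simps[OF B_mid, folded facs_bar_eq Bar_def]
lemmas B_factor = TMs_factor[OF B_mid, folded facs_bar_eq]
lemmas grB = bimD(1)[OF bim_Bar]
lemmas B_lact = BT_lact_pure[OF B_mid, folded facs_bar_eq Bar_def]
lemmas B_ract = BT_ract_pure[OF B_mid, folded facs_bar_eq Bar_def]
lemmas B_pure_bal = TT_pure[OF B_mid, folded facs_bar_eq]
lemma ahom_Bar: "ahom (Bar n) H = ahom (tensor K (facs_bar n)) H" "ahom N (Bar n) = ahom N (tensor K (facs_bar n))"
 by (simp_all add: ahom_def B_simps)

lemma B_bal: "balanced K (HB n @ [fac_A]) (Bar n) (Bpure n)"
 using B_pure_bal[of n] by (simp add: facs_bar_HB balanced_def B_simps)

lemma B_pure_in: "[| us : TB n; b : cA |] ==> Bpure n (us @ [b]) : cB n"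
 using bal_in[OF B_bal, of "us @ [b]"] by (simp add: car_A)

lemma B_pure_lact: "[| x # us : TB n; b : cA; c : cA |] ==>
  lact (Bar n) c (Bpure n (x # us @ [b])) = Bpure n ((c ** x) # us @ [b])"
 by (rule B_lact) (auto simp: facs_bar_HB HB_def car_A)

lemma B_pure_ract: "[| us : TB n; b : cA; c : cA |] ==>
  ract (Bar n) (Bpure n (us @ [b])) c = Bpure n (us @ [b ** c])" by (rule B_ract) (auto simp: facs_bar_HB car_A)

lemma HB_ConsE:
 assumes "us : TB n" obtains x vs where "us = x # vs" "x : cA"
 using assms unfolding HB_def by (auto simp: car_A elim: tuples_ConsE)

lemma HB_lact: "[| x # us : TB n; c : cA |] ==> (c ** x) # us : TB n" by (simp add: HB_def car_A)

lemma HB_SucE: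
 assumes "us : TB (Suc n)" obtains vs c where "us = vs @ [to_bar c]" "vs : TB n" "c : cA" proof -
 obtain vs ws where "us = vs @ ws" "vs : TB n" "ws : tuples [fac_Abar]"
  using assms unfolding HB_Suc by (elim tuples_appendE)
 moreover from this obtain d where "ws = [d]" "d : carrier fac_Abar" by (auto elim!: tuples_ConsE)
 moreover from this obtain c where "c : cA" "d = to_bar c" by (auto elim: Abar_carrierE)
 ultimately show thesis using that by blast
qed

lemma HB_SucI: "[| vs : TB n; c : cA |] ==> vs @ [to_bar c] : TB (Suc n)" by (simp add: HB_Suc to_bar_in)

lemma facs_barE:
 assumes "xs : tuples (facs_bar n)" obtains us b where "xs = us @ [b]" "us : TB n" "b : cA" proof -
 obtain us ws where "xs = us @ ws" "us : TB n" "ws : tuples [fac_A]"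
  using assms unfolding facs_bar_HB by (elim tuples_appendE)
 moreover from this obtain b where "ws = [b]" "b : cA" by (auto elim!: tuples_ConsE simp: car_A)
 ultimately show thesis using that by blast
qed

lemma facs_barI: "[| us : TB n; b : cA |] ==> us @ [b] : tuples (facs_bar n)" by (simp add: facs_bar_HB car_A)

lemma B_hom_eq:
 assumes "abelian_group H" "f : ahom (Bar n) H" "g : ahom (Bar n) H"
  "!!us b. [| us : TB n; b : cA |] ==> f (Bpure n (us @ [b])) = g (Bpure n (us @ [b]))"
  "X : cB n"
 shows "f X = g X" by (rule ahom_tensor_eq[OF B_factor assms(1) assms(2,3)[unfolded ahom_Bar]])
  (use assms in \<open>auto elim!: facs_barE simp: B_simps\<close>)

subsection \<open>Maps out of the bar resolution\<close>

lemma bal_snoc_ract: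
 assumes H: "bim H" and b: "balanced K (Us0 @ [M0]) H g"
  and lin: "!!us x z. [| us : tuples Us0; x : carrier M0; z : K |] ==> g (us @ [ract M0 x z]) = ract H (g (us @ [x])) (proj z)"
 shows "balanced K ((Us0 @ [M0]) @ [fac_A]) H (%xs. ract H (g (butlast xs)) (last xs))" proof (rule bal_snocI)
 note gc = bal_in[OF b]
 show "balanced K (Us0 @ [M0]) H (%us. ract H (g (butlast (us @ [y]))) (last (us @ [y])))" if "y : carrier fac_A" for y
  using bal_comp[OF b bimD(3)[OF H]] that by (simp add: car_A)
 show "ract H (g (butlast (us @ [x +[fac_A] y]))) (last (us @ [x +[fac_A] y])) =
  ract H (g (butlast (us @ [x]))) (last (us @ [x])) +[H] ract H (g (butlast (us @ [y]))) (last (us @ [y]))"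
  if "us : tuples (Us0 @ [M0])" "x : carrier fac_A" "y : carrier fac_A" for us x y
  using that gc H by (simp add: car_A A_add bimD(11))
 show "ract H (g (butlast (us @ [ract L x z, y]))) (last (us @ [ract L x z, y])) =
  ract H (g (butlast (us @ [x, lact fac_A z y]))) (last (us @ [x, lact fac_A z y]))"
  if "Us0 @ [M0] = Us @ [L]" "us : tuples Us" "x : carrier L" "y : carrier fac_A" "z : K" for Us L us x y z
  using that gc[of "us @ [x]"] lin[of us x z] H by (simp add: butlast_append A_lact car_A bimD(8) proj_K_in)
qed

lemma B_make:
 assumes H: "bim H" and e: "HB n = Us0 @ [M0]" and b: "balanced K (HB n) H g"
  and lin: "!!us x z. [| us : tuples Us0; x : carrier M0; z : K |] ==> g (us @ [ract M0 x z]) = ract H (g (us @ [x])) (proj z)"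
  and left: "!!x us c. [| x # us : TB n; c : cA |] ==> g ((c ** x) # us) = lact H c (g (x # us))"
 defines "R \<equiv> tensor_lift H (%xs. ract H (g (butlast xs)) (last xs))"
 shows "R : bhom (Bar n) H" "[| us : TB n; c : cA |] ==> R (Bpure n (us @ [c])) = ract H (g us) c" proof -
 note gr = bimD(1)[OF H]
 have bal: "balanced K (facs_bar n) H (%xs. ract H (g (butlast xs)) (last xs))"
  unfolding facs_bar_HB e by (rule bal_snoc_ract[OF H b[unfolded e] lin])
 have L: "R : ahom (Bar n) H" unfolding R_def ahom_Bar by (rule tensor_lift_addhom[OF B_factor gr bal])
 have V: "R (Bpure n (us @ [c])) = ract H (g us) c" if "us : TB n" "c : cA" for us c
  unfolding R_def using tensor_lift_pure[OF B_factor gr bal facs_barI[OF that]] by simp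
 show "[| us : TB n; c : cA |] ==> R (Bpure n (us @ [c])) = ract H (g us) c" by (rule V)
 note gc = bal_in[OF b]
 show "R : bhom (Bar n) H" proof (rule bhomI[OF L])
  fix a X assume a: "a : cA" and X: "X : cB n"
  show "R (lact (Bar n) a X) = lact H a (R X)"
  proof (rule B_hom_eq[OF gr ahom_comp[OF L bimD(2)[OF bim_Bar a]] ahom_comp[OF bimD(2)[OF H a] L] _ X])
  fix us c assume u: "us : TB n" "c : cA"
  then obtain x vs where x: "us = x # vs" by (elim HB_ConsE)
  show "R (lact (Bar n) a (Bpure n (us @ [c]))) = lact H a (R (Bpure n (us @ [c])))"
  using u a gc[OF u(1)] V[OF HB_lact[OF u(1)[unfolded x] a] u(2)] V[OF u] unfolding x
  by (simp add: B_pure_lact left bimD(9)[OF H])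
  qed
  show "R (ract (Bar n) X a) = ract H (R X) a"
  by (rule B_hom_eq[OF gr ahom_comp[OF L bimD(3)[OF bim_Bar a]] ahom_comp[OF bimD(3)[OF H a] L] _ X])
  (use a in \<open>simp add: B_pure_ract V gc bimD(8)[OF H]\<close>)
 qed
qed

lemma HB_split: obtains Us M where "HB n = Us @ [M]" "M = fac_A \<or> M = fac_Abar" proof (cases n)
 case 0
 thus ?thesis using that[of "[]" fac_A] by (simp add: HB_0)
next
 case (Suc m)
 thus ?thesis using that[of "HB m" fac_Abar] by (simp add: HB_Suc)
qed

text \<open>The right linear extension of a left linear map, from its values on tensors ending in \<open>1\<close>\<close>

lemma B_rext:
 assumes H: "bim H" and f: "f : lhom (Bar n) H"
 defines "R \<equiv> tensor_lift H (%xs. ract H (f (Bpure n (butlast xs @ [\<one>[A]]))) (last xs))"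
 shows "R : bhom (Bar n) H"
  "[| us : TB n; c : cA |] ==> R (Bpure n (us @ [c])) = ract H (f (Bpure n (us @ [\<one>[A]]))) c" proof -
 obtain Us M where e: "HB n = Us @ [M]" by (rule HB_split)
 let ?g = "%us. f (Bpure n (us @ [\<one>[A]]))"
 have b: "balanced K (HB n) H ?g"
  using bal_comp[OF bal_append[OF B_bal[of n], of "[\<one>[A]]"] lhomD(1)[OF f]] by (simp add: car_A)
 have "?g (us @ [ract M x z]) = ract H (?g (us @ [x])) (proj z)" if "us : tuples Us" "x : carrier M" "z : K" for us x z
 proof -
  have t: "us @ [x] : TB n" using that e by simp
  have "Bpure n (us @ [ract M x z, \<one>[A]]) = Bpure n (us @ [x, lact fac_A z \<one>[A]])"
  using bal_act[of K Us M fac_A "[]" "Bar n" "Bpure n" us "[]" x "\<one>[A]" z] B_bal[of n] e that by (simp add: car_A)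
  also have "\<dots> = ract (Bar n) (Bpure n ((us @ [x]) @ [\<one>[A]])) (proj z)"
  using B_pure_ract[OF t A_one proj_K_in[OF that(3)]] that(3) by (simp add: A_lact proj_K_in)
  finally show ?thesis using lhomD(3)[OF f that(3) B_pure_in[OF t A_one]] by simp
 qed
 note M = B_make[OF H e b this]
 have "f (Bpure n (((c ** x) # us) @ [\<one>[A]])) = lact H c (f (Bpure n ((x # us) @ [\<one>[A]])))"
  if "x # us : TB n" "c : cA" for x us c
  using that B_pure_in[OF that(1) A_one] by (simp add: lhomD(2)[OF f] flip: B_pure_lact)
 from M[OF _ _ _ this] show "R : bhom (Bar n) H"
  "[| us : TB n; c : cA |] ==> R (Bpure n (us @ [c])) = ract H (f (Bpure n (us @ [\<one>[A]]))) c"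
  unfolding R_def by simp_all
qed

lemma B_unit_eq:
 assumes H: "bim H" and f: "f : bhom (Bar n) H" "g : bhom (Bar n) H"
  and u: "!!us. us : TB n ==> f (Bpure n (us @ [\<one>[A]])) = g (Bpure n (us @ [\<one>[A]]))" and X: "X : cB n"
 shows "f X = g X" proof (rule B_hom_eq[OF bimD(1)[OF H] bhomD(1)[OF f(1)] bhomD(1)[OF f(2)] _ X])
 fix us b assume us: "us : TB n" "b : cA"
 have "Bpure n (us @ [b]) = ract (Bar n) (Bpure n (us @ [\<one>[A]])) b" using us by (simp add: B_pure_ract)
 thus "f (Bpure n (us @ [b])) = g (Bpure n (us @ [b]))"
  using us u by (simp add: bhomD(3)[OF f(1)] bhomD(3)[OF f(2)] B_pure_in)
qed

lemma P_unit_eq: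
 assumes H: "bim H" and f: "f : bhom (P n) H" "g : bhom (P n) H"
  and u: "!!a w. [| a : cA; w : chains n |] ==> f (Ppure n a (ppath w) \<one>[A]) = g (Ppure n a (ppath w) \<one>[A])"
  and X: "X : cP n"
 shows "f X = g X" proof (rule P_hom_eq[OF bimD(1)[OF H] bhomD(1)[OF f(1)] bhomD(1)[OF f(2)] _ X])
 fix a w b assume a: "a : cA" "w : chains n" "b : cA"
 have "Ppure n a (ppath w) b = ract (P n) (Ppure n a (ppath w) \<one>[A]) b" using a by (simp add: Ppure_ract pp_span)
 thus "f (Ppure n a (ppath w) b) = g (Ppure n a (ppath w) b)"
  using a u by (simp add: bhomD(3)[OF f(1)] bhomD(3)[OF f(2)] Ppure_in pp_span)
qed

subsection \<open>The contraction of the bar resolution\<close>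

lemma varpi_hom: "varpi n : ahom (Bar n) (tensor K (HB (Suc n)))" and varpi_pure: "[| us : TB n; b : cA |] ==>
  varpi n (Bpure n (us @ [b])) = pure_tensor K (HB (Suc n)) (us @ [to_bar b])" proof -
 have Ms: "fac_A # replicate (Suc n) fac_Abar = HB (Suc n)" by (simp add: HB_def)
 have bal: "balanced K (HB n @ [fac_A]) (tensor K (HB (Suc n)))
  (%xs. pure_tensor K (HB (Suc n)) (butlast xs @ [to_bar (last xs)]))" by (rule bal_last[OF to_bar_hom])
  (use bal_pure[OF HB_factor[of "Suc n"]] in \<open>simp_all add: A_lact car_A to_bar_act HB_Suc\<close>)
 note gr = abelian_group_tensor[OF HB_factor[of "Suc n"]]
 show "varpi n : ahom (Bar n) (tensor K (HB (Suc n)))" unfolding varpi_def Let_def Ms ahom_Bar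
  by (rule tensor_lift_addhom[OF B_factor gr]) (use bal in \<open>simp add: facs_bar_HB\<close>)
 show "[| us : TB n; b : cA |] ==>
  varpi n (Bpure n (us @ [b])) = pure_tensor K (HB (Suc n)) (us @ [to_bar b])" unfolding varpi_def Let_def Ms
  by (subst tensor_lift_pure[OF B_factor gr]) (use bal in \<open>simp_all add: facs_bar_HB car_A\<close>)
qed

text \<open>\<open>vap n X b\<close> is \<open>\<varpi>\<^sub>n(X) \<otimes> b\<close>\<close>

definition vap where "vap n X b = tensor_append K (facs_bar (Suc n)) (varpi n X) [b]"

lemma HB_append:
 assumes "b : cA"
 shows "(%X. tensor_append K (facs_bar n) X [b]) : ahom (tensor K (HB n)) (Bar n)"
  "us : TB n ==> tensor_append K (facs_bar n) (pure_tensor K (HB n) us) [b] = Bpure n (us @ [b])"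
 using tensor_append[of "HB n" "[fac_A]" K "[b]"] B_factor[of n] assms by (simp_all add: facs_bar_HB car_A ahom_Bar)

lemma vap_hom: "b : cA ==> (%X. vap n X b) : ahom (Bar n) (Bar (Suc n))"
 unfolding vap_def by (rule ahom_comp[OF HB_append(1) varpi_hom])

lemma vap_pure: "[| us : TB n; a : cA; b : cA |] ==>
  vap n (Bpure n (us @ [a])) b = Bpure (Suc n) (us @ [to_bar a, b])"
 using HB_append(2)[OF _ HB_SucI] by (simp add: vap_def varpi_pure)

lemma vap_ract: "[| X : cB n; b : cA; c : cA |] ==> ract (Bar (Suc n)) (vap n X b) c = vap n X (b ** c)" proof -
 assume X: "X : cB n" and bc: "b : cA" "c : cA"
 show ?thesis
 proof (rule B_hom_eq[OF grB ahom_comp[OF bimD(3)[OF bim_Bar bc(2)] vap_hom[OF bc(1)]] vap_hom[OF A.m_closed[OF bc]] _ X])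
  fix us a assume u: "us : TB n" "a : cA"
  show "ract (Bar (Suc n)) (vap n (Bpure n (us @ [a])) b) c = vap n (Bpure n (us @ [a])) (b ** c)"
  using u bc B_pure_ract[OF HB_SucI[OF u] bc] by (simp add: vap_pure)
 qed
qed

definition sgB :: "nat => nat => ('v, 'e, 'k) tens => ('v, 'e, 'k) tens" where
 "sgB n m x = (if even m then x else \<ominus>\<^bsub>Bar n\<^esub> x)"

lemma sgB_int: "x : cB n ==> [((-1::int) ^ m)] \<cdot>\<^bsub>Bar n\<^esub> x = sgB n m x"
 using abelian_group.sign_mult[OF grB] by (simp add: sgB_def)

lemma sgB_bhom: "sgB n m : bhom (Bar n) (Bar n)" proof -
 interpret B: abelian_group "Bar n" by (rule grB)
 have "(%x. \<ominus>\<^bsub>Bar n\<^esub> x) : bhom (Bar n) (Bar n)" proof (rule bhomI)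
  show "(%x. \<ominus>\<^bsub>Bar n\<^esub> x) : ahom (Bar n) (Bar n)" by (rule ahomI) (simp_all add: B.minus_add)
 qed (simp_all add: ahom_neg[OF grB grB bimD(2)[OF bim_Bar]] ahom_neg[OF grB grB bimD(3)[OF bim_Bar]])
 moreover have "(%x. x) : bhom (Bar n) (Bar n)" by (rule bhomI[OF ahom_id]) simp_all
 ultimately show ?thesis by (cases "even m") (simp_all add: sgB_def[abs_def])
qed

lemma sgB_sgB: "x : cB n ==> sgB n m (sgB n m x) = x" proof -
 interpret B: abelian_group "Bar n" by (rule grB)
 show "x : cB n ==> sgB n m (sgB n m x) = x" by (simp add: sgB_def)
qed

definition sB :: "nat => ('v, 'e, 'k) tens => ('v, 'e, 'k) tens" where
 "sB n X = sgB (Suc n) (Suc n) (vap n X \<one>[A])"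

lemma sB_hom: "sB n : ahom (Bar n) (Bar (Suc n))"
 using ahom_comp[OF bhomD(1)[OF sgB_bhom] vap_hom[OF A_one]] by (simp add: sB_def[abs_def])

lemma sB_pure: "[| us : TB n; a : cA |] ==>
  sB n (Bpure n (us @ [a])) = sgB (Suc n) (Suc n) (Bpure (Suc n) (us @ [to_bar a, \<one>[A]]))"
 by (simp add: sB_def vap_pure)

lemma sB_lhom: "sB n : lhom (Bar n) (Bar (Suc n))" proof (rule lhomI[OF sB_hom])
 fix c X assume c: "c : cA" and X: "X : cB n"
 show "sB n (lact (Bar n) c X) = lact (Bar (Suc n)) c (sB n X)"
 proof (rule B_hom_eq[OF grB ahom_comp[OF sB_hom bimD(2)[OF bim_Bar c]] ahom_comp[OF bimD(2)[OF bim_Bar c] sB_hom] _ X])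
  fix us b assume u: "us : TB n" "b : cA"
  then obtain x vs where x: "us = x # vs" by (elim HB_ConsE)
  note t = HB_SucI[OF u, unfolded x, simplified] HB_lact[OF u(1)[unfolded x] c]
  have "sB n (lact (Bar n) c (Bpure n (us @ [b]))) = sgB (Suc n) (Suc n) (Bpure (Suc n) ((c ** x) # vs @ [to_bar b, \<one>[A]]))"
  using u c sB_pure[OF t(2) u(2)] unfolding x by (simp add: B_pure_lact)
  also have "\<dots> = lact (Bar (Suc n)) c (sB n (Bpure n (us @ [b])))"
  using u c sB_pure[OF u] B_pure_lact[OF t(1) A_one c] B_pure_in[OF HB_SucI[OF u] A_one]
  unfolding x by (simp add: bhomD(2)[OF sgB_bhom, symmetric])
  finally show "sB n (lact (Bar n) c (Bpure n (us @ [b]))) = lact (Bar (Suc n)) c (sB n (Bpure n (us @ [b])))" .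
 qed
next
 fix z X assume z: "z : K" and X: "X : cB n"
 note zc = proj_K_in[OF z]
 show "sB n (ract (Bar n) X (proj z)) = ract (Bar (Suc n)) (sB n X) (proj z)"
 proof (rule B_hom_eq[OF grB ahom_comp[OF sB_hom bimD(3)[OF bim_Bar zc]] ahom_comp[OF bimD(3)[OF bim_Bar zc] sB_hom] _ X])
  fix us b assume u: "us : TB n" "b : cA"
  have "Bpure (Suc n) (us @ [ract fac_Abar (to_bar b) z, \<one>[A]]) = Bpure (Suc n) (us @ [to_bar b, lact fac_A z \<one>[A]])"
  using bal_act[of K "HB n" fac_Abar fac_A "[]" "Bar (Suc n)" "Bpure (Suc n)" us "[]" "to_bar b" "\<one>[A]" z]
  B_bal[of "Suc n"] u z by (simp add: car_A HB_Suc to_bar_in)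
  hence "Bpure (Suc n) (us @ [to_bar (b ** proj z), \<one>[A]]) = ract (Bar (Suc n)) (Bpure (Suc n) (us @ [to_bar b, \<one>[A]])) (proj z)"
  using B_pure_ract[OF HB_SucI[OF u] A_one zc] u z by (simp add: to_bar_act A_lact zc)
  thus "sB n (ract (Bar n) (Bpure n (us @ [b])) (proj z)) = ract (Bar (Suc n)) (sB n (Bpure n (us @ [b]))) (proj z)"
  using u zc B_pure_in[OF HB_SucI[OF u] A_one] by (simp add: B_pure_ract sB_pure bhomD(3)[OF sgB_bhom])
 qed
qed

lemma sB_in: "X : cB n ==> sB n X : cB (Suc n)" by (rule ahom_in[OF sB_hom])

lemma to_bar_one: "to_bar \<one>[A] = \<zero>[fac_Abar]" using to_bar_K[OF scalar_K, of 1] by (simp add: proj_one)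

lemma sB_unit: assumes "us : TB n" shows "sB n (Bpure n (us @ [\<one>[A]])) = \<zero>[Bar (Suc n)]" proof -
 have "(%x. Bpure (Suc n) (us @ x # [\<one>[A]])) : ahom fac_Abar (Bar (Suc n))"
  using B_bal[of "Suc n"] assms by (intro bal_slot[of K "HB n" fac_Abar "[fac_A]"]) (simp_all add: HB_Suc car_A)
 from ahom_zero[OF _ grB this] have "Bpure (Suc n) (us @ [to_bar \<one>[A], \<one>[A]]) = \<zero>[Bar (Suc n)]"
  using fac_Abar_factor by (simp add: factor_def to_bar_one)
 thus ?thesis using assms ahom_zero[OF grB grB bhomD(1)[OF sgB_bhom]] by (simp add: sB_pure)
qed

text \<open>
 The contraction takes values in tensors ending in \<open>1\<close>, so right linear extensions may be compared
 there.
\<close>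
lemma sB_unit_agree:
 assumes H: "abelian_group H" and f: "f : ahom (Bar (Suc n)) H" "g : ahom (Bar (Suc n)) H"
  and u: "!!us. us : TB (Suc n) ==> f (Bpure (Suc n) (us @ [\<one>[A]])) = g (Bpure (Suc n) (us @ [\<one>[A]]))"
  and X: "X : cB n"
 shows "f (sB n X) = g (sB n X)" proof (rule B_hom_eq[OF H ahom_comp[OF f(1) sB_hom] ahom_comp[OF f(2) sB_hom] _ X])
 fix us b assume us: "us : TB n" "b : cA"
 have "Bpure (Suc n) (us @ [to_bar b, \<one>[A]]) : cB (Suc n)" using B_pure_in[OF HB_SucI[OF us] A_one] by simp
 thus "f (sB n (Bpure n (us @ [b]))) = g (sB n (Bpure n (us @ [b])))"
  using us u[OF HB_SucI[OF us]] ahom_neg[OF grB H f(1)] ahom_neg[OF grB H f(2)] by (simp add: sB_pure sgB_def)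
qed

lemma sB_sB: assumes "X : cB n" shows "sB (Suc n) (sB n X) = \<zero>[Bar (Suc (Suc n))]"
 by (rule sB_unit_agree[OF grB sB_hom ahom_const_zero[OF grB grB] sB_unit assms])


subsection \<open>The bar differential\<close>

lemma two_split: "[p, q] = us @ x # vs ==> us = [] & x = p & vs = [q] \<or> us = [p] & x = q & vs = []"
 by (auto simp: Cons_eq_append_conv)

lemma aug_B_bal: "balanced K (facs_bar 0) A (%xs. xs ! 0 ** xs ! 1)" proof (rule balancedI)
 have e: "facs_bar 0 = [fac_A, fac_A]" by (simp add: facs_bar_def)
 show "xs ! 0 ** xs ! 1 : cA" if "xs : tuples (facs_bar 0)" for xs
  using that unfolding e by (auto elim!: tuples_ConsE simp: car_A)
 show "(us @ (x +[M] y) # vs) ! 0 ** (us @ (x +[M] y) # vs) ! 1 =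
  (us @ x # vs) ! 0 ** (us @ x # vs) ! 1 +[A] (us @ y # vs) ! 0 ** (us @ y # vs) ! 1"
  if "facs_bar 0 = Us @ M # Vs" "us : tuples Us" "vs : tuples Vs" "x : carrier M" "y : carrier M" for Us M Vs us x y vs
  using that(2-5) two_split[OF that(1)[unfolded e]]
  by (auto elim!: tuples_ConsE simp: car_A A_add A.l_distr A.r_distr)
 show "(us @ ract M x z # y # vs) ! 0 ** (us @ ract M x z # y # vs) ! 1 =
  (us @ x # lact N z y # vs) ! 0 ** (us @ x # lact N z y # vs) ! 1"
  if "facs_bar 0 = Us @ M # N # Vs" "us : tuples Us" "vs : tuples Vs" "x : carrier M" "y : carrier N" "z : K" for Us M N Vs us x y vs z
  using that(2-6) two_split[OF that(1)[unfolded e]] by (auto simp: car_A A_ract A_lact A.m_assoc proj_K_in)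
qed

lemma aug_B_hom: "aug_Bar : ahom (Bar 0) A"
 unfolding aug_Bar_def ahom_Bar by (rule tensor_lift_addhom[OF B_factor grA aug_B_bal])

lemma aug_B_pure: "[| a : cA; b : cA |] ==> aug_Bar (Bpure 0 [a, b]) = a ** b" unfolding aug_Bar_def
 by (subst tensor_lift_pure[OF B_factor grA aug_B_bal]) (simp_all add: facs_bar_def car_A)

lemma aug_B_in: "X : cB 0 ==> aug_Bar X : cA" by (rule ahom_in[OF aug_B_hom])

lemma B0_induct_eq:
 assumes "abelian_group H" "f : ahom (Bar 0) H" "g : ahom (Bar 0) H"
  "!!a b. [| a : cA; b : cA |] ==> f (Bpure 0 [a, b]) = g (Bpure 0 [a, b])" "X : cB 0"
 shows "f X = g X" by (rule B_hom_eq[OF assms(1-3) _ assms(5)]) (auto simp: HB_0 car_A assms(4) elim!: tuples_ConsE)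

lemma B0_simps:
 assumes "a : cA" "b : cA"
 shows "Bpure 0 [a, b] : cB 0"
  "c : cA ==> lact (Bar 0) c (Bpure 0 [a, b]) = Bpure 0 [c ** a, b]"
  "c : cA ==> ract (Bar 0) (Bpure 0 [a, b]) c = Bpure 0 [a, b ** c]"
 using B_pure_in[of "[a]" 0 b] B_pure_lact[of a "[]" 0 b c] B_pure_ract[of "[a]" 0 b c] assms
 by (simp_all add: HB_0 car_A)

lemma aug_B_act:
 assumes "X : cB 0" "c : cA"
 shows "aug_Bar (lact (Bar 0) c X) = c ** aug_Bar X" "aug_Bar (ract (Bar 0) X c) = aug_Bar X ** c" proof -
 have m: "(%x. c ** x) : ahom A A" "(%x. x ** c) : ahom A A"
  using assms by (auto intro!: ahomI simp: A.l_distr A.r_distr)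
 show "aug_Bar (lact (Bar 0) c X) = c ** aug_Bar X"
  by (rule B0_induct_eq[OF grA ahom_comp[OF aug_B_hom bimD(2)[OF bim_Bar assms(2)]] ahom_comp[OF m(1) aug_B_hom] _ assms(1)])
  (use assms(2) in \<open>simp add: B0_simps aug_B_pure A.m_assoc\<close>)
 show "aug_Bar (ract (Bar 0) X c) = aug_Bar X ** c"
  by (rule B0_induct_eq[OF grA ahom_comp[OF aug_B_hom bimD(3)[OF bim_Bar assms(2)]] ahom_comp[OF m(2) aug_B_hom] _ assms(1)])
  (use assms(2) in \<open>simp add: B0_simps aug_B_pure A.m_assoc\<close>)
qed

definition ib :: "('v, 'e, 'k) pathalg set => ('v, 'e, 'k) tens" where
 "ib a = Bpure 0 [a, \<one>[A]]"

lemma ib_hom: "ib : ahom A (Bar 0)"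
 using bal_slot[of K "[]" fac_A "[fac_A]" "Bar 0" "Bpure 0" "[]" "[\<one>[A]]"] B_bal[of 0]
 by (auto simp: ahom_def car_A A_add HB_0 ib_def)

lemma ib_in: "a : cA ==> ib a : cB 0" by (rule ahom_in[OF ib_hom])

lemma ib_lact: "[| a : cA; c : cA |] ==> ib (c ** a) = lact (Bar 0) c (ib a)" by (simp add: ib_def B0_simps)

lemma ib_ract:
 assumes "a : cA" "z : K" shows "ib (a ** proj z) = ract (Bar 0) (ib a) (proj z)" proof -
 have "Bpure 0 [ract fac_A a z, \<one>[A]] = Bpure 0 [a, lact fac_A z \<one>[A]]"
  using bal_act[of K "[]" fac_A fac_A "[]" "Bar 0" "Bpure 0" "[]" "[]" a "\<one>[A]" z] B_bal[of 0] assms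
  by (simp add: HB_0 car_A)
 thus ?thesis using assms by (simp add: ib_def B0_simps A_ract A_lact proj_K_in)
qed

lemma aug_ib: "a : cA ==> aug_Bar (ib a) = a" by (simp add: ib_def aug_B_pure)

lemma ib_aug_lhom: "(%X. ib (aug_Bar X)) : lhom (Bar 0) (Bar 0)" proof (rule lhomI[OF ahom_comp[OF ib_hom aug_B_hom]])
 show "ib (aug_Bar (lact (Bar 0) a X)) = lact (Bar 0) a (ib (aug_Bar X))" if "a : cA" "X : cB 0" for a X
  using that by (simp add: aug_B_act ib_lact aug_B_in)
 show "ib (aug_Bar (ract (Bar 0) X (proj z))) = ract (Bar 0) (ib (aug_Bar X)) (proj z)" if "z : K" "X : cB 0" for z X
  using that ib_ract[OF aug_B_in] by (simp add: aug_B_act proj_K_in)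
qed

lemma unbar:
 assumes fac: "\<forall>M\<in>set Ms. factor K M" and b: "balanced K (Ms @ [fac_A]) H g" and H: "abelian_group H"
  and kill: "!!us z. [| us : tuples Ms; z : K |] ==> g (us @ [proj z]) = \<zero>[H]"
 shows "[| us : tuples Ms; a : cA |] ==> g (us @ [lift_A (to_bar a)]) = g (us @ [a])"
  and "balanced K (Ms @ [fac_Abar]) H (%xs. g (butlast xs @ [lift_A (last xs)]))" proof -
 interpret H: abelian_group H by (rule H)
 have gc: "g (us @ [a]) : carrier H" if "us : tuples Ms" "a : cA" for us a
  using bal_in[OF b, of "us @ [a]"] that by (simp add: car_A)
 have ad: "g (us @ [x +[A] y]) = g (us @ [x]) +[H] g (us @ [y])" if "us : tuples Ms" "x : cA" "y : cA" for us x y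
  using bal_add[OF b, of us "[]" x y] that by (simp add: car_A A_add)
 have l: "g (us @ [lift_A (to_bar a)]) = g (us @ [a])" if u: "us : tuples Ms" and a: "a : cA" for us a proof -
  obtain z where z: "z : K" "lift_A (to_bar a) = a +[A] proj z" by (rule lift_A_to_bar[OF a])
  show ?thesis using u a z gc[OF u a] by (simp add: ad proj_K_in kill)
 qed
 show "[| us : tuples Ms; a : cA |] ==> g (us @ [lift_A (to_bar a)]) = g (us @ [a])" by (rule l)
 show "balanced K (Ms @ [fac_Abar]) H (%xs. g (butlast xs @ [lift_A (last xs)]))" proof (rule bal_snocI)
  show "balanced K Ms H (%us. g (butlast (us @ [y]) @ [lift_A (last (us @ [y]))]))" if "y : carrier fac_Abar" for y
  using bal_append[OF b, of "[lift_A y]"] lift_A_in[OF that] by (simp add: car_A)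
  fix us x y
  assume u: "us : tuples Ms" "x : carrier fac_Abar" "y : carrier fac_Abar"
  obtain c d where cd: "c : cA" "x = to_bar c" "d : cA" "y = to_bar d" using u(2,3) by (auto elim!: Abar_carrierE)
  have "x +[fac_Abar] y = to_bar (c +[A] d)" using cd ahom_add[OF to_bar_hom, of c d] by (simp add: car_A A_add)
  thus "g (butlast (us @ [x +[fac_Abar] y]) @ [lift_A (last (us @ [x +[fac_Abar] y]))]) =
  g (butlast (us @ [x]) @ [lift_A (last (us @ [x]))]) +[H] g (butlast (us @ [y]) @ [lift_A (last (us @ [y]))])"
  using u cd by (simp add: l ad)
 next
  fix Us L us x y z
  assume a: "Ms = Us @ [L]" "us : tuples Us" "x : carrier L" "y : carrier fac_Abar" "z : K"
  obtain c where c: "c : cA" "y = to_bar c" using a(4) by (auto elim!: Abar_carrierE)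
  have r: "us @ [x] : tuples Ms" "g (us @ [ract L x z, c]) = g (us @ [x, proj z ** c])"
  using bal_act[of K Us L fac_A "[]" H g us "[]" x c z] b a c by (simp_all add: car_A A_lact)
  have "ract L x z : carrier L" using fac ahom_in[of "%x. ract L x z" L L x] a by (simp add: factor_def)
  hence t: "us @ [ract L x z] : tuples Ms" using a by simp
  show "g (butlast (us @ [ract L x z, y]) @ [lift_A (last (us @ [ract L x z, y]))]) =
  g (butlast (us @ [x, lact fac_Abar z y]) @ [lift_A (last (us @ [x, lact fac_Abar z y]))])"
  using l[OF t c(1)] l[OF r(1), of "proj z ** c"] r(2) c a(5) by (simp add: butlast_append proj_K_in to_bar_act)
 qed
qed

definition ddof where
 "ddof n f = tensor_lift (Bar n) (%xs. ract (Bar n)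
  (sgB n (Suc n) (f (Bpure n (butlast (butlast xs) @ [lift_A (last (butlast xs))])))) (last xs))"

text \<open>
 \<open>NB n\<close> is \<open>1 - \<sigma> d\<close>.  It kills tensors ending in \<open>1\<close>, and the differential of the next degree is, up to
 sign, its right linear extension.  Taking this as the definition of the differential makes
 \<open>d \<sigma> = 1 - \<sigma> d\<close> and \<open>d d = 0\<close> formal; the comparison with the alternating sum comes afterwards.
\<close>
primrec NB :: "nat => ('v, 'e, 'k) tens => ('v, 'e, 'k) tens" where
 "NB 0 = (%X. X -[Bar 0] ib (aug_Bar X))"
| "NB (Suc n) = (%X. X -[Bar (Suc n)] sB n (ddof n (NB n) X))"

definition dd where "dd n = ddof n (NB n)"

lemma ddof:
 assumes f: "f : lhom (Bar n) (Bar n)" and kill: "!!us. us : TB n ==> f (Bpure n (us @ [\<one>[A]])) = \<zero>[Bar n]"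
 shows "ddof n f : bhom (Bar (Suc n)) (Bar n)"
  "[| us : TB n; a : cA; b : cA |] ==>
  ddof n f (Bpure (Suc n) (us @ [to_bar a, b])) = ract (Bar n) (sgB n (Suc n) (f (Bpure n (us @ [a])))) b" proof -
 let ?k = "%xs. sgB n (Suc n) (f (Bpure n xs))" and ?g = "%xs. sgB n (Suc n) (f (Bpure n (butlast xs @ [lift_A (last xs)])))"
 have sf: "(%X. sgB n (Suc n) (f X)) : lhom (Bar n) (Bar n)" by (rule lhom_comp[OF bhomD(5)[OF sgB_bhom] f])
 have b0: "balanced K (HB n @ [fac_A]) (Bar n) ?k" by (rule bal_comp[OF B_bal lhomD(1)[OF sf]])
 have r: "?k (us @ [a ** proj z]) = ract (Bar n) (?k (us @ [a])) (proj z)" if "us : TB n" "a : cA" "z : K" for us a z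
  using that lhomD(3)[OF sf that(3) B_pure_in[OF that(1,2)]] by (simp add: B_pure_ract proj_K_in)
 have k: "?k (us @ [proj z]) = \<zero>[Bar n]" if "us : TB n" "z : K" for us z
  using r[OF that(1) A_one that(2)] kill[OF that(1)] that ahom_zero[OF grB grB bhomD(1)[OF sgB_bhom]]
  by (simp add: proj_K_in act_zero[OF bim_Bar])
 note l = unbar(1)[OF HB_factor b0 grB k] and b = unbar(2)[OF HB_factor b0 grB k]
 have v: "?g (us @ [to_bar a]) = ?k (us @ [a])" if "us : TB n" "a : cA" for us a using l[OF _ _ that] by simp
 have lin: "?g (us @ [ract fac_Abar x z]) = ract (Bar n) (?g (us @ [x])) (proj z)"
  if u: "us : TB n" "x : carrier fac_Abar" "z : K" for us x z proof -
  obtain a where a: "a : cA" "x = to_bar a" using u(2) by (elim Abar_carrierE)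
  show ?thesis using v[of us "a ** proj z"] v[of us a] r[of us a z] u a by (simp add: to_bar_act proj_K_in)
 qed
 have left: "?g ((c ** x) # us) = lact (Bar n) c (?g (x # us))" if xs: "x # us : TB (Suc n)" and c: "c : cA" for x us c
 proof -
  obtain vs a where a: "x # us = vs @ [to_bar a]" "vs : TB n" "a : cA" using xs by (elim HB_SucE)
  obtain y ws where y: "vs = y # ws" using a(2) by (elim HB_ConsE)
  hence e: "x = y" "us = ws @ [to_bar a]" using a(1) by simp_all
  note t = HB_lact[OF a(2)[unfolded y] c]
  have "?g ((c ** x) # us) = ?k (((c ** y) # ws) @ [a])" using v[OF t a(3)] e by simp
  also have "\<dots> = lact (Bar n) c (?k (vs @ [a]))"
  using lhomD(2)[OF sf c B_pure_in[OF a(2,3)]] B_pure_lact[OF a(2)[unfolded y] a(3) c] y by simp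
  also have "?k (vs @ [a]) = ?g (x # us)" using v[OF a(2,3)] a(1) by simp
  finally show ?thesis .
 qed
 have bb: "balanced K (HB (Suc n)) (Bar n) ?g" using b by (simp add: HB_Suc)
 note M = B_make[OF bim_Bar HB_Suc bb lin left]
 show "ddof n f : bhom (Bar (Suc n)) (Bar n)" unfolding ddof_def by (rule M(1))
 show "[| us : TB n; a : cA; b : cA |] ==>
  ddof n f (Bpure (Suc n) (us @ [to_bar a, b])) = ract (Bar n) (sgB n (Suc n) (f (Bpure n (us @ [a])))) b" proof -
  assume u: "us : TB n" "a : cA" "b : cA"
  have "ddof n f (Bpure (Suc n) ((us @ [to_bar a]) @ [b])) = ract (Bar n) (?g (us @ [to_bar a])) b"
  unfolding ddof_def using M(2) HB_SucI[OF u(1,2)] u(3) by blast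
  thus ?thesis using v[OF u(1,2)] by simp
 qed
qed

context
 fixes n :: nat
 assumes N: "NB n : lhom (Bar n) (Bar n)" "!!us. us : TB n ==> NB n (Bpure n (us @ [\<one>[A]])) = \<zero>[Bar n]"
  and sN: "!!Y. Y : cB n ==> sB n (NB n Y) = sB n Y"
begin

lemma dd_step: "dd n : bhom (Bar (Suc n)) (Bar n)"
 "[| us : TB n; a : cA; b : cA |] ==>
  dd n (Bpure (Suc n) (us @ [to_bar a, b])) = ract (Bar n) (sgB n (Suc n) (NB n (Bpure n (us @ [a])))) b"
 using ddof[OF N] by (simp_all add: dd_def)

lemma NB_step: "NB (Suc n) : lhom (Bar (Suc n)) (Bar (Suc n))"
 "us : TB (Suc n) ==> NB (Suc n) (Bpure (Suc n) (us @ [\<one>[A]])) = \<zero>[Bar (Suc n)]"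
 "Y : cB (Suc n) ==> sB (Suc n) (NB (Suc n) Y) = sB (Suc n) Y" proof -
 have e: "NB (Suc n) = (%X. X -[Bar (Suc n)] sB n (dd n X))" by (simp add: dd_def)
 interpret B: abelian_group "Bar (Suc n)" by (rule grB)
 interpret B2: abelian_group "Bar (Suc (Suc n))" by (rule grB)
 show "NB (Suc n) : lhom (Bar (Suc n)) (Bar (Suc n))"
  unfolding e by (rule lhom_minus[OF bim_Bar bim_Bar lhom_id lhom_comp[OF sB_lhom bhomD(5)[OF dd_step(1)]]])
 show "NB (Suc n) (Bpure (Suc n) (us @ [\<one>[A]])) = \<zero>[Bar (Suc n)]" if us: "us : TB (Suc n)" proof -
  obtain vs c where c: "us = vs @ [to_bar c]" "vs : TB n" "c : cA" using us by (elim HB_SucE)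
  let ?Y = "Bpure n (vs @ [c])"
  note Y = B_pure_in[OF c(2,3)]
  note NY = lhomD(4)[OF N(1) Y]
  have "dd n (Bpure (Suc n) (us @ [\<one>[A]])) = sgB n (Suc n) (NB n ?Y)"
  using dd_step(2)[OF c(2,3) A_one] c(1) NY by (simp add: bimD(5)[OF bim_Bar] bhomD(4)[OF sgB_bhom])
  also have "sB n (sgB n (Suc n) (NB n ?Y)) = sgB (Suc n) (Suc n) (sB n (NB n ?Y))"
  using NY ahom_neg[OF grB grB sB_hom] by (simp add: sgB_def)
  also have "\<dots> = Bpure (Suc n) (us @ [\<one>[A]])"
  using sN[OF Y] c B_pure_in[OF us A_one] by (simp add: sB_pure sgB_sgB)
  finally show ?thesis unfolding e using B_pure_in[OF us A_one] by (simp add: B.minus_eq B.r_neg)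
 qed
 show "sB (Suc n) (NB (Suc n) Y) = sB (Suc n) Y" if Y: "Y : cB (Suc n)" proof -
  note d = bhomD(4)[OF dd_step(1) Y]
  have "sB (Suc n) (NB (Suc n) Y) = sB (Suc n) Y -[Bar (Suc (Suc n))] sB (Suc n) (sB n (dd n Y))"
  unfolding e using Y sB_in[OF d] by (intro ahom_minus[OF grB grB sB_hom])
  thus ?thesis using sB_sB[OF d] sB_in[OF Y] by (simp add: B2.minus_eq B2.minus_zero_eq)
 qed
qed

end

lemma NB_0: "NB 0 : lhom (Bar 0) (Bar 0)" "us : TB 0 ==> NB 0 (Bpure 0 (us @ [\<one>[A]])) = \<zero>[Bar 0]"
 "Y : cB 0 ==> sB 0 (NB 0 Y) = sB 0 Y" proof -
 interpret B: abelian_group "Bar 0" by (rule grB)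
 interpret B1: abelian_group "Bar (Suc 0)" by (rule grB)
 show "NB 0 : lhom (Bar 0) (Bar 0)" using lhom_minus[OF bim_Bar bim_Bar lhom_id ib_aug_lhom] by simp
 show "NB 0 (Bpure 0 (us @ [\<one>[A]])) = \<zero>[Bar 0]" if "us : TB 0"
  using that by (auto simp: HB_0 car_A aug_B_pure ib_def B0_simps B.minus_eq B.r_neg elim!: tuples_ConsE)
 show "sB 0 (NB 0 Y) = sB 0 Y" if Y: "Y : cB 0" proof -
  note a = aug_B_in[OF Y]
  have "sB 0 (ib (aug_Bar Y)) = \<zero>[Bar (Suc 0)]"
  using sB_unit[of "[aug_Bar Y]" 0] a by (simp add: ib_def HB_0 car_A)
  thus ?thesis using Y ib_in[OF a] sB_in[OF Y]
  by (simp add: ahom_minus[OF grB grB sB_hom]) (simp add: B1.minus_eq B1.minus_zero_eq)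
 qed
qed

lemma NB_all: "NB n : lhom (Bar n) (Bar n) & (\<forall>us\<in>TB n. NB n (Bpure n (us @ [\<one>[A]])) = \<zero>[Bar n]) & (\<forall>Y\<in>cB n. sB n (NB n Y) = sB n Y)"
proof (induction n)
 case 0
 show ?case using NB_0 by blast
next
 case (Suc n)
 thus ?case using NB_step[of n] by blast
qed

lemma NB_lhom: "NB n : lhom (Bar n) (Bar n)"
 and NB_unit: "us : TB n ==> NB n (Bpure n (us @ [\<one>[A]])) = \<zero>[Bar n]"
 and sB_NB: "Y : cB n ==> sB n (NB n Y) = sB n Y" using NB_all by blast+

lemma dd_bhom: "dd n : bhom (Bar (Suc n)) (Bar n)" and dd_pure: "[| us : TB n; a : cA; b : cA |] ==>
  dd n (Bpure (Suc n) (us @ [to_bar a, b])) = ract (Bar n) (sgB n (Suc n) (NB n (Bpure n (us @ [a])))) b"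
 using dd_step[OF NB_lhom NB_unit sB_NB, of n] by blast+

lemma NB_Suc: "NB (Suc n) X = X -[Bar (Suc n)] sB n (dd n X)" by (simp add: dd_def)

lemma dd_sB: assumes "X : cB n" shows "dd n (sB n X) = NB n X"
proof (rule B_hom_eq[OF grB ahom_comp[OF bhomD(1)[OF dd_bhom] sB_hom] lhomD(1)[OF NB_lhom] _ assms])
 fix us b assume u: "us : TB n" "b : cA"
 let ?N = "NB n (Bpure n (us @ [b]))"
 have N: "?N : cB n" using lhomD(4)[OF NB_lhom B_pure_in[OF u]] .
 have p: "Bpure (Suc n) (us @ [to_bar b, \<one>[A]]) : cB (Suc n)" using B_pure_in[OF HB_SucI[OF u] A_one] by simp
 have d: "dd n (Bpure (Suc n) (us @ [to_bar b, \<one>[A]])) = sgB n (Suc n) ?N"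
  using dd_pure[OF u A_one] N by (simp add: bimD(5)[OF bim_Bar] bhomD(4)[OF sgB_bhom])
 have "dd n (sgB (Suc n) (Suc n) (Bpure (Suc n) (us @ [to_bar b, \<one>[A]]))) = sgB n (Suc n) (sgB n (Suc n) ?N)"
  using p d ahom_neg[OF grB grB bhomD(1)[OF dd_bhom]] by (simp add: sgB_def)
 thus "dd n (sB n (Bpure n (us @ [b]))) = ?N" using u N by (simp add: sB_pure sgB_sgB)
qed

lemma aug_dd: assumes "X : cB (Suc 0)" shows "aug_Bar (dd 0 X) = \<zero>[A]"
proof (rule B_hom_eq[OF grA ahom_comp[OF aug_B_hom bhomD(1)[OF dd_bhom]] ahom_const_zero[OF grB grA] _ assms])
 interpret B: abelian_group "Bar 0" by (rule grB)
 fix us b assume u: "us : TB (Suc 0)" "b : cA"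
 then obtain vs c where c: "us = vs @ [to_bar c]" "vs : TB 0" "c : cA" by (elim HB_SucE)
 obtain x where x: "vs = [x]" "x : cA" using c(2) by (auto simp: HB_0 car_A elim!: tuples_ConsE)
 have "aug_Bar (NB 0 (Bpure 0 [x, c])) = \<zero>[A]"
  using x c by (simp add: ahom_minus[OF grB grA aug_B_hom] B0_simps ib_in aug_B_pure aug_ib A.minus_eq A.r_neg)
 moreover have "NB 0 (Bpure 0 [x, c]) : cB 0" using lhomD(4)[OF NB_lhom] x c by (simp only: B0_simps)
 ultimately have "aug_Bar (ract (Bar 0) (sgB 0 (Suc 0) (NB 0 (Bpure 0 [x, c]))) b) = \<zero>[A]"
  using u(2) bhomD(4)[OF sgB_bhom] ahom_neg[OF grB grA aug_B_hom] by (simp add: aug_B_act sgB_def A.minus_zero_eq)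
 thus "aug_Bar (dd 0 (Bpure (Suc 0) (us @ [b]))) = \<zero>[A]" using dd_pure[OF c(2,3) u(2)] c(1) x(1) by simp
qed

lemma dd_dd_NB: "(\<forall>X\<in>cB (Suc n). NB n (dd n X) = dd n X) & (\<forall>X\<in>cB (Suc (Suc n)). dd n (dd (Suc n) X) = \<zero>[Bar n])"
proof (induction n)
 have dd0: "\<forall>X\<in>cB (Suc (Suc n)). dd n (dd (Suc n) X) = \<zero>[Bar n]"
  if NBd: "\<forall>X\<in>cB (Suc n). NB n (dd n X) = dd n X" for n proof
  interpret B: abelian_group "Bar n" by (rule grB)
  fix X assume X: "X : cB (Suc (Suc n))"
  show "dd n (dd (Suc n) X) = \<zero>[Bar n]"
  proof (rule B_hom_eq[OF grB ahom_comp[OF bhomD(1)[OF dd_bhom] bhomD(1)[OF dd_bhom]] ahom_const_zero[OF grB grB] _ X])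
  fix us b assume u: "us : TB (Suc (Suc n))" "b : cA"
  obtain vs c where c: "us = vs @ [to_bar c]" "vs : TB (Suc n)" "c : cA" by (rule HB_SucE[OF u(1)])
  let ?Y = "Bpure (Suc n) (vs @ [c])"
  note Y = B_pure_in[OF c(2,3)]
  note dY = bhomD(4)[OF dd_bhom Y]
  note N = lhomD(4)[OF NB_lhom Y]
  have "dd n (NB (Suc n) ?Y) = dd n ?Y -[Bar n] dd n (sB n (dd n ?Y))"
  unfolding NB_Suc using Y dY by (intro ahom_minus[OF grB grB bhomD(1)[OF dd_bhom]] sB_in)
  also have "\<dots> = \<zero>[Bar n]" using dd_sB[OF dY] NBd Y dY by (simp add: B.minus_eq B.r_neg)
  finally have "dd n (sgB (Suc n) (Suc (Suc n)) (NB (Suc n) ?Y)) = \<zero>[Bar n]"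
  using ahom_neg[OF grB grB bhomD(1)[OF dd_bhom] N] by (simp add: sgB_def B.minus_zero_eq)
  thus "dd n (dd (Suc n) (Bpure (Suc (Suc n)) (us @ [b]))) = \<zero>[Bar n]"
  using dd_pure[OF c(2,3) u(2)] c(1) u(2) bhomD(4)[OF sgB_bhom N, of "Suc (Suc n)"]
  by (simp add: bhomD(3)[OF dd_bhom] act_zero[OF bim_Bar])
  qed
 qed
 { case 0
  interpret B: abelian_group "Bar 0" by (rule grB)
  have "\<forall>X\<in>cB (Suc 0). NB 0 (dd 0 X) = dd 0 X"
  using aug_dd bhomD(4)[OF dd_bhom] ahom_zero[OF grA grB ib_hom] by (simp add: B.minus_eq B.minus_zero_eq)
  thus ?case using dd0 by blast }
 { case (Suc n)
  interpret B: abelian_group "Bar (Suc n)" by (rule grB)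
  have "NB (Suc n) (dd (Suc n) X) = dd (Suc n) X" if X: "X : cB (Suc (Suc n))" for X
  using Suc X bhomD(4)[OF dd_bhom X] ahom_zero[OF grB grB sB_hom]
  unfolding NB_Suc by (simp add: B.minus_eq B.minus_zero_eq)
  thus ?case using dd0 by blast }
qed

lemma NB_dd: "X : cB (Suc n) ==> NB n (dd n X) = dd n X"
 and dd_dd: "X : cB (Suc (Suc n)) ==> dd n (dd (Suc n) X) = \<zero>[Bar n]" using dd_dd_NB by blast+

subsection \<open>The explicit form of the bar differential\<close>

lemma bar_list:
 assumes "length ys = Suc n" "set ys <= cA"
 shows "hd ys # map to_bar (tl ys) : TB n" proof -
 obtain y zs where "ys = y # zs" "n = length zs" using assms(1) by (cases ys) auto
 moreover have "map to_bar zs : tuples (replicate (length zs) fac_Abar)" if "set zs <= cA" for zs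
  using that by (induction zs) (simp_all add: to_bar_in)
 ultimately show ?thesis using assms(2) by (simp add: HB_def car_A)
qed

lemma Bar_elt_snoc:
 assumes "length ys = Suc n"
 shows "Bar_elt n (ys @ [b]) = Bpure n ((hd ys # map to_bar (tl ys)) @ [b])"
 using assms by (cases ys) (simp_all add: Bar_elt_def butlast_append)

lemma Bar_elt_vap:
 assumes "length ys = Suc (Suc n)" "set ys <= cA" "b : cA"
 shows "Bar_elt (Suc n) (ys @ [b]) = vap n (Bar_elt n ys) b" "Bar_elt n ys : cB n" proof -
 obtain zs a where z: "ys = zs @ [a]" "length zs = Suc n" using assms(1) by (cases ys rule: rev_cases) auto
 have "set zs <= cA" "a : cA" using assms(2) z by auto
 note u = bar_list[OF z(2) this(1)] this
 have "hd ys # map to_bar (tl ys) = (hd zs # map to_bar (tl zs)) @ [to_bar a]" using z by (cases zs) auto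
 thus "Bar_elt (Suc n) (ys @ [b]) = vap n (Bar_elt n ys) b" "Bar_elt n ys : cB n"
  using assms z u Bar_elt_snoc[OF assms(1), of b] Bar_elt_snoc[OF z(2), of a] vap_pure[OF u(1,3) assms(3)] B_pure_in[OF u(1,3)]
  by simp_all
qed

lemma A_list_merge:
 assumes "set as <= cA" "Suc i < length as"
 shows "set (take i as @ [as ! i ** as ! Suc i] @ drop (i + 2) as) <= cA"
  "length (take i as @ [as ! i ** as ! Suc i] @ drop (i + 2) as) = length as - 1" proof -
 have "as ! i : cA" "as ! Suc i : cA" using assms by (auto simp: subset_iff)
 thus "set (take i as @ [as ! i ** as ! Suc i] @ drop (i + 2) as) <= cA"
  using assms(1) set_take_subset[of i as] set_drop_subset[of "i + 2" as] by auto
qed (use assms(2) in simp)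

definition DB where
 "DB n as = (\<Oplus>\<^bsub>Bar n\<^esub>i\<in>{0..Suc n}. [((-1::int) ^ i)] \<cdot>\<^bsub>Bar n\<^esub>
  Bar_elt n (take i as @ [as ! i ** as ! Suc i] @ drop (i + 2) as))"

text \<open>
 Each step of the recursion splits off the summand that multiplies the last two entries and leaves the
 sum for the shorter tensor.
\<close>
lemma DB_dd:
 assumes "length ys = Suc n" "set ys <= cA" "a : cA" "b : cA"
 shows "DB n (ys @ [a, b]) = dd n (Bar_elt (Suc n) (ys @ [a, b]))" proof -
 have dd: "dd n (Bar_elt (Suc n) (ys @ [a, b])) = ract (Bar n) (sgB n (Suc n) (NB n (Bar_elt n (ys @ [a])))) b"
  if "length ys = Suc n" "set ys <= cA" "a : cA" "b : cA" for n ys a b proof -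
  have "hd (ys @ [a]) # map to_bar (tl (ys @ [a])) = (hd ys # map to_bar (tl ys)) @ [to_bar a]" using that(1) by (cases ys) auto
  thus ?thesis
  using Bar_elt_snoc[of "ys @ [a]" "Suc n" b] Bar_elt_snoc[OF that(1), of a] dd_pure[OF bar_list[OF that(1,2)] that(3,4)] that(1) by simp
 qed
 show ?thesis using assms proof (induction n arbitrary: ys a b)
  case 0
  interpret B: abelian_group "Bar 0" by (rule grB)
  obtain x where x: "ys = [x]" "x : cA" using 0 by (cases ys) auto
  have e: "Bar_elt 0 [p, q] = Bpure 0 [p, q]" for p q by (simp add: Bar_elt_def)
  have s: "{0..Suc 0} = {0, Suc 0}" by auto
  have "DB 0 (ys @ [a, b]) = Bpure 0 [x ** a, b] +[Bar 0] (\<ominus>\<^bsub>Bar 0\<^esub> Bpure 0 [x, a ** b])"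
  using x 0 sgB_int[of "Bpure 0 [x, a ** b]" 0 "Suc 0"] sgB_int[of "Bpure 0 [x ** a, b]" 0 0]
  by (simp add: DB_def s e B0_simps sgB_def)
  moreover have "dd 0 (Bar_elt (Suc 0) (ys @ [a, b])) = \<ominus>\<^bsub>Bar 0\<^esub> (Bpure 0 [x, a ** b] -[Bar 0] Bpure 0 [x ** a, b])"
  proof -
  have "ract (Bar 0) (\<ominus>\<^bsub>Bar 0\<^esub> (Bpure 0 [x, a] -[Bar 0] ib (x ** a))) b =
  \<ominus>\<^bsub>Bar 0\<^esub> (ract (Bar 0) (Bpure 0 [x, a]) b -[Bar 0] ract (Bar 0) (ib (x ** a)) b)"
  using x 0 ahom_neg[OF grB grB bimD(3)[OF bim_Bar 0(4)], of "Bpure 0 [x, a] -[Bar 0] ib (x ** a)"]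
  by (simp add: act_minus[OF bim_Bar] B0_simps ib_in)
  thus ?thesis using dd[OF 0] x 0 by (simp add: e aug_B_pure sgB_def B0_simps ib_def)
  qed
  moreover have "Bpure 0 [x ** a, b] : cB 0" "Bpure 0 [x, a ** b] : cB 0" using x 0 by (simp_all add: B0_simps)
  ultimately show ?case by simp algebra
 next
  case (Suc n)
  let ?B = "Bar (Suc n)"
  interpret B: abelian_group ?B by (rule grB)
  interpret B0: abelian_group "Bar n" by (rule grB)
  obtain zs c where z: "ys = zs @ [c]" "length zs = Suc n" "set zs <= cA" "c : cA"
  using Suc.prems by (cases ys rule: rev_cases) auto
  let ?as = "zs @ [c, a]"
  let ?M = "%as i. take i as @ [as ! i ** as ! Suc i] @ drop (i + 2) as"
  have A: "set ?as <= cA" "length ?as = Suc (Suc (Suc n))" using z Suc.prems by auto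
  have M: "length (?M ?as i) = Suc (Suc n)" "set (?M ?as i) <= cA" if "i <= Suc n" for i
  using A_list_merge[OF A(1), of i] A(2) that by simp_all
  note V = vap_hom[OF Suc.prems(4), of n]
  define E where "E i = Bar_elt (Suc n) (?M (?as @ [b]) i)" for i
  define L where "L i = Bar_elt n (?M ?as i)" for i
  have Ei: "E i = vap n (L i) b" if "i <= Suc n" for i proof -
  have "?M (as @ [b]) i = ?M as i @ [b]" if "Suc i < length as" for as using that by (simp add: nth_append)
  from this[of ?as] have "?M (?as @ [b]) i = ?M ?as i @ [b]" using A(2) that by simp
  thus ?thesis unfolding E_def L_def using Bar_elt_vap(1)[OF M[OF that] Suc.prems(4)] by simp
  qed
  have Mc: "L i : cB n" if "i <= Suc n" for i unfolding L_def using Bar_elt_vap(2)[OF M[OF that] Suc.prems(4)] .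
  have DBL: "DB n ?as = (\<Oplus>\<^bsub>Bar n\<^esub>i\<in>{0..Suc n}. [((-1::int) ^ i)] \<cdot>\<^bsub>Bar n\<^esub> L i)" by (simp only: DB_def L_def)
  have Lc: "[((-1::int) ^ i)] \<cdot>\<^bsub>Bar n\<^esub> L i : cB n" if "i : {0..Suc n}" for i
  using Mc[of i] that by (simp add: sgB_int bhomD(4)[OF sgB_bhom])
  have Ec: "[((-1::int) ^ i)] \<cdot>\<^bsub>?B\<^esub> E i : carrier ?B" if "i : {0..Suc n}" for i
  using Mc[of i] that ahom_in[OF V] by (simp add: Ei sgB_int bhomD(4)[OF sgB_bhom])
  have s1: "(\<Oplus>\<^bsub>?B\<^esub>i\<in>{0..Suc n}. [((-1::int) ^ i)] \<cdot>\<^bsub>?B\<^esub> E i) = vap n (DB n ?as) b"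
  proof -
  have "vap n (DB n ?as) b = (\<Oplus>\<^bsub>?B\<^esub>i\<in>{0..Suc n}. vap n ([((-1::int) ^ i)] \<cdot>\<^bsub>Bar n\<^esub> L i) b)"
  unfolding DBL using Lc by (intro ahom_finsum[OF grB grB V])
  also have "\<dots> = (\<Oplus>\<^bsub>?B\<^esub>i\<in>{0..Suc n}. [((-1::int) ^ i)] \<cdot>\<^bsub>?B\<^esub> E i)"
  using Mc Ec by (intro B.finsum_cong'[OF refl]) (simp_all add: Ei ahom_int[OF grB grB V] Pi_def)
  finally show ?thesis by simp
  qed
  have ys: "length ys = Suc (Suc n)" using z by simp
  let ?Y = "Bar_elt (Suc n) (ys @ [a])"
  note Yb = bar_list[OF ys Suc.prems(2)]
  have Y: "?Y = Bpure (Suc n) ((hd ys # map to_bar (tl ys)) @ [a])" "?Y : carrier ?B"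
  using Bar_elt_snoc[OF ys, of a] B_pure_in[OF Yb Suc.prems(3)] by simp_all
  have Yr: "ract ?B ?Y b = Bar_elt (Suc n) (ys @ [a ** b])"
  unfolding Y(1) Bar_elt_snoc[OF ys] by (rule B_pure_ract[OF Yb Suc.prems(3,4)])
  have Yc: "Bar_elt (Suc n) (ys @ [a ** b]) : carrier ?B"
  using Bar_elt_snoc[OF ys] B_pure_in[OF Yb] Suc.prems(3,4) by simp
  have l: "?M (?as @ [b]) (Suc (Suc n)) = ys @ [a ** b]" using z by (simp add: nth_append)
  have dc: "DB n ?as : cB n" unfolding DBL using Lc by (intro B0.finsum_closed) blast
  have El: "E (Suc (Suc n)) = Bar_elt (Suc n) (ys @ [a ** b])" unfolding E_def l ..
  have "ys @ [a, b] = ?as @ [b]" using z(1) by simp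
  hence "DB (Suc n) (ys @ [a, b]) = (\<Oplus>\<^bsub>?B\<^esub>i\<in>insert (Suc (Suc n)) {0..Suc n}. [((-1::int) ^ i)] \<cdot>\<^bsub>?B\<^esub> E i)"
  unfolding DB_def E_def by (simp only: atLeast0_atMost_Suc[of "Suc n"])
  also have "\<dots> = [((-1::int) ^ Suc (Suc n))] \<cdot>\<^bsub>?B\<^esub> E (Suc (Suc n)) +[?B] (\<Oplus>\<^bsub>?B\<^esub>i\<in>{0..Suc n}. [((-1::int) ^ i)] \<cdot>\<^bsub>?B\<^esub> E i)"
  proof (rule B.finsum_insert)
  show "[((-1::int) ^ Suc (Suc n))] \<cdot>\<^bsub>?B\<^esub> E (Suc (Suc n)) : carrier ?B" unfolding El using Yc by (simp only: sgB_int bhomD(4)[OF sgB_bhom])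
  qed (use Ec in auto)
  finally have D: "DB (Suc n) (ys @ [a, b]) = sgB (Suc n) (Suc (Suc n)) (Bar_elt (Suc n) (ys @ [a ** b])) +[?B] vap n (DB n ?as) b"
  using Yc by (simp only: s1 El sgB_int)
  have IH: "dd n ?Y = DB n ?as" using Suc.IH[OF z(2-4) Suc.prems(3)] z(1) by simp
  let ?v = "vap n (DB n ?as) \<one>[A]"
  have v: "?v : carrier ?B" using ahom_in[OF vap_hom[OF A_one] dc] .
  have vb: "ract ?B ?v b = vap n (DB n ?as) b" using vap_ract[OF dc A_one Suc.prems(4)] Suc.prems(4) by simp
  have vbc: "vap n (DB n ?as) b : carrier ?B" using ahom_in[OF V dc] .
  have "dd (Suc n) (Bar_elt (Suc (Suc n)) (ys @ [a, b])) = ract ?B (sgB (Suc n) (Suc (Suc n)) (?Y -[?B] sgB (Suc n) (Suc n) ?v)) b"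
  using dd[OF Suc.prems] by (simp only: NB_Suc IH sB_def)
  also have "\<dots> = sgB (Suc n) (Suc (Suc n)) (ract ?B ?Y b -[?B] sgB (Suc n) (Suc n) (ract ?B ?v b))"
  using Y(2) v Suc.prems(4) bhomD(4)[OF sgB_bhom v, of "Suc n"]
  by (simp add: bhomD(3)[OF sgB_bhom, symmetric] act_minus[OF bim_Bar])
  also have "\<dots> = sgB (Suc n) (Suc (Suc n)) (Bar_elt (Suc n) (ys @ [a ** b])) +[?B] vap n (DB n ?as) b"
  unfolding Yr vb using Yc vbc by (simp add: sgB_def B.minus_eq B.minus_add)
  finally show ?case using D by simp
 qed
qed

lemma dBar_dd: assumes "X : cB (Suc n)" shows "dBar (Suc n) X = dd n X" unfolding dBar_def
proof (rule tensor_lift_unique[OF B_factor[of "Suc n"]])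
 show "abelian_group (Bar (Suc n - 1))" by (simp add: grB)
 show "dd n : ahom (tensor K (facs_bar (Suc n))) (Bar (Suc n - 1))" using bhomD(1)[OF dd_bhom] by (simp add: ahom_Bar(1))
 show "X : carrier (tensor K (facs_bar (Suc n)))" using assms by (simp add: B_simps)
 fix xs assume xs: "xs : tuples (facs_bar (Suc n))"
 then obtain us b where u: "xs = us @ [b]" "us : TB (Suc n)" "b : cA" by (elim facs_barE)
 then obtain x vs where x: "us = x # vs" "x : cA" "vs : tuples (replicate (Suc n) fac_Abar)"
  unfolding HB_def by (auto simp: car_A elim!: tuples_ConsE[of us])
 have lv: "length vs = m & set (map lift_A vs) <= cA & map to_bar (map lift_A vs) = vs" if "vs : tuples (replicate m fac_Abar)" for m vs
  using that proof (induction m arbitrary: vs)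
  case (Suc m)
  then obtain v ws where "vs = v # ws" "v : carrier fac_Abar" "ws : tuples (replicate m fac_Abar)" by (auto elim: tuples_ConsE)
  thus ?case using Suc.IH by (simp add: lift_A_in to_bar_lift)
 qed simp
 note L = lv[OF x(3)]
 let ?as = "map lift_A xs"
 have as: "?as = (x # map lift_A vs) @ [b]" using u x by (simp add: lift_A_A)
 obtain ws a where w: "x # map lift_A vs = ws @ [a]" by (cases "x # map lift_A vs" rule: rev_cases) auto
 have "length (ws @ [a]) = Suc (Suc n)" "set (ws @ [a]) <= cA" unfolding w[symmetric] using L x(2) by simp_all
 hence ws: "length ws = Suc n" "set ws <= cA" "a : cA" by auto
 have aw: "?as = ws @ [a, b]" using as w by simp
 have "Bar_elt (Suc n) ?as = Bpure (Suc n) xs" unfolding as using u(1) x(1) L by (simp add: Bar_elt_def butlast_append)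
 hence "DB n ?as = dd n (Bpure (Suc n) xs)" using DB_dd[OF ws u(3)] aw by simp
 thus "(let as = map lift_A xs in \<Oplus>\<^bsub>Bar (Suc n - 1)\<^esub>i\<in>{0..Suc n}. [((-1::int) ^ i)] \<cdot>\<^bsub>Bar (Suc n - 1)\<^esub>
  Bar_elt (Suc n - 1) (take i as @ [as ! i ** as ! Suc i] @ drop (i + 2) as)) = dd n (Bpure (Suc n) xs)"
  by (simp add: DB_def Let_def)
qed

lemma bhom_cong:
 assumes "bim M" "f : bhom M N" "!!x. x : carrier M ==> g x = f x" shows "g : bhom M N" proof (rule bhomI)
 show "g : ahom M N" by (rule ahom_cong[OF bimD(1)[OF assms(1)] assms(3)[symmetric] bhomD(1)[OF assms(2)]])
qed (use assms in \<open>simp_all add: bhomD(2)[OF assms(2)] bhomD(3)[OF assms(2)] bimD(12,13)[OF assms(1)]\<close>)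

lemma dBar_bhom: "dBar (Suc n) : bhom (Bar (Suc n)) (Bar n)" by (rule bhom_cong[OF bim_Bar dd_bhom dBar_dd])


section \<open>The comparison maps\<close>

lemma B_minus_zero: "x : cB n ==> x -[Bar n] \<zero>[Bar n] = x" proof -
 interpret B: abelian_group "Bar n" by (rule grB)
 show "x : cB n ==> x -[Bar n] \<zero>[Bar n] = x" by (simp add: B.minus_eq B.minus_zero_eq)
qed

lemma P_minus_zero: "x : cP n ==> x -[P n] \<zero>[P n] = x" proof -
 interpret B: abelian_group "P n" by (rule grP)
 show "x : cP n ==> x -[P n] \<zero>[P n] = x" by (simp add: B.minus_eq B.minus_zero_eq)
qed

lemmas sB_zero = ahom_zero[OF grB grB sB_hom] and dP_zero = ahom_zero[OF grP grP bhomD(1)[OF dP_bimodule_hom]]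
 and dBar_zero = ahom_zero[OF grB grB bhomD(1)[OF dBar_bhom]]
 and rho_zero' = ahom_zero[OF grP grP lhomD(1)[OF rho_left_hom]]

lemma dBar_in: "X : cB (Suc n) ==> dBar (Suc n) X : cB n" by (rule bhomD(4)[OF dBar_bhom])

lemma dP_in': "X : cP (Suc n) ==> dP (Suc n) X : cP n" by (rule bhomD(4)[OF dP_bimodule_hom])

lemma rho_in': "X : cP n ==> \<rho> n X : cP (Suc n)" by (rule lhomD(4)[OF rho_left_hom])

lemma dBar_sB_0: "X : cB 0 ==> dBar (Suc 0) (sB 0 X) = X -[Bar 0] ib (aug_Bar X)"
 using dd_sB[of X 0] by (simp add: dBar_dd sB_in)

lemma dBar_sB_Suc: "X : cB (Suc n) ==>
  dBar (Suc (Suc n)) (sB (Suc n) X) = X -[Bar (Suc n)] sB n (dBar (Suc n) X)"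
 using dd_sB[of X "Suc n"] by (simp add: dBar_dd sB_in NB_Suc del: NB.simps)

lemma dBar_dBar: "X : cB (Suc (Suc n)) ==> dBar (Suc n) (dBar (Suc (Suc n)) X) = \<zero>[Bar n]"
 using dd_dd[of X n] bhomD(4)[OF dd_bhom, of X "Suc n"] by (simp add: dBar_dd)

lemma aug_dBar: "X : cB (Suc 0) ==> aug_Bar (dBar (Suc 0) X) = \<zero>[A]" using aug_dd by (simp add: dBar_dd)

lemma sB_dBar_unit:
 assumes "us : TB (Suc n)"
 shows "sB n (dBar (Suc n) (Bpure (Suc n) (us @ [\<one>[A]]))) = Bpure (Suc n) (us @ [\<one>[A]])" proof -
 interpret B: abelian_group "Bar (Suc n)" by (rule grB)
 let ?u = "Bpure (Suc n) (us @ [\<one>[A]])"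
 have u: "?u : cB (Suc n)" by (rule B_pure_in[OF assms A_one])
 have "?u -[Bar (Suc n)] sB n (dd n ?u) = \<zero>[Bar (Suc n)]" using NB_unit[OF assms] by (simp only: NB_Suc)
 from B.eq_if_minus_zero[OF this u sB_in[OF bhomD(4)[OF dd_bhom u]]] have "?u = sB n (dd n ?u)" .
 thus ?thesis using u by (simp add: dBar_dd)
qed

lemma ib_aug_unit:
 assumes "us : TB 0" shows "ib (aug_Bar (Bpure 0 (us @ [\<one>[A]]))) = Bpure 0 (us @ [\<one>[A]])"
 using assms by (auto simp: HB_0 car_A aug_B_pure ib_def elim!: tuples_ConsE)

subsection \<open>From the small to the bar resolution\<close>

lemma ib_aug_P_lhom: "(%X. ib (aug_P X)) : lhom (P 0) (Bar 0)" proof (rule lhomI[OF ahom_comp[OF ib_hom aug_P_hom]])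
 note c = ahom_in[OF aug_P_hom]
 show "ib (aug_P (lact (P 0) a X)) = lact (Bar 0) a (ib (aug_P X))" if "a : cA" "X : cP 0" for a X
  using that c by (simp add: aug_P_act ib_lact)
 show "ib (aug_P (ract (P 0) X (proj z))) = ract (Bar 0) (ib (aug_P X)) (proj z)" if "z : K" "X : cP 0" for z X
  using that ib_ract[OF c] by (simp add: aug_P_act proj_K_in)
qed

lemma F_props: "F n : bhom (P n) (Bar n) & (\<forall>a\<in>cA. \<forall>w\<in>chains n. F n (Ppure n a (ppath w) \<one>[A]) =
  (case n of 0 => ib (aug_P (Ppure n a (ppath w) \<one>[A])) | Suc m => sB m (F m (dP n (Ppure n a (ppath w) \<one>[A])))))"
proof (induction n)
 have main: "Fn : bhom (P n) (Bar n) & (\<forall>a\<in>cA. \<forall>w\<in>chains n. Fn (Ppure n a (ppath w) \<one>[A]) = f (Ppure n a (ppath w) \<one>[A]))"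
  if f: "f : lhom (P n) (Bar n)" and Fn: "Fn = P_lift (Bar n) g"
  and g: "!!a w b. [| a : cA; w : chains n; b : cA |] ==> g a w b = ract (Bar n) (f (Ppure n a (ppath w) \<one>[A])) b"
  for n f Fn g proof -
  note R = P_rext[OF bim_Bar f]
  have e: "Fn X = P_lift (Bar n) (%a w b. ract (Bar n) (f (Ppure n a (ppath w) \<one>[A])) b) X" if "X : cP n" for X
  unfolding Fn by (rule P_lift_unique[OF grB bhomD(1)[OF R(1)] _ that]) (simp add: g R(2))
  have pc: "Ppure n a (ppath w) \<one>[A] : cP n" if "a : cA" "w : chains n" for a w
  using that by (simp add: Ppure_in pp_span)
  show ?thesis using bhom_cong[OF bim_P R(1) e] e[OF pc] R(2)[OF _ _ A_one] lhomD(4)[OF f pc]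
  by (simp add: bimD(5)[OF bim_Bar])
 qed
 { case 0
  have "F 0 : bhom (P 0) (Bar 0) & (\<forall>a\<in>cA. \<forall>w\<in>chains 0. F 0 (Ppure 0 a (ppath w) \<one>[A]) = ib (aug_P (Ppure 0 a (ppath w) \<one>[A])))"
  proof (rule main[OF ib_aug_P_lhom F.simps(1)])
  fix a w b assume a: "a : cA" "w : chains 0" "b : cA"
  have "aug_P (Ppure 0 a (ppath w) \<one>[A]) : cA"
  using a by (intro ahom_in[OF aug_P_hom] Ppure_in) (simp_all add: pp_span)
  thus "Bpure 0 [aug_P (Ppure 0 a (ppath w) \<one>[A]), b] = ract (Bar 0) (ib (aug_P (Ppure 0 a (ppath w) \<one>[A]))) b"
  using a by (simp add: ib_def B0_simps)
  qed
  thus ?case by simp }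
 { case (Suc n)
  hence Fn: "F n : bhom (P n) (Bar n)" by blast
  have f: "(%X. sB n (F n (dP (Suc n) X))) : lhom (P (Suc n)) (Bar (Suc n))"
  by (rule lhom_comp[OF sB_lhom bhomD(5)[OF bhom_comp[OF Fn dP_bimodule_hom]]])
  have "F (Suc n) : bhom (P (Suc n)) (Bar (Suc n)) & (\<forall>a\<in>cA. \<forall>w\<in>chains (Suc n).
  F (Suc n) (Ppure (Suc n) a (ppath w) \<one>[A]) = sB n (F n (dP (Suc n) (Ppure (Suc n) a (ppath w) \<one>[A]))))"
  proof (rule main[OF f F.simps(2)])
  fix a w b assume a: "a : cA" "w : chains (Suc n)" "b : cA"
  let ?X = "F n (dP (Suc n) (Ppure (Suc n) a (ppath w) \<one>[A]))"
  have X: "?X : cB n" using a by (intro bhomD(4)[OF Fn] dP_in' Ppure_in) (simp_all add: pp_span)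
  have "[((-1::int) ^ Suc n)] \<cdot>\<^bsub>Bar (Suc n)\<^esub> vap n ?X b = ract (Bar (Suc n)) (sB n ?X) b"
  using a X ahom_in[OF vap_hom X] unfolding sB_def
  by (simp add: sgB_int vap_ract bhomD(3)[OF sgB_bhom, symmetric] del: power_Suc)
  thus "[((-1::int) ^ Suc n)] \<cdot>\<^bsub>Bar (Suc n)\<^esub> tensor_append K (facs_bar (Suc n)) (varpi n ?X) [b] = ract (Bar (Suc n)) (sB n ?X) b"
  by (simp only: vap_def)
  qed
  thus ?case by simp }
qed

lemma F_bhom: "F n : bhom (P n) (Bar n)" using F_props by blast

lemma F_unit_0: "[| a : cA; w : chains 0 |] ==> F 0 (Ppure 0 a (ppath w) \<one>[A]) = ib (aug_P (Ppure 0 a (ppath w) \<one>[A]))"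
 using F_props[of 0] by simp

lemma F_unit_Suc: "[| a : cA; w : chains (Suc n) |] ==>
  F (Suc n) (Ppure (Suc n) a (ppath w) \<one>[A]) = sB n (F n (dP (Suc n) (Ppure (Suc n) a (ppath w) \<one>[A])))"
 using F_props[of "Suc n"] by (simp del: F.simps)

lemma F_in: "X : cP n ==> F n X : cB n" by (rule bhomD(4)[OF F_bhom])

lemma aug_F: assumes "X : cP 0" shows "aug_Bar (F 0 X) = aug_P X"
proof (rule P_hom_eq[OF grA ahom_comp[OF aug_B_hom bhomD(1)[OF F_bhom]] aug_P_hom _ assms])
 fix a w b assume a: "a : cA" "w : chains 0" "b : cA"
 let ?x = "Ppure 0 a (ppath w) \<one>[A]"
 have x: "?x : cP 0" "Ppure 0 a (ppath w) b = ract (P 0) ?x b" using a by (simp_all add: Ppure_in Ppure_ract pp_span)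
 have "aug_Bar (F 0 ?x) = aug_P ?x" using F_unit_0[OF a(1,2)] aug_ib[OF ahom_in[OF aug_P_hom x(1)]] by simp
 thus "aug_Bar (F 0 (Ppure 0 a (ppath w) b)) = aug_P (Ppure 0 a (ppath w) b)"
  unfolding x(2) using a x(1) by (simp add: bhomD(3)[OF F_bhom] aug_B_act aug_P_act F_in del: F.simps)
qed

lemma dF: "X : cP (Suc n) ==> dBar (Suc n) (F (Suc n) X) = F n (dP (Suc n) X)" proof (induction n arbitrary: X)
 have main: "dBar (Suc n) (F (Suc n) X) = F n (dP (Suc n) X)" if X: "X : cP (Suc n)"
  and u: "!!x. x : cP (Suc n) ==> dBar (Suc n) (sB n (F n (dP (Suc n) x))) = F n (dP (Suc n) x)" for n X
 proof (rule P_unit_eq[OF bim_Bar bhom_comp[OF dBar_bhom F_bhom] bhom_comp[OF F_bhom dP_bimodule_hom] _ X])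
  fix a w assume "a : cA" "w : chains (Suc n)"
  thus "dBar (Suc n) (F (Suc n) (Ppure (Suc n) a (ppath w) \<one>[A])) = F n (dP (Suc n) (Ppure (Suc n) a (ppath w) \<one>[A]))"
  using F_unit_Suc u Ppure_in by (simp add: pp_span del: F.simps)
 qed
 { case 0
  show ?case proof (rule main[OF 0])
  fix x assume x: "x : cP (Suc 0)"
  note d = dP_in'[OF x]
  have "aug_Bar (F 0 (dP (Suc 0) x)) = \<zero>[A]" using aug_F[OF d] aug_dP[of x] x by simp
  thus "dBar (Suc 0) (sB 0 (F 0 (dP (Suc 0) x))) = F 0 (dP (Suc 0) x)"
  using dBar_sB_0[OF F_in[OF d]] ahom_zero[OF grA grB ib_hom] B_minus_zero[OF F_in[OF d]] by (simp del: F.simps)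
  qed }
 { case (Suc n)
  show ?case proof (rule main[OF Suc(2)])
  fix x assume x: "x : cP (Suc (Suc n))"
  note d = dP_in'[OF x]
  have "dBar (Suc n) (F (Suc n) (dP (Suc (Suc n)) x)) = \<zero>[Bar n]"
  using Suc.IH[OF d] dP_dP[OF x] ahom_zero[OF grP grB bhomD(1)[OF F_bhom]] by (simp del: F.simps)
  thus "dBar (Suc (Suc n)) (sB (Suc n) (F (Suc n) (dP (Suc (Suc n)) x))) = F (Suc n) (dP (Suc (Suc n)) x)"
  using dBar_sB_Suc[OF F_in[OF d]] sB_zero B_minus_zero[OF F_in[OF d]] by (simp del: F.simps)
  qed }
qed

subsection \<open>From the bar to the small resolution\<close>

lemma G_props: "G n : bhom (Bar n) (P n) & (\<forall>us\<in>TB n. G n (Bpure n (us @ [\<one>[A]])) =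
  (case n of 0 => \<rho>_aug (aug_Bar (Bpure n (us @ [\<one>[A]]))) | Suc m => \<rho> m (G m (dBar n (Bpure n (us @ [\<one>[A]]))))))"
proof (induction n)
 have main: "Gn : bhom (Bar n) (P n) & (\<forall>us\<in>TB n. Gn (Bpure n (us @ [\<one>[A]])) = f (Bpure n (us @ [\<one>[A]])))"
  if f: "f : lhom (Bar n) (P n)" and Gn: "Gn = tensor_lift (P n) (%xs. ract (P n) (f (Bpure n (butlast xs @ [\<one>[A]]))) (last xs))"
  for n f Gn using B_rext(1)[OF bim_P f] B_rext(2)[OF bim_P f _ A_one] lhomD(4)[OF f B_pure_in[OF _ A_one]]
  unfolding Gn by (simp add: bimD(5)[OF bim_P])
 { case 0
  have "(%X. \<rho>_aug (aug_Bar X)) : lhom (Bar 0) (P 0)" proof (rule lhomI[OF ahom_comp[OF rho_aug_hom aug_B_hom]])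
  show "\<rho>_aug (aug_Bar (lact (Bar 0) a X)) = lact (P 0) a (\<rho>_aug (aug_Bar X))" if "a : cA" "X : cB 0" for a X
  using that by (simp add: aug_B_act rho_aug_lact aug_B_in)
  show "\<rho>_aug (aug_Bar (ract (Bar 0) X (proj z))) = ract (P 0) (\<rho>_aug (aug_Bar X)) (proj z)" if "z : K" "X : cB 0" for z X
  using that by (simp add: aug_B_act rho_aug_ract aug_B_in proj_K_in)
  qed
  from main[OF this G.simps(1)] show ?case by simp }
 { case (Suc n)
  hence Gn: "G n : bhom (Bar n) (P n)" by blast
  have "(%X. \<rho> n (G n (dBar (Suc n) X))) : lhom (Bar (Suc n)) (P (Suc n))"
  by (rule lhom_comp[OF rho_left_hom bhomD(5)[OF bhom_comp[OF Gn dBar_bhom]]])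
  from main[OF this G.simps(2)] show ?case by simp }
qed

lemma G_bhom: "G n : bhom (Bar n) (P n)" using G_props by blast

lemma G_unit_0: "us : TB 0 ==> G 0 (Bpure 0 (us @ [\<one>[A]])) = \<rho>_aug (aug_Bar (Bpure 0 (us @ [\<one>[A]])))"
 using G_props[of 0] by simp

lemma G_unit_Suc: "us : TB (Suc n) ==>
  G (Suc n) (Bpure (Suc n) (us @ [\<one>[A]])) = \<rho> n (G n (dBar (Suc n) (Bpure (Suc n) (us @ [\<one>[A]]))))"
 using G_props[of "Suc n"] by (simp del: G.simps)

lemma G_in: "X : cB n ==> G n X : cP n" by (rule bhomD(4)[OF G_bhom])

lemma aug_G: assumes "X : cB 0" shows "aug_P (G 0 X) = aug_Bar X"
proof (rule B_hom_eq[OF grA ahom_comp[OF aug_P_hom bhomD(1)[OF G_bhom]] aug_B_hom _ assms])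
 fix us b assume u: "us : TB 0" "b : cA"
 let ?u = "Bpure 0 (us @ [\<one>[A]])"
 have x: "?u : cB 0" "Bpure 0 (us @ [b]) = ract (Bar 0) ?u b" using u by (simp_all add: B_pure_in B_pure_ract)
 have "aug_P (G 0 ?u) = aug_Bar ?u" using G_unit_0[OF u(1)] aug_P_rho[OF aug_B_in[OF x(1)]] by simp
 thus "aug_P (G 0 (Bpure 0 (us @ [b]))) = aug_Bar (Bpure 0 (us @ [b]))"
  unfolding x(2) using u x(1) by (simp add: bhomD(3)[OF G_bhom] aug_B_act aug_P_act G_in del: G.simps)
qed

lemma dG: "X : cB (Suc n) ==> dP (Suc n) (G (Suc n) X) = G n (dBar (Suc n) X)" proof (induction n arbitrary: X)
 have main: "dP (Suc n) (G (Suc n) X) = G n (dBar (Suc n) X)" if X: "X : cB (Suc n)"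
  and u: "!!x. x : cB (Suc n) ==> dP (Suc n) (\<rho> n (G n (dBar (Suc n) x))) = G n (dBar (Suc n) x)" for n X
 proof (rule B_unit_eq[OF bim_P bhom_comp[OF dP_bimodule_hom G_bhom] bhom_comp[OF G_bhom dBar_bhom] _ X])
  fix us assume "us : TB (Suc n)"
  thus "dP (Suc n) (G (Suc n) (Bpure (Suc n) (us @ [\<one>[A]]))) = G n (dBar (Suc n) (Bpure (Suc n) (us @ [\<one>[A]])))"
  using G_unit_Suc u B_pure_in[OF _ A_one] by (simp del: G.simps)
 qed
 { case 0
  show ?case proof (rule main[OF 0])
  fix x assume x: "x : cB (Suc 0)"
  note d = dBar_in[OF x]
  have "aug_P (G 0 (dBar (Suc 0) x)) = \<zero>[A]" using aug_G[OF d] aug_dBar[OF x] by simp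
  thus "dP (Suc 0) (\<rho> 0 (G 0 (dBar (Suc 0) x))) = G 0 (dBar (Suc 0) x)"
  using dP_rho_0[OF G_in[OF d]] ahom_zero[OF grA grP rho_aug_hom] P_minus_zero[OF G_in[OF d]] by (simp del: G.simps)
  qed }
 { case (Suc n)
  show ?case proof (rule main[OF Suc(2)])
  fix x assume x: "x : cB (Suc (Suc n))"
  note d = dBar_in[OF x]
  have "dP (Suc n) (G (Suc n) (dBar (Suc (Suc n)) x)) = \<zero>[P n]"
  using Suc.IH[OF d] dBar_dBar[OF x] ahom_zero[OF grB grP bhomD(1)[OF G_bhom]] by (simp del: G.simps)
  thus "dP (Suc (Suc n)) (\<rho> (Suc n) (G (Suc n) (dBar (Suc (Suc n)) x))) = G (Suc n) (dBar (Suc (Suc n)) x)"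
  using dP_rho_Suc[OF G_in[OF d]] rho_zero' P_minus_zero[OF G_in[OF d]] by (simp del: G.simps)
  qed }
qed

lemma G_sB: "X : cB n ==> G (Suc n) (sB n X) = \<rho> n (G n (dBar (Suc n) (sB n X)))"
 by (rule sB_unit_agree[OF grP bhomD(1)[OF G_bhom] lhomD(1)[OF lhom_comp[OF rho_left_hom bhomD(5)[OF bhom_comp[OF G_bhom dBar_bhom]]]]])
  (simp_all add: G_unit_Suc del: G.simps)

lemma F_rho_aug: assumes "a : cA" shows "F 0 (\<rho>_aug a) = ib a" using assms proof (induction rule: A_induct)
 case zero
 show ?case using ahom_zero[OF grA grP rho_aug_hom] ahom_zero[OF grP grB bhomD(1)[OF F_bhom]]
  ahom_zero[OF grA grB ib_hom] by (simp del: F.simps)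
next
 case (path p c)
 have "F 0 (\<rho>_aug (pi p)) = ib (aug_P (\<rho>_aug (pi p)))"
  using rho_aug_pi[OF path] F_unit_0[OF pi_in[OF path] rho_aug_pi(2)[OF path]] by (simp del: F.simps)
 hence "F 0 (lact (P 0) (kk c) (\<rho>_aug (pi p))) = lact (Bar 0) (kk c) (ib (pi p))"
  using path by (simp add: bhomD(2)[OF F_bhom] rho_aug_in pi_in aug_P_rho del: F.simps)
 thus ?case using path by (simp add: rho_aug_lact ib_lact pi_in del: F.simps)
next
 case (add a b)
 thus ?case by (simp add: ahom_add[OF rho_aug_hom] ahom_add[OF bhomD(1)[OF F_bhom]] ahom_add[OF ib_hom] rho_aug_in del: F.simps)
qed

text \<open>
 On elements ending in \<open>1\<close> the inductive step is \<open>\<rho> G d \<sigma> F \<partial> = \<rho> G (1 - \<sigma> d) F \<partial>\<close>.  Here \<open>d F \<partial> = F \<partial> \<partial> = 0\<close>, and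
 \<open>\<rho> \<partial>\<close> is the identity on such elements because \<open>\<rho>\<close> kills them.
\<close>
lemma GF: "X : cP n ==> G n (F n X) = X" proof (induction n arbitrary: X)
 have idb: "(%X. X) : bhom (P n) (P n)" for n by (rule bhomI[OF ahom_id]) simp_all
 have main: "G n (F n X) = X" if X: "X : cP n"
  and u: "!!a w. [| a : cA; w : chains n |] ==> G n (F n (Ppure n a (ppath w) \<one>[A])) = Ppure n a (ppath w) \<one>[A]" for n X
  by (rule P_unit_eq[OF bim_P bhom_comp[OF G_bhom F_bhom] idb u X])
 { case 0
  show ?case proof (rule main[OF 0])
  fix a w assume a: "a : cA" "w : chains 0"
  let ?x = "Ppure 0 a (ppath w) \<one>[A]"
  interpret P: abelian_group "P 0" by (rule grP)
  have x: "?x : cP 0" using a by (simp add: Ppure_in pp_span)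
  note c = ahom_in[OF aug_P_hom x]
  have "G 0 (F 0 ?x) = \<rho>_aug (aug_P ?x)"
  using F_unit_0[OF a] G_unit_0[of "[aug_P ?x]"] c aug_ib[OF c] by (simp add: ib_def HB_0 car_A del: F.simps G.simps)
  moreover have "?x -[P 0] \<rho>_aug (aug_P ?x) = \<zero>[P 0]"
  using dP_rho_0[OF x] rho_unit[OF a] dP_zero[of 0] by simp
  from P.eq_if_minus_zero[OF this x rho_aug_in[OF c]] have "?x = \<rho>_aug (aug_P ?x)" .
  ultimately show "G 0 (F 0 ?x) = ?x" by simp
  qed }
 { case (Suc n)
  show ?case proof (rule main[OF Suc(2)])
  fix a w assume a: "a : cA" "w : chains (Suc n)"
  let ?x = "Ppure (Suc n) a (ppath w) \<one>[A]"
  interpret P: abelian_group "P (Suc n)" by (rule grP)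
  have x: "?x : cP (Suc n)" using a by (simp add: Ppure_in pp_span)
  note d = dP_in'[OF x]
  have s: "F (Suc n) ?x = sB n (F n (dP (Suc n) ?x))" by (rule F_unit_Suc[OF a])
  have "G (Suc n) (F (Suc n) ?x) = \<rho> n (G n (dBar (Suc n) (F (Suc n) ?x)))"
  unfolding s by (rule G_sB[OF F_in[OF d]])
  also have "\<dots> = \<rho> n (dP (Suc n) ?x)" using dF[OF x] Suc.IH[OF d] by simp
  also have "\<dots> = ?x" proof -
  have "?x -[P (Suc n)] \<rho> n (dP (Suc n) ?x) = \<zero>[P (Suc n)]"
  using dP_rho_Suc[OF x] rho_unit[OF a] dP_zero by (simp del: dP.simps)
  from P.eq_if_minus_zero[OF this x rho_in'[OF d]] show ?thesis by (rule sym)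
  qed
  finally show "G (Suc n) (F (Suc n) ?x) = ?x" .
  qed }
qed

subsection \<open>The homotopy\<close>

primrec hh :: "nat => ('v, 'e, 'k) tens => ('v, 'e, 'k) tens" where
 "hh 0 = (%X. \<zero>[Bar (Suc 0)])"
| "hh (Suc n) = tensor_lift (Bar (Suc (Suc n))) (%xs. ract (Bar (Suc (Suc n)))
  (sB (Suc n) (F (Suc n) (G (Suc n) (Bpure (Suc n) (butlast xs @ [\<one>[A]]))) -[Bar (Suc n)]
  hh n (dBar (Suc n) (Bpure (Suc n) (butlast xs @ [\<one>[A]]))))) (last xs))"

lemma zero_bhom: "(%X. \<zero>[Bar m]) : bhom (Bar n) (Bar m)"
 by (rule bhomI[OF ahom_const_zero[OF grB grB]]) (simp_all add: act_zero[OF bim_Bar])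

definition hf where "hf n X = sB (Suc n) (F (Suc n) (G (Suc n) X) -[Bar (Suc n)] hh n (dBar (Suc n) X))"

lemma hf_lhom: assumes "hh n : bhom (Bar n) (Bar (Suc n))" shows "hf n : lhom (Bar (Suc n)) (Bar (Suc (Suc n)))"
 unfolding hf_def[abs_def]
 by (rule lhom_comp[OF sB_lhom lhom_minus[OF bim_Bar bim_Bar bhomD(5)[OF bhom_comp[OF F_bhom G_bhom]]
  bhomD(5)[OF bhom_comp[OF assms dBar_bhom]]]])

lemma hh_bhom: "hh n : bhom (Bar n) (Bar (Suc n))" proof (induction n)
 case 0
 show ?case using zero_bhom by simp
next
 case (Suc n)
 show ?case using B_rext(1)[OF bim_Bar hf_lhom[OF Suc]] by (simp add: hf_def)
qed

lemma hh_pure: "[| us : TB (Suc n); b : cA |] ==>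
  hh (Suc n) (Bpure (Suc n) (us @ [b])) = ract (Bar (Suc (Suc n))) (hf n (Bpure (Suc n) (us @ [\<one>[A]]))) b"
 using B_rext(2)[OF bim_Bar hf_lhom[OF hh_bhom]] by (simp add: hf_def)

lemma hf_in: "X : cB (Suc n) ==> hf n X : cB (Suc (Suc n))" by (rule lhomD(4)[OF hf_lhom[OF hh_bhom]])

lemma hh_unit: "us : TB (Suc n) ==> hh (Suc n) (Bpure (Suc n) (us @ [\<one>[A]])) = hf n (Bpure (Suc n) (us @ [\<one>[A]]))"
 using hh_pure[OF _ A_one] hf_in[OF B_pure_in[OF _ A_one]] by (simp add: bimD(5)[OF bim_Bar] del: hh.simps)

lemma hh_sB: "X : cB n ==> hh (Suc n) (sB n X) = hf n (sB n X)"
 by (rule sB_unit_agree[OF grB bhomD(1)[OF hh_bhom] lhomD(1)[OF hf_lhom[OF hh_bhom]]]) (simp_all add: hh_unit del: hh.simps)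

lemma hh_in: "X : cB n ==> hh n X : cB (Suc n)" by (rule bhomD(4)[OF hh_bhom])

lemmas hh_zero = ahom_zero[OF grB grB bhomD(1)[OF hh_bhom]]

lemma FG_in: "X : cB n ==> F n (G n X) : cB n" by (simp add: F_in G_in del: F.simps G.simps)

lemma homotopy_0: assumes "X : cB 0" shows "F 0 (G 0 X) = X"
proof (rule B_unit_eq[OF bim_Bar bhom_comp[OF F_bhom G_bhom] _ _ assms])
 show "(%X. X) : bhom (Bar 0) (Bar 0)" by (rule bhomI[OF ahom_id]) simp_all
 fix us assume us: "us : TB 0"
 show "F 0 (G 0 (Bpure 0 (us @ [\<one>[A]]))) = Bpure 0 (us @ [\<one>[A]])"
  using G_unit_0[OF us] F_rho_aug[OF aug_B_in[OF B_pure_in[OF us A_one]]] ib_aug_unit[OF us] by (simp del: F.simps G.simps)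
qed

text \<open>
 By right linearity it suffices to look at tensors ending in \<open>1\<close>, where the homotopy is a value of \<open>\<sigma>\<close>
 and the contraction identity of the bar resolution applies.
\<close>
lemma homotopy: "X : cB n ==> F n (G n X) -[Bar n] X =
  (if n = 0 then \<zero>[Bar n] else hh (n - 1) (dBar n X)) +[Bar n] dBar (Suc n) (hh n X)"
proof (induction n arbitrary: X)
 case 0
 interpret B: abelian_group "Bar 0" by (rule grB)
 show ?case using 0 homotopy_0 dBar_zero[of 0] by (simp add: B.minus_eq B.r_neg del: F.simps G.simps)
next
 case (Suc n)
 let ?B = "Bar (Suc n)"
 interpret B: abelian_group ?B by (rule grB)
 interpret Bn: abelian_group "Bar n" by (rule grB)
 have idb: "(%X. X) : lhom ?B ?B" by (rule lhom_id)
 have dh: "dBar (Suc (Suc n)) (hh (Suc n) X) = F (Suc n) (G (Suc n) X) -[?B] (X +[?B] hh n (dBar (Suc n) X))"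
  if X: "X : carrier ?B" for X proof (rule B_unit_eq[OF bim_Bar bhom_comp[OF dBar_bhom hh_bhom] _ _ X])
  note c = bhomD(4)[OF dBar_bhom] FG_in hh_in
  show "(%X. F (Suc n) (G (Suc n) X) -[?B] (X +[?B] hh n (dBar (Suc n) X))) : bhom ?B ?B" proof (rule bhomI)
  show "(%X. F (Suc n) (G (Suc n) X) -[?B] (X +[?B] hh n (dBar (Suc n) X))) : ahom ?B ?B"
  by (rule ahom_minus_fun[OF grB grB ahom_comp[OF bhomD(1)[OF F_bhom] bhomD(1)[OF G_bhom]]
  ahom_plus_fun[OF grB grB ahom_id ahom_comp[OF bhomD(1)[OF hh_bhom] bhomD(1)[OF dBar_bhom]]]])
  qed (simp_all add: c bimD(12,13)[OF bim_Bar] act_minus[OF bim_Bar] ahom_add[OF bimD(2)[OF bim_Bar]] ahom_add[OF bimD(3)[OF bim_Bar]]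
  bhomD(2,3)[OF F_bhom] bhomD(2,3)[OF G_bhom] bhomD(2,3)[OF hh_bhom] bhomD(2,3)[OF dBar_bhom] G_in del: F.simps G.simps)
  fix us assume us: "us : TB (Suc n)"
  let ?y = "Bpure (Suc n) (us @ [\<one>[A]])"
  let ?FG = "F (Suc n) (G (Suc n) ?y)" and ?hd = "hh n (dBar (Suc n) ?y)"
  have y: "?y : carrier ?B" by (rule B_pure_in[OF us A_one])
  have cl: "?FG : carrier ?B" "?hd : carrier ?B" "dBar (Suc n) ?y : cB n" using y c by (simp_all del: F.simps G.simps)
  note Z = B.minus_closed[OF cl(1,2)]
  have "dBar (Suc n) (?FG -[?B] ?hd) = dBar (Suc n) ?FG -[Bar n] dBar (Suc n) ?hd"
  by (rule ahom_minus[OF grB grB bhomD(1)[OF dBar_bhom] cl(1,2)])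
  also have "dBar (Suc n) ?FG = F n (G n (dBar (Suc n) ?y))" using dF[OF G_in[OF y]] dG[OF y] by simp
  also have "F n (G n (dBar (Suc n) ?y)) -[Bar n] dBar (Suc n) ?hd = dBar (Suc n) ?y" proof -
  let ?d = "dBar (Suc n) ?y"
  have "(if n = 0 then \<zero>[Bar n] else hh (n - 1) (dBar n ?d)) = \<zero>[Bar n]" proof (cases n)
  case (Suc m)
  thus ?thesis using dBar_dBar[of ?y m] y hh_zero[of m] by simp
  qed simp
  hence "F n (G n ?d) -[Bar n] ?d = dBar (Suc n) ?hd" using Suc.IH[OF cl(3)] bhomD(4)[OF dBar_bhom cl(2)] by simp
  moreover have "F n (G n ?d) : cB n" by (rule FG_in[OF cl(3)])
  ultimately show ?thesis using cl(3) by (simp del: F.simps G.simps flip: `F n (G n ?d) -[Bar n] ?d = dBar (Suc n) ?hd`) algebra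
  qed
  finally have dZ: "dBar (Suc n) (?FG -[?B] ?hd) = dBar (Suc n) ?y" .
  have "dBar (Suc (Suc n)) (hh (Suc n) ?y) = (?FG -[?B] ?hd) -[?B] ?y"
  using hh_unit[OF us] dBar_sB_Suc[OF Z] dZ sB_dBar_unit[OF us] by (simp add: hf_def del: F.simps G.simps hh.simps)
  also have "\<dots> = ?FG -[?B] (?y +[?B] ?hd)" using cl y by algebra
  finally show "dBar (Suc (Suc n)) (hh (Suc n) ?y) = ?FG -[?B] (?y +[?B] ?hd)" .
 qed
 have c: "F (Suc n) (G (Suc n) X) : carrier ?B" "hh n (dBar (Suc n) X) : carrier ?B"
  using Suc.prems FG_in hh_in dBar_in by blast+
 show ?case unfolding dh[OF Suc.prems] using c Suc.prems by (simp del: F.simps G.simps hh.simps) algebra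
qed

lemma hF: "X : cP n ==> hh n (F n X) = \<zero>[Bar (Suc n)]" proof (induction n arbitrary: X)
 case 0
 thus ?case by simp
next
 case (Suc n)
 have z: "(%X. \<zero>[Bar (Suc (Suc n))]) : bhom (P (Suc n)) (Bar (Suc (Suc n)))"
  by (rule bhomI[OF ahom_const_zero[OF grP grB]]) (simp_all add: act_zero[OF bim_Bar])
 show ?case proof (rule P_unit_eq[OF bim_Bar bhom_comp[OF hh_bhom F_bhom] z _ Suc.prems])
  fix a w assume a: "a : cA" "w : chains (Suc n)"
  let ?x = "Ppure (Suc n) a (ppath w) \<one>[A]"
  have x: "?x : cP (Suc n)" using a by (simp add: Ppure_in pp_span)
  note d = dP_in'[OF x]
  have s: "F (Suc n) ?x = sB n (F n (dP (Suc n) ?x))" by (rule F_unit_Suc[OF a])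
  have "hh (Suc n) (F (Suc n) ?x) = hf n (F (Suc n) ?x)" unfolding s by (rule hh_sB[OF F_in[OF d]])
  also have "\<dots> = sB (Suc n) (F (Suc n) ?x -[Bar (Suc n)] \<zero>[Bar (Suc n)])"
  unfolding hf_def using GF[OF x] dF[OF x] Suc.IH[OF d] by simp
  also have "\<dots> = sB (Suc n) (sB n (F n (dP (Suc n) ?x)))" using B_minus_zero[OF F_in[OF x]] s by simp
  also have "\<dots> = \<zero>[Bar (Suc (Suc n))]" by (rule sB_sB[OF F_in[OF d]])
  finally show "hh (Suc n) (F (Suc n) ?x) = \<zero>[Bar (Suc (Suc n))]" .
 qed
qed

text \<open>On \<open>y = a\<^sub>0 \<otimes> \<dots> \<otimes> 1\<close> the homotopy is \<open>\<sigma>(Z)\<close> with \<open>d \<sigma>(Z) = FG y - h d y - y\<close>.\<close>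

lemma h_on_unit:
 assumes us: "us : TB (Suc n)" defines "y \<equiv> Bpure (Suc n) (us @ [\<one>[A]])"
 defines "Z \<equiv> F (Suc n) (G (Suc n) y) -[Bar (Suc n)] hh n (dBar (Suc n) y)"
 shows "y : cB (Suc n)" "Z : cB (Suc n)" "hh (Suc n) y = sB (Suc n) Z"
  "dBar (Suc (Suc n)) (sB (Suc n) Z) = Z -[Bar (Suc n)] y" proof -
 let ?B = "Bar (Suc n)"
 interpret B: abelian_group ?B by (rule grB)
 show y: "y : carrier ?B" unfolding y_def by (rule B_pure_in[OF us A_one])
 have cl: "F (Suc n) (G (Suc n) y) : carrier ?B" "hh n (dBar (Suc n) y) : carrier ?B"
  using FG_in[OF y] hh_in[OF dBar_in[OF y]] by simp_all
 show "Z : carrier ?B" unfolding Z_def using cl by (rule B.minus_closed)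
 show 1: "hh (Suc n) y = sB (Suc n) Z" using hh_unit[OF us] by (simp add: hf_def y_def Z_def del: hh.simps F.simps G.simps)
 have "dBar (Suc (Suc n)) (hh (Suc n) y) : carrier ?B" by (rule dBar_in[OF hh_in[OF y]])
 moreover have "F (Suc n) (G (Suc n) y) -[?B] y = hh n (dBar (Suc n) y) +[?B] dBar (Suc (Suc n)) (hh (Suc n) y)"
  using homotopy[OF y] by (simp del: F.simps G.simps hh.simps)
 ultimately have "dBar (Suc (Suc n)) (hh (Suc n) y) = (F (Suc n) (G (Suc n) y) -[?B] y) -[?B] hh n (dBar (Suc n) y)"
  using cl y by (simp del: F.simps G.simps hh.simps) algebra
 also have "\<dots> = Z -[?B] y" unfolding Z_def using cl y by algebra
 finally show "dBar (Suc (Suc n)) (sB (Suc n) Z) = Z -[?B] y" unfolding 1 .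
qed

lemma Gh: "X : cB n ==> G (Suc n) (hh n X) = \<zero>[P (Suc n)]" proof (induction n arbitrary: X)
 case 0
 show ?case using ahom_zero[OF grB grP bhomD(1)[OF G_bhom]] by (simp del: G.simps)
next
 case (Suc n)
 have z: "(%X. \<zero>[P (Suc (Suc n))]) : bhom (Bar (Suc n)) (P (Suc (Suc n)))"
  by (rule bhomI[OF ahom_const_zero[OF grB grP]]) (simp_all add: act_zero[OF bim_P])
 show ?case proof (rule B_unit_eq[OF bim_P bhom_comp[OF G_bhom hh_bhom] z _ Suc.prems])
  fix us assume us: "us : TB (Suc n)"
  interpret P: abelian_group "P (Suc n)" by (rule grP)
  define y where "y = Bpure (Suc n) (us @ [\<one>[A]])"
  define Z where "Z = F (Suc n) (G (Suc n) y) -[Bar (Suc n)] hh n (dBar (Suc n) y)"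
  note h = h_on_unit[OF us, folded y_def, folded Z_def]
  have gz: "G (Suc n) Z = G (Suc n) y" proof -
  have "G (Suc n) Z = G (Suc n) (F (Suc n) (G (Suc n) y)) -[P (Suc n)] G (Suc n) (hh n (dBar (Suc n) y))"
  unfolding Z_def by (rule ahom_minus[OF grB grP bhomD(1)[OF G_bhom] FG_in[OF h(1)] hh_in[OF dBar_in[OF h(1)]]])
  thus ?thesis using GF[OF G_in[OF h(1)]] Suc.IH[OF dBar_in[OF h(1)]] P_minus_zero[OF G_in[OF h(1)]] by (simp del: G.simps F.simps)
  qed
  have "G (Suc (Suc n)) (hh (Suc n) y) = \<rho> (Suc n) (G (Suc n) (Z -[Bar (Suc n)] y))"
  unfolding h(3) using G_sB[OF h(2)] h(4) by (simp del: G.simps)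
  also have "G (Suc n) (Z -[Bar (Suc n)] y) = G (Suc n) Z -[P (Suc n)] G (Suc n) y"
  by (rule ahom_minus[OF grB grP bhomD(1)[OF G_bhom] h(2,1)])
  also have "\<dots> = \<zero>[P (Suc n)]" unfolding gz using G_in[OF h(1)] by (simp add: P.minus_eq P.r_neg del: G.simps)
  also have "\<rho> (Suc n) \<zero>[P (Suc n)] = \<zero>[P (Suc (Suc n))]" by (rule rho_zero')
  finally show "G (Suc (Suc n)) (hh (Suc n) (Bpure (Suc n) (us @ [\<one>[A]]))) = \<zero>[P (Suc (Suc n))]" unfolding y_def .
 qed
qed

lemma hh_hh: "X : cB n ==> hh (Suc n) (hh n X) = \<zero>[Bar (Suc (Suc n))]" proof (induction n arbitrary: X)
 case 0
 show ?case using hh_zero[of "Suc 0"] by (simp del: hh.simps(2))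
next
 case (Suc n)
 show ?case proof (rule B_unit_eq[OF bim_Bar bhom_comp[OF hh_bhom hh_bhom] zero_bhom _ Suc.prems])
  fix us assume us: "us : TB (Suc n)"
  interpret B: abelian_group "Bar (Suc (Suc n))" by (rule grB)
  interpret B3: abelian_group "Bar (Suc (Suc (Suc n)))" by (rule grB)
  define y where "y = Bpure (Suc n) (us @ [\<one>[A]])"
  define Z where "Z = F (Suc n) (G (Suc n) y) -[Bar (Suc n)] hh n (dBar (Suc n) y)"
  note h = h_on_unit[OF us, folded y_def, folded Z_def]
  have hZ: "hh (Suc n) Z = \<zero>[Bar (Suc (Suc n))]" proof -
  have "hh (Suc n) Z = hh (Suc n) (F (Suc n) (G (Suc n) y)) -[Bar (Suc (Suc n))] hh (Suc n) (hh n (dBar (Suc n) y))"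
  unfolding Z_def by (rule ahom_minus[OF grB grB bhomD(1)[OF hh_bhom] FG_in[OF h(1)] hh_in[OF dBar_in[OF h(1)]]])
  thus ?thesis using hF[OF G_in[OF h(1)]] Suc.IH[OF dBar_in[OF h(1)]] by (simp add: B.minus_eq B.minus_zero_eq del: hh.simps F.simps G.simps)
  qed
  let ?s = "sB (Suc n) Z"
  have "hh (Suc (Suc n)) (hh (Suc n) y) = hf (Suc n) ?s" unfolding h(3) by (rule hh_sB[OF h(2)])
  also have "F (Suc (Suc n)) (G (Suc (Suc n)) ?s) = \<zero>[Bar (Suc (Suc n))]"
  using Gh[OF h(1)] h(3) ahom_zero[OF grP grB bhomD(1)[OF F_bhom]] by (simp del: G.simps F.simps hh.simps)
  hence "hf (Suc n) ?s = sB (Suc (Suc n)) (\<zero>[Bar (Suc (Suc n))] \<ominus>\<^bsub>Bar (Suc (Suc n))\<^esub> hh (Suc n) (Z -[Bar (Suc n)] y))"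
  unfolding hf_def h(4) by simp
  also have "hh (Suc n) (Z -[Bar (Suc n)] y) = hh (Suc n) Z -[Bar (Suc (Suc n))] hh (Suc n) y"
  by (rule ahom_minus[OF grB grB bhomD(1)[OF hh_bhom] h(2,1)])
  also have "\<zero>[Bar (Suc (Suc n))] \<ominus>\<^bsub>Bar (Suc (Suc n))\<^esub> (hh (Suc n) Z -[Bar (Suc (Suc n))] hh (Suc n) y) = hh (Suc n) y"
  unfolding hZ using hh_in[OF h(1)] by (simp add: B.minus_eq del: hh.simps)
  also have "sB (Suc (Suc n)) (hh (Suc n) y) = \<zero>[Bar (Suc (Suc (Suc n)))]" unfolding h(3) by (rule sB_sB[OF h(2)])
  finally show "hh (Suc (Suc n)) (hh (Suc n) (Bpure (Suc n) (us @ [\<one>[A]]))) = \<zero>[Bar (Suc (Suc (Suc n)))]" unfolding y_def .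
 qed
qed

subsection \<open>The explicit form of the homotopy\<close>

lemma HB_take: "i <= n ==> HB n = HB i @ replicate (n - i) fac_Abar" by (simp add: HB_def flip: replicate_add)

lemma HB_cut:
 assumes "us : TB n" "i <= n"
 shows "take (Suc i) us : TB i" "drop (Suc i) us : tuples (replicate (n - i) fac_Abar)" proof -
 obtain vs ws where v: "us = vs @ ws" "vs : TB i" "ws : tuples (replicate (n - i) fac_Abar)"
  using assms(1) unfolding HB_take[OF assms(2)] by (elim tuples_appendE)
 hence "length vs = Suc i" using tuples_length[of vs "HB i"] by (simp add: HB_def)
 thus "take (Suc i) us : TB i" "drop (Suc i) us : tuples (replicate (n - i) fac_Abar)" using v by simp_all
qed

lemma append_hom:
 assumes "i <= n" "ys : tuples (replicate (n - i) fac_Abar)" "b : cA"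
 shows "(%X. tensor_append K (facs_bar n) X (ys @ [b])) : ahom (tensor K (HB i)) (Bar n)"
  "us : TB i ==> tensor_append K (facs_bar n) (pure_tensor K (HB i) us) (ys @ [b]) = Bpure n (us @ ys @ [b])" proof -
 have e: "facs_bar n = HB i @ (replicate (n - i) fac_Abar @ [fac_A])" using HB_take[OF assms(1)] by (simp add: facs_bar_HB)
 have t: "ys @ [b] : tuples (replicate (n - i) fac_Abar @ [fac_A])" using assms by (simp add: car_A)
 show "(%X. tensor_append K (facs_bar n) X (ys @ [b])) : ahom (tensor K (HB i)) (Bar n)"
  unfolding ahom_Bar e by (rule tensor_append(1)[OF B_factor[of n, unfolded e] t])
 show "us : TB i ==> tensor_append K (facs_bar n) (pure_tensor K (HB i) us) (ys @ [b]) = Bpure n (us @ ys @ [b])"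
  unfolding e by (rule tensor_append(2)[OF B_factor[of n, unfolded e] t])
qed

lemma append_vap:
 assumes i: "i <= n" and ys: "ys : tuples (replicate (n - i) fac_Abar)" and a: "a : cA" and b: "b : cA"
  and X: "X : carrier (tensor K (HB i))"
 shows "tensor_append K (facs_bar (Suc n)) X (ys @ [to_bar a, b]) = vap n (tensor_append K (facs_bar n) X (ys @ [a])) b"
proof -
 have t: "ys @ [to_bar a] : tuples (replicate (Suc n - i) fac_Abar)"
  using i ys a by (simp add: Suc_diff_le to_bar_in flip: replicate_append_same)
 note L = append_hom[OF le_SucI[OF i] t b] and R = append_hom[OF i ys a]
 have "tensor_append K (facs_bar (Suc n)) X ((ys @ [to_bar a]) @ [b]) = vap n (tensor_append K (facs_bar n) X (ys @ [a])) b"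
 proof (rule ahom_tensor_eq[OF HB_factor grB L(1) ahom_comp[OF vap_hom[OF b] R(1)] _ X])
  fix us assume us: "us : TB i"
  have "us @ ys : TB n" unfolding HB_take[OF i] using us ys by blast
  thus "tensor_append K (facs_bar (Suc n)) (pure_tensor K (HB i) us) ((ys @ [to_bar a]) @ [b]) =
  vap n (tensor_append K (facs_bar n) (pure_tensor K (HB i) us) (ys @ [a])) b"
  using L(2)[OF us] R(2)[OF us] vap_pure[of "us @ ys" n a b] a b by simp
 qed
 thus ?thesis by simp
qed

definition hexp where
 "hexp n xs = (\<Oplus>\<^bsub>Bar (Suc n)\<^esub>i\<in>{1..n}. [((-1::int) ^ (i + 1))] \<cdot>\<^bsub>Bar (Suc n)\<^esub>
  tensor_append K (facs_bar (Suc n)) (varpi i (F i (G i (Bpure i (take (i + 1) xs @ [\<one>[A]]))))) (drop (i + 1) xs))"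

lemma sB_hh_sB: "X : cB n ==> sB (Suc (Suc n)) (hh (Suc n) (sB n X)) = \<zero>[Bar (Suc (Suc (Suc n)))]"
 using sB_sB[of "F (Suc n) (G (Suc n) (sB n X)) -[Bar (Suc n)] hh n (dBar (Suc n) (sB n X))" "Suc n"]
  abelian_group.minus_closed[OF grB FG_in[OF sB_in] hh_in[OF dBar_in[OF sB_in]]]
 by (simp add: hh_sB hf_def del: F.simps G.simps hh.simps)

text \<open>
 Unfolding the recursion, the term \<open>\<sigma> F G\<close> is the summand of highest index and \<open>\<sigma> h d\<close> yields the
 others, with the remaining tensor factors carried along.
\<close>
lemma hexp_hh:
 assumes "us : TB n" "b : cA"
 shows "hexp n (us @ [b]) = hh n (Bpure n (us @ [b]))" using assms proof (induction n arbitrary: us b)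
 case 0
 interpret B: abelian_group "Bar (Suc 0)" by (rule grB)
 show ?case by (simp add: hexp_def)
next
 case (Suc n)
 let ?B = "Bar (Suc (Suc n))"
 interpret B: abelian_group ?B by (rule grB)
 interpret Bn: abelian_group "Bar (Suc n)" by (rule grB)
 obtain vs a where v: "us = vs @ [to_bar a]" "vs : TB n" "a : cA" using HB_SucE[OF Suc.prems(1)] .
 let ?U = "Bpure (Suc n) (us @ [\<one>[A]])" and ?V = "Bpure n (vs @ [a])"
 let ?FG = "F (Suc n) (G (Suc n) ?U)"
 have U: "?U : cB (Suc n)" by (rule B_pure_in[OF Suc.prems(1) A_one])
 have V: "?V : cB n" by (rule B_pure_in[OF v(2,3)])
 note FG = FG_in[OF U] and hV = hh_in[OF V]
 note N = lhomD(4)[OF NB_lhom V]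
 have lv: "length vs = Suc n" using tuples_length[OF v(2)] by (simp add: HB_def)
 define t where "t i = F i (G i (Bpure i (take (i + 1) vs @ [\<one>[A]])))" for i
 have tc: "t i : cB i" if "i <= n" for i
  unfolding t_def using HB_cut(1)[OF v(2) that] by (intro FG_in B_pure_in) simp_all
 define e where "e i = tensor_append K (facs_bar (Suc n)) (varpi i (t i)) (drop (i + 1) vs @ [a])" for i
 have ec: "e i : cB (Suc n)" and ev: "tensor_append K (facs_bar (Suc (Suc n))) (varpi i (t i)) (drop (i + 1) vs @ [to_bar a, b]) = vap (Suc n) (e i) b"
  if "i : {1..n}" for i proof -
  have i: "Suc i <= Suc n" "i <= n" using that by simp_all
  have d: "drop (i + 1) vs : tuples (replicate (Suc n - Suc i) fac_Abar)" using HB_cut(2)[OF v(2) i(2)] by simp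
  note T = ahom_in[OF varpi_hom tc[OF i(2)]]
  show "e i : cB (Suc n)" unfolding e_def by (rule ahom_in[OF append_hom(1)[OF i(1) d v(3)] T])
  show "tensor_append K (facs_bar (Suc (Suc n))) (varpi i (t i)) (drop (i + 1) vs @ [to_bar a, b]) = vap (Suc n) (e i) b"
  unfolding e_def by (rule append_vap[OF i(1) d v(3) Suc.prems(2) T])
 qed
 have IH: "hh n ?V = (\<Oplus>\<^bsub>Bar (Suc n)\<^esub>i\<in>{1..n}. [((-1::int) ^ (i + 1))] \<cdot>\<^bsub>Bar (Suc n)\<^esub> e i)"
  unfolding Suc.IH[OF v(2,3), symmetric] hexp_def
  using ec lv by (intro Bn.finsum_cong'[OF refl]) (simp_all add: e_def t_def sgB_int bhomD(4)[OF sgB_bhom] Pi_def del: F.simps G.simps)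
 note W = vap_hom[OF Suc.prems(2), of "Suc n"]
 let ?xs = "us @ [b]"
 let ?T = "%i. [((-1::int) ^ (i + 1))] \<cdot>\<^bsub>?B\<^esub> tensor_append K (facs_bar (Suc (Suc n)))
  (varpi i (F i (G i (Bpure i (take (i + 1) ?xs @ [\<one>[A]]))))) (drop (i + 1) ?xs)"
 have Ti: "?T i = vap (Suc n) ([((-1::int) ^ (i + 1))] \<cdot>\<^bsub>Bar (Suc n)\<^esub> e i) b" if "i : {1..n}" for i
 proof -
  have "take (i + 1) ?xs = take (i + 1) vs" "drop (i + 1) ?xs = drop (i + 1) vs @ [to_bar a, b]" using v(1) lv that by simp_all
  hence "?T i = [((-1::int) ^ (i + 1))] \<cdot>\<^bsub>?B\<^esub> vap (Suc n) (e i) b" using ev[OF that] by (simp only: t_def)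
  thus ?thesis using ahom_int[OF grB grB W ec[OF that]] by simp
 qed
 have Tc: "[((-1::int) ^ (i + 1))] \<cdot>\<^bsub>Bar (Suc n)\<^esub> e i : cB (Suc n)" if "i : {1..n}" for i
  unfolding sgB_int[OF ec[OF that]] by (rule bhomD(4)[OF sgB_bhom ec[OF that]])
 have "(\<Oplus>\<^bsub>?B\<^esub>i\<in>{1..n}. ?T i) = (\<Oplus>\<^bsub>?B\<^esub>i\<in>{1..n}. vap (Suc n) ([((-1::int) ^ (i + 1))] \<cdot>\<^bsub>Bar (Suc n)\<^esub> e i) b)"
  using Ti ahom_in[OF W Tc] by (intro B.finsum_cong'[OF refl]) (simp_all only: Pi_def mem_Collect_eq, blast)
 also have "\<dots> = vap (Suc n) (hh n ?V) b" unfolding IH using Tc by (intro ahom_finsum[OF grB grB W, symmetric])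
 finally have s1: "(\<Oplus>\<^bsub>?B\<^esub>i\<in>{1..n}. ?T i) = vap (Suc n) (hh n ?V) b" .
 have last: "?T (Suc n) = sgB (Suc (Suc n)) (Suc (Suc n)) (vap (Suc n) ?FG b)" proof -
  have "take (Suc n + 1) ?xs = us" "drop (Suc n + 1) ?xs = [b]" using v(1) lv by simp_all
  hence "?T (Suc n) = [((-1::int) ^ Suc (Suc n))] \<cdot>\<^bsub>?B\<^esub> vap (Suc n) ?FG b" by (simp only: vap_def Suc_eq_plus1)
  thus ?thesis using ahom_in[OF W FG] by (simp only: sgB_int)
 qed
 have lc: "?T (Suc n) : carrier ?B" unfolding last by (rule bhomD(4)[OF sgB_bhom ahom_in[OF W FG]])
 have "hexp (Suc n) ?xs = (\<Oplus>\<^bsub>?B\<^esub>i\<in>insert (Suc n) {1..n}. ?T i)"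
  unfolding hexp_def by (rule arg_cong[where f = "finsum ?B ?T"]) auto
 also have "\<dots> = ?T (Suc n) +[?B] (\<Oplus>\<^bsub>?B\<^esub>i\<in>{1..n}. ?T i)" proof (rule B.finsum_insert)
  show "?T (Suc n) : carrier ?B" by (rule lc)
  show "?T : {1..n} \<rightarrow> carrier ?B" using Ti ahom_in[OF W Tc] by (intro Pi_I) (simp only:)
 qed simp_all
 finally have L: "hexp (Suc n) ?xs = sgB (Suc (Suc n)) (Suc (Suc n)) (vap (Suc n) ?FG b) +[?B] vap (Suc n) (hh n ?V) b"
  unfolding last s1 .
 have dU: "dBar (Suc n) ?U = sgB n (Suc n) (NB n ?V)"
  using dBar_dd[OF U] dd_pure[OF v(2,3) A_one] v(1) bhomD(4)[OF sgB_bhom N] by (simp add: bimD(5)[OF bim_Bar])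
 have kill: "sB (Suc n) (hh n (NB n ?V)) = sB (Suc n) (hh n ?V)" proof (cases n)
  case 0
  thus ?thesis by simp
 next
  case (Suc m)
  note Vm = V[unfolded Suc]
  note dV = bhomD(4)[OF dd_bhom Vm]
  interpret B3: abelian_group "Bar (Suc (Suc (Suc m)))" by (rule grB)
  have "hh (Suc m) (NB (Suc m) (Bpure (Suc m) (vs @ [a]))) =
  hh (Suc m) (Bpure (Suc m) (vs @ [a])) -[Bar (Suc (Suc m))] hh (Suc m) (sB m (dd m (Bpure (Suc m) (vs @ [a]))))"
  unfolding NB_Suc by (rule ahom_minus[OF grB grB bhomD(1)[OF hh_bhom] Vm sB_in[OF dV]])
  thus ?thesis unfolding Suc using ahom_minus[OF grB grB sB_hom hh_in[OF Vm] hh_in[OF sB_in[OF dV]]] sB_hh_sB[OF dV]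
  B_minus_zero[OF sB_in[OF hh_in[OF Vm]]] by (simp del: hh.simps NB.simps)
 qed
 let ?s = "Suc (Suc n)"
 have hdU: "sB (Suc n) (hh n (dBar (Suc n) ?U)) = \<ominus>\<^bsub>?B\<^esub> vap (Suc n) (hh n ?V) \<one>[A]" proof -
  have h1: "hh n (sgB n (Suc n) (NB n ?V)) = sgB (Suc n) (Suc n) (hh n (NB n ?V))"
  using N ahom_neg[OF grB grB bhomD(1)[OF hh_bhom] N] by (simp add: sgB_def del: hh.simps)
  have h2: "sB (Suc n) (sgB (Suc n) (Suc n) (hh n (NB n ?V))) = sgB ?s (Suc n) (sB (Suc n) (hh n (NB n ?V)))"
  using ahom_neg[OF grB grB sB_hom hh_in[OF N]] by (simp add: sgB_def del: hh.simps)
  show ?thesis unfolding dU h1 h2 kill unfolding sB_def[of "Suc n"]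
  using ahom_in[OF vap_hom[OF A_one] hV] by (simp add: sgB_def)
 qed
 have c1: "vap (Suc n) ?FG \<one>[A] : carrier ?B" "vap (Suc n) (hh n ?V) \<one>[A] : carrier ?B"
  using ahom_in[OF vap_hom[OF A_one]] FG hV by blast+
 have "hf n ?U = sB (Suc n) ?FG -[?B] sB (Suc n) (hh n (dBar (Suc n) ?U))"
  unfolding hf_def by (rule ahom_minus[OF grB grB sB_hom FG hh_in[OF dBar_in[OF U]]])
 also have "\<dots> = sgB ?s ?s (vap (Suc n) ?FG \<one>[A]) +[?B] vap (Suc n) (hh n ?V) \<one>[A]"
  unfolding hdU sB_def[of "Suc n" ?FG] using c1 by (simp add: B.minus_eq)
 finally have hfU: "hf n ?U = sgB ?s ?s (vap (Suc n) ?FG \<one>[A]) +[?B] vap (Suc n) (hh n ?V) \<one>[A]" .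
 have "hh (Suc n) (Bpure (Suc n) ?xs) = ract ?B (hf n ?U) b" by (rule hh_pure[OF Suc.prems])
 also have "\<dots> = sgB ?s ?s (vap (Suc n) ?FG b) +[?B] vap (Suc n) (hh n ?V) b"
  unfolding hfU using ahom_add[OF bimD(3)[OF bim_Bar Suc.prems(2)] bhomD(4)[OF sgB_bhom c1(1)] c1(2)]
  bhomD(3)[OF sgB_bhom Suc.prems(2) c1(1)] vap_ract[OF FG A_one Suc.prems(2)] vap_ract[OF hV A_one Suc.prems(2)] Suc.prems(2)
  by simp
 finally show ?case using L by simp
qed

lemma h_hh: assumes "X : cB n" shows "h n X = hh n X" unfolding h_def
proof (rule tensor_lift_unique[OF B_factor[of n] grB])
 show "hh n : ahom (tensor K (facs_bar n)) (Bar (Suc n))" using bhomD(1)[OF hh_bhom] by (simp add: ahom_Bar(1))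
 show "X : carrier (tensor K (facs_bar n))" using assms by (simp add: B_simps)
 fix xs assume "xs : tuples (facs_bar n)"
 then obtain us b where "xs = us @ [b]" "us : TB n" "b : cA" by (elim facs_barE)
 thus "(\<Oplus>\<^bsub>Bar (Suc n)\<^esub>i\<in>{1..n}. [((-1::int) ^ (i + 1))] \<cdot>\<^bsub>Bar (Suc n)\<^esub>
  tensor_append K (facs_bar (Suc n)) (varpi i (F i (G i (Bpure i (take (i + 1) xs @ [\<one>[A]]))))) (drop (i + 1) xs)) = hh n (Bpure n xs)"
  using hexp_hh unfolding hexp_def by blast
qed

lemma h_bhom: "h n : bhom (Bar n) (Bar (Suc n))" by (rule bhom_cong[OF bim_Bar hh_bhom h_hh])

theorem retract: "homotopy_deformation_retract A P dP Bar dBar F G h"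
 unfolding homotopy_deformation_retract_def complex_morphism_def bimodule_complex_def proof (intro conjI allI ballI)
 show "F n (G n y) -[Bar n] y = (if n = 0 then \<zero>[Bar n] else h (n - 1) (dBar n y)) +[Bar n] dBar (Suc n) (h n y)"
  if y: "y : cB n" for n y proof (cases n)
  case 0
  thus ?thesis using homotopy[OF y] h_hh[OF y] by simp
 next
  case (Suc m)
  thus ?thesis using homotopy[OF y] h_hh[OF y] h_hh[OF dBar_in, of y m] y by simp
 qed
qed (simp_all add: dP_bimodule_hom dBar_bhom F_bhom G_bhom h_bhom dP_dP dBar_dBar dF dG GF del: F.simps G.simps dP.simps)

theorem special_retract: "special P Bar F G h" unfolding special_def
 by (simp add: h_hh F_in hh_in hF Gh hh_hh del: F.simps G.simps hh.simps)

end

theorem theorem5p11: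
  fixes Q :: "('v, 'e) pre_digraph"
    and I :: "('v, 'e, 'k::field_char_0) pathalg set"
    and S :: "('v, 'e) path set"
    and \<phi> :: "('v, 'e) path => ('v, 'e, 'k) pathalg"
  assumes "fin_digraph Q"
    and "ideal I (path_algebra Q)"
    and "reduction_system Q S \<phi>"
    and "diamond Q I S \<phi>"
  shows
    "homotopy_deformation_retract (presentation.A Q I)
       (presentation.P Q I S) (presentation.dP Q I S) (presentation.Bar Q I) (presentation.dBar Q I)
       (presentation.F Q I S) (presentation.G Q I S) (presentation.h Q I S) \<and>
     (\<forall>x\<in>carrier (presentation.P Q I S 0).
        presentation.aug_Bar Q I (presentation.F Q I S 0 x) = presentation.aug_P Q I x) \<and>
     (\<forall>y\<in>carrier (presentation.Bar Q I 0).
        presentation.aug_P Q I (presentation.G Q I S 0 y) = presentation.aug_Bar Q I y) \<and>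
     special (presentation.P Q I S) (presentation.Bar Q I)
       (presentation.F Q I S) (presentation.G Q I S) (presentation.h Q I S)"
proof -
  interpret confluent_presentation Q I S \<phi>
    using assms by (simp add: confluent_presentation_def)
  show ?thesis
    using retract special_retract aug_F aug_G by blast
qed

end
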